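(* Let $p,q$ satisfy (H1)-(H3) of the context, and let $(u_n)\subset D^{1,p(\cdot)}(\mathbb R^N)$ converge weakly to $u\in D^{1,p(\cdot)}(\mathbb R^N)$. Then there exist two bounded measures $\mu,\nu$ on $\mathbb R^N$, an at most countable index set $I$, points $x_i\in\mathcal A$ and positive real numbers $\mu_i,\nu_i$ ($i\in I$) such that the following convergences hold weakly in the sense of measures: $$|\nabla u_n|^{p(x)}dx\rightharpoonup\mu\ \ge\ |\nabla u|^{p(x)}dx+\sum_{i\in I}\mu_i\delta_{x_i},$$ $$|u_n|^{q(x)}dx\rightharpoonup\nu:=|u|^{q(x)}dx+\sum_{i\in I}\nu_i\delta_{x_i},$$ and $$S_{x_i}\,\nu_i^{\frac{1}{p^*(x_i)}}\le\mu_i^{\frac1{p(x_i)}}\qquad\text{for all }i\in I.$$ Moreover, if $$\nu_\infty=\lim_{R\to\infty}\limsup_{n\to\infty}\int_{|x|>R}|u_n|^{q(x)}dx,\qquad \mu_\infty=\lim_{R\to\infty}\limsup_{n\to\infty}\int_{|x|>R}|\nabla u_n|^{p(x)}dx,$$ then $$\limsup_{n\to\infty}\int_{\mathbb R^N}|\nabla u_n|^{p(x)}dx=\mu(\mathbb R^N)+\mu_\infty,\qquad \limsup_{n\to\infty}\int_{\mathbb R^N}|u_n|^{q(x)}dx=\nu(\mathbb R^N)+\nu_\infty,$$ $$S_\infty\,\nu_\infty^{\frac1{q(\infty)}}\le\mu_\infty^{\frac1{p(\infty)}}.$$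
   Context: **Spaces.** For a measurable bounded exponent $r(\cdot)\ge1$ and an open set $U\subset\mathbb R^N$, $L^{r(\cdot)}(U)$ is the space of measurable $u$ with $\int_U|u|^{r(x)}dx<\infty$, with Luxemburg norm $\|u\|_{L^{r(\cdot)}(U)}=\inf\{\lambda>0:\int_U|u(x)/\lambda|^{r(x)}dx\le1\}$. $W^{1,p(\cdot)}(U)=\{u\in W^{1,1}_{loc}(U): u,|\nabla u|\in L^{p(\cdot)}(U)\}$ with norm $\|u\|_{L^{p(\cdot)}(U)}+\|\nabla u\|_{L^{p(\cdot)}(U)}$, and $W^{1,p(\cdot)}_0(U)$ is the closure of $C_c^\infty(U)$ in it. $D^{1,p(\cdot)}(\mathbb R^N)$ is the closure of $C_c^\infty(\mathbb R^N)$ for the norm $\|\nabla u\|_{L^{p(\cdot)}(\mathbb R^N)}$. $p^*(x)=\frac{Np(x)}{N-p(x)}$. **Assumptions.** $p,q:\mathbb R^N\to[1,+\infty)$ are measurable. (H1) There is a function $\rho$ with $\lim_{h\to0}\rho(h)\ln|h|=0$ such that $|p(x+h)-p(x)|\le\rho(h)$ and $|q(x+h)-q(x)|\le\rho(h)$ for all $x,h\in\mathbb R^N$. (H2) There are real numbers $p(\infty),q(\infty)$ with $\lim_{|x|\to\infty}|p(x)-p(\infty)|\ln|x|=0$ and $\lim_{|x|\to\infty}|q(x)-q(\infty)|\ln|x|=0$. (H3) With $p^-=\inf p$, $p^+=\sup p$: $1<p^-\le p^+<N$, $1\le q\le p^*$ on $\mathbb R^N$, and $q(\infty)=p(\infty)^*=\frac{Np(\infty)}{N-p(\infty)}$.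 The critical set $\mathcal A=\{x\in\mathbb R^N:q(x)=p^*(x)\}$ may be empty or not. **Localized Sobolev constants.** For open $U$, $S(p(\cdot),q(\cdot),U)=\inf_{u\in W_0^{1,p(\cdot)}(U),u\ne0}\frac{\|\nabla u\|_{L^{p(\cdot)}(U)}}{\|u\|_{L^{q(\cdot)}(U)}}$. For $x\in\mathcal A$, $S_x=\lim_{\varepsilon\to0}S(p(\cdot),q(\cdot),B_x(\varepsilon))=\sup_{\varepsilon>0}S(p(\cdot),q(\cdot),B_x(\varepsilon))$, where $B_x(\varepsilon)$ is the ball of center $x$ and radius $\varepsilon$; $S_\infty=\lim_{R\to\infty}S(p(\cdot),q(\cdot),\mathbb R^N\setminus B_R)=\sup_{R>0}S(p(\cdot),q(\cdot),\mathbb R^N\setminus B_R)$, where $B_R=B_0(R)$. **Convention.** Measures are non-negative Borel measures; weak convergence in the sense of measures means convergence of integrals against every function in $C_c(\mathbb R^N)$; $\delta_x$ is the Dirac mass at $x$.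
   Formalization: The conclusion, including the limsups and the definitions of ν_∞ and μ_∞, is stated for a subsequence of (u_n); for the whole sequence it fails, e.g. when u_n alternates between 0 and φ(x)sin(n x_1)/n, where |∇u_n|^{p(x)}dx has no weak limit. *)

theory Defs
  imports "HOL-Analysis.Analysis"
begin

text \<open>
  The space \<open>\<real>\<^sup>N\<close> is a type \<open>'a::euclidean_space\<close> with \<open>N = DIM('a)\<close>.  Functions on an open set
  \<open>U\<close> are total functions of which only the values on \<open>U\<close> matter; elements of the function
  spaces are functions, not equivalence classes modulo null sets.  Norms and Sobolev constants
  take values in \<^typ>\<open>ennreal\<close>, so that infima and suprema are always the true ones.
\<close>

subsection \<open>Variable exponent Lebesgue spaces\<close>

definition modular :: "('a::euclidean_space \<Rightarrow> real) \<Rightarrow> 'a set \<Rightarrow> ('a \<Rightarrow> 'b::real_normed_vector) \<Rightarrow> ennreal"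
  where "modular r U u = (\<integral>\<^sup>+ x. ennreal (norm (u x) powr r x) \<partial>lebesgue_on U)"

definition Lvar :: "('a::euclidean_space \<Rightarrow> real) \<Rightarrow> 'a set \<Rightarrow> ('a \<Rightarrow> 'b::real_normed_vector) set"
  where "Lvar r U = {u \<in> borel_measurable (lebesgue_on U). modular r U u < \<infinity>}"

definition Lnorm :: "('a::euclidean_space \<Rightarrow> real) \<Rightarrow> 'a set \<Rightarrow> ('a \<Rightarrow> 'b::real_normed_vector) \<Rightarrow> ennreal"
  where "Lnorm r U u =
    (INF s \<in> {s::real. 0 < s \<and> modular r U (\<lambda>x. u x /\<^sub>R s) \<le> 1}. ennreal s)"

subsection \<open>Test functions and weak gradients\<close>

primrec C_k :: "nat \<Rightarrow> ('a::euclidean_space \<Rightarrow> real) \<Rightarrow> bool" where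
  "C_k 0 f \<longleftrightarrow> continuous_on UNIV f"
| "C_k (Suc k) f \<longleftrightarrow> (\<forall>x. f differentiable (at x)) \<and>
     (\<forall>b\<in>Basis. C_k k (\<lambda>x. frechet_derivative f (at x) b))"

definition test_functions :: "'a::euclidean_space set \<Rightarrow> ('a \<Rightarrow> real) set"
  where "test_functions U =
    {\<phi>. (\<forall>k. C_k k \<phi>) \<and> compact (closure {x. \<phi> x \<noteq> 0}) \<and> closure {x. \<phi> x \<noteq> 0} \<subseteq> U}"

definition loc_integrable :: "'a::euclidean_space set \<Rightarrow> ('a \<Rightarrow> 'b::euclidean_space) \<Rightarrow> bool"
  where "loc_integrable U f \<longleftrightarrow> (\<forall>K. compact K \<and> K \<subseteq> U \<longrightarrow> set_integrable lebesgue K f)"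

definition has_weak_gradient :: "'a::euclidean_space set \<Rightarrow> ('a \<Rightarrow> real) \<Rightarrow> ('a \<Rightarrow> 'a) \<Rightarrow> bool"
  where "has_weak_gradient U u g \<longleftrightarrow> loc_integrable U u \<and> loc_integrable U g \<and>
    (\<forall>\<phi>\<in>test_functions U. \<forall>b\<in>Basis.
       (LINT x:U|lebesgue. u x * frechet_derivative \<phi> (at x) b)
         = - (LINT x:U|lebesgue. (g x \<bullet> b) * \<phi> x))"

definition W11loc :: "'a::euclidean_space set \<Rightarrow> ('a \<Rightarrow> real) set"
  where "W11loc U = {u. \<exists>g. has_weak_gradient U u g}"

text \<open>A choice of the weak gradient, which is unique up to null sets.\<close>

definition wgrad :: "'a::euclidean_space set \<Rightarrow> ('a \<Rightarrow> real) \<Rightarrow> 'a \<Rightarrow> 'a"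
  where "wgrad U u = (SOME g. has_weak_gradient U u g)"

subsection \<open>Variable exponent Sobolev spaces\<close>

definition W1 :: "('a::euclidean_space \<Rightarrow> real) \<Rightarrow> 'a set \<Rightarrow> ('a \<Rightarrow> real) set"
  where "W1 p U = {u \<in> W11loc U. u \<in> Lvar p U \<and> wgrad U u \<in> Lvar p U}"

definition W1norm :: "('a::euclidean_space \<Rightarrow> real) \<Rightarrow> 'a set \<Rightarrow> ('a \<Rightarrow> real) \<Rightarrow> ennreal"
  where "W1norm p U u = Lnorm p U u + Lnorm p U (wgrad U u)"

definition W10 :: "('a::euclidean_space \<Rightarrow> real) \<Rightarrow> 'a set \<Rightarrow> ('a \<Rightarrow> real) set"
  where "W10 p U =
    {u \<in> W1 p U. \<forall>\<epsilon>>0. \<exists>\<phi>\<in>test_functions U. W1norm p U (\<lambda>x. u x - \<phi> x) < ennreal \<epsilon>}"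

definition crit_exp :: "('a::euclidean_space \<Rightarrow> real) \<Rightarrow> 'a \<Rightarrow> real"
  where "crit_exp p x = real DIM('a) * p x / (real DIM('a) - p x)"

definition crit_set :: "('a::euclidean_space \<Rightarrow> real) \<Rightarrow> ('a \<Rightarrow> real) \<Rightarrow> 'a set"
  where "crit_set p q = {x. q x = crit_exp p x}"

definition Dnorm :: "('a::euclidean_space \<Rightarrow> real) \<Rightarrow> ('a \<Rightarrow> real) \<Rightarrow> ennreal"
  where "Dnorm p u = Lnorm p UNIV (wgrad UNIV u)"

text \<open>
  The gradient norm does not see constants, so a closure for it has to be taken inside a space
  of functions on which it is a norm.  The ambient space is that of the weakly differentiable
  \<open>u\<close> in \<open>L\<^bsup>p\<^sup>*(\<cdot>)\<^esup>(\<real>\<^sup>N)\<close> with gradient in \<open>L\<^bsup>p(\<cdot>)\<^esup>(\<real>\<^sup>N)\<close>; by the Sobolev inequality the closure of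
  the test functions in it is their completion.
\<close>

definition D1 :: "('a::euclidean_space \<Rightarrow> real) \<Rightarrow> ('a \<Rightarrow> real) set"
  where "D1 p =
    {u \<in> W11loc UNIV. u \<in> Lvar (crit_exp p) UNIV \<and> wgrad UNIV u \<in> Lvar p UNIV \<and>
       (\<forall>\<epsilon>>0. \<exists>\<phi>\<in>test_functions UNIV. Dnorm p (\<lambda>x. u x - \<phi> x) < ennreal \<epsilon>)}"

definition D1_dual :: "('a::euclidean_space \<Rightarrow> real) \<Rightarrow> (('a \<Rightarrow> real) \<Rightarrow> real) set"
  where "D1_dual p = {l.
    (\<forall>u\<in>D1 p. \<forall>v\<in>D1 p. \<forall>a b. l (\<lambda>x. a * u x + b * v x) = a * l u + b * l v) \<and>
    (\<exists>C::real. \<forall>u\<in>D1 p. ennreal \<bar>l u\<bar> \<le> ennreal C * Dnorm p u)}"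

definition weakly_converges_D1 ::
  "('a::euclidean_space \<Rightarrow> real) \<Rightarrow> (nat \<Rightarrow> 'a \<Rightarrow> real) \<Rightarrow> ('a \<Rightarrow> real) \<Rightarrow> bool"
  where "weakly_converges_D1 p u u0 \<longleftrightarrow>
    (\<forall>n. u n \<in> D1 p) \<and> u0 \<in> D1 p \<and> (\<forall>l\<in>D1_dual p. (\<lambda>n. l (u n)) \<longlonglongrightarrow> l u0)"

subsection \<open>Localized Sobolev constants\<close>

definition sobolev_const ::
  "('a::euclidean_space \<Rightarrow> real) \<Rightarrow> ('a \<Rightarrow> real) \<Rightarrow> 'a set \<Rightarrow> ennreal"
  where "sobolev_const p q U =
    (INF u \<in> {u \<in> W10 p U. \<not> (AE x in lebesgue_on U. u x = 0)}.
       Lnorm p U (wgrad U u) / Lnorm q U u)"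

text \<open>
  The constants are monotone in the domain, so the suprema below are also the limits for
  \<open>\<epsilon> \<rightarrow> 0\<close> and \<open>R \<rightarrow> \<infinity>\<close>.  Removing closed balls keeps the exterior domains open; by the same
  monotonicity removing open balls gives the same supremum.
\<close>

definition sobolev_const_at ::
  "('a::euclidean_space \<Rightarrow> real) \<Rightarrow> ('a \<Rightarrow> real) \<Rightarrow> 'a \<Rightarrow> ennreal"
  where "sobolev_const_at p q x = (SUP \<epsilon>\<in>{0<..}. sobolev_const p q (ball x \<epsilon>))"

definition sobolev_const_infinity ::
  "('a::euclidean_space \<Rightarrow> real) \<Rightarrow> ('a \<Rightarrow> real) \<Rightarrow> ennreal"
  where "sobolev_const_infinity p q = (SUP R\<in>{0<..}. sobolev_const p q (- cball 0 R))"

subsection \<open>Measures\<close>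

definition power_measure ::
  "('a::euclidean_space \<Rightarrow> real) \<Rightarrow> ('a \<Rightarrow> 'b::real_normed_vector) \<Rightarrow> 'a measure"
  where "power_measure r f = density lebesgue (\<lambda>x. ennreal (norm (f x) powr r x))"

text \<open>Convergence of the integrals against all functions in \<open>C\<^sub>c(\<real>\<^sup>N)\<close>.\<close>

definition weakly_converges_measure ::
  "(nat \<Rightarrow> 'a::euclidean_space measure) \<Rightarrow> 'a measure \<Rightarrow> bool"
  where "weakly_converges_measure M M0 \<longleftrightarrow>
    (\<forall>f::'a \<Rightarrow> real. continuous_on UNIV f \<and> compact (closure {x. f x \<noteq> 0}) \<longrightarrow>
       (\<lambda>n. integral\<^sup>L (M n) f) \<longlonglongrightarrow> integral\<^sup>L M0 f)"

text \<open>The value at \<open>A\<close> of the measure \<open>\<Sum>i\<in>I. m i \<delta>\<^bsub>x i\<^esub>\<close>.\<close>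

definition dirac_sum :: "'i set \<Rightarrow> ('i \<Rightarrow> real) \<Rightarrow> ('i \<Rightarrow> 'a) \<Rightarrow> 'a set \<Rightarrow> ennreal"
  where "dirac_sum I m x A = (\<Sum>\<^sub>\<infinity>i\<in>I. ennreal (m i) * indicator A (x i))"

end

theory Submission
  imports Defs "HOL-Probability.Probability"
begin

text \<open>
 The differences \<open>u\<^sub>n - u\<close> are approximated by test functions \<open>w\<^sub>n\<close>.  Weak convergence bounds their gradient
 modulars, so the Sobolev inequality (Diening's key estimate and Hedberg's argument) bounds them in \<open>L\<^bsup>p*\<^esup>\<close>
 and \<open>L\<^bsup>q\<^esup>\<close>, and comparison with ball averages gives \<open>w\<^sub>n \<rightarrow> 0\<close> in \<open>L\<^sup>1\<close> locally.  By the Brezis--Lieb lemma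
 \<open>\<nu> = |u|\<^bsup>q\<^esup> dx + N\<close>, where \<open>N\<close> and \<open>M\<close> are the limits of \<open>|w\<^sub>n|\<^bsup>q\<^esup> dx\<close> and \<open>|\<nabla>w\<^sub>n|\<^bsup>p\<^esup> dx\<close>.  When \<open>w\<^sub>n\<close> is
 multiplied by a cutoff \<open>\<eta>\<close>, the term \<open>|w\<^sub>n|\<^bsup>p\<^esup> |\<nabla>\<eta>|\<^bsup>p\<^esup>\<close> disappears in the limit because \<open>p\<close> is strictly
 subcritical, so every localized Sobolev inequality passes to \<open>M\<close> and \<open>N\<close>.  Where \<open>q > p\<close> this is a reverse
 Hoelder inequality \<open>N(A) \<le> C M(A)\<^bsup>1+\<sigma>\<^esup>\<close>, which forces \<open>N\<close> onto the atoms of \<open>M\<close>; where \<open>q < p*\<close> the measure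
 \<open>N\<close> vanishes by interpolation.  Cutoffs shrinking to an atom or escaping to infinity make the exponents
 constant in the limit and give the inequalities with the two Sobolev constants.
\<close>

text \<open>Variable exponents destroy homogeneity: a norm is not a power of a modular. A Sobolev
  constant is therefore used at a scale \<open>t\<close>: if the gradient of \<open>v / t\<close>
  has modular at most 1, so has \<open>c * v / t\<close> (the predicate \<open>SI\<close>). For
  gradient mass b the right scale is about \<open>b powr (1 / p)\<close>, which makes sense only
  where p is nearly constant; so the sharp constants appear at single points and at infinity, where
  p and q have limits. Elsewhere the order of the exponents is enough: if p < \<alpha> < \<beta> <
  q, mass b of M allows only mass of order \<open>b powr (\<beta> / \<alpha>)\<close> of N, which is
  o(b). Test functions replace \<open>u n - u0\<close> so that cutoffs obey the classical product
  rule. The price is that an element of \<open>D1\<close>, linked to its approximants through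
  gradients alone, must be shown to be their limit: the difference has weak gradient zero, and
  moving test functions to infinity shows that it vanishes. The weights of the theorem are the
  masses of \<open>\<mu>\<close> at the atoms of N. They dominate those of M because the density of
  the weak limit charges no point; for the same reason \<open>\<mu>\<close> lies above that density
  and the Dirac sum together.\<close>

abbreviation (input) "LN f \<equiv> \<integral>\<^sup>+x. f x \<partial>lebesgue"

abbreviation (input) "BN f \<equiv> \<integral>\<^sup>+x. f x \<partial>lborel"

abbreviation (input) "LI f \<equiv> \<integral>\<^sup>+x. ennreal (f x) \<partial>lebesgue"

abbreviation (input) "BI f \<equiv> \<integral>\<^sup>+x. ennreal (f x) \<partial>lborel"

abbreviation (input) "Mod r f \<equiv> \<integral>\<^sup>+x. ennreal (norm (f x) powr r x) \<partial>lebesgue"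

abbreviation (input) "Mda r f \<equiv> \<integral>\<^sup>+x. ennreal (\<bar>f x\<bar> powr r x) \<partial>lebesgue"

abbreviation (input) "L1ball R f \<equiv> \<integral>\<^sup>+x. ennreal \<bar>f x\<bar> * indicator (cball 0 R) x \<partial>lebesgue"

abbreviation (input) "lmeas \<equiv> borel_measurable lebesgue"

abbreviation (input) "tests \<equiv> test_functions UNIV"

abbreviation (input) "wgr u \<equiv> wgrad UNIV u"

abbreviation (input) "LB f \<equiv> \<integral>x. f x \<partial>lebesgue"

abbreviation (input) "EN M f \<equiv> \<integral>\<^sup>+x. ennreal (f x) \<partial>M"

abbreviation (input) lim_seq (infixr "---->" 60) where "X ----> L \<equiv> (X \<longlongrightarrow> L) sequentially"

section \<open>Smooth functions\<close>

lemma frechet_derivative_eqI: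
 "(f has_derivative f') (at x) ==> frechet_derivative f (at x) = f'" by (metis frechet_derivative_at)

lemma C_k_differentiable: "C_k (Suc k) f ==> f differentiable (at x)" by simp

lemma C_k_continuous: "C_k k f ==> continuous_on UNIV f" by (cases k) (auto simp: continuous_at_imp_continuous_on differentiable_imp_continuous_within)

lemma C_k_SucD: "C_k (Suc k) f ==> C_k k f" proof (induction k arbitrary: f)
 case 0
 then show ?case using C_k_continuous by (simp only: C_k.simps(1))
next
 case (Suc k)
 then show ?case by (metis C_k.simps(2))
qed

lemma C_k_const: "C_k k (%x. c)" by (induction k arbitrary: c) (auto simp: frechet_derivative_const)

lemma C_k_inner: "C_k k (%x. x \<bullet> a)" proof (cases k)
 case (Suc j)
 have "((%x. x \<bullet> a) has_derivative (%h. h \<bullet> a)) (at x)" for x :: 'a by (auto intro!: derivative_eq_intros)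
 note D = this
 show ?thesis using Suc D by (auto simp: frechet_derivative_eqI[OF D] C_k_const differentiable_def)
qed (auto intro!: continuous_intros)

lemma C_k_add: "C_k k f ==> C_k k g ==> C_k k (%x. f x + g x)" proof (induction k arbitrary: f g)
 case 0
 then show ?case by (auto intro!: continuous_intros)
next
 case (Suc k)
 have "frechet_derivative (%x. f x + g x) (at x) =
   (%h. frechet_derivative f (at x) h + frechet_derivative g (at x) h)" for x using Suc.prems by (intro frechet_derivative_eqI has_derivative_add)
   (auto simp: frechet_derivative_works[symmetric])
 then show ?case using Suc by (auto intro: differentiable_add)
qed

lemma C_k_mult: "C_k k f ==> C_k k g ==> C_k k (%x. f x * g x)" proof (induction k arbitrary: f g)
 case 0
 then show ?case by (auto intro!: continuous_intros)
next
 case (Suc k)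
 have "frechet_derivative (%x. f x * g x) (at x) =
   (%h. f x * frechet_derivative g (at x) h + frechet_derivative f (at x) h * g x)" for x using Suc.prems by (intro frechet_derivative_eqI has_derivative_mult)
   (auto simp: frechet_derivative_works[symmetric])
 moreover have "C_k k f" "C_k k g" using Suc.prems C_k_SucD by blast+
 ultimately show ?case using Suc by (auto intro!: C_k_add)
qed

lemma C_k_sum: "(!!i. i \<in> I ==> C_k k (f i)) ==> C_k k (%x. \<Sum>i\<in>I. f i x)" by (induction I rule: infinite_finite_induct) (auto simp: C_k_const C_k_add)

lemma C_k_diff: "C_k k f ==> C_k k g ==> C_k k (%x. f x - g x)" using C_k_add[OF _ C_k_mult[OF C_k_const[of k "-1"]], of f g] by simp

lemma C_k_inverse:
 "C_k k f ==> (!!x. f x ~= 0) ==> C_k k (%x. inverse (f x))" proof (induction k)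
 case 0
 then show ?case by (auto intro!: continuous_intros)
next
 case (Suc k)
 have D: "((%x. inverse (f x)) has_derivative
   (%h. - (inverse (f x) * frechet_derivative f (at x) h * inverse (f x)))) (at x)" for x
  using Suc.prems Deriv.has_derivative_inverse[of f x "frechet_derivative f (at x)" UNIV] by (auto simp: frechet_derivative_works[symmetric])
 have "C_k k (%x. inverse (f x))" using Suc C_k_SucD by blast
 then have "C_k k (%x. 0 - inverse (f x) * frechet_derivative f (at x) b * inverse (f x))"
  if "b \<in> Basis" for b using Suc.prems that by (intro C_k_diff C_k_mult C_k_const) auto
 then show ?case using D by (auto simp: frechet_derivative_eqI[OF D] differentiable_def)
qed

text \<open>Differentiating the composition replaces \<open>H n\<close> by \<open>H (Suc n)\<close>,
  so the outer function is given as a sequence of successive derivatives and the induction on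
  \<open>k\<close> runs for all \<open>n\<close> at once.\<close>

lemma C_k_compose:
 assumes H: "!!n t. (H n has_real_derivative H (Suc n) t) (at t)"
 shows "C_k k f ==> C_k k (%x. H n (f x))" proof (induction k arbitrary: n)
 case 0
 have "continuous_on UNIV (H n)" using H by (intro DERIV_continuous_on[of _ _ "H (Suc n)"]) (auto intro: has_field_derivative_at_within)
 then show ?case using 0 by (auto intro: continuous_on_compose2)
next
 case (Suc k)
 have D: "((%x. H n (f x)) has_derivative
   (%h. H (Suc n) (f x) * frechet_derivative f (at x) h)) (at x)" for x
  using has_derivative_compose[of f "frechet_derivative f (at x)" x UNIV "H n" "(*) (H (Suc n) (f x))"]
   H[of n "f x"] Suc.prems by (auto simp: has_field_derivative_def frechet_derivative_works)
 have "C_k k f" using Suc.prems C_k_SucD by blast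
 then show ?case using Suc D by (auto simp: frechet_derivative_eqI[OF D] differentiable_def intro!: C_k_mult)
qed

section \<open>A smooth step built from exp(-1/t)\<close>

definition flat_exp :: "real => real"
 where "flat_exp t = (if t <= 0 then 0 else exp (- inverse t))"

text \<open>The \<open>n\<close>-th derivative of \<^const>\<open>flat_exp\<close> is \<open>P\<^sub>n(1/t) exp(-1/t)\<close> for \<open>t > 0\<close>.\<close>

primrec flat_exp_poly :: "nat => real poly" where
 "flat_exp_poly 0 = 1"
| "flat_exp_poly (Suc n) = [:0, 0, 1:] * (flat_exp_poly n - pderiv (flat_exp_poly n))"

lemma poly_mult_exp_minus_tendsto: "((%s::real. poly P s * exp (- s)) \<longlongrightarrow> 0) at_top" proof -
 have "((%s::real. \<Sum>i\<in>{..degree P}. coeff P i * (s ^ i / exp s)) \<longlongrightarrow> (\<Sum>i\<in>{..degree P}. coeff P i * 0)) at_top"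
  by (intro tendsto_sum tendsto_mult tendsto_const tendsto_power_div_exp_0)
 then show ?thesis by (simp add: poly_altdef sum_distrib_right exp_minus divide_inverse mult.assoc)
qed

lemma flat_exp_poly_deriv:
 fixes H :: "nat => real => real"
 defines "H \<equiv> %n t. if t <= 0 then 0 else poly (flat_exp_poly n) (inverse t) * exp (- inverse t)"
 shows "(H n has_real_derivative H (Suc n) t) (at t)" proof -
 consider "t < 0" | "t = 0" | "t > 0" by linarith
 then show ?thesis proof cases
  case 1
  have "((%_. 0) has_real_derivative H (Suc n) t) (at t)" using 1 by (simp add: H_def)
  then show ?thesis by (rule has_field_derivative_transform_within_open[of _ _ _ "{..<0}"]) (use 1 in \<open>auto simp: H_def\<close>)
 next
  case 3
  let ?F = "%t. poly (flat_exp_poly n) (inverse t) * exp (- inverse t)"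
  have "(?F has_real_derivative
    poly (flat_exp_poly n) (inverse t) * (exp (- inverse t) * inverse t ^ 2)
    + poly (pderiv (flat_exp_poly n)) (inverse t) * (- (inverse t ^ 2)) * exp (- inverse t)) (at t)"
   using 3 by (auto intro!: derivative_eq_intros simp: power2_eq_square field_simps)
  then have "(?F has_real_derivative H (Suc n) t) (at t)" using 3 by (simp add: H_def algebra_simps power2_eq_square)
  then show ?thesis by (rule has_field_derivative_transform_within_open[of _ _ _ "{0<..}"]) (use 3 in \<open>auto simp: H_def\<close>)
 next
  case 2
  \<comment> \<open>From the right, the difference quotient at 0 is
    \<open>s * P s * exp (- s)\<close> with \<open>s = 1 / y\<close> tending to infinity;
    \<open>[:0,1:]\<close> is the extra factor \<open>s\<close>.\<close>
  have "((%s. poly ([:0,1:] * flat_exp_poly n) s * exp (- s)) \<longlongrightarrow> 0) at_top" by (rule poly_mult_exp_minus_tendsto)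
  from filterlim_compose[OF this filterlim_inverse_at_top_right]
  have "((%y. (H n y - H n 0) / (y - 0)) \<longlongrightarrow> 0) (at_right 0)" by (rule Lim_transform_eventually)
    (auto simp: H_def eventually_at_right_less divide_inverse mult_ac intro!: eventually_at_rightI[of 0 1])
  moreover have "((%y. (H n y - H n 0) / (y - 0)) \<longlongrightarrow> 0) (at_left 0)"
   by (rule Lim_transform_eventually[of "%_. 0"]) (auto simp: H_def intro!: eventually_at_leftI[of "-1"])
  ultimately have "((%y. (H n y - H n 0) / (y - 0)) \<longlongrightarrow> 0) (at 0)" by (simp add: filterlim_split_at)
  then show ?thesis using 2 by (simp add: has_field_derivative_iff H_def)
 qed
qed

lemma C_k_flat_exp: "C_k k f ==> C_k k (%x. flat_exp (f x))" using C_k_compose[where n = 0 and f = f and k = k and H = "%n t. if t <= 0 then 0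
  else poly (flat_exp_poly n) (inverse t) * exp (- inverse t)"] flat_exp_poly_deriv by (simp add: flat_exp_def[abs_def] cong: if_cong)

lemma flat_exp_nonneg: "0 <= flat_exp t" and flat_exp_pos: "0 < t ==> 0 < flat_exp t"
 and flat_exp_zero: "t <= 0 ==> flat_exp t = 0" by (auto simp: flat_exp_def)

text \<open>It is 0 for \<open>t <= 0\<close> and 1 for \<open>t >= 1\<close>. The denominator is
  positive because \<open>t\<close> and \<open>1 - t\<close> cannot both be nonpositive.\<close>

definition smooth_step :: "real => real"
 where "smooth_step t = flat_exp t * inverse (flat_exp t + flat_exp (1 - t))"

lemma flat_exp_add_pos: "0 < flat_exp t + flat_exp (1 - t)" by (cases "0 < t") (auto intro: add_pos_nonneg add_nonneg_pos simp: flat_exp_nonneg flat_exp_pos)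

lemma C_k_smooth_step:
 assumes "C_k k f"
 shows "C_k k (%x. smooth_step (f x))" unfolding smooth_step_def proof (intro C_k_mult C_k_inverse C_k_add C_k_flat_exp C_k_diff C_k_const assms)
 show "flat_exp (f x) + flat_exp (1 - f x) ~= 0" for x using flat_exp_add_pos[of "f x"] by simp
qed

lemma smooth_step_0: "t <= 0 ==> smooth_step t = 0" by (simp add: smooth_step_def flat_exp_zero)

lemma smooth_step_1: "1 <= t ==> smooth_step t = 1" using flat_exp_pos[of t] by (simp add: smooth_step_def flat_exp_zero)

lemma smooth_step_nonneg: "0 <= smooth_step t" unfolding smooth_step_def using flat_exp_add_pos[of t] flat_exp_nonneg by simp

lemma smooth_step_le_1: "smooth_step t <= 1" unfolding smooth_step_def using flat_exp_add_pos[of t] flat_exp_nonneg[of "1 - t"] by (simp add: divide_inverse[symmetric])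

section \<open>Test functions\<close>

lemma test_functionsI:
 assumes "!!k. C_k k phi" "compact K" "K \<subseteq> U" "!!x. x \<notin> K ==> phi x = 0"
 shows "phi \<in> test_functions U" proof -
 have "closure {x. phi x ~= 0} \<subseteq> K" using assms by (intro closure_minimal compact_imp_closed) auto
 then show ?thesis using assms compact_Int_closed[of K "closure {x. phi x ~= 0}"] by (auto simp: test_functions_def Int_absorb1)
qed

lemma test_functionsE:
 assumes "phi \<in> test_functions U"
 obtains K where "!!k. C_k k phi" "compact K" "K \<subseteq> U" "!!x. x \<notin> K ==> phi x = 0" proof
 show "!!x. x \<notin> closure {x. phi x ~= 0} ==> phi x = 0" using closure_subset[of "{x. phi x ~= 0}"] by auto
qed (use assms in \<open>auto simp: test_functions_def\<close>)

lemma test_mono: "U \<subseteq> V ==> phi \<in> test_functions U ==> phi \<in> test_functions V" by (auto simp: test_functions_def)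

lemma test_mult_left:
 assumes "!!k. C_k k f" "phi \<in> test_functions U"
 shows "(%x. f x * phi x) \<in> test_functions U" using assms(2) proof (rule test_functionsE)
 fix K assume "!!k. C_k k phi" "compact K" "K \<subseteq> U" "!!x. x \<notin> K ==> phi x = 0"
 then show ?thesis by (intro test_functionsI[of _ K] C_k_mult assms) auto
qed

lemma test_C_k: "phi \<in> test_functions U ==> C_k k phi" by (auto simp: test_functions_def)

lemma test_add:
 assumes "phi \<in> test_functions U" "psi \<in> test_functions U"
 shows "(%x. phi x + psi x) \<in> test_functions U" proof -
 obtain K where K: "compact K" "K \<subseteq> U" "!!x. x \<notin> K ==> phi x = 0" using test_functionsE[OF assms(1)] by metis
 obtain L where L: "compact L" "L \<subseteq> U" "!!x. x \<notin> L ==> psi x = 0" using test_functionsE[OF assms(2)] by metis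
 show ?thesis using assms K L by (intro test_functionsI[of _ "K \<union> L"] C_k_add compact_Un) (auto simp: test_C_k)
qed

lemma test_cmult: "phi \<in> test_functions U ==> (%x. c * phi x) \<in> test_functions U" by (rule test_mult_left) (rule C_k_const)

lemma test_diff:
 "phi \<in> test_functions U ==> psi \<in> test_functions U ==> (%x. phi x - psi x) \<in> test_functions U" using test_add[OF _ test_cmult[of psi U "-1"]] by simp

lemma test_zero: "(%x. 0) \<in> test_functions U" by (rule test_functionsI[of _ "{}"]) (auto intro: C_k_const)

lemma test_continuous: "phi \<in> test_functions U ==> continuous_on A phi" using C_k_continuous[of 0 phi] continuous_on_subset test_C_k by blast

lemma test_differentiable: "phi \<in> test_functions U ==> phi differentiable (at x)" using test_C_k[of phi U "Suc 0"] C_k_differentiable by blast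

section \<open>Classical gradients of test functions\<close>

definition grad :: "('a::euclidean_space => real) => 'a => 'a"
 where "grad f x = (\<Sum>b\<in>Basis. frechet_derivative f (at x) b *\<^sub>R b)"

lemma grad_inner_Basis: "b \<in> Basis ==> grad f x \<bullet> b = frechet_derivative f (at x) b" by (simp add: grad_def inner_sum_left_Basis)

lemma frechet_derivative_eq_grad:
 assumes "f differentiable (at x)"
 shows "frechet_derivative f (at x) v = grad f x \<bullet> v" proof -
 interpret bounded_linear "frechet_derivative f (at x)" using assms frechet_derivative_works has_derivative_bounded_linear by blast
 have "frechet_derivative f (at x) v = frechet_derivative f (at x) (\<Sum>b\<in>Basis. (v \<bullet> b) *\<^sub>R b)" by (simp add: euclidean_representation)
 also have "... = (\<Sum>b\<in>Basis. frechet_derivative f (at x) b * (b \<bullet> v))"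
  by (simp add: sum scaleR) (intro sum.cong refl, simp only: inner_commute mult.commute)
 also have "... = grad f x \<bullet> v" by (simp add: grad_def inner_sum_left)
 finally show ?thesis .
qed

lemma has_derivative_grad:
 "f differentiable (at x) ==> (f has_derivative (%v. grad f x \<bullet> v)) (at x)" by (simp flip: frechet_derivative_eq_grad frechet_derivative_works)

lemma grad_eqI: "(f has_derivative (%v. g \<bullet> v)) (at x) ==> grad f x = g" by (rule euclidean_eqI) (simp add: grad_inner_Basis frechet_derivative_eqI)

lemma grad_mult:
 assumes "f differentiable (at x)" "g differentiable (at x)"
 shows "grad (%x. f x * g x) x = f x *\<^sub>R grad g x + g x *\<^sub>R grad f x" using has_derivative_mult[OF assms[THEN has_derivative_grad]]
 by (intro grad_eqI) (simp add: inner_add_left mult.commute)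

lemma grad_diff:
 assumes "f differentiable (at x)" "g differentiable (at x)"
 shows "grad (%x. f x - g x) x = grad f x - grad g x" using has_derivative_diff[OF assms[THEN has_derivative_grad]] by (intro grad_eqI) (simp add: inner_diff_left)

lemma grad_cmult:
 assumes "f differentiable (at x)"
 shows "grad (%x. c * f x) x = c *\<^sub>R grad f x" using has_derivative_mult_right[OF assms[THEN has_derivative_grad], of c] by (intro grad_eqI) simp

lemma grad_const: "grad (%x. c) x = 0" by (intro grad_eqI) simp

lemma continuous_on_grad:
 assumes "C_k (Suc 0) f"
 shows "continuous_on A (grad f)" proof -
 have "continuous_on UNIV (%x. frechet_derivative f (at x) b)" if "b \<in> Basis" for b using assms that by auto
 then have "continuous_on UNIV (grad f)" unfolding grad_def[abs_def] by (intro continuous_intros)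
 then show ?thesis using continuous_on_subset by blast
qed

lemma test_continuous_grad: "phi \<in> test_functions U ==> continuous_on A (grad phi)" by (intro continuous_on_grad test_C_k)

lemma grad_eq_0:
 assumes "open S" "x \<in> S" "!!y. y \<in> S ==> f y = c"
 shows "grad f x = 0" proof (rule grad_eqI)
 show "(f has_derivative (%v. 0 \<bullet> v)) (at x)" by (rule has_derivative_transform_within_open[of "%_. c" _ _ _ S]) (use assms in auto)
qed

lemma test_support_ball:
 assumes "phi \<in> test_functions U"
 obtains R where "0 < R" "!!x. R <= norm x ==> phi x = 0" "!!x. R <= norm x ==> grad phi x = 0" proof -
 obtain K where K: "compact K" "!!x. x \<notin> K ==> phi x = 0" using test_functionsE[OF assms] by metis
 then obtain B where B: "!!x. x \<in> K ==> norm x <= B"  using compact_imp_bounded bounded_iff by metis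
 have z: "phi x = 0" if "B < norm x" for x using that B K by force
 have "grad phi x = 0" if "B < norm x" for x using that z by (intro grad_eq_0[of "- cball 0 B"]) auto
 then show thesis using z by (intro that[of "max 1 (B + 1)"]) auto
qed

lemma test_bounded:
 assumes "phi \<in> test_functions U"
 obtains B where "0 < B" "!!x. \<bar>phi x\<bar> <= B" "!!x. norm (grad phi x) <= B" proof -
 obtain R where R: "!!x. R <= norm x ==> phi x = 0" "!!x. R <= norm x ==> grad phi x = 0" using assms by (metis test_support_ball)
 obtain B where B: "0 < B" "\<forall>x\<in>phi ` cball 0 R. norm x <= B"
  using compact_imp_bounded[OF compact_continuous_image[OF test_continuous[OF assms] compact_cball]]
  bounded_pos by blast
 obtain C where C: "0 < C" "\<forall>x\<in>grad phi ` cball 0 R. norm x <= C"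
  using compact_imp_bounded[OF compact_continuous_image[OF test_continuous_grad[OF assms] compact_cball]]
  bounded_pos by blast
 show thesis proof
  show "0 < max B C" using B by auto
  show "\<bar>phi x\<bar> <= max B C" for x using B R(1)[of x] by (cases "R <= norm x") (auto simp: le_max_iff_disj)
  show "norm (grad phi x) <= max B C" for x using B C R(2)[of x] by (cases "R <= norm x") (auto simp: le_max_iff_disj)
 qed
qed

lemma test_Lipschitz:
 assumes "phi \<in> test_functions U" and B: "!!x. norm (grad phi x) <= B"
 shows "\<bar>phi x - phi y\<bar> <= B * norm (x - y)" proof -
 have "norm (phi x - phi y) <= B * norm (x - y)" proof (rule differentiable_bound[of UNIV])
  show "(phi has_derivative (%v. grad phi x \<bullet> v)) (at x)" for x using assms by (intro has_derivative_grad test_differentiable)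
  show "onorm (%v. grad phi x \<bullet> v) <= B" for x using order_trans[OF Cauchy_Schwarz_ineq2 mult_right_mono[OF B norm_ge_zero]] by (intro onorm_le) simp
 qed auto
 then show ?thesis by simp
qed

lemma sum_coord_diff_square:
 fixes x y :: "'a::euclidean_space"
 shows "(\<Sum>b\<in>Basis. (y \<bullet> b - x \<bullet> b) * (y \<bullet> b - x \<bullet> b)) = (norm (y - x))\<^sup>2" proof -
 have "(norm (y - x))\<^sup>2 = (\<Sum>b\<in>Basis. ((y - x) \<bullet> b) * ((y - x) \<bullet> b))" unfolding power2_norm_eq_inner by (rule euclidean_inner)
 then show ?thesis by (simp only: inner_diff_left)
qed

text \<open>Smooth bumps on the balls of a finite cover add up to a function \<open>s\<close> that
  is positive on \<open>K\<close>. Compactness gives a positive minimum \<open>m\<close> there, and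
  \<open>smooth_step\<close> applied to \<open>s / m\<close> levels the sum to 1 on
  \<open>K\<close>.\<close>

lemma smooth_Urysohn:
 fixes K U :: "'a::euclidean_space set"
 assumes "compact K" "open U" "K \<subseteq> U"
 obtains phi where "phi \<in> test_functions U" "!!x. 0 <= phi x" "!!x. phi x <= 1" "!!x. x \<in> K ==> phi x = 1" proof -
 have "\<exists>r>0. cball x r \<subseteq> U" if "x \<in> K" for x using assms that open_contains_cball by blast
 then obtain r where r: "!!x. x \<in> K ==> r x > 0" "!!x. x \<in> K ==> cball x (r x) \<subseteq> U" by metis
 obtain F where F: "F \<subseteq> K" "finite F" "K \<subseteq> (\<Union>x\<in>F. ball x (r x))" proof (rule compactE_image[OF assms(1), of K "%x. ball x (r x)"])
  show "K \<subseteq> (\<Union>x\<in>K. ball x (r x))" using r(1) by force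
 qed auto
 \<comment> \<open>Squared distances are written in coordinates, so that smoothness is a matter of
   sums and products of inner products with basis vectors.\<close>
 define s where "s y = (\<Sum>x\<in>F. flat_exp ((r x)\<^sup>2 - (\<Sum>b\<in>Basis. (y \<bullet> b - x \<bullet> b) * (y \<bullet> b - x \<bullet> b))))" for y
 note norm_eq = sum_coord_diff_square
 have s_C: "C_k k s" for k unfolding s_def[abs_def] by (intro C_k_sum C_k_flat_exp C_k_diff C_k_mult C_k_const C_k_inner)
 have s_pos: "0 < s y" if "y \<in> K" for y proof -
  obtain x where x: "x \<in> F" "y \<in> ball x (r x)" using F(3) \<open>y \<in> K\<close> by blast
  then have "(norm (y - x))\<^sup>2 < (r x)\<^sup>2" by (intro power_strict_mono) (auto simp: dist_norm norm_minus_commute)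
  then have "0 < flat_exp ((r x)\<^sup>2 - (norm (y - x))\<^sup>2)" by (intro flat_exp_pos) simp
  then show ?thesis unfolding s_def norm_eq using x F(2) by (intro sum_pos2[of F x]) (auto simp: flat_exp_nonneg)
 qed
 have s_0: "s y = 0" if "y \<notin> (\<Union>x\<in>F. cball x (r x))" for y proof -
  have "(r x)\<^sup>2 <= (norm (y - x))\<^sup>2" if "x \<in> F" for x
   using that \<open>y \<notin> _\<close> r F by (intro power_mono) (force simp: dist_norm norm_minus_commute less_imp_le)+
  then show ?thesis unfolding s_def norm_eq by (intro sum.neutral) (auto simp: flat_exp_zero)
 qed
 obtain m where m: "0 < m" "!!y. y \<in> K ==> m <= s y" proof (cases "K = {}")
  case False
  then obtain z where "z \<in> K" "\<forall>y\<in>K. s z <= s y" using continuous_attains_inf[OF assms(1), of s] C_k_continuous[OF s_C[of 0]] continuous_on_subset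
   by blast
  then show thesis using s_pos that by blast
 qed (use that[of 1] in auto)
 show thesis proof
  show "(%y. smooth_step (s y * inverse m)) \<in> test_functions U" proof (rule test_functionsI)
   show "compact (\<Union>x\<in>F. cball x (r x))" using F by (intro compact_UN) auto
   show "(\<Union>x\<in>F. cball x (r x)) \<subseteq> U" using F r by blast
  qed (auto intro!: C_k_smooth_step C_k_mult s_C C_k_const simp: s_0 smooth_step_0)
  show "smooth_step (s x * inverse m) = 1" if "x \<in> K" for x using m that by (intro smooth_step_1) (simp add: field_simps)
 qed (auto simp: smooth_step_nonneg smooth_step_le_1)
qed

text \<open>Equal to 1 on the ball of radius \<open>R\<close> about \<open>c\<close> and to 0 from
  radius \<open>2 * R\<close> on; the squared norm keeps it smooth at the centre.\<close>

definition cutoff :: "'a::euclidean_space => real => 'a => real"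
 where "cutoff c R x = smooth_step (2 - (norm (x - c) / R)\<^sup>2)"

lemma cutoff_bounds: "0 <= cutoff c R x" "cutoff c R x <= 1" by (simp_all add: cutoff_def smooth_step_nonneg smooth_step_le_1)

lemma cutoff_eq_1: "0 < R ==> norm (x - c) <= R ==> cutoff c R x = 1" unfolding cutoff_def by (intro smooth_step_1) (simp add: power_le_one)

lemma cutoff_eq_0:
 assumes "0 < R" "2 * R <= norm (x - c)"
 shows "cutoff c R x = 0" proof -
 have "2 <= norm (x - c) / R" using assms by (simp add: field_simps)
 then have "2\<^sup>2 <= (norm (x - c) / R)\<^sup>2" by (intro power_mono) auto
 then show ?thesis unfolding cutoff_def by (intro smooth_step_0) simp
qed

lemma cutoff_test_functions:
 assumes "0 < R" "cball c (2 * R) \<subseteq> U"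
 shows "cutoff c R \<in> test_functions U" proof (rule test_functionsI[of _ "cball c (2 * R)"])
 have "(norm (x - c) / R)\<^sup>2 = (\<Sum>b\<in>Basis. (x \<bullet> b - c \<bullet> b) * (x \<bullet> b - c \<bullet> b)) * inverse (R\<^sup>2)" for x
  by (simp add: sum_coord_diff_square power_divide divide_inverse[of _ "R\<^sup>2"])
 then show "C_k k (cutoff c R)" for k unfolding cutoff_def[abs_def] by (simp only:) (intro C_k_smooth_step C_k_sum C_k_diff C_k_mult C_k_const C_k_inner)
qed (use assms in \<open>auto intro!: cutoff_eq_0 simp: dist_norm norm_minus_commute\<close>)

section \<open>Weak gradients\<close>

lemma borel_measurable_lebesgue_continuous:
 fixes f :: "'a::euclidean_space => 'b::topological_space"
 shows "continuous_on UNIV f ==> f \<in> lmeas" by (rule measurable_completion) (simp add: borel_measurable_continuous_onI)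

lemma integrable_compact_support:
 fixes f :: "'a::euclidean_space => 'b::{banach, second_countable_topology}"
 assumes "continuous_on UNIV f" "!!x. R <= norm x ==> f x = 0"
 shows "integrable lborel f" proof -
 have "indicator (cball 0 R) x *\<^sub>R f x = f x" for x using assms(2)[of x] by (auto simp: indicator_def)
 then show ?thesis using borel_integrable_compact[OF compact_cball continuous_on_subset[OF assms(1)], of 0 R] by simp
qed

lemma integral_translate:
 fixes f :: "'a::euclidean_space => 'b::{banach, second_countable_topology}"
 assumes "f \<in> borel_measurable borel"
 shows "(\<integral>x. f (a + x) \<partial>lborel) = integral\<^sup>L lborel f"
  and "integrable lborel f ==> integrable lborel (%x. f (a + x))" proof -
 have "integral\<^sup>L (distr lborel borel ((+) a)) f = (\<integral>x. f (a + x) \<partial>lborel)" using assms by (intro integral_distr) auto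
 then show "(\<integral>x. f (a + x) \<partial>lborel) = integral\<^sup>L lborel f" by (simp add: lborel_distr_plus)
 have "integrable (distr lborel borel ((+) a)) f \<longleftrightarrow> integrable lborel (%x. f (a + x))" using assms by (intro integrable_distr_eq) auto
 then show "integrable lborel f ==> integrable lborel (%x. f (a + x))" by (simp add: lborel_distr_plus)
qed

lemma difference_quotient_tendsto:
 fixes f :: "'a::euclidean_space => real"
 assumes "f differentiable (at x)" "t ----> 0" "!!n. t n ~= 0"
 shows "(%n. (f (x + t n *\<^sub>R b) - f x) / t n) ----> frechet_derivative f (at x) b" proof -
 have "((%s. x + s *\<^sub>R b) has_derivative (%s. s *\<^sub>R b)) (at 0)" by (auto intro!: derivative_eq_intros)
 from has_derivative_compose[OF this, of f "%v. grad f x \<bullet> v"]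
 have "((%s. f (x + s *\<^sub>R b)) has_derivative (%s. s * (grad f x \<bullet> b))) (at 0)" using assms by (simp add: has_derivative_grad)
 then have "((%s. f (x + s *\<^sub>R b)) has_real_derivative (grad f x \<bullet> b)) (at 0)"
  unfolding has_field_derivative_def by (rule has_derivative_eq_rhs) (simp add: fun_eq_iff)
 then have "((%s. (f (x + s *\<^sub>R b) - f x) / s) \<longlongrightarrow> grad f x \<bullet> b) (at 0)" by (simp add: has_field_derivative_iff)
 moreover have "filterlim t (at 0) sequentially" using assms by (auto simp: filterlim_at)
 ultimately have "(%n. (f (x + t n *\<^sub>R b) - f x) / t n) ----> grad f x \<bullet> b" by (rule filterlim_compose)
 then show ?thesis by (simp only: frechet_derivative_eq_grad[OF assms(1)])
qed

text \<open>Difference quotients have integral 0 by translation invariance. They are bounded through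
  the Lipschitz constant and, as all steps are at most 1, supported in one ball, so dominated
  convergence carries this over to the derivative.\<close>

lemma integral_partial_derivative_eq_0:
 assumes "phi \<in> test_functions U"
 shows "LB (%x. frechet_derivative phi (at x) b) = 0" proof -
 obtain R where R: "0 < R" "!!x. R <= norm x ==> phi x = 0" using test_support_ball[OF assms] by metis
 obtain B where B: "0 < B" "!!x. norm (grad phi x) <= B" using test_bounded[OF assms] by metis
 have cont: "continuous_on UNIV phi" and borel[measurable]: "phi \<in> borel_measurable borel"
  using test_continuous[OF assms] by (auto intro: borel_measurable_continuous_onI)
 have int: "integrable lborel phi" using cont R(2) by (rule integrable_compact_support)
 define t where "t n = inverse (real (Suc n))" for n
 define D where "D n x = (phi (x + t n *\<^sub>R b) - phi x) / t n" for n x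
 have t: "t ----> 0" "!!n. 0 < t n" "!!n. t n <= 1" unfolding t_def using LIMSEQ_inverse_real_of_nat by (auto simp: field_simps)
 have D_eq_0: "D n x = 0" if "x \<notin> cball 0 (R + norm b)" for n x proof -
  have "norm (t n *\<^sub>R b) <= norm b" using t by (simp add: abs_of_pos mult_left_le_one_le less_imp_le)
  moreover have "R + norm b < norm x" using that by simp
  ultimately have "R <= norm (x + t n *\<^sub>R b)" "R <= norm x"
   using \<open>R + norm b < norm x\<close> norm_diff_ineq[of x "t n *\<^sub>R b"] norm_ge_zero[of b] by linarith+
  then show ?thesis using R by (simp add: D_def)
 qed
 have "norm (D n x) <= B * norm b" for n x proof -
  have "\<bar>phi (x + t n *\<^sub>R b) - phi x\<bar> <= B * (t n * norm b)" using test_Lipschitz[OF assms B(2), of "x + t n *\<^sub>R b" x] t(2)[of n] by simp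
  then show ?thesis using t(2)[of n] by (simp add: D_def field_simps)
 qed
 then have D_bound: "norm (D n x) <= indicator (cball 0 (R + norm b)) x * (B * norm b)" for n x using D_eq_0[of x n] by (cases "x \<in> cball 0 (R + norm b)") auto
 have cont_fd: "continuous_on UNIV (%x. frechet_derivative phi (at x) b)" using test_continuous_grad[OF assms, of UNIV]
  by (subst frechet_derivative_eq_grad[OF test_differentiable[OF assms]]) (intro continuous_intros)
 have fd_borel[measurable]: "(%x. frechet_derivative phi (at x) b) \<in> borel_measurable borel" using cont_fd by (rule borel_measurable_continuous_onI)
 have "(%n. \<integral>x. D n x \<partial>lborel) ----> (\<integral>x. frechet_derivative phi (at x) b \<partial>lborel)" proof (rule integral_dominated_convergence)
  show "integrable lborel (%x. indicator (cball 0 (R + norm b)) x * (B * norm b))"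
   by (intro integrable_mult_left integrable_real_indicator) (auto simp: emeasure_bounded_finite[OF bounded_cball, unfolded infinity_ennreal_def])
  show "AE x in lborel. (%n. D n x) ----> frechet_derivative phi (at x) b" unfolding D_def using t
   by (intro AE_I2 difference_quotient_tendsto test_differentiable[OF assms]) (auto simp: less_le)
  show "AE x in lborel. norm (D n x) <= indicator (cball 0 (R + norm b)) x * (B * norm b)" for n using D_bound by simp
 qed (auto simp: D_def[abs_def])
 moreover have "(\<integral>x. D n x \<partial>lborel) = 0" for n proof -
  note T = integral_translate[OF borel, of "t n *\<^sub>R b"]
  have "(\<integral>x. D n x \<partial>lborel) = ((\<integral>x. phi (t n *\<^sub>R b + x) \<partial>lborel) - (\<integral>x. phi x \<partial>lborel)) / t n"
   using int T(2) unfolding D_def by (simp add: add.commute[of _ "t n *\<^sub>R b"])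
  then show ?thesis by (simp only: T(1)) simp
 qed
 ultimately have "(\<integral>x. frechet_derivative phi (at x) b \<partial>lborel) = 0" by (simp add: LIMSEQ_const_iff)
 then show ?thesis by (simp add: integral_completion)
qed

lemma loc_integrable_mult:
 assumes "loc_integrable U f" "compact K" "K \<subseteq> U" "continuous_on UNIV h" "!!x. x \<notin> K ==> h x = 0"
 shows "integrable lebesgue (%x. h x *\<^sub>R f x)" proof -
 have int: "integrable lebesgue (%x. indicator K x *\<^sub>R f x)" using assms by (auto simp: loc_integrable_def set_integrable_def)
 obtain B where B: "0 < B" "\<forall>y\<in>h ` K. norm y <= B" using compact_imp_bounded[OF compact_continuous_image[OF continuous_on_subset[OF assms(4)] assms(2)]]
  bounded_pos by (metis subset_UNIV)
 have [measurable]: "h \<in> lmeas" "(%x. indicator K x *\<^sub>R f x) \<in> lmeas" using assms(4) int by (auto intro: borel_measurable_lebesgue_continuous)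
 have "integrable lebesgue (%x. h x *\<^sub>R (indicator K x *\<^sub>R f x))" proof (rule Bochner_Integration.integrable_bound[OF integrable_scaleR_right[OF int, of B]])
  show "AE x in lebesgue. norm (h x *\<^sub>R (indicator K x *\<^sub>R f x)) <= norm (B *\<^sub>R (indicator K x *\<^sub>R f x))"
   using B by (auto intro!: AE_I2 mult_right_mono simp: indicator_def)
 qed measurable
 moreover have "(%x. h x *\<^sub>R (indicator K x *\<^sub>R f x)) = (%x. h x *\<^sub>R f x)" using assms(5) by (auto simp: indicator_def fun_eq_iff)
 ultimately show ?thesis by metis
qed

lemma loc_integrable_continuous:
 fixes f :: "'a::euclidean_space => 'b::euclidean_space"
 assumes "continuous_on UNIV f"
 shows "loc_integrable U f" unfolding loc_integrable_def set_integrable_def proof safe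
 fix K :: "'a set" assume "compact K"
 then have "integrable lborel (%x. indicator K x *\<^sub>R f x)" using assms continuous_on_subset by (intro borel_integrable_compact) auto
 moreover have "f \<in> borel_measurable borel" using assms by (rule borel_measurable_continuous_onI)
 moreover have "K \<in> sets borel" using \<open>compact K\<close> by (simp add: borel_compact)
 ultimately show "integrable lebesgue (%x. indicator K x *\<^sub>R f x)" by (subst integrable_completion) auto
qed

lemma set_integral_eq_integral:
 "(!!x. x \<notin> U ==> f x = 0) ==> (LINT x:U|M. f x) = integral\<^sup>L M f"
 unfolding set_lebesgue_integral_def by (intro Bochner_Integration.integral_cong) (auto simp: indicator_def)

lemma test_partial_eq_0:
 assumes "compact K" "!!x. x \<notin> K ==> phi x = 0" "x \<notin> K"
 shows "frechet_derivative phi (at x) = (%_. 0)" proof (rule frechet_derivative_eqI)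
 show "(phi has_derivative (%_. 0)) (at x)" by (rule has_derivative_transform_within_open[of "%_. 0" _ _ _ "- K"]) (use assms compact_imp_closed in auto)
qed

lemma test_partial:
 assumes "phi \<in> test_functions U"
 shows "continuous_on UNIV (%x. frechet_derivative phi (at x) b)" using test_continuous_grad[OF assms, of UNIV]
 by (subst frechet_derivative_eq_grad[OF test_differentiable[OF assms]]) (intro continuous_intros)

text \<open>Integration by parts: \<open>phi x * psi x\<close> is again a test function, so its
  partial derivatives have integral 0.\<close>

lemma has_weak_gradient_test_function:
 assumes "phi \<in> tests"
 shows "has_weak_gradient U phi (grad phi)" unfolding has_weak_gradient_def proof (intro conjI ballI)
 show "loc_integrable U phi" "loc_integrable U (grad phi)" using assms by (auto intro: loc_integrable_continuous test_continuous test_continuous_grad)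
 fix psi :: "'a => real" and b :: 'a assume psi: "psi \<in> test_functions U" and b: "b \<in> Basis"
 obtain K where K: "compact K" "K \<subseteq> U" "!!x. x \<notin> K ==> psi x = 0" using test_functionsE[OF psi] by metis
 have K': "frechet_derivative psi (at x) = (%_. 0)" if "x \<notin> K" for x using test_partial_eq_0 K that by blast
 have KU: "frechet_derivative psi (at x) b = 0" if "x \<notin> U" for x using K(2) K' that by (metis subsetD)
 note dp = test_differentiable[OF assms] test_differentiable[OF psi]
 have "(%x. phi x * psi x) \<in> test_functions U" using assms psi by (intro test_mult_left test_C_k)
 then have "LB (%x. frechet_derivative (%x. phi x * psi x) (at x) b) = 0" by (rule integral_partial_derivative_eq_0)
 also have "frechet_derivative (%x. phi x * psi x) (at x) b
   = phi x * frechet_derivative psi (at x) b + (grad phi x \<bullet> b) * psi x" for x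
  by (simp add: frechet_derivative_eqI[OF has_derivative_mult[OF dp(1)[THEN has_derivative_grad]
    dp(2)[THEN has_derivative_grad]]] frechet_derivative_eq_grad[OF dp(2)])
 moreover have "integrable lebesgue (%x. frechet_derivative psi (at x) b *\<^sub>R phi x)" using K K' assms psi
  by (intro loc_integrable_mult[of UNIV _ K] loc_integrable_continuous test_continuous
   test_partial) auto
 moreover have "integrable lebesgue (%x. psi x *\<^sub>R (grad phi x \<bullet> b))" using K assms psi
  by (intro loc_integrable_mult[of UNIV _ K] loc_integrable_continuous continuous_intros
   test_continuous test_continuous_grad) auto
 ultimately have "LB (%x. phi x * frechet_derivative psi (at x) b)
   + LB (%x. (grad phi x \<bullet> b) * psi x) = 0" by (simp add: mult.commute)
 moreover have "(LINT x:U|lebesgue. phi x * frechet_derivative psi (at x) b)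
   = LB (%x. phi x * frechet_derivative psi (at x) b)" using KU by (intro set_integral_eq_integral) simp
 moreover have "(LINT x:U|lebesgue. (grad phi x \<bullet> b) * psi x)
   = LB (%x. (grad phi x \<bullet> b) * psi x)" using K by (intro set_integral_eq_integral) auto
 ultimately show "(LINT x:U|lebesgue. phi x * frechet_derivative psi (at x) b)
   = - (LINT x:U|lebesgue. (grad phi x \<bullet> b) * psi x)" by linarith
qed

text \<open>Test functions \<open>phi n\<close> that are 1 on \<open>K\<close> and live in shrinking
  neighbourhoods \<open>V n\<close> converge pointwise to the indicator of \<open>K\<close>. The
  fixed test function \<open>psi\<close> keeps the products inside \<open>U\<close> and provides the
  integrable bound.\<close>

lemma integral_compact_eq_0:
 fixes f :: "'a::euclidean_space => real"
 assumes U: "open U" and f: "loc_integrable U f"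
  and 0: "!!phi. phi \<in> test_functions U ==> (LINT x:U|lebesgue. f x * phi x) = 0"
  and K: "compact K" "K \<subseteq> U"
 shows "LB (%x. indicator K x * f x) = 0" proof (cases "K = {}")
 case False
 define V where "V n = {x. infdist x K < inverse (real (Suc n))}" for n
 have "open (V n)" "K \<subseteq> V n" for n by (auto simp: V_def intro!: open_Collect_less continuous_intros)
 then have "\<exists>phi. phi \<in> test_functions (V n) & (\<forall>x. 0 <= phi x & phi x <= 1) & (\<forall>x\<in>K. phi x = 1)" for n
  using smooth_Urysohn[OF K(1), of "V n"] by metis
 then obtain phi where phi: "!!n. phi n \<in> test_functions (V n)"
  "!!n x. 0 <= phi n x" "!!n x. phi n x <= 1" "!!n x. x \<in> K ==> phi n x = 1" by metis
 obtain psi where psi: "psi \<in> test_functions U" "!!x. 0 <= psi x" "!!x. psi x <= 1" "!!x. x \<in> K ==> psi x = 1" using smooth_Urysohn[OF K(1) U K(2)] by metis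
 obtain L where L: "compact L" "L \<subseteq> U" "!!x. x \<notin> L ==> psi x = 0" using test_functionsE[OF psi(1)] by metis
 have int: "integrable lebesgue (%x. indicator L x *\<^sub>R f x)" using f L by (auto simp: loc_integrable_def set_integrable_def)
 have KL: "K \<subseteq> L" using psi(4) L(3) by (metis subsetI zero_neq_one)
 have [measurable]: "phi n \<in> lmeas" "psi \<in> lmeas" for n using test_continuous phi(1) psi(1) by (blast intro: borel_measurable_lebesgue_continuous)+
 have [measurable]: "(%x. indicator L x * f x) \<in> lmeas" using int by simp
 have [measurable]: "K \<in> sets lebesgue" using K by (simp add: borel_compact)
 have tends: "(%n. phi n x) ----> indicator K x" for x proof (cases "x \<in> K")
  case False
  then have "0 < infdist x K" using K \<open>K ~= {}\<close> compact_imp_closed[OF K(1)] by (simp add: infdist_pos_not_in_closed)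
  then obtain N where N: "inverse (real (Suc N)) < infdist x K" using reals_Archimedean by blast
  have "phi n x = 0" if "N <= n" for n proof -
   have "inverse (real (Suc n)) <= inverse (real (Suc N))" using that by simp
   then have "x \<notin> V n" unfolding V_def mem_Collect_eq using N by linarith
   then show ?thesis using phi(1)[of n] test_functionsE by (metis subsetD)
  qed
  then have "eventually (%n. phi n x = indicator K x) sequentially" using False by (auto simp: eventually_sequentially)
  then show ?thesis by (rule tendsto_eventually)
 qed (simp add: phi)
 have "(%n. \<integral>x. phi n x * psi x * (indicator L x *\<^sub>R f x) \<partial>lebesgue) ---->
   LB (%x. indicator K x * psi x * (indicator L x *\<^sub>R f x))" proof (rule integral_dominated_convergence[OF _ _ integrable_norm[OF int]])
  show "AE x in lebesgue. norm (phi n x * psi x * (indicator L x *\<^sub>R f x)) <= norm (indicator L x *\<^sub>R f x)" for n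
   using phi psi by (auto intro!: AE_I2 mult_left_le_one_le mult_le_one simp: abs_mult)
 qed (auto intro!: AE_I2 tendsto_mult tends)
 moreover have "LB (%x. phi n x * psi x * (indicator L x *\<^sub>R f x)) = 0" for n proof -
  have "(%x. phi n x * psi x) \<in> test_functions U" using phi(1) psi(1) by (intro test_mult_left test_C_k)
  note 0[OF this]
  moreover have "(LINT x:U|lebesgue. f x * (phi n x * psi x)) = LB (%x. f x * (phi n x * psi x))" using L by (intro set_integral_eq_integral) auto
  moreover have "(%x. phi n x * psi x * (indicator L x *\<^sub>R f x)) = (%x. f x * (phi n x * psi x))" using L(3) by (auto simp: indicator_def fun_eq_iff)
  ultimately show ?thesis by metis
 qed
 ultimately have "LB (%x. indicator K x * psi x * (indicator L x *\<^sub>R f x)) = 0" by (simp add: LIMSEQ_const_iff)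
 moreover have "(%x. indicator K x * psi x * (indicator L x *\<^sub>R f x)) = (%x. indicator K x * f x)" using KL psi(4) by (auto simp: indicator_def fun_eq_iff)
 ultimately show ?thesis by metis
qed simp

text \<open>If f were positive on a set of positive measure, inner regularity would give a compact
  subset of positive measure, and the integral of f over it would be positive.\<close>

lemma AE_le_0_if_integral_compact_le_0:
 fixes f :: "'a::euclidean_space => real"
 assumes K: "compact K" and int: "integrable lebesgue (%x. indicator K x * f x)"
  and le: "!!C. compact C ==> C \<subseteq> K ==> LB (%x. indicator C x * f x) <= 0"
 shows "AE x in lebesgue. x \<in> K --> f x <= 0" proof -
 define A where "A = {x \<in> space lebesgue. 0 < indicator K x * f x}"
 have A: "A \<in> sets lebesgue" unfolding A_def using int by (intro borel_measurable_less) auto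
 have AK0: "x \<in> K & 0 < f x" if "x \<in> A" for x using that by (cases "x \<in> K") (auto simp: A_def)
 then have AK: "A \<subseteq> K" "!!x. x \<in> A ==> 0 < f x" by auto
 have null: "C \<in> null_sets lebesgue" if C: "closed C" "C \<subseteq> A" for C proof -
  have cC: "compact C" using C AK K by (metis Int_absorb1 compact_Int_closed order_trans)
  then have [measurable]: "C \<in> sets lebesgue" by (simp add: borel_compact)
  have eq: "indicator C x * f x = indicator C x * (indicator K x * f x)" for x using C AK by (auto simp: indicator_def)
  have intC: "integrable lebesgue (%x. indicator C x * f x)" unfolding eq using integrable_mult_indicator[OF _ int, of C] by simp
  have nn: "AE x in lebesgue. 0 <= indicator C x * f x" using C AK by (auto simp: indicator_def less_imp_le subset_eq)
  have "LB (%x. indicator C x * f x) = 0" using le[OF cC] C AK integral_nonneg_AE[OF nn] by fastforce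
  then have "AE x in lebesgue. indicator C x * f x = 0" using integral_nonneg_eq_0_iff_AE[OF intC nn] by simp
  then have "AE x in lebesgue. x \<notin> C" proof eventually_elim
   case (elim x)
   show ?case proof
    assume "x \<in> C"
    moreover from this have "0 < f x" using C AK(2) by blast
    ultimately show False using elim by simp
   qed
  qed
  then show ?thesis by (simp add: AE_iff_null_sets)
 qed
 have "emeasure lebesgue A <= 0 + ennreal e" if e: "e > 0" for e proof -
  obtain T where T: "closed T" "T \<subseteq> A" "A - T \<in> lmeasurable" "emeasure lebesgue (A - T) < ennreal e" using sets_lebesgue_inner_closed[OF A e] by metis
  have "emeasure lebesgue A = emeasure lebesgue (T \<union> (A - T))" using T by (simp add: Un_absorb1)
  also have "... = emeasure lebesgue (A - T)" using null[OF T(1,2)] T A by (subst Un_commute, intro emeasure_Un_null_set) auto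
  finally show ?thesis using T by simp
 qed
 then have "emeasure lebesgue A <= 0" by (rule ennreal_le_epsilon)
 then have "A \<in> null_sets lebesgue" using A by auto
 from AE_not_in[OF this] show ?thesis by eventually_elim (auto simp: A_def)
qed

lemma fundamental_lemma:
 fixes f :: "'a::euclidean_space => real"
 assumes U: "open U" and f: "loc_integrable U f"
  and 0: "!!phi. phi \<in> test_functions U ==> (LINT x:U|lebesgue. f x * phi x) = 0"
 shows "AE x in lebesgue. x \<in> U --> f x = 0" proof -
 obtain C :: "nat => 'a set" where C: "!!n. compact (C n)" "!!n. C n \<subseteq> U" "(\<Union>n. C n) = U" using open_Union_compact_subsets[OF U] by metis
 have "AE x in lebesgue. x \<in> C n --> f x = 0" for n proof -
  have int: "integrable lebesgue (%x. indicator (C n) x * f x)" using f C by (auto simp: loc_integrable_def set_integrable_def)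
  have z: "LB (%x. indicator K x * f x) = 0" if "compact K" "K \<subseteq> C n" for K using integral_compact_eq_0[OF U f 0 that(1)] that C by blast
  have "AE x in lebesgue. x \<in> C n --> f x <= 0" using z by (intro AE_le_0_if_integral_compact_le_0 C int) auto
  moreover have "AE x in lebesgue. x \<in> C n --> - f x <= 0" using z int by (intro AE_le_0_if_integral_compact_le_0 C) auto
  ultimately show ?thesis by eventually_elim auto
 qed
 then have "AE x in lebesgue. \<forall>n. x \<in> C n --> f x = 0" unfolding AE_all_countable by blast
 then show ?thesis by eventually_elim (use C(3) in blast)
qed

lemma loc_integrable_lin:
 assumes "loc_integrable U f" "loc_integrable U g"
 shows "loc_integrable U (%x. a *\<^sub>R f x + b *\<^sub>R g x)" using assms unfolding loc_integrable_def by (auto intro!: set_integral_add set_integrable_scaleR_right)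

lemma loc_integrable_inner: "loc_integrable U f ==> loc_integrable U (%x. f x \<bullet> b)" unfolding loc_integrable_def set_integrable_def
 by (auto simp flip: inner_scaleR_left)

lemma loc_integrable_test:
 assumes "loc_integrable U f" "phi \<in> test_functions U"
 shows "integrable lebesgue (%x. indicator U x *\<^sub>R (f x * phi x))"
  "integrable lebesgue (%x. indicator U x *\<^sub>R (f x * frechet_derivative phi (at x) b))" proof -
 obtain K where K: "compact K" "K \<subseteq> U" "!!x. x \<notin> K ==> phi x = 0" using test_functionsE[OF assms(2)] by metis
 have K': "frechet_derivative phi (at x) = (%_. 0)" if "x \<notin> K" for x using test_partial_eq_0 K that by blast
 have eq: "indicator U x *\<^sub>R (f x * phi x) = phi x *\<^sub>R f x"
  "indicator U x *\<^sub>R (f x * frechet_derivative phi (at x) b) = frechet_derivative phi (at x) b *\<^sub>R f x" for x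
  using K(2) K(3)[of x] K'[of x] by (cases "x \<in> U"; auto simp: indicator_def subset_eq)+
 show "integrable lebesgue (%x. indicator U x *\<^sub>R (f x * phi x))" unfolding eq using K test_continuous[OF assms(2)] by (intro loc_integrable_mult[OF assms(1)]) auto
 show "integrable lebesgue (%x. indicator U x *\<^sub>R (f x * frechet_derivative phi (at x) b))"
  unfolding eq using K K' test_partial[OF assms(2)] by (intro loc_integrable_mult[OF assms(1)]) auto
qed

lemma has_weak_gradient_lin:
 assumes "has_weak_gradient U u g" "has_weak_gradient U v h"
 shows "has_weak_gradient U (%x. al * u x + bt * v x) (%x. al *\<^sub>R g x + bt *\<^sub>R h x)" unfolding has_weak_gradient_def proof (intro conjI ballI)
 have loc: "loc_integrable U u" "loc_integrable U v" "loc_integrable U g" "loc_integrable U h" using assms by (auto simp: has_weak_gradient_def)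
 show "loc_integrable U (%x. al * u x + bt * v x)" "loc_integrable U (%x. al *\<^sub>R g x + bt *\<^sub>R h x)"
  using loc_integrable_lin[OF loc(1,2)] loc_integrable_lin[OF loc(3,4)] by auto
 fix phi :: "'a => real" and b :: 'a assume phi: "phi \<in> test_functions U" and b: "b \<in> Basis"
 note I = loc_integrable_test(2)[OF loc(1) phi, of b] loc_integrable_test(2)[OF loc(2) phi, of b]
  loc_integrable_test(1)[OF loc_integrable_inner[OF loc(3)] phi, of b]
  loc_integrable_test(1)[OF loc_integrable_inner[OF loc(4)] phi, of b]
 let ?D = "%x. frechet_derivative phi (at x) b"
 have "(LINT x:U|lebesgue. (al * u x + bt * v x) * ?D x)
   = al * (LINT x:U|lebesgue. u x * ?D x) + bt * (LINT x:U|lebesgue. v x * ?D x)" proof -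
  have "(LINT x:U|lebesgue. (al * u x + bt * v x) * ?D x)
   = LB (%x. al * (indicator U x *\<^sub>R (u x * ?D x)) + bt * (indicator U x *\<^sub>R (v x * ?D x)))" unfolding set_lebesgue_integral_def
   by (intro Bochner_Integration.integral_cong refl) (simp add: algebra_simps)
  then show ?thesis using I unfolding set_lebesgue_integral_def by simp
 qed
 also have "... = - (al * (LINT x:U|lebesgue. (g x \<bullet> b) * phi x) + bt * (LINT x:U|lebesgue. (h x \<bullet> b) * phi x))"
  using assms phi b by (simp add: has_weak_gradient_def)
 also have "al * (LINT x:U|lebesgue. (g x \<bullet> b) * phi x) + bt * (LINT x:U|lebesgue. (h x \<bullet> b) * phi x)
   = (LINT x:U|lebesgue. ((al *\<^sub>R g x + bt *\<^sub>R h x) \<bullet> b) * phi x)" proof -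
  have "(LINT x:U|lebesgue. ((al *\<^sub>R g x + bt *\<^sub>R h x) \<bullet> b) * phi x)
   = LB (%x. al * (indicator U x *\<^sub>R ((g x \<bullet> b) * phi x)) + bt * (indicator U x *\<^sub>R ((h x \<bullet> b) * phi x)))" unfolding set_lebesgue_integral_def
   by (intro Bochner_Integration.integral_cong refl) (simp add: algebra_simps inner_add_left)
  then show ?thesis using I unfolding set_lebesgue_integral_def by simp
 qed
 finally show "(LINT x:U|lebesgue. (al * u x + bt * v x) * ?D x)
  = - (LINT x:U|lebesgue. ((al *\<^sub>R g x + bt *\<^sub>R h x) \<bullet> b) * phi x)" .
qed

lemma has_weak_gradient_unique:
 assumes U: "open U" and "has_weak_gradient U u g" "has_weak_gradient U u h"
 shows "AE x in lebesgue. x \<in> U --> g x = h x" proof -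
 have W: "has_weak_gradient U (%x. 0) (%x. g x - h x)" using has_weak_gradient_lin[OF assms(2,3), of 1 "-1"] by simp
 have "AE x in lebesgue. x \<in> U --> (g x - h x) \<bullet> b = 0" if b: "b \<in> Basis" for b proof (rule fundamental_lemma[OF U])
  show "loc_integrable U (%x. (g x - h x) \<bullet> b)" using W by (intro loc_integrable_inner) (auto simp: has_weak_gradient_def)
  fix phi :: "'a => real" assume "phi \<in> test_functions U"
  then show "(LINT x:U|lebesgue. ((g x - h x) \<bullet> b) * phi x) = 0" using W b by (auto simp: has_weak_gradient_def)
 qed
 then have "AE x in lebesgue. \<forall>b\<in>Basis. x \<in> U --> (g x - h x) \<bullet> b = 0" by (intro AE_finite_allI) auto
 then show ?thesis proof eventually_elim
  case (elim x)
  then show ?case by (simp add: euclidean_eq_iff[of "g x" "h x"] inner_diff_left)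
 qed
qed

lemma has_weak_gradient_wgrad: "u \<in> W11loc U ==> has_weak_gradient U u (wgrad U u)"
 unfolding W11loc_def wgrad_def mem_Collect_eq by (rule someI_ex[of "has_weak_gradient U u"])

lemma wgrad_AE_eq:
 assumes "open U" "has_weak_gradient U u g"
 shows "AE x in lebesgue. x \<in> U --> wgrad U u x = g x" using has_weak_gradient_unique[OF assms(1) has_weak_gradient_wgrad assms(2)] assms(2)
 by (auto simp: W11loc_def)

lemma wgrad_test_function:
 assumes "open U" "phi \<in> tests"
 shows "AE x in lebesgue. x \<in> U --> wgrad U phi x = grad phi x" using assms by (intro wgrad_AE_eq has_weak_gradient_test_function)

section \<open>Ball averages and the maximal function\<close>

abbreviation unif_ball :: "'a::euclidean_space measure"
 where "unif_ball \<equiv> uniform_measure lborel (ball 0 1)"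

text \<open>Rescaling to the unit ball makes the average an expectation under one fixed probability
  measure; Jensen's inequality and Fubini in the radius \<open>s\<close> then apply
  directly.\<close>

definition ball_avg :: "('a::euclidean_space => real) => 'a => real => real"
 where "ball_avg f x s = (\<integral>z. f (x + s *\<^sub>R z) \<partial>unif_ball)"

text \<open>Boundedness keeps averages and maximal functions real valued. Gradient norms of test
  functions are of this kind, so the class is large enough for the Sobolev inequality.\<close>

definition bdd_borel :: "real => ('a::euclidean_space => real) => bool"
 where "bdd_borel B f \<longleftrightarrow> f \<in> borel_measurable borel & (\<forall>x. 0 <= f x & f x <= B)"

lemma bdd_borelD:
 assumes "bdd_borel B f"
 shows "f \<in> borel_measurable borel" "0 <= f x" "f x <= B" using assms by (auto simp: bdd_borel_def)

lemma emeasure_ball_scale: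
 fixes x :: "'a::euclidean_space"
 assumes "0 <= s" "0 <= c"
 shows "emeasure lborel (ball x (c * s)) = ennreal (c ^ DIM('a)) * emeasure lborel (ball x s)"
 using assms by (simp add: emeasure_ball power_mult_distrib ennreal_mult[symmetric] mult.left_commute)

lemma emeasure_unit_ball:
 "0 < emeasure lborel (ball (0::'a::euclidean_space) 1)" "emeasure lborel (ball (0::'a) 1) < top" by (simp_all add: emeasure_ball)

lemma prob_space_unif_ball: "prob_space (unif_ball :: 'a::euclidean_space measure)" using emeasure_unit_ball[where 'a='a] by (intro prob_space_uniform_measure) auto

lemma nn_integral_ball_scale:
 fixes F :: "'a::euclidean_space => ennreal"
 assumes [measurable]: "F \<in> borel_measurable borel" and s: "0 < s"
 shows "BN (%y. F y * indicator (ball x s) y)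
  = emeasure lborel (ball x s) * (\<integral>\<^sup>+z. F (x + s *\<^sub>R z) \<partial>unif_ball)" proof -
 let ?G = "%y. F y * indicator (ball x s) y"
 let ?J = "\<integral>\<^sup>+z. F (x + s *\<^sub>R z) * indicator (ball 0 1) z \<partial>lborel"
 let ?V = "emeasure lborel (ball (0::'a) 1)"
 have V: "?V ~= 0" "?V ~= top" using emeasure_unit_ball[where 'a='a] by auto
 have [measurable]: "?G \<in> borel_measurable borel" by (intro borel_measurable_times_ennreal borel_measurable_indicator assms) auto
 have [measurable]: "ball (0::'a) 1 \<in> sets borel" by simp
 have "integral\<^sup>N lborel ?G
   = integral\<^sup>N (density (distr lborel borel (%z. x + s *\<^sub>R z)) (%_. ennreal (\<bar>s\<bar> ^ DIM('a)))) ?G"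
  using lborel_affine[of s x] s by (intro arg_cong[of _ _ "%M. integral\<^sup>N M ?G"]) auto
 also have "... = (\<integral>\<^sup>+y. ennreal (s ^ DIM('a)) * ?G y \<partial>distr lborel borel (%z. x + s *\<^sub>R z))"
  using s by (subst nn_integral_density) simp_all
 also have "... = BN (%z. ennreal (s ^ DIM('a)) * ?G (x + s *\<^sub>R z))" by (subst nn_integral_distr) simp_all
 also have "... = BN (%z. ennreal (s ^ DIM('a)) * (F (x + s *\<^sub>R z) * indicator (ball 0 1) z))"
  using s by (intro nn_integral_cong) (auto simp: indicator_def dist_norm)
 also have "... = ennreal (s ^ DIM('a)) * ?J" by (subst nn_integral_cmult) auto
 also have "... = (ennreal (s ^ DIM('a)) * ?V) * (?J / ?V)" proof -
  have "?V * (?J / ?V) = ?J" using V by (simp only: ennreal_times_divide mult.commute[of ?V] ennreal_mult_divide_eq[OF V])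
  then show ?thesis by (simp only: mult.assoc)
 qed
 also have "ennreal (s ^ DIM('a)) * ?V = emeasure lborel (ball x s)" using s by (simp add: emeasure_ball ennreal_mult[symmetric] mult.commute)
 also have "?J / ?V = (\<integral>\<^sup>+z. F (x + s *\<^sub>R z) \<partial>unif_ball)" by (subst nn_integral_uniform_measure) auto
 finally show ?thesis .
qed

lemma integrable_unif_ball:
 fixes x :: "'a::euclidean_space"
 assumes "bdd_borel B f"
 shows "integrable unif_ball (%z. f (x + s *\<^sub>R z))" proof -
 interpret prob_space "unif_ball :: 'a measure" by (rule prob_space_unif_ball)
 note [measurable] = bdd_borelD(1)[OF assms]
 show ?thesis by (rule integrable_const_bound[of _ B]) (use bdd_borelD[OF assms] in auto)
qed

lemma ball_avg_nn_integral:
 assumes "bdd_borel B f"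
 shows "ennreal (ball_avg f x s) = EN unif_ball (%z. f (x + s *\<^sub>R z))" unfolding ball_avg_def using assms
 by (intro nn_integral_eq_integral[symmetric] integrable_unif_ball AE_I2) (auto dest: bdd_borelD)

lemma ball_avg_nonneg: "bdd_borel B f ==> 0 <= ball_avg f x s" unfolding ball_avg_def by (intro Bochner_Integration.integral_nonneg) (auto dest: bdd_borelD)

lemma ball_avg_mono:
 assumes "bdd_borel B f" "bdd_borel B' g" "!!z. norm z < 1 ==> f (x + s *\<^sub>R z) <= g (x + s *\<^sub>R z)"
 shows "ball_avg f x s <= ball_avg g x s" proof -
 have "AE z in unif_ball. norm z < 1" by (rule AE_uniform_measureI) auto
 then show ?thesis unfolding ball_avg_def using assms by (intro integral_mono_AE integrable_unif_ball) (auto elim: eventually_mono)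
qed

lemma ball_avg_const:
 fixes x :: "'a::euclidean_space"
 shows "ball_avg (%_. c) x s = c" proof -
 interpret prob_space "unif_ball :: 'a measure" by (rule prob_space_unif_ball)
 show ?thesis using prob_space by (simp add: ball_avg_def)
qed

lemma ball_avg_le:
 assumes "bdd_borel B f"
 shows "ball_avg f x s <= B" proof -
 have "0 <= B" using bdd_borelD[OF assms] order_trans by blast
 then have "bdd_borel B (%_::'a. B)" by (simp add: bdd_borel_def)
 from ball_avg_mono[OF assms this] show ?thesis using bdd_borelD[OF assms] by (simp add: ball_avg_const)
qed

lemma ball_avg_add:
 assumes "bdd_borel B f" "bdd_borel B' g"
 shows "ball_avg (%x. f x + g x) x s = ball_avg f x s + ball_avg g x s"
 unfolding ball_avg_def using assms by (intro Bochner_Integration.integral_add integrable_unif_ball)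

lemma ball_avg_integral:
 assumes "bdd_borel B f" "0 < s"
 shows "ennreal (ball_avg f x s) * emeasure lborel (ball x s)
  = BN (%y. ennreal (f y) * indicator (ball x s) y)" using assms bdd_borelD(1)[OF assms(1)]
 by (subst nn_integral_ball_scale) (auto simp: ball_avg_nn_integral mult.commute)

text \<open>Convexity of the power: apart from the trivial cases this is Young's inequality with
  weights \<open>1/r\<close> and \<open>1 - 1/r\<close> for the numbers \<open>t powr r\<close> and
  \<open>a powr r\<close>.\<close>

lemma powr_above_tangent:
 fixes t a r :: real
 assumes "0 <= t" "0 < a" "1 <= r"
 shows "a powr r + r * a powr (r - 1) * (t - a) <= t powr r" proof (cases "r = 1 \<or> t = 0")
 case True
 then show ?thesis proof
  assume "r = 1" then show ?thesis using assms by simp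
 next
  assume "t = 0"
  have "a powr (r - 1) * a = a powr r" using assms by (simp add: powr_diff)
  moreover have "0 <= (r - 1) * a powr r" using assms by simp
  ultimately show ?thesis using \<open>t = 0\<close> assms by (simp add: algebra_simps)
 qed
next
 case False
 then have "(t powr r) powr (1/r) * (a powr r) powr (1 - 1/r) <= 1/r * t powr r + (1 - 1/r) * a powr r"
  using assms Youngs_inequality_0[of "1/r" "1 - 1/r" "t powr r" "a powr r"] by auto
 moreover have "(t powr r) powr (1/r) = t" "(a powr r) powr (1 - 1/r) = a powr (r - 1)" using assms False by (auto simp: powr_powr right_diff_distrib)
 ultimately have "r * (t * a powr (r - 1)) <= r * (1/r * t powr r + (1 - 1/r) * a powr r)" using assms by (intro mult_left_mono) auto
 also have "... = t powr r + (r - 1) * a powr r" using assms by (simp add: field_simps)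
 finally have "r * a powr (r - 1) * t <= t powr r + (r - 1) * a powr r" by (simp add: mult_ac)
 moreover have "a powr (r - 1) * a = a powr r" using assms by (simp add: powr_diff)
 ultimately show ?thesis by (simp add: algebra_simps)
qed

lemma bdd_borel_powr:
 assumes "bdd_borel B f" "0 <= r"
 shows "bdd_borel (B powr r) (%x. f x powr r)" using assms by (auto simp: bdd_borel_def intro!: powr_mono2)

text \<open>The tangent inequality at the mean value \<open>a\<close> is integrated; the linear term
  has mean zero.\<close>

lemma ball_avg_Jensen:
 fixes x :: "'a::euclidean_space"
 assumes f: "bdd_borel B f" and r: "1 <= r"
 shows "ball_avg f x s powr r <= ball_avg (%y. f y powr r) x s" proof (cases "ball_avg f x s = 0")
 case True
 then show ?thesis using ball_avg_nonneg[OF bdd_borel_powr[OF f, of r]] r by simp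
next
 case False
 interpret prob_space "unif_ball :: 'a measure" by (rule prob_space_unif_ball)
 define a where "a = ball_avg f x s"
 have a: "0 < a" using False ball_avg_nonneg[OF f, of x s] by (simp add: a_def)
 have "(\<integral>z. a powr r + r * a powr (r - 1) * (f (x + s *\<^sub>R z) - a) \<partial>unif_ball)
   <= (\<integral>z. f (x + s *\<^sub>R z) powr r \<partial>unif_ball)"
  using integrable_unif_ball[OF f] integrable_unif_ball[OF bdd_borel_powr[OF f, of r]] r a bdd_borelD[OF f] by (intro integral_mono powr_above_tangent) auto
 also have "(\<integral>z. a powr r + r * a powr (r - 1) * (f (x + s *\<^sub>R z) - a) \<partial>unif_ball)
   = a powr r + r * a powr (r - 1) * (ball_avg f x s - a)" using integrable_unif_ball[OF f] prob_space by (simp add: ball_avg_def)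
 finally show ?thesis by (simp add: a_def ball_avg_def)
qed

section \<open>The centred Hardy--Littlewood maximal function\<close>

definition maximal :: "('a::euclidean_space => real) => 'a => real"
 where "maximal f x = (SUP s\<in>{0<..}. ball_avg f x s)"

lemma bdd_above_ball_avg: "bdd_borel B f ==> bdd_above (ball_avg f x ` {0<..})" using ball_avg_le by (auto intro!: bdd_aboveI2[of _ _ B])

lemma ball_avg_le_maximal: "bdd_borel B f ==> 0 < s ==> ball_avg f x s <= maximal f x" unfolding maximal_def by (intro cSUP_upper bdd_above_ball_avg) auto

lemma maximal_le: "(!!s. 0 < s ==> ball_avg f x s <= c) ==> maximal f x <= c" unfolding maximal_def by (intro cSUP_least) auto

lemma maximal_nonneg: "bdd_borel B f ==> 0 <= maximal f x" using ball_avg_le_maximal[of B f 1 x] ball_avg_nonneg[of B f x 1] by linarith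

lemma maximal_le_bound: "bdd_borel B f ==> maximal f x <= B" by (intro maximal_le ball_avg_le)

lemma less_maximal_iff:
 "bdd_borel B f ==> t < maximal f x \<longleftrightarrow> (\<exists>s>0. t < ball_avg f x s)"
 unfolding maximal_def by (subst less_cSUP_iff) (auto intro: bdd_above_ball_avg)

text \<open>A ball about a nearby point \<open>y\<close> with radius enlarged by \<open>e\<close>
  contains the ball about \<open>x\<close>, so the average drops at most by the ratio
  \<open>(1 + e / s) ^ N\<close> of the volumes, which tends to 1 with \<open>e\<close>.\<close>

lemma open_maximal:
 fixes f :: "'a::euclidean_space => real"
 assumes f: "bdd_borel B f" and t: "0 <= t"
 shows "open {x. t < maximal f x}" unfolding open_contains_ball proof
 fix x assume "x \<in> {x. t < maximal f x}"
 then obtain s where s: "0 < s" "t < ball_avg f x s" using less_maximal_iff[OF f] by auto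
 have "((%e. t * (1 + e / s) ^ DIM('a)) \<longlongrightarrow> t * (1 + 0 / s) ^ DIM('a)) (at_right 0)" by (intro tendsto_intros) (use s in auto)
 then have "eventually (%e. t * (1 + e / s) ^ DIM('a) < ball_avg f x s) (at_right 0)" using s by (intro order_tendstoD) auto
 then obtain e where e: "0 < e" "t * (1 + e / s) ^ DIM('a) < ball_avg f x s" by (metis (mono_tags, lifting) eventually_at_right_field field_lbound_gt_zero zero_less_one)
 have "t < maximal f y" if y: "y \<in> ball x e" for y proof -
  have sub: "ball x s \<subseteq> ball y ((1 + e / s) * s)"
   using y s by (intro subsetI) (simp add: algebra_simps, metis add.commute add_strict_mono dist_commute dist_triangle_lt)
  let ?m = "emeasure lborel (ball x s)"
  have m: "0 < ?m" "?m < top" using s by (auto simp: emeasure_ball)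
  have mm: "emeasure lborel (ball y ((1 + e / s) * s)) = ennreal ((1 + e / s) ^ DIM('a)) * ?m" using s e by (subst emeasure_ball_scale) (auto simp: emeasure_ball)
  have "ennreal (t * (1 + e / s) ^ DIM('a)) * ?m < ennreal (ball_avg f x s) * ?m" using m e t s by (intro ennreal_mult_strict_right_mono) (auto simp: ennreal_less_iff)
  also have "... <= ennreal (ball_avg f y ((1 + e / s) * s)) * (ennreal ((1 + e / s) ^ DIM('a)) * ?m)" proof -
   have "0 < (1 + e / s) * s" using s e by (simp add: add_pos_pos)
   then show ?thesis using sub s by (subst mm[symmetric], subst (1 2) ball_avg_integral[OF f]) (auto intro!: nn_integral_mono simp: indicator_def)
  qed
  finally have "ennreal t * (ennreal ((1 + e / s) ^ DIM('a)) * ?m)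
    < ennreal (ball_avg f y ((1 + e / s) * s)) * (ennreal ((1 + e / s) ^ DIM('a)) * ?m)" using t s e by (simp add: ennreal_mult mult.assoc)
  then have "ennreal t < ennreal (ball_avg f y ((1 + e / s) * s))" by (meson leD le_less_linear mult_right_mono zero_le)
  then have "t < ball_avg f y ((1 + e / s) * s)" using t by (simp add: ennreal_less_iff)
  moreover have "0 < (1 + e / s) * s" using s e by (simp add: add_pos_pos)
  ultimately show ?thesis using less_maximal_iff[OF f] by blast
 qed
 then show "\<exists>e>0. ball x e \<subseteq> {x. t < maximal f x}" using e by blast
qed

lemma borel_measurable_maximal:
 assumes f: "bdd_borel B f"
 shows "maximal f \<in> borel_measurable borel" proof (rule borel_measurableI_greater)
 fix t :: real
 show "{x \<in> space borel. t < maximal f x} \<in> sets borel" proof (cases "0 <= t")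
  case False
  then have "{x \<in> space borel. t < maximal f x} = UNIV" using maximal_nonneg[OF f] by (auto intro: less_le_trans[of _ 0])
  then show ?thesis by simp
 qed (use open_maximal[OF f] in simp)
qed

lemma emeasure_UN_le_count_space:
 assumes [measurable]: "!!i. i \<in> I ==> X i \<in> sets M" and "countable I"
 shows "emeasure M (\<Union>i\<in>I. X i) <= (\<integral>\<^sup>+i. emeasure M (X i) \<partial>count_space I)" proof -
 have "emeasure M (\<Union>i\<in>I. X i) = (\<integral>\<^sup>+x. indicator (\<Union>i\<in>I. X i) x \<partial>M)"
  using assms by (subst nn_integral_indicator) (auto intro!: sets.countable_UN')
 also have "... <= (\<integral>\<^sup>+x. (\<integral>\<^sup>+i. indicator (X i) x \<partial>count_space I) \<partial>M)" proof (intro nn_integral_mono)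
  fix x
  show "indicator (\<Union>i\<in>I. X i) x <= (\<integral>\<^sup>+i. indicator (X i) x \<partial>count_space I)" proof (cases "x \<in> (\<Union>i\<in>I. X i)")
   case True
   then obtain i where "i \<in> I" "x \<in> X i" by auto
   then show ?thesis using nn_integral_ge_point[of i I "%i. indicator (X i) x"] by (simp only: indicator_simps(1)[OF True] indicator_simps(1))
  qed simp
 qed
 also have "... = (\<integral>\<^sup>+i. emeasure M (X i) \<partial>count_space I)"
  using assms by (subst nn_integral_count_space_nn_integral) (auto intro!: nn_integral_cong)
 finally show ?thesis .
qed

text \<open>Vitali's covering lemma: every point of the level set has a ball with average above
  \<open>t\<close>; a disjoint family of these covers the level set after fivefold enlargement, and
  the integrals over disjoint balls add up to at most the whole integral.\<close>

lemma maximal_weak_type: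
 fixes f :: "'a::euclidean_space => real"
 assumes f: "bdd_borel B f" and fin: "BI (%x. f x) < top" and t: "0 < t"
 shows "ennreal t * emeasure lborel {x. t < maximal f x} <= 5 ^ DIM('a) * BI (%x. f x)" proof -
 note [measurable] = bdd_borelD(1)[OF f]
 define S where "S = {x. t < maximal f x}"
 define J where "J = enn2real (BI (%x. f x))"
 have J: "BI (%x. f x) = ennreal J" "0 <= J" using fin by (auto simp: J_def)
 define V where "V = unit_ball_vol (real DIM('a))"
 have V: "0 < V" by (simp add: V_def)
 have "\<exists>s>0. t < ball_avg f x s" if "x \<in> S" for x using that less_maximal_iff[OF f] by (auto simp: S_def)
 then obtain r where r: "!!x. x \<in> S ==> 0 < r x" "!!x. x \<in> S ==> t < ball_avg f x (r x)" by metis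
 have ball_le: "ennreal t * emeasure lborel (ball x (r x)) <= BN (%y. ennreal (f y) * indicator (ball x (r x)) y)"
  if "x \<in> S" for x using r[OF that] by (subst ball_avg_integral[OF f, symmetric]) (auto intro!: mult_right_mono ennreal_leI)
 \<comment> \<open>The covering lemma asks for bounded radii. A ball with average above
   \<open>t\<close> has volume at most \<open>J / t\<close>, because the total integral is
   \<open>J\<close>.\<close>
 have r_le: "r x <= max 1 (J / (t * V))" if "x \<in> S" for x proof (cases "r x <= 1")
  case False
  have "ennreal (t * (V * r x ^ DIM('a))) = ennreal t * emeasure lborel (ball x (r x))" using r(1)[OF that] t V by (simp add: emeasure_ball ennreal_mult[symmetric] V_def)
  also note ball_le[OF that]
  also have "BN (%y. ennreal (f y) * indicator (ball x (r x)) y) <= ennreal J" unfolding J(1)[symmetric] by (intro nn_integral_mono) (auto simp: indicator_def)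
  finally have "t * (V * r x ^ DIM('a)) <= J" using J by (simp add: ennreal_le_iff)
  then have "r x ^ DIM('a) <= J / (t * V)" using t V by (simp add: field_simps)
  moreover have "r x ^ 1 <= r x ^ DIM('a)" using False by (intro power_increasing) (auto simp: Suc_leI)
  ultimately show ?thesis by simp
 qed simp
 obtain C where C: "countable C" "C \<subseteq> S" "pairwise (%i j. disjnt (ball i (r i)) (ball j (r j))) C"
  "S \<subseteq> (\<Union>i\<in>C. ball i (5 * r i))"
  using Vitali_covering_lemma_balls[where S = S and K = S and a = "%x. x" and r = r and B = "max 1 (J / (t * V))"] r r_le
  by (metis (no_types, lifting) UN_iff centre_in_ball subsetI)
 have disj: "disjoint_family_on (%i. ball i (r i)) C" using C(3) by (auto simp: disjoint_family_on_def pairwise_def disjnt_def)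
 have "ennreal t * emeasure lborel S <= ennreal t * emeasure lborel (\<Union>i\<in>C. ball i (5 * r i))"
  using C by (intro mult_left_mono emeasure_mono sets.countable_UN') auto
 also have "... <= ennreal t * (\<integral>\<^sup>+i. emeasure lborel (ball i (5 * r i)) \<partial>count_space C)"
  using C by (intro mult_left_mono emeasure_UN_le_count_space) auto
 also have "... = (\<integral>\<^sup>+i. ennreal t * emeasure lborel (ball i (5 * r i)) \<partial>count_space C)" by (subst nn_integral_cmult) auto
 also have "... <= (\<integral>\<^sup>+i. 5 ^ DIM('a) * emeasure (density lborel (%x. ennreal (f x))) (ball i (r i)) \<partial>count_space C)"
 proof (intro nn_integral_mono)
  fix i assume "i \<in> space (count_space C)"
  then have i: "i \<in> S" using C by auto
  have "ennreal t * emeasure lborel (ball i (5 * r i))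
    = 5 ^ DIM('a) * (ennreal t * emeasure lborel (ball i (r i)))" using r(1)[OF i] by (subst emeasure_ball_scale) (auto simp: mult_ac ennreal_power[symmetric])
  also have "... <= 5 ^ DIM('a) * BN (%y. ennreal (f y) * indicator (ball i (r i)) y)" using ball_le[OF i] by (intro mult_left_mono) auto
  finally show "ennreal t * emeasure lborel (ball i (5 * r i))
    <= 5 ^ DIM('a) * emeasure (density lborel (%x. ennreal (f x))) (ball i (r i))" by (simp add: emeasure_density)
 qed
 also have "... = 5 ^ DIM('a) * (\<integral>\<^sup>+i. emeasure (density lborel (%x. ennreal (f x))) (ball i (r i)) \<partial>count_space C)"
  by (subst nn_integral_cmult) auto
 also have "(\<integral>\<^sup>+i. emeasure (density lborel (%x. ennreal (f x))) (ball i (r i)) \<partial>count_space C)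
   = emeasure (density lborel (%x. ennreal (f x))) (\<Union>i\<in>C. ball i (r i))" using C disj by (intro emeasure_UN_countable[symmetric]) auto
 also have "5 ^ DIM('a) * emeasure (density lborel (%x. ennreal (f x))) (\<Union>i\<in>C. ball i (r i))
   <= 5 ^ DIM('a) * emeasure (density lborel (%x. ennreal (f x))) UNIV" by (intro mult_left_mono emeasure_mono) auto
 also have "emeasure (density lborel (%x. ennreal (f x))) UNIV = BI (%x. f x)" by (subst emeasure_density) auto
 finally show ?thesis by (simp add: S_def)
qed

lemma nn_integral_powr_Ioo:
 fixes a b :: real
 assumes "-1 < b" "0 <= a"
 shows "BN (%t. ennreal (t powr b) * indicator {0<..<a} t) = ennreal (a powr (b + 1) / (b + 1))" proof -
 have "((%t. if t \<in> {0..a} then t powr b else 0) has_integral (a powr (b + 1) / (b + 1))) UNIV"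
  using has_integral_powr_from_0[OF assms] by (simp only: has_integral_restrict_UNIV)
 then have "BI (%t. if t \<in> {0..a} then t powr b else 0) = ennreal (a powr (b + 1) / (b + 1))" by (intro nn_integral_has_integral_lborel) auto
 moreover have "BN (%t. ennreal (t powr b) * indicator {0<..<a} t)
   = BI (%t. if t \<in> {0..a} then t powr b else 0)" proof (rule nn_integral_cong_AE)
  show "AE t in lborel. ennreal (t powr b) * indicator {0<..<a} t = ennreal (if t \<in> {0..a} then t powr b else 0)"
   using AE_lborel_singleton[of 0] AE_lborel_singleton[of a] by eventually_elim (auto simp: indicator_def)
 qed
 ultimately show ?thesis by simp
qed

text \<open>The part of \<open>f\<close> below \<open>t/2\<close> contributes at most
  \<open>t/2\<close> to any average, so only the part \<open>h\<close> above it has to be fed into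
  the weak estimate, at level \<open>t/2\<close>. The truncation is what makes the integral over all
  levels converge.\<close>

lemma maximal_weak_type_truncated:
 fixes f :: "'a::euclidean_space => real"
 assumes f: "bdd_borel B f" and fin: "BI (%x. f x) < top" and t: "0 < t"
 shows "ennreal t * emeasure lborel {x. t < maximal f x}
  <= 2 * 5 ^ DIM('a) * BN (%x. ennreal (f x) * indicator {x. t < 2 * f x} x)" proof -
 define h where "h x = f x * indicator {x. t < 2 * f x} x" for x
 note [measurable] = bdd_borelD(1)[OF f]
 have [measurable]: "h \<in> borel_measurable borel" unfolding h_def[abs_def] by measurable
 have h: "bdd_borel B h" using bdd_borelD[OF f] order_trans[OF bdd_borelD(2,3)[OF f]] by (auto simp: bdd_borel_def) (auto simp: h_def indicator_def)
 have eq: "ennreal (h x) = ennreal (f x) * indicator {x. t < 2 * f x} x" for x by (auto simp: h_def indicator_def)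
 have c: "bdd_borel (t/2) (%_::'a. t/2)" using t by (simp add: bdd_borel_def)
 have hc: "bdd_borel (B + t/2) (%x. h x + t/2)" using h t by (auto simp: bdd_borel_def)
 have "maximal f x <= maximal h x + t/2" for x proof (rule maximal_le)
  fix s :: real assume s: "0 < s"
  have "ball_avg f x s <= ball_avg (%x. h x + t/2) x s" using t bdd_borelD(2)[OF f] by (intro ball_avg_mono[OF f hc]) (auto simp: h_def indicator_def)
  also have "... = ball_avg h x s + t/2" by (subst ball_avg_add[OF h c]) (simp add: ball_avg_const)
  also have "... <= maximal h x + t/2" using ball_avg_le_maximal[OF h s] by simp
  finally show "ball_avg f x s <= maximal h x + t/2" .
 qed
 then have sub: "{x. t < maximal f x} \<subseteq> {x. t/2 < maximal h x}" by (auto simp: field_simps) (smt (verit, best))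
 have "{x. t/2 < maximal h x} \<in> sets lborel" using open_maximal[OF h, of "t/2"] t by simp
 then have "ennreal t * emeasure lborel {x. t < maximal f x} <= ennreal t * emeasure lborel {x. t/2 < maximal h x}" using sub by (intro mult_left_mono emeasure_mono) auto
 also have "... = 2 * (ennreal (t/2) * emeasure lborel {x. t/2 < maximal h x})"
  using t by (simp add: mult.assoc[symmetric] ennreal_mult'[symmetric] flip: ennreal_numeral)
 also have "... <= 2 * (5 ^ DIM('a) * BI (%x. h x))" proof (intro mult_left_mono maximal_weak_type[OF h])
  have "BI (%x. h x) <= BI (%x. f x)" unfolding eq by (intro nn_integral_mono) (auto simp: indicator_def)
  then show "BI (%x. h x) < top" using fin by simp
 qed (use t in auto)
 finally show ?thesis by (simp add: eq mult.assoc)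
qed

text \<open>Marcinkiewicz interpolation: the power is an integral over levels \<open>t\<close>, the
  truncated weak estimate is inserted at each level, and Fubini leaves the integral of
  \<open>t powr (r - 2)\<close> up to \<open>2 * f x\<close>, finite because
  \<open>r > 1\<close>.\<close>

lemma maximal_strong_type:
 fixes f :: "'a::euclidean_space => real"
 assumes f: "bdd_borel B f" and fin: "BI (%x. f x) < top" and r: "1 < r"
 shows "BI (%x. maximal f x powr r)
  <= ennreal (r * 2 powr (r - 1) / (r - 1) * (2 * 5 ^ DIM('a))) * BI (%x. f x powr r)" proof -
 note [measurable] = bdd_borelD(1)[OF f] borel_measurable_maximal[OF f]
 define K :: ennreal where "K = 2 * 5 ^ DIM('a)"
 have "BI (%x. maximal f x powr r)
   = BN (%x. BN (%t. ennreal r * (ennreal (t powr (r - 1)) * indicator {0<..<maximal f x} t)))" proof (intro nn_integral_cong)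
  fix x
  show "ennreal (maximal f x powr r)
   = BN (%t. ennreal r * (ennreal (t powr (r - 1)) * indicator {0<..<maximal f x} t))" using r maximal_nonneg[OF f, of x]
   by (subst nn_integral_cmult, simp, subst nn_integral_powr_Ioo) (auto simp: ennreal_mult[symmetric])
 qed
 also have "... = BN (%t. BN (%x. ennreal r * (ennreal (t powr (r - 1)) * indicator {0<..<maximal f x} t)))"
  by (rule lborel_pair.Fubini'[symmetric]) (simp add: greaterThanLessThan_iff indicator_def)
 also have "... <= BN (%t. BN (%x. (K * ennreal r * ennreal (f x)) * (ennreal (t powr (r - 2)) * indicator {0<..<2 * f x} t)))" proof (rule nn_integral_mono)
  fix t :: real
  show "BN (%x. ennreal r * (ennreal (t powr (r - 1)) * indicator {0<..<maximal f x} t))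
   <= BN (%x. (K * ennreal r * ennreal (f x)) * (ennreal (t powr (r - 2)) * indicator {0<..<2 * f x} t))" proof (cases "0 < t")
   case True
   have "BN (%x. ennreal r * (ennreal (t powr (r - 1)) * indicator {0<..<maximal f x} t))
    = BN (%x. (ennreal r * ennreal (t powr (r - 1))) * indicator {x. t < maximal f x} x)" using True by (intro nn_integral_cong) (auto simp: indicator_def)
   also have "... = (ennreal r * ennreal (t powr (r - 1))) * emeasure lborel {x. t < maximal f x}" by (subst nn_integral_cmult_indicator) auto
   also have "... = ennreal r * ennreal (t powr (r - 2)) * (ennreal t * emeasure lborel {x. t < maximal f x})" proof -
    have "ennreal (t powr (r - 1)) = ennreal (t powr (r - 2)) * ennreal t" using True powr_add[of t "r - 2" 1] by (simp add: ennreal_mult[symmetric])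
    then show ?thesis by (simp add: mult.assoc)
   qed
   also have "... <= ennreal r * ennreal (t powr (r - 2)) * (K * BN (%x. ennreal (f x) * indicator {x. t < 2 * f x} x))"
    unfolding K_def by (intro mult_left_mono maximal_weak_type_truncated[OF f fin True]) auto
   also have "... = BN (%x. (ennreal r * ennreal (t powr (r - 2)) * K) * (ennreal (f x) * indicator {x. t < 2 * f x} x))"
    by (subst nn_integral_cmult) (auto simp: mult.assoc)
   also have "... = BN (%x. (K * ennreal r * ennreal (f x)) * (ennreal (t powr (r - 2)) * indicator {0<..<2 * f x} t))"
    using True by (intro nn_integral_cong) (auto simp: indicator_def mult_ac)
   finally show ?thesis .
  qed simp
 qed
 also have "... = BN (%x. BN (%t. (K * ennreal r * ennreal (f x)) * (ennreal (t powr (r - 2)) * indicator {0<..<2 * f x} t)))"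
  by (rule lborel_pair.Fubini') (simp add: greaterThanLessThan_iff indicator_def)
 also have "... = BN (%x. ennreal (r * 2 powr (r - 1) / (r - 1) * (2 * 5 ^ DIM('a))) * ennreal (f x powr r))" proof (intro nn_integral_cong)
  fix x
  have K: "K = ennreal (2 * 5 ^ DIM('a))" by (simp add: K_def ennreal_mult ennreal_power[symmetric])
  have "BN (%t. (K * ennreal r * ennreal (f x)) * (ennreal (t powr (r - 2)) * indicator {0<..<2 * f x} t))
   = K * ennreal r * ennreal (f x) * ennreal ((2 * f x) powr (r - 1) / (r - 1))" using r bdd_borelD(2)[OF f, of x]
   by (subst nn_integral_cmult, simp, subst nn_integral_powr_Ioo) (auto simp: algebra_simps)
  also have "... = ennreal (2 * 5 ^ DIM('a) * r * f x * ((2 * f x) powr (r - 1) / (r - 1)))" proof -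
   have "0 <= (2 * f x) powr (r - 1) / (r - 1)" "0 <= f x" "0 <= r" "0 <= (2 * 5 ^ DIM('a) :: real)" using r bdd_borelD(2)[OF f, of x] by auto
   then show ?thesis unfolding K by (simp only: ennreal_mult mult_nonneg_nonneg)
  qed
  also have "2 * 5 ^ DIM('a) * r * f x * ((2 * f x) powr (r - 1) / (r - 1))
   = (r * 2 powr (r - 1) / (r - 1) * (2 * 5 ^ DIM('a))) * f x powr r" proof -
   have "f x * (2 * f x) powr (r - 1) = 2 powr (r - 1) * f x powr r" proof (cases "f x = 0")
   case False
   then have "f x * f x powr (r - 1) = f x powr r" using bdd_borelD(2)[OF f, of x] powr_add[of "f x" 1 "r - 1"] by simp
   then show ?thesis by (simp add: powr_mult mult.left_commute)
  qed (use r in simp)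
  then show ?thesis by (simp add: field_simps)
  qed
  also have "ennreal ... = ennreal (r * 2 powr (r - 1) / (r - 1) * (2 * 5 ^ DIM('a))) * ennreal (f x powr r)" using r by (intro ennreal_mult) auto
  finally show "BN (%t. (K * ennreal r * ennreal (f x)) * (ennreal (t powr (r - 2)) * indicator {0<..<2 * f x} t))
   = ennreal (r * 2 powr (r - 1) / (r - 1) * (2 * 5 ^ DIM('a))) * ennreal (f x powr r)" .
 qed
 also have "... = ennreal (r * 2 powr (r - 1) / (r - 1) * (2 * 5 ^ DIM('a))) * BI (%x. f x powr r)" by (rule nn_integral_cmult) auto
 finally show ?thesis .
qed

section \<open>Variable exponents\<close>

text \<open>The integrable error made when two exponents with the same limit at infinity are
  exchanged. The power exceeds the dimension by one.\<close>

definition decay :: "'a::euclidean_space => real"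
 where "decay y = (1 + norm y) powr (- (real DIM('a) + 1))"

lemma decay_nonneg: "0 <= decay y" by (simp add: decay_def)

text \<open>Dyadic shells: where \<open>2 ^ k <= 1 + norm y < 2 ^ (k + 1)\<close> the value is at
  most \<open>2 ^ (- k (N + 1))\<close>, and the enclosing ball has volume of order
  \<open>2 ^ (k N)\<close>, so the series is geometric.\<close>

lemma nn_integral_decay: "BI (%y. decay (y::'a::euclidean_space)) < top" proof -
 define N where "N = DIM('a)"
 define V where "V = unit_ball_vol (real N)"
 have "V > 0" by (simp add: V_def)
 have le: "ennreal (decay y) <= (\<Sum>k. ennreal ((1/2) ^ (k * (N + 1))) * indicator (ball 0 (2 ^ (k + 1))) y)" for y :: 'a proof -
  define k where "k = (LEAST k. 1 + norm y < 2 ^ (k + 1))"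
  obtain n where "1 + norm y < 2 ^ n" using real_arch_pow[of 2 "1 + norm y"] by auto
  then have "1 + norm y < 2 ^ (n + 1)" using power_increasing[of n "n + 1" "2::real"] by linarith
  then have k: "1 + norm y < 2 ^ (k + 1)" unfolding k_def by (rule LeastI)
  have k': "2 ^ k <= 1 + norm y" proof (cases k)
   case (Suc j)
   then have "j < k" by simp
   then have "\<not> 1 + norm y < 2 ^ (j + 1)" unfolding k_def by (rule not_less_Least)
   then show ?thesis using Suc by simp
  qed simp
  have "decay y <= (2 ^ k) powr (- (real N + 1))" unfolding decay_def N_def[symmetric] using k' by (intro powr_mono2') auto
  also have "... = inverse ((2 ^ k) powr real (N + 1))" by (subst powr_minus) (simp add: add.commute)
  also have "... = (1/2) ^ (k * (N + 1))" by (subst powr_realpow) (simp, simp only: power_mult power_one_over inverse_eq_divide)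
  finally have "ennreal (decay y) <= ennreal ((1/2) ^ (k * (N + 1))) * indicator (ball 0 (2 ^ (k + 1))) y" using k by (auto intro!: ennreal_leI simp: indicator_def)
  also have "... <= (\<Sum>k. ennreal ((1/2) ^ (k * (N + 1))) * indicator (ball 0 (2 ^ (k + 1))) y)"
   (is "?F k <= suminf ?F") proof -
   have "sum ?F {k} <= suminf ?F" by (intro sum_le_suminf) auto
   moreover have "sum ?F {k} = ?F k" by (rule sum.insert[of "{}" k, simplified sum.empty add_0_right]) auto
   ultimately show ?thesis by (simp only:)
  qed
  finally show ?thesis .
 qed
 have "BI (%y. decay (y::'a))
   <= BN (%y. (\<Sum>k. ennreal ((1/2) ^ (k * (N + 1))) * indicator (ball 0 (2 ^ (k + 1))) (y::'a)))" by (intro nn_integral_mono le)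
 also have "... = (\<Sum>k. ennreal ((1/2) ^ (k * (N + 1))) * emeasure lborel (ball (0::'a) (2 ^ (k + 1))))"
  by (subst nn_integral_suminf) (auto simp: nn_integral_cmult_indicator
   intro!: borel_measurable_times_ennreal borel_measurable_indicator)
 also have "... = (\<Sum>k. ennreal (V * 2 ^ N * (1/2) ^ k))" proof (intro suminf_cong)
  fix k
  define a where "a = (2::real) ^ k"
  have a: "(1/2::real) ^ (k * (N + 1)) = 1 / a ^ (N + 1)" "(1/2::real) ^ k = 1 / a" "0 < a"
   unfolding a_def by (simp_all only: power_mult power_one_over zero_less_power zero_less_numeral)
  have "((2::real) ^ (k + 1)) ^ N = a ^ N * 2 ^ N" by (simp add: a_def power_mult_distrib mult.commute)
  then have eq: "(1/2::real) ^ (k * (N + 1)) * (V * (2 ^ (k + 1)) ^ N) = V * 2 ^ N * (1/2) ^ k" unfolding a(1,2) using a(3) by simp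
  have "emeasure lborel (ball (0::'a) (2 ^ (k + 1))) = ennreal (V * (2 ^ (k + 1)) ^ N)" by (simp add: emeasure_ball V_def N_def)
  then show "ennreal ((1/2) ^ (k * (N + 1))) * emeasure lborel (ball (0::'a) (2 ^ (k + 1))) = ennreal (V * 2 ^ N * (1/2) ^ k)"
   unfolding eq[symmetric] using \<open>V > 0\<close> by (simp only:) (intro ennreal_mult[symmetric], auto)
 qed
 also have "... < top" using \<open>V > 0\<close> by (subst suminf_ennreal2) (auto intro!: summable_mult summable_geometric)
 finally show ?thesis .
qed

text \<open>Values \<open>t\<close> below \<open>(1 + r) powr (- m)\<close> go into the error term.
  Above it and up to 1, the quotient of the two powers is at most
  \<open>exp (m * \<bar>al - bt\<bar> * ln (1 + r))\<close>, which the logarithmic decay bounds by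
  \<open>exp (m * K)\<close>; beyond 1 the factor \<open>T powr b\<close> suffices.\<close>

lemma powr_compare:
 fixes al bt b K r t T m :: real
 assumes "1 <= al" "al <= b" "1 <= bt" "\<bar>al - bt\<bar> * ln (1 + r) <= K" "0 <= r" "0 <= t" "t <= T" "1 <= T" "0 <= m"
 shows "t powr al <= exp (m * K) * T powr b * t powr bt + (1 + r) powr (- m)" proof (cases "t < (1 + r) powr (- m)")
 case True
 have "(1 + r) powr (- m) <= 1" using assms by (simp add: powr_minus inverse_le_1_iff ge_one_powr_ge_zero)
 then have "t powr al <= t powr 1" using True assms by (intro powr_mono') auto
 also have "t powr 1 <= (1 + r) powr (- m)" using True assms by simp
 finally show ?thesis by (rule order_trans) simp
next
 case False
 have tpos: "0 < t" using False assms by (smt (verit) powr_gt_zero)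
 have K0: "0 <= K" using assms by (smt (verit) ln_ge_zero mult_nonneg_nonneg)
 have "t powr (al - bt) <= exp (m * K) * T powr b" proof (cases "t <= 1")
  case True
  have "t powr (al - bt) <= t powr (- \<bar>al - bt\<bar>)" using True tpos by (intro powr_mono') auto
  also have "... <= ((1 + r) powr (- m)) powr (- \<bar>al - bt\<bar>)" using False assms by (intro powr_mono2') auto
  also have "... = exp (m * (\<bar>al - bt\<bar> * ln (1 + r)))" using assms by (simp add: powr_powr powr_def mult_ac)
  also have "... <= exp (m * K)" using assms by (auto intro!: mult_left_mono)
  also have "... <= exp (m * K) * T powr b" using assms by (simp add: ge_one_powr_ge_zero)
  finally show ?thesis .
 next
  case False
  have "t powr (al - bt) <= t powr b" using False assms by (intro powr_mono) auto
  also have "... <= T powr b" using assms by (intro powr_mono2) auto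
  also have "... <= exp (m * K) * T powr b" using assms K0 by simp
  finally show ?thesis .
 qed
 then have "t powr (al - bt) * t powr bt <= exp (m * K) * T powr b * t powr bt" by (intro mult_right_mono) auto
 moreover have "t powr (al - bt) * t powr bt = t powr al" by (simp flip: powr_add)
 moreover have "0 <= (1 + r) powr (- m)" by simp
 ultimately show ?thesis by linarith
qed

text \<open>The limit with \<open>ln (norm x)\<close> becomes a bound on the whole space with
  \<open>ln (1 + norm x)\<close>, which is nowhere negative. Far out, \<open>1 + norm x\<close> is
  at most the square of \<open>norm x\<close>, at the price of a factor 2; near the origin
  \<open>B\<close> takes over.\<close>

lemma bounded_log_decay:
 fixes f :: "'a::euclidean_space => real"
 assumes "((%x. \<bar>f x - c\<bar> * ln (norm x)) \<longlongrightarrow> 0) at_infinity" and B: "!!x. \<bar>f x - c\<bar> <= B"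
 obtains K where "0 <= K" "!!x. \<bar>f x - c\<bar> * ln (1 + norm x) <= K" proof -
 have "eventually (%x. \<bar>f x - c\<bar> * ln (norm x) < 1) at_infinity" using assms(1) by (rule order_tendstoD) simp
 then obtain R where R: "!!x. R <= norm x ==> \<bar>f x - c\<bar> * ln (norm x) < 1" by (auto simp: eventually_at_infinity)
 have B0: "0 <= B" using B[of 0] by linarith
 show thesis proof
  show "0 <= 2 + B * ln (3 + \<bar>R\<bar>)" using B0 by (intro add_nonneg_nonneg mult_nonneg_nonneg ln_ge_zero) auto
  fix x :: 'a
  show "\<bar>f x - c\<bar> * ln (1 + norm x) <= 2 + B * ln (3 + \<bar>R\<bar>)" proof (cases "max 2 R <= norm x")
   case True
   have "1 + norm x <= 2 * norm x" using True by simp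
   also have "... <= norm x * norm x" using True by (intro mult_right_mono) auto
   finally have "ln (1 + norm x) <= ln (norm x * norm x)" using True by (subst ln_le_cancel_iff) (auto intro: add_pos_nonneg)
   also have "... = 2 * ln (norm x)" using True by (subst ln_mult) auto
   finally have "\<bar>f x - c\<bar> * ln (1 + norm x) <= \<bar>f x - c\<bar> * (2 * ln (norm x))" by (intro mult_left_mono) auto
   also have "... <= 2" using R[of x] True by simp
   finally show ?thesis using B0 by (smt (verit) ln_ge_zero mult_nonneg_nonneg)
  next
   case False
   then have "ln (1 + norm x) <= ln (3 + \<bar>R\<bar>)" by (subst ln_le_cancel_iff) (auto intro: add_pos_nonneg)
   then have "\<bar>f x - c\<bar> * ln (1 + norm x) <= B * ln (3 + \<bar>R\<bar>)" using B B0 by (intro mult_mono) auto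
   then show ?thesis by simp
  qed
 qed
qed

lemma tendsto_of_log_decay:
 fixes f :: "'a::euclidean_space => real"
 assumes "((%x. \<bar>f x - c\<bar> * ln (norm x)) \<longlongrightarrow> 0) at_infinity"
 shows "(f \<longlongrightarrow> c) at_infinity" proof -
 have "eventually (%x::'a. exp 1 <= norm x) at_infinity" by (auto simp: eventually_at_infinity)
 then have "eventually (%x::'a. norm (f x - c) <= \<bar>f x - c\<bar> * ln (norm x)) at_infinity" proof eventually_elim
  case (elim x)
  have "0 < norm x" using elim exp_gt_zero[of 1] by linarith
  then have "1 <= ln (norm x)" using elim by (simp add: ln_ge_iff)
  then show ?case using mult_left_mono[of 1 "ln (norm x)" "\<bar>f x - c\<bar>"] by simp
 qed
 then have "((%x. f x - c) \<longlongrightarrow> 0) at_infinity" by (rule Lim_null_comparison) (rule assms)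
 then show ?thesis by (simp add: LIM_zero_iff)
qed

text \<open>Close to 0 the limit bounds the product by 1; for \<open>norm h >= d\<close> the
  logarithm is at most \<open>ln (1 / d)\<close> and the oscillation at most
  \<open>B\<close>.\<close>

lemma bounded_log_Hoelder:
 fixes f :: "'a::euclidean_space => real"
 assumes lim: "((%h. \<rho> h * ln (norm h)) \<longlongrightarrow> 0) (at (0::'a))"
  and \<rho>: "!!x h. \<bar>f (x + h) - f x\<bar> <= \<rho> h" and B: "!!x y. \<bar>f x - f y\<bar> <= B"
 obtains K where "0 < K" "!!x y. x ~= y ==> norm (y - x) < 1 ==> \<bar>f y - f x\<bar> * ln (1 / norm (y - x)) <= K" proof -
 have "eventually (%h. \<rho> h * ln (norm h) > -1) (at (0::'a))" using lim by (rule order_tendstoD) simp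
 then obtain d where d: "0 < d" "!!h::'a. h ~= 0 ==> norm h < d ==> \<rho> h * ln (norm h) > -1" by (auto simp: eventually_at)
 have B0: "0 <= B" using B[of 0 0] by simp
 show thesis proof
  show "0 < 1 + B * \<bar>ln (1 / d)\<bar>" using B0 by (simp add: add_pos_nonneg)
  fix x y :: 'a assume xy: "x ~= y" "norm (y - x) < 1"
  define h where "h = y - x"
  have h: "h ~= 0" "norm h < 1" "0 < norm h" "y = x + h" using xy by (auto simp: h_def)
  have ln: "ln (1 / norm h) = - ln (norm h)" "0 <= ln (1 / norm h)" using h by (auto simp: ln_div)
  show "\<bar>f y - f x\<bar> * ln (1 / norm (y - x)) <= 1 + B * \<bar>ln (1 / d)\<bar>" unfolding h_def[symmetric] proof (cases "norm h < d")
   case True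
   have "\<bar>f y - f x\<bar> * ln (1 / norm h) <= \<rho> h * ln (1 / norm h)" using \<rho>[of x h] ln h by (intro mult_right_mono) auto
   also have "... <= 1" using d(2)[OF h(1) True] ln by simp
   finally show "\<bar>f y - f x\<bar> * ln (1 / norm h) <= 1 + B * \<bar>ln (1 / d)\<bar>" using B0 by (smt (verit) abs_ge_zero mult_nonneg_nonneg)
  next
   case False
   have "ln (1 / norm h) <= ln (1 / d)" using False d h by (subst ln_le_cancel_iff) (auto simp: field_simps)
   then have "\<bar>f y - f x\<bar> * ln (1 / norm h) <= B * \<bar>ln (1 / d)\<bar>" using B[of y x] ln B0 by (intro mult_mono) auto
   then show "\<bar>f y - f x\<bar> * ln (1 / norm h) <= 1 + B * \<bar>ln (1 / d)\<bar>" by simp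
  qed
 qed
qed

lemma continuous_of_log_Hoelder:
 fixes f :: "'a::euclidean_space => real"
 assumes K: "0 < K" "!!x y. x ~= y ==> norm (y - x) < 1 ==> \<bar>f y - f x\<bar> * ln (1 / norm (y - x)) <= K"
 shows "continuous_on A f" proof -
 have "isCont f x" for x proof (rule continuous_at_eps_delta[THEN iffD2], intro allI impI)
  fix e :: real assume e: "0 < e"
  show "\<exists>d>0. \<forall>x'. dist x' x < d --> dist (f x') (f x) < e" unfolding dist_norm proof (rule exI[of _ "exp (- (K / e + 1))"], intro conjI allI impI)
   show "0 < exp (- (K / e + 1))" by simp
   fix y assume y: "norm (y - x) < exp (- (K / e + 1))"
   show "norm (f y - f x) < e" proof (cases "x = y")
    case False
    then have pos: "0 < norm (y - x)" by simp
    have "0 < K / e" using K e by simp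
    then have e1: "exp (- (K / e + 1)) < 1" by simp
    then have n1: "norm (y - x) < 1" using y by linarith
    have "ln (norm (y - x)) < - (K / e + 1)" using y pos by (metis exp_gt_zero ln_exp ln_less_cancel_iff)
    then have l: "K / e < ln (1 / norm (y - x))" using pos by (simp add: ln_div)
    show ?thesis proof (rule ccontr)
     assume "\<not> norm (f y - f x) < e"
     then have "e * (K / e) < \<bar>f y - f x\<bar> * ln (1 / norm (y - x))" using l e K by (intro mult_le_less_imp_less) auto
     then show False using K(2)[OF False n1] e by simp
    qed
   qed (use e in simp)
  qed
 qed
 then show ?thesis by (simp add: continuous_at_imp_continuous_on)
qed

section \<open>The exponents p, q and the critical exponent\<close>

locale exponents =
 fixes p q :: "'a::euclidean_space => real" and p_inf q_inf :: real
 assumes ge1: "\<forall>x. 1 <= p x" "\<forall>x. 1 <= q x"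
  and H1: "\<exists>\<rho> :: 'a => real. ((%h. \<rho> h * ln (norm h)) \<longlongrightarrow> 0) (at 0) &
   (\<forall>x h. \<bar>p (x + h) - p x\<bar> <= \<rho> h & \<bar>q (x + h) - q x\<bar> <= \<rho> h)"
  and H2: "((%x. \<bar>p x - p_inf\<bar> * ln (norm x)) \<longlongrightarrow> 0) at_infinity"
   "((%x. \<bar>q x - q_inf\<bar> * ln (norm x)) \<longlongrightarrow> 0) at_infinity"
  and H3: "1 < Inf (range p)" "bdd_above (range p)" "Sup (range p) < real DIM('a)"
   "\<forall>x. q x <= crit_exp p x"
   "q_inf = real DIM('a) * p_inf / (real DIM('a) - p_inf)"
begin

definition "dm = real DIM('a)"
definition "pm = Inf (range p)"
definition "pp = Sup (range p)"
text \<open>The critical exponent that belongs to the largest value of \<open>p\<close>; an upper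
  bound of \<open>ps\<close>, hence of \<open>q\<close>.\<close>

definition "psp = dm * pp / (dm - pp)"

abbreviation (input) "ps \<equiv> crit_exp p"

lemma pm_gt_1: "1 < pm" and pp_less: "pp < dm" using H3 by (auto simp: pm_def pp_def dm_def)

lemma p_ge: "pm <= p x" and p_le: "p x <= pp" using H3 ge1 by (auto simp: pm_def pp_def intro!: cInf_lower cSup_upper bdd_belowI[of _ 1])

lemma p_gt_1: "1 < p x" and p_less: "p x < dm" and pm_le_pp: "pm <= pp" using pm_gt_1 pp_less p_ge[of x] p_le[of x] by auto

lemma dm_pos: "0 < dm" by (simp add: dm_def)

lemma frac_mono: "a <= b ==> b < dm ==> 0 <= a ==> dm * a / (dm - a) <= dm * b / (dm - b)"
 using dm_pos by (intro frac_le mult_left_mono) (auto intro!: mult_nonneg_nonneg)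

lemma ps_le: "ps x <= psp" using frac_mono[OF p_le pp_less, of x] p_gt_1[of x] by (simp add: crit_exp_def psp_def dm_def)

text \<open>The gap between \<open>ps\<close> and \<open>p\<close> is
  \<open>p * p / (dm - p)\<close>. That it is bounded below uniformly in \<open>x\<close> lets local
  interpolation kill the p-modulars of the vanishing sequence in
  \<open>cutoff_inequality\<close>.\<close>

lemma p_le_ps: "p x + 1 / dm <= ps x" proof -
 have d: "0 < dm - p x" "dm - p x <= dm" using p_less p_gt_1[of x] by auto
 have "1 <= p x * p x" using p_gt_1[of x] mult_mono[of 1 "p x" 1 "p x"] by simp
 then have "1 / dm <= p x * p x / (dm - p x)" using d by (intro frac_le) auto
 also have "... = ps x - p x" using d by (simp add: crit_exp_def dm_def[symmetric] field_simps)
 finally show ?thesis by simp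
qed

lemma p_less_ps: "p x < ps x" using p_le_ps[of x] dm_pos by (smt (verit) divide_pos_pos)

lemma ps_gt_1: "1 < ps x" and psp_gt_1: "1 < psp" using p_less_ps[of x] p_gt_1[of x] ps_le[of x] by auto

lemma inverse_ps: "1 / ps x = 1 / p x - 1 / dm" using p_less[of x] p_gt_1[of x] dm_pos by (simp add: crit_exp_def dm_def[symmetric] field_simps)

lemma q_ge_1: "1 <= q x" and q_le_ps: "q x <= ps x" and q_le: "q x <= psp" using ge1 H3 ps_le[of x] order_trans by blast+

lemma p_inf_ge: "pm <= p_inf" and p_inf_le: "p_inf <= pp" proof -
 have "(p \<longlongrightarrow> p_inf) at_infinity" using H2(1) by (rule tendsto_of_log_decay)
 then show "pm <= p_inf" "p_inf <= pp" by (auto intro!: tendsto_lowerbound[of p p_inf at_infinity] tendsto_upperbound[of p p_inf at_infinity]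
   always_eventually simp: p_ge p_le trivial_limit_at_infinity)
qed

lemma p_inf_gt_1: "1 < p_inf" and p_inf_less: "p_inf < dm" using p_inf_ge p_inf_le pm_gt_1 pp_less by auto

lemma q_inf_eq: "q_inf = dm * p_inf / (dm - p_inf)" using H3(5) by (simp add: dm_def)

lemma q_inf_le: "q_inf <= psp" and p_inf_less_q_inf: "p_inf < q_inf" and q_inf_gt_1: "1 < q_inf" proof -
 show "q_inf <= psp" using frac_mono[OF p_inf_le pp_less] p_inf_gt_1 by (simp add: q_inf_eq psp_def)
 have "0 < p_inf * p_inf / (dm - p_inf)" using p_inf_gt_1 p_inf_less by simp
 also have "... = q_inf - p_inf" using p_inf_less by (simp add: q_inf_eq field_simps)
 finally show "p_inf < q_inf" by simp
 then show "1 < q_inf" using p_inf_gt_1 by simp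
qed

lemma ratio_inf: "p_inf / q_inf = 1 - p_inf / dm" using p_inf_gt_1 p_inf_less dm_pos by (simp add: q_inf_eq field_simps)

lemma p_log_Hoelder:
 obtains K where "0 < K" "!!x y. x ~= y ==> norm (y - x) < 1 ==> \<bar>p y - p x\<bar> * ln (1 / norm (y - x)) <= K" proof -
 obtain \<rho> where \<rho>: "((%h. \<rho> h * ln (norm h)) \<longlongrightarrow> 0) (at (0::'a))" "!!x h. \<bar>p (x + h) - p x\<bar> <= \<rho> h" using H1 by blast
 have "\<bar>p x - p y\<bar> <= pp" for x y using p_gt_1[of x] p_gt_1[of y] p_le[of x] p_le[of y] by linarith
 from bounded_log_Hoelder[OF \<rho> this] show thesis using that by metis
qed

lemma q_log_Hoelder:
 obtains K where "0 < K" "!!x y. x ~= y ==> norm (y - x) < 1 ==> \<bar>q y - q x\<bar> * ln (1 / norm (y - x)) <= K" proof -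
 obtain \<rho> where \<rho>: "((%h. \<rho> h * ln (norm h)) \<longlongrightarrow> 0) (at (0::'a))" "!!x h. \<bar>q (x + h) - q x\<bar> <= \<rho> h" using H1 by blast
 have "\<bar>q x - q y\<bar> <= psp" for x y using q_ge_1[of x] q_ge_1[of y] q_le[of x] q_le[of y] by linarith
 from bounded_log_Hoelder[OF \<rho> this] show thesis using that by metis
qed

lemma continuous_on_p: "continuous_on A p" and continuous_on_q: "continuous_on A q" using p_log_Hoelder q_log_Hoelder continuous_of_log_Hoelder by metis+

lemma continuous_on_ps: "continuous_on A ps" proof -
 have "real DIM('a) - p x ~= 0" for x using p_less[of x] by (simp add: dm_def)
 then show ?thesis unfolding crit_exp_def[abs_def] by (intro continuous_intros continuous_on_p) auto
qed

lemma borel_p[measurable]: "p \<in> borel_measurable borel"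
 and borel_q[measurable]: "q \<in> borel_measurable borel"
 and borel_ps[measurable]: "ps \<in> borel_measurable borel" by (intro borel_measurable_continuous_onI continuous_on_p continuous_on_q continuous_on_ps)+

text \<open>As a function of \<open>p\<close>, the critical exponent is Lipschitz with constant
  \<open>c\<close>, so \<open>ps\<close> inherits the decay of \<open>p\<close>. Since
  \<open>q_inf\<close> is the critical exponent of \<open>p_inf\<close>, the functions
  \<open>q\<close> and \<open>ps\<close> approach the same limit and can be compared with each
  other.\<close>

lemma decay_bounds:
 obtains K where "0 <= K" "!!x. \<bar>p x - p_inf\<bar> * ln (1 + norm x) <= K"
  "!!x. \<bar>q x - q_inf\<bar> * ln (1 + norm x) <= K" "!!x. \<bar>ps x - q_inf\<bar> * ln (1 + norm x) <= K"
  "!!x. \<bar>q x - ps x\<bar> * ln (1 + norm x) <= K" proof -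
 have "\<bar>p x - p_inf\<bar> <= pp" for x using p_gt_1[of x] p_le[of x] p_inf_gt_1 p_inf_le by linarith
 from bounded_log_decay[OF H2(1) this]
 obtain K1 where K1: "0 <= K1" "!!x. \<bar>p x - p_inf\<bar> * ln (1 + norm x) <= K1" by metis
 have "\<bar>q x - q_inf\<bar> <= psp" for x using q_ge_1[of x] q_le[of x] q_inf_gt_1 q_inf_le by linarith
 from bounded_log_decay[OF H2(2) this]
 obtain K2 where K2: "0 <= K2" "!!x. \<bar>q x - q_inf\<bar> * ln (1 + norm x) <= K2" by metis
 define c where "c = dm * dm / ((dm - pp) * (dm - pp))"
 have c0: "0 <= c" using pp_less by (simp add: c_def)
 have "\<bar>ps x - q_inf\<bar> <= c * \<bar>p x - p_inf\<bar>" for x proof -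
  have d: "dm - pp <= dm - p x" "dm - pp <= dm - p_inf" "0 < dm - pp" using p_le[of x] p_inf_le pp_less by auto
  have "ps x - q_inf = dm * dm * (p x - p_inf) / ((dm - p x) * (dm - p_inf))" using d by (simp add: crit_exp_def q_inf_eq dm_def[symmetric] field_simps)
  then have "\<bar>ps x - q_inf\<bar> = dm * dm * \<bar>p x - p_inf\<bar> / ((dm - p x) * (dm - p_inf))" using d by (simp add: abs_mult)
  also have "... <= dm * dm * \<bar>p x - p_inf\<bar> / ((dm - pp) * (dm - pp))" using d dm_pos by (intro frac_le mult_mono) auto
  finally show ?thesis by (simp add: c_def)
 qed
 then have K3: "\<bar>ps x - q_inf\<bar> * ln (1 + norm x) <= c * K1" for x
  using K1(2)[of x] c0 mult_right_mono[of "\<bar>ps x - q_inf\<bar>" "c * \<bar>p x - p_inf\<bar>" "ln (1 + norm x)"]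
   mult_left_mono[of "\<bar>p x - p_inf\<bar> * ln (1 + norm x)" K1 c] by (simp add: mult.assoc)
 have K4: "\<bar>q x - ps x\<bar> * ln (1 + norm x) <= K2 + c * K1" for x proof -
  have "\<bar>q x - ps x\<bar> * ln (1 + norm x) <= (\<bar>q x - q_inf\<bar> + \<bar>ps x - q_inf\<bar>) * ln (1 + norm x)" by (intro mult_right_mono) auto
  then show ?thesis using K2(2)[of x] K3[of x] by (simp add: distrib_right)
 qed
 have "0 <= c * K1" using c0 K1 by simp
 then show thesis using K1 K2 K3 K4 by (intro that[of "K1 + K2 + c * K1"]) (smt (verit))+
qed

end

section \<open>The Sobolev inequality\<close>

lemma segment_estimate:
 assumes phi: "phi \<in> test_functions U" and z: "norm z <= 1" and S: "0 <= S"
 shows "ennreal \<bar>phi (x + S *\<^sub>R z) - phi x\<bar> <= BN (%s. ennreal (norm (grad phi (x + s *\<^sub>R z))) * indicator {0..S} s)" proof -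
 define f where "f s = grad phi (x + s *\<^sub>R z) \<bullet> z" for s
 have D: "((%s. phi (x + s *\<^sub>R z)) has_real_derivative f s) (at s)" for s proof -
  have "((%s. x + s *\<^sub>R z) has_derivative (%t. t *\<^sub>R z)) (at s)" by (auto intro!: derivative_eq_intros)
  from has_derivative_compose[OF this has_derivative_grad[OF test_differentiable[OF phi]]]
  show ?thesis unfolding has_field_derivative_def f_def by (rule has_derivative_eq_rhs) (simp add: fun_eq_iff)
 qed
 have cg: "continuous_on UNIV (%s. grad phi (x + s *\<^sub>R z))" by (intro continuous_on_compose2[OF test_continuous_grad[OF phi, of UNIV]] continuous_intros) auto
 have cf: "continuous_on UNIV f" unfolding f_def by (intro continuous_intros cg)
 have H: "has_bochner_integral lborel (%s. indicator {0..S} s *\<^sub>R f s) (phi (x + S *\<^sub>R z) - phi (x + 0 *\<^sub>R z))" by (rule has_bochner_integral_FTC_Icc)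
   (use S D continuous_on_subset[OF cf] in \<open>auto simp: has_real_derivative_iff_has_vector_derivative[symmetric]
    intro: has_field_derivative_at_within\<close>)
 have "ennreal \<bar>phi (x + S *\<^sub>R z) - phi x\<bar> = ennreal (norm (\<integral>s. indicator {0..S} s *\<^sub>R f s \<partial>lborel))"
  using has_bochner_integral_integral_eq[OF H] by simp
 also have "... <= BN (%s. norm (indicator {0..S} s *\<^sub>R f s))" using H by (intro integral_norm_bound_ennreal) (rule integrable.intros)
 also have "... <= BN (%s. ennreal (norm (grad phi (x + s *\<^sub>R z))) * indicator {0..S} s)" proof (rule nn_integral_mono)
  fix s
  have "\<bar>f s\<bar> <= norm (grad phi (x + s *\<^sub>R z)) * norm z" unfolding f_def by (rule Cauchy_Schwarz_ineq2)
  also have "... <= norm (grad phi (x + s *\<^sub>R z))" using z by (intro mult_left_le) auto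
  finally show "ennreal (norm (indicator {0..S} s *\<^sub>R f s)) <= ennreal (norm (grad phi (x + s *\<^sub>R z))) * indicator {0..S} s"
   by (auto simp: indicator_def intro!: ennreal_leI)
 qed
 finally show ?thesis .
qed

lemma potential_ray:
 assumes phi: "phi \<in> test_functions U" and z: "z ~= 0" "norm z < 1"
 shows "ennreal \<bar>phi x\<bar> <= BN (%s. ennreal (norm (grad phi (x + s *\<^sub>R z))) * indicator {0<..} s)" proof -
 obtain R where R: "0 < R" "!!x. R <= norm x ==> phi x = 0" using test_support_ball[OF phi] by metis
 define S where "S = (R + norm x) / norm z"
 have S: "0 <= S" using R by (simp add: S_def)
 have "norm (S *\<^sub>R z) = R + norm x" using R z by (simp add: S_def abs_of_nonneg)
 then have "R <= norm (x + S *\<^sub>R z)" using norm_diff_ineq[of "S *\<^sub>R z" x] by (simp add: add.commute)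
 then have phiS: "phi (x + S *\<^sub>R z) = 0" by (rule R)
 have "ennreal \<bar>phi x\<bar> <= BN (%s. ennreal (norm (grad phi (x + s *\<^sub>R z))) * indicator {0..S} s)" using segment_estimate[OF phi _ S, of z x] z phiS by simp
 also have "... <= BN (%s. ennreal (norm (grad phi (x + s *\<^sub>R z))) * indicator {0<..} s)"
  by (rule nn_integral_mono_AE, use AE_lborel_singleton[of "0::real"] in eventually_elim) (auto simp: indicator_def)
 finally show ?thesis .
qed

lemma AE_unif_ball: "AE z::'a::euclidean_space in unif_ball. z ~= 0 & norm z < 1" using AE_lborel_singleton[of "0::'a"] by (intro AE_uniform_measureI) auto

text \<open>On each ray from \<open>x\<close> the function is bounded by the integral of its
  gradient up to the point where the ray has left the support. Averaging over directions
  \<open>z\<close> in the unit ball and applying Fubini writes the Riesz potential of order one as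
  an integral of ball averages over all radii.\<close>

lemma potential_estimate:
 fixes phi :: "'a::euclidean_space => real"
 assumes phi: "phi \<in> test_functions U" and B: "bdd_borel B (%x. norm (grad phi x))"
 shows "ennreal \<bar>phi x\<bar> <= BN (%s. ennreal (ball_avg (%x. norm (grad phi x)) x s) * indicator {0<..} s)" proof -
 interpret P: prob_space "unif_ball :: 'a measure" by (rule prob_space_unif_ball)
 interpret PP: pair_sigma_finite "unif_ball :: 'a measure" "lborel :: real measure" ..
 have [measurable]: "(%x. norm (grad phi x)) \<in> borel_measurable borel" using bdd_borelD[OF B] by simp
 have "ennreal \<bar>phi x\<bar> = (\<integral>\<^sup>+z. ennreal \<bar>phi x\<bar> \<partial>(unif_ball :: 'a measure))" using P.emeasure_space_1 by simp
 also have "... <= (\<integral>\<^sup>+z. BN (%s. ennreal (norm (grad phi (x + s *\<^sub>R z))) * indicator {0<..} s) \<partial>unif_ball)"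
  by (rule nn_integral_mono_AE, use AE_unif_ball in eventually_elim) (auto intro: potential_ray[OF phi])
 also have "... = BN (%s. (\<integral>\<^sup>+z. ennreal (norm (grad phi (x + s *\<^sub>R z))) * indicator {0<..} s \<partial>unif_ball))"
  by (rule PP.Fubini'[symmetric]) measurable
 also have "... = BN (%s. ennreal (ball_avg (%x. norm (grad phi x)) x s) * indicator {0<..} s)"
  by (intro nn_integral_cong) (simp add: ball_avg_nn_integral[OF B] nn_integral_multc)
 finally show ?thesis .
qed

lemma nn_integral_powr_atLeast:
 fixes e a :: real
 assumes "e < -1" "0 < a"
 shows "BN (%s. ennreal (s powr e) * indicator {a..} s) = ennreal (- (a powr (e + 1)) / (e + 1))" proof -
 have "((%s. if s \<in> {a..} then s powr e else 0) has_integral (- (a powr (e + 1)) / (e + 1))) UNIV"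
  using has_integral_powr_to_inf[OF assms] by (simp only: has_integral_restrict_UNIV)
 then have "BI (%s. if s \<in> {a..} then s powr e else 0) = ennreal (- (a powr (e + 1)) / (e + 1))" by (intro nn_integral_has_integral_lborel) auto
 moreover have "BN (%s. ennreal (s powr e) * indicator {a..} s)
   = BI (%s. if s \<in> {a..} then s powr e else 0)" by (intro nn_integral_cong) (auto simp: indicator_def)
 ultimately show ?thesis by simp
qed

lemma Hedberg_split:
 fixes a :: "real => real"
 assumes m: "!!s. 0 < s ==> a s <= m" and D: "!!s. 0 < s ==> a s <= D * s powr (- bt)"
  and "1 < bt" "0 < dl" "0 <= m" "0 <= D"
 shows "BN (%s. ennreal (a s) * indicator {0<..} s)
  <= ennreal (dl * m + D * (dl powr (1 - bt) / (bt - 1)))" proof -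
 have "BN (%s. ennreal (a s) * indicator {0<..} s)
  <= BN (%s. ennreal m * indicator {0..dl} s + ennreal D * (ennreal (s powr (- bt)) * indicator {dl..} s))" proof (rule nn_integral_mono)
  fix s :: real
  show "ennreal (a s) * indicator {0<..} s
   <= ennreal m * indicator {0..dl} s + ennreal D * (ennreal (s powr (- bt)) * indicator {dl..} s)" proof (cases "0 < s")
   case True
   show ?thesis proof (cases "s <= dl")
    case True
    have "ennreal (a s) * indicator {0<..} s <= ennreal m * indicator {0..dl} s" using True \<open>0 < s\<close> m[of s] by (simp add: ennreal_leI)
    then show ?thesis by (rule order_trans) simp
   next
    case False
    have "ennreal (a s) * indicator {0<..} s <= ennreal D * (ennreal (s powr (- bt)) * indicator {dl..} s)"
     using False \<open>0 < s\<close> D[of s] assms by (simp add: ennreal_mult[symmetric] ennreal_leI)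
    then show ?thesis by (rule order_trans) simp
   qed
  qed simp
 qed
 also have "... = ennreal m * ennreal dl + ennreal D * ennreal (- (dl powr (- bt + 1)) / (- bt + 1))" using assms
  by (subst nn_integral_add, simp, simp, subst (2) nn_integral_cmult, simp, subst nn_integral_powr_atLeast) (auto simp: nn_integral_cmult_indicator)
 also have "- (dl powr (- bt + 1)) / (- bt + 1) = dl powr (1 - bt) / (bt - 1)" using assms by (simp add: divide_simps) (simp add: algebra_simps)
 also have "ennreal m * ennreal dl + ennreal D * ennreal (dl powr (1 - bt) / (bt - 1))
  = ennreal (dl * m + D * (dl powr (1 - bt) / (bt - 1)))" proof -
  have "0 <= dl powr (1 - bt) / (bt - 1)" using assms by simp
  then show ?thesis using assms by (simp only: ennreal_mult[symmetric] less_imp_le) (simp only: ennreal_plus[symmetric] mult_nonneg_nonneg less_imp_le mult.commute[of m])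
 qed
 finally show ?thesis .
qed

text \<open>Radii below \<open>dl\<close> are estimated by the maximal function, radii above it by
  the decay \<open>s powr (- N / P)\<close>. The choice \<open>dl = F powr (- (k / N))\<close> makes
  both contributions the same power of \<open>F\<close>. \<open>P'\<close> keeps \<open>P\<close>
  away from \<open>N\<close>, so that the constant is uniform when \<open>P\<close> is the value of
  \<open>p\<close> at a variable point.\<close>

lemma Hedberg:
 fixes a :: "real => real" and c F k P P' N :: real
 assumes m: "!!s. 0 < s ==> a s <= (c * F) powr (k / P)"
  and D: "!!s. 0 < s ==> a s <= (c * s powr (- N)) powr (1 / P)"
  and c: "1 <= c" and F: "0 <= F" and P: "1 <= P" "P <= P'" "P' < N" "0 < k" "k <= P"
 shows "BN (%s. ennreal (a s) * indicator {0<..} s)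
  <= ennreal (c * (1 + P' / (N - P')) * F powr (k * (1 / P - 1 / N)))" proof (cases "F = 0")
 case True
 have "BN (%s. ennreal (a s) * indicator {0<..} s) = (\<integral>\<^sup>+(s::real). 0 \<partial>lborel)" proof (rule nn_integral_cong)
  fix s :: real
  show "ennreal (a s) * indicator {0<..} s = 0" using m[of s] True by (cases "0 < s") (auto simp: ennreal_neg)
 qed
 then show ?thesis by simp
next
 case False
 then have F: "0 < F" using F by simp
 define dl where "dl = F powr (- (k / N))"
 define C where "C = P' / (N - P')"
 have N: "0 < N" "P < N" using P by auto
 have "BN (%s. ennreal (a s) * indicator {0<..} s)
  <= ennreal (dl * (c * F) powr (k / P) + c * (dl powr (1 - N / P) / (N / P - 1)))" proof (rule Hedberg_split)
  show "a s <= c * s powr - (N / P)" if "0 < s" for s proof -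
   have "a s <= (c * s powr (- N)) powr (1 / P)" by (rule D[OF that])
   also have "... = c powr (1 / P) * s powr (- (N / P))" by (simp add: powr_mult powr_powr)
   also have "c powr (1 / P) <= c powr 1" using c P by (intro powr_mono) auto
   finally show ?thesis using c by (simp add: mult_right_mono)
  qed
 qed (use m c F N P in \<open>auto simp: dl_def\<close>)
 also have "... <= ennreal (c * (1 + C) * F powr (k * (1 / P - 1 / N)))" proof (rule ennreal_leI)
  have "(c * F) powr (k / P) = c powr (k / P) * F powr (k / P)" by (simp add: powr_mult)
  also have "... <= c powr 1 * F powr (k / P)" using c P by (intro mult_right_mono powr_mono) auto
  finally have "dl * (c * F) powr (k / P) <= dl * (c * F powr (k / P))" using c by (intro mult_left_mono) (auto simp: dl_def)
  also have "... = c * F powr (k * (1 / P - 1 / N))" by (simp add: dl_def powr_add[symmetric] right_diff_distrib)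
  finally have 1: "dl * (c * F) powr (k / P) <= c * F powr (k * (1 / P - 1 / N))" .
  have e: "- (k / N) * (1 - N / P) = k * (1 / P - 1 / N)" using N P by (simp add: field_simps)
  have "dl powr (1 - N / P) = F powr (k * (1 / P - 1 / N))" unfolding dl_def powr_powr e ..
  moreover have "1 / (N / P - 1) <= C" proof -
   have "1 / (N / P - 1) = P / (N - P)" using N P by (simp add: field_simps)
   also have "... <= C" unfolding C_def using N P by (intro frac_le) auto
   finally show ?thesis .
  qed
  ultimately have "dl powr (1 - N / P) / (N / P - 1) <= C * F powr (k * (1 / P - 1 / N))"
   using mult_right_mono[of "1 / (N / P - 1)" C "F powr (k * (1 / P - 1 / N))"] by simp
  then have "c * (dl powr (1 - N / P) / (N / P - 1)) <= c * (C * F powr (k * (1 / P - 1 / N)))" using c by (intro mult_left_mono) auto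
  with 1 show "dl * (c * F) powr (k / P) + c * (dl powr (1 - N / P) / (N / P - 1))
   <= c * (1 + C) * F powr (k * (1 / P - 1 / N))" by (simp add: algebra_simps)
 qed
 finally show ?thesis unfolding C_def .
qed

lemma ball_avg_le_integral:
 fixes f :: "'a::euclidean_space => real"
 assumes f: "bdd_borel B f" and int: "BI (%y. f y) <= ennreal J" "0 <= J" and s: "0 < s"
 shows "ball_avg f x s <= J / unit_ball_vol (real DIM('a)) * s powr (- real DIM('a))" proof -
 define V where "V = unit_ball_vol (real DIM('a))"
 have V: "0 < V" by (simp add: V_def)
 have "ennreal (ball_avg f x s * (V * s ^ DIM('a))) = ennreal (ball_avg f x s) * emeasure lborel (ball x s)"
  using s V ball_avg_nonneg[OF f] by (simp add: emeasure_ball V_def[symmetric] ennreal_mult)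
 also have "... = BN (%y. ennreal (f y) * indicator (ball x s) y)" by (rule ball_avg_integral[OF f s])
 also have "... <= BI (%y. f y)" by (intro nn_integral_mono) (auto simp: indicator_def)
 also note int(1)
 finally have "ball_avg f x s * (V * s ^ DIM('a)) <= J" using int(2) by (simp add: ennreal_le_iff)
 then have "ball_avg f x s <= J / (V * s ^ DIM('a))" using V s by (simp add: field_simps)
 also have "... = J / V * s powr (- real DIM('a))" using s by (simp add: powr_minus powr_realpow field_simps)
 finally show ?thesis by (simp add: V_def)
qed

text \<open>Jensen's inequality is used with the constant \<open>r0\<close>, which lies below the
  variable exponent on the whole ball. Raising \<open>r0\<close> to the exponent \<open>r\<close> of
  the centre costs a power of the bound \<open>A\<close> for the average.\<close>

lemma ball_avg_exponent_change:
 fixes x :: "'a::euclidean_space"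
 assumes g: "bdd_borel B g" and f: "bdd_borel B' f" and rx: "1 <= r0" "r0 <= r"
  and le: "!!y. norm (y - x) < s ==> g y powr r0 <= f y" and s: "0 < s"
  and A: "ball_avg f x s <= A" "1 <= A"
 shows "ball_avg g x s powr r <= A powr (r - r0) * ball_avg f x s" proof -
 define a where "a = ball_avg f x s"
 have a0: "0 <= a" unfolding a_def by (rule ball_avg_nonneg[OF f])
 have "ball_avg g x s powr r0 <= ball_avg (%y. g y powr r0) x s" by (rule ball_avg_Jensen[OF g rx(1)])
 also have "... <= a" unfolding a_def using s rx by (intro ball_avg_mono[OF bdd_borel_powr[OF g] f] le) auto
 finally have "ball_avg g x s powr r0 <= a" .
 then have "(ball_avg g x s powr r0) powr (r / r0) <= a powr (r / r0)" using rx by (intro powr_mono2) auto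
 then have 1: "ball_avg g x s powr r <= a powr (r / r0)" using rx by (simp add: powr_powr)
 show ?thesis proof (cases "a = 0")
  case True then show ?thesis using 1 by (simp add: a_def)
 next
  case False
  then have "0 < a" using a0 by simp
  have e: "r / r0 - 1 = (r - r0) / r0" using rx by (simp add: field_simps)
  have e': "0 <= r / r0 - 1" "r / r0 - 1 <= r - r0" unfolding e using rx by (auto simp: divide_le_eq mult_left_mono[of 1 r0 "r - r0", simplified])
  have "a powr (r / r0) = a powr (r / r0 - 1) * a" using \<open>0 < a\<close> powr_add[of a "r / r0 - 1" 1] by simp
  also have "a powr (r / r0 - 1) <= A powr (r / r0 - 1)" using A a0 e' by (intro powr_mono2) (auto simp: a_def)
  also have "A powr (r / r0 - 1) <= A powr (r - r0)" using A e' by (intro powr_mono) auto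
  finally show ?thesis using 1 a0 by (simp add: a_def mult_right_mono)
 qed
qed

context exponents
begin

text \<open>
 Diening's key estimate.  Since \<open>g\<close> has no values in \<open>(0,1)\<close>, lowering the exponent at any point
 only decreases powers of \<open>g\<close>, so there is no error term and no decay condition is needed.
\<close>

lemma key_estimate:
 obtains c where "1 <= c" "!!B B' (g :: 'a => real) x (s::real). bdd_borel B g ==> (!!y. g y = 0 \<or> 1 <= g y) ==>
   bdd_borel B' (%y. g y powr (p y / pm)) ==>
  BI (%y. g y powr p y) <= 1 ==> 0 < s ==>
  ball_avg g x s powr (p x / pm) <= c * ball_avg (%y. g y powr (p y / pm)) x s" proof -
 obtain K where K: "0 < K" "!!x y. x ~= y ==> norm (y - x) < 1 ==> \<bar>p y - p x\<bar> * ln (1 / norm (y - x)) <= K" using p_log_Hoelder by metis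
 define C1 where "C1 = max 1 (1 / unit_ball_vol dm)"
 \<comment> \<open>\<open>c1\<close> serves radii below 1/2, where logarithmic Hoelder continuity
   acts; \<open>c2\<close> serves the larger radii, where the averages of \<open>f\<close> are
   bounded by a constant.\<close>
 define c1 where "c1 = C1 powr (K / ln 2) * exp (dm * K)"
 define c2 where "c2 = (C1 * 2 powr dm) powr pp"
 have C1: "1 <= C1" by (simp add: C1_def)
 have two: "1 <= (2::real) powr dm" using dm_pos by (simp add: ge_one_powr_ge_zero)
 have C12: "1 <= C1 * 2 powr dm" using mult_mono[OF C1 two] C1 by simp
 have "1 <= C1 powr (K / ln 2)" "1 <= exp (dm * K)" using C1 K dm_pos by (auto simp: ge_one_powr_ge_zero)
 then have c1: "1 <= c1" unfolding c1_def using mult_mono[of 1 "C1 powr (K / ln 2)" 1 "exp (dm * K)"] by simp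
 show thesis proof (rule that[of "c1 + c2"])
  show "1 <= c1 + c2" using c1 by (simp add: c2_def add_increasing2)
  fix B B' and g :: "'a => real" and x and s :: real
  assume g: "bdd_borel B g" and g01: "!!y. g y = 0 \<or> 1 <= g y"
   and f: "bdd_borel B' (%y. g y powr (p y / pm))"
   and int: "BI (%y. g y powr p y) <= 1" and s: "0 < s"
  define f where "f = (%y. g y powr (p y / pm))"
  define r where "r y = p y / pm" for y
  have r: "1 <= r y" "r y <= pp" for y using p_ge[of y] p_le[of y] p_gt_1[of y] pm_gt_1 frac_le[of "p y" "p y" 1 pm] by (auto simp: r_def)
  have f: "bdd_borel B' f" using f by (simp add: f_def)
  have f0: "0 <= ball_avg f x s" by (rule ball_avg_nonneg[OF f])
  have fp: "f y powr pm = g y powr p y" for y using pm_gt_1 by (simp add: f_def powr_powr)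
  have fpb: "bdd_borel (B' powr pm) (%y. f y powr pm)" using pm_gt_1 by (intro bdd_borel_powr[OF f]) auto
  have A: "ball_avg f x s <= C1 * max 1 (s powr (- dm))" proof -
   have "ball_avg f x s powr pm <= ball_avg (%y. f y powr pm) x s" using pm_gt_1 by (intro ball_avg_Jensen[OF f]) auto
   also have "... <= 1 / unit_ball_vol dm * s powr (- dm)" unfolding dm_def using s int by (intro ball_avg_le_integral[OF fpb]) (auto simp: fp)
   also have "... <= C1 * max 1 (s powr (- dm))" using C1 by (intro mult_mono) (auto simp: C1_def)
   finally have *: "ball_avg f x s powr pm <= C1 * max 1 (s powr (- dm))" .
   show ?thesis proof (cases "ball_avg f x s <= 1")
    case True
    then show ?thesis using mult_mono[of 1 C1 1 "max 1 (s powr (- dm))"] C1 by simp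
   next
    case False
    then have "ball_avg f x s powr 1 <= ball_avg f x s powr pm" using pm_gt_1 by (intro powr_mono) auto
    then show ?thesis using * False by simp
   qed
  qed
  have g_le: "g y powr r0 <= f y" if "r0 <= r y" for r0 y using g01[of y] that r unfolding f_def r_def[symmetric] by (auto intro: powr_mono)
  have "ball_avg g x s powr r x <= (c1 + c2) * ball_avg f x s" proof (cases "s < 1/2")
   case False
   have "s powr (- dm) <= (1/2) powr (- dm)" using False dm_pos by (intro powr_mono2') auto
   also have "... = 2 powr dm" by (simp add: powr_minus powr_divide)
   finally have "max 1 (s powr (- dm)) <= 2 powr dm" using two by simp
   then have "ball_avg f x s <= C1 * 2 powr dm" using A C1 mult_left_mono[of "max 1 (s powr (- dm))" "2 powr dm" C1] by linarith
   then have "ball_avg g x s powr r x <= (C1 * 2 powr dm) powr (r x - 1) * ball_avg f x s" using r s C12 by (intro ball_avg_exponent_change[OF g f] g_le) auto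
   also have "... <= c2 * ball_avg f x s" unfolding c2_def using C12 r(2)[of x] f0 by (intro mult_right_mono powr_mono) auto
   finally show ?thesis using c1 f0 by (simp add: distrib_right add_increasing)
  next
   case True
   \<comment> \<open>The oscillation of the exponent that logarithmic Hoelder continuity permits on
     a ball of radius \<open>s\<close>; thus \<open>r0\<close> below is a lower bound for the
     exponent on that ball.\<close>
   define om where "om = K / ln (1 / s)"
   have l2: "ln 2 < ln (1 / s)" "0 < ln (2::real)" using True s by (auto simp: field_simps)
   have l3: "0 < ln (1 / s)" using l2 by linarith
   have om: "0 < om" "om <= K / ln 2" unfolding om_def using K l2 l3 by (auto intro!: divide_left_mono divide_pos_pos mult_pos_pos simp del: ln_div)
   define r0 where "r0 = max 1 (r x - om)"
   have r0: "1 <= r0" "r0 <= r x" "r x - r0 <= om" using om r by (auto simp: r0_def)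
   have r0_le: "r0 <= r y" if "norm (y - x) < s" for y proof (cases "y = x")
    case False
    have n: "0 < norm (y - x)" "norm (y - x) < 1" using False that True by auto
    have ls: "ln (1 / s) <= ln (1 / norm (y - x))" using n that s by (subst ln_le_cancel_iff) (auto simp: frac_le)
    have "\<bar>p y - p x\<bar> * ln (1 / s) <= \<bar>p y - p x\<bar> * ln (1 / norm (y - x))" using ls by (intro mult_left_mono) auto
    also have "... <= K" using False n by (intro K(2)) auto
    finally have "\<bar>p y - p x\<bar> <= om" unfolding om_def using l3 by (simp only: pos_le_divide_eq)
    moreover have "\<bar>r y - r x\<bar> <= \<bar>p y - p x\<bar>"
     using pm_gt_1 mult_left_mono[of 1 pm "\<bar>p y - p x\<bar>"] by (simp add: r_def diff_divide_distrib[symmetric] divide_le_eq)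
    ultimately show ?thesis using r(1)[of y] by (auto simp: r0_def)
   qed (use r0 in simp)
   have sd: "1 <= s powr (- dm)" using True s dm_pos powr_mono2'[of "- dm" s 1] by simp
   have Cs: "1 <= C1 * s powr (- dm)" using mult_mono[OF C1 sd] C1 by simp
   have "ball_avg g x s powr r x <= (C1 * s powr (- dm)) powr (r x - r0) * ball_avg f x s" using r0 A sd s Cs by (intro ball_avg_exponent_change[OF g f] g_le r0_le) auto
   also have "(C1 * s powr (- dm)) powr (r x - r0) <= (C1 * s powr (- dm)) powr om" using Cs r0 by (intro powr_mono) auto
   also have "... = C1 powr om * s powr (- dm * om)" by (simp add: powr_mult powr_powr)
   \<comment> \<open>The decisive cancellation: the bound for the averages blows up like
     \<open>s powr (- dm)\<close>, but raised to the oscillation \<open>om\<close> it becomes a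
     constant independent of \<open>s\<close>.\<close>
   also have "s powr (- dm * om) = exp (dm * K)" proof -
    have "- dm * om * ln s = dm * (om * ln (1 / s))" using s by (simp add: ln_div)
    also have "om * ln (1 / s) = K" using l3 by (simp add: om_def del: ln_div)
    finally show ?thesis using s by (simp add: powr_def)
   qed
   also have "C1 powr om * exp (dm * K) <= c1" unfolding c1_def using C1 om by (intro mult_right_mono powr_mono) auto
   finally have "ball_avg g x s powr r x <= c1 * ball_avg f x s" using f0 by (simp add: mult_right_mono)
   then show ?thesis using f0 by (simp add: c2_def distrib_right add_increasing2)
  qed
  then show "ball_avg g x s powr (p x / pm) <= (c1 + c2) * ball_avg (%y. g y powr (p y / pm)) x s" by (simp add: f_def r_def)
 qed
qed

end

lemma powr_add_le_two:
 fixes a b s :: real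
 assumes "0 <= a" "0 <= b" "0 <= s"
 shows "(a + b) powr s <= (2 * a) powr s + (2 * b) powr s" proof (cases "a <= b")
 case True
 then have "(a + b) powr s <= (2 * b) powr s" using assms by (intro powr_mono2) auto
 then show ?thesis by (simp add: add_increasing)
next
 case False
 then have "(a + b) powr s <= (2 * a) powr s" using assms by (intro powr_mono2) auto
 then show ?thesis by (simp add: add_increasing2)
qed

lemma ball_avg_borel:
 fixes x :: "'a::euclidean_space"
 assumes "bdd_borel B f"
 shows "(%s. ennreal (ball_avg f x s)) \<in> borel_measurable borel" proof -
 interpret P: prob_space "unif_ball :: 'a measure" by (rule prob_space_unif_ball)
 note [measurable] = bdd_borelD(1)[OF assms]
 have "(%s. \<integral>\<^sup>+z. ennreal (f (x + s *\<^sub>R z)) \<partial>unif_ball) \<in> borel_measurable borel" by (rule P.borel_measurable_nn_integral) measurable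
 then show ?thesis by (simp add: ball_avg_nn_integral[OF assms])
qed

lemma nn_integral_bounded_support:
 fixes f :: "'a::euclidean_space => real"
 assumes "!!x. f x <= B" "!!x. R <= norm x ==> f x = 0"
 shows "BI (%x. f x) < top" proof -
 have "BI (%x. f x) <= BN (%x. ennreal B * indicator (cball (0::'a) R) x)" proof (rule nn_integral_mono)
  fix x
  show "ennreal (f x) <= ennreal B * indicator (cball 0 R) x" using assms(1)[of x] assms(2)[of x] by (cases "x \<in> cball 0 R") (auto intro: ennreal_leI)
 qed
 also have "... = ennreal B * emeasure lborel (cball (0::'a) R)" by (rule nn_integral_cmult_indicator) simp
 also have "... < top" using emeasure_bounded_finite[OF bounded_cball, of "0::'a" R] by (simp add: ennreal_mult_less_top)
 finally show ?thesis .
qed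

context exponents
begin

text \<open>With \<open>m = N + 1\<close> the error term of \<open>powr_compare\<close> is exactly
  \<open>decay\<close>. This is used for the part of a gradient that lies below 1.\<close>

lemma powr_p_inf_le:
 obtains C where "0 <= C" "!!t y. 0 <= t ==> t <= 1 ==> t powr p_inf <= C * t powr p y + decay y" proof -
 obtain K where K: "!!x. \<bar>p x - p_inf\<bar> * ln (1 + norm x) <= K" using decay_bounds by metis
 have "t powr p_inf <= exp ((dm + 1) * K) * 1 powr p_inf * t powr p y + (1 + norm y) powr (- (dm + 1))"
  if "0 <= t" "t <= 1" for t y using K[of y] p_inf_gt_1 p_gt_1[of y] dm_pos that by (intro powr_compare) (auto simp: abs_minus_commute)
 then show thesis by (intro that[of "exp ((dm + 1) * K)"]) (auto simp: decay_def dm_def)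
qed

lemma powr_ps_le:
 obtains C where "0 <= C" "!!t y. 0 <= t ==> t <= 1 ==> t powr ps y <= C * t powr q_inf + decay y" proof -
 obtain K where K: "!!x. \<bar>ps x - q_inf\<bar> * ln (1 + norm x) <= K" using decay_bounds by metis
 have "t powr ps y <= exp ((dm + 1) * K) * 1 powr psp * t powr q_inf + (1 + norm y) powr (- (dm + 1))"
  if "0 <= t" "t <= 1" for t y using K[of y] q_inf_gt_1 ps_gt_1[of y] ps_le[of y] dm_pos that by (intro powr_compare) auto
 then show thesis by (intro that[of "exp ((dm + 1) * K)"]) (auto simp: decay_def dm_def)
qed

text \<open>For \<open>t <= 1\<close> the exponents \<open>q\<close> and \<open>ps\<close> may be
  exchanged up to \<open>decay\<close>, because they have the same limit at infinity; for
  \<open>t > 1\<close> the inequality \<open>q <= ps\<close> decides.\<close>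

lemma powr_q_le:
 obtains C where "0 <= C" "!!t y. 0 <= t ==> t powr q y <= C * t powr ps y + decay y" proof -
 obtain K where K: "0 <= K" "!!x. \<bar>q x - ps x\<bar> * ln (1 + norm x) <= K" using decay_bounds by metis
 have "t powr q y <= exp ((dm + 1) * K) * t powr ps y + (1 + norm y) powr (- (dm + 1))"
  if "0 <= t" for t y proof (cases "t <= 1")
  case True
  have "t powr q y <= exp ((dm + 1) * K) * 1 powr psp * t powr ps y + (1 + norm y) powr (- (dm + 1))"
   using K(2)[of y] q_ge_1[of y] ps_gt_1[of y] q_le[of y] dm_pos that True by (intro powr_compare) auto
  then show ?thesis by simp
 next
  case False
  then have "t powr q y <= t powr ps y" using q_le_ps by (intro powr_mono) auto
  also have "... <= exp ((dm + 1) * K) * t powr ps y" using K(1) dm_pos by (simp add: mult_le_cancel_right1)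
  finally show ?thesis by (rule order_trans) simp
 qed
 then show thesis by (intro that[of "exp ((dm + 1) * K)"]) (auto simp: decay_def dm_def)
qed

text \<open>The gradient is split at height 1. The large part fits \<open>key_estimate\<close> and
  is governed by the maximal function \<open>F1\<close> of its power \<open>p / pm\<close>; for the
  small part \<open>p\<close> is replaced by \<open>p_inf\<close> at the cost of
  \<open>decay\<close>, and \<open>F2\<close> governs it. Hedberg's lemma gives a pointwise bound of
  \<open>phi\<close> by powers of \<open>F1\<close> and \<open>F2\<close>, and the strong maximal
  inequality, with the exponents \<open>pm\<close> and \<open>p_inf\<close> above 1, integrates
  it.\<close>

lemma sobolev_ps:
 obtains C where "0 < C" "!!phi. phi \<in> tests ==>
  BI (%x. norm (grad phi x) powr p x) <= 1 ==>
  BI (%x. \<bar>phi x\<bar> powr ps x) <= ennreal C" proof -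
 define V where "V = unit_ball_vol dm"
 have V: "0 < V" using dm_pos by (simp add: V_def)
 obtain c where c: "1 <= c" "!!B B' (g :: 'a => real) x (s::real). bdd_borel B g ==> (!!y. g y = 0 \<or> 1 <= g y) ==>
   bdd_borel B' (%y. g y powr (p y / pm)) ==>
  BI (%y. g y powr p y) <= 1 ==> 0 < s ==>
  ball_avg g x s powr (p x / pm) <= c * ball_avg (%y. g y powr (p y / pm)) x s" using key_estimate by blast
 obtain E1 where E1: "0 <= E1" "!!t y. 0 <= t ==> t <= 1 ==> t powr p_inf <= E1 * t powr p y + decay y" using powr_p_inf_le by metis
 obtain E2 where E2: "0 <= E2" "!!t y. 0 <= t ==> t <= 1 ==> t powr ps y <= E2 * t powr q_inf + decay y" using powr_ps_le by metis
 define dec where "dec = enn2real (BI (%y. decay (y::'a)))"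
 have dec: "BI (%y. decay (y::'a)) = ennreal dec" "0 <= dec" using nn_integral_decay[where 'a='a] by (auto simp: dec_def)
 have [measurable]: "(decay :: 'a => real) \<in> borel_measurable borel" unfolding decay_def[abs_def] by measurable
 define J2 where "J2 = E1 + dec"
 have J2: "0 <= J2" using E1 dec by (simp add: J2_def)
 define c1 where "c1 = c powr pm * max 1 (1 / V)"
 define c2 where "c2 = max 1 (J2 / V)"
 have cpm: "c <= c powr pm" using powr_mono[of 1 pm c] c(1) pm_gt_1 by simp
 have c1: "1 <= c1" "c <= c1" "c powr pm * (1 / V) <= c1" and c2: "1 <= c2" "J2 / V <= c2" proof -
  have "c * 1 <= c powr pm * max 1 (1 / V)" using cpm c(1) by (intro mult_mono) auto
  then show "c <= c1" "1 <= c1" using c(1) by (auto simp: c1_def)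
  show "c powr pm * (1 / V) <= c1" unfolding c1_def by (intro mult_left_mono) auto
 qed (auto simp: c2_def)
 define L where "L = 1 + pp / (dm - pp)"
 have L: "1 <= L" using pp_less pm_gt_1 pm_le_pp by (simp add: L_def)
 define D1 where "D1 = c1 * L"
 define D2 where "D2 = c2 * L"
 have D: "1 <= D1" "1 <= D2" using c1(1) c2(1) L mult_mono[of 1 c1 1 L] mult_mono[of 1 c2 1 L] by (auto simp: D1_def D2_def)
 define K1 where "K1 = pm * 2 powr (pm - 1) / (pm - 1) * (2 * 5 ^ DIM('a))"
 define K2 where "K2 = p_inf * 2 powr (p_inf - 1) / (p_inf - 1) * (2 * 5 ^ DIM('a))"
 have K: "0 <= K1" "0 <= K2" using pm_gt_1 p_inf_gt_1 by (auto simp: K1_def K2_def)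
 define C where "C = (2 * D1) powr psp * K1 + (2 * D2) powr psp * (E2 * (K2 * J2) + dec) + 1"
 have C: "0 < C" unfolding C_def using K J2 E2 dec by (intro add_nonneg_pos add_nonneg_nonneg mult_nonneg_nonneg) auto
 have main: "BI (%x. \<bar>phi x\<bar> powr ps x) <= ennreal C"
  if phi: "phi \<in> tests" and int: "BI (%x. norm (grad phi x) powr p x) <= 1" for phi proof -
  define g where "g x = norm (grad phi x)" for x
  obtain R where R: "0 < R" "!!x. R <= norm x ==> grad phi x = 0" using test_support_ball[OF phi] by metis
  obtain B0 where B0: "!!x. norm (grad phi x) <= B0" using test_bounded[OF phi] by metis
  define B where "B = max 1 B0"
  have gB: "0 <= g x" "g x <= B" for x using B0[of x] by (auto simp: g_def B_def)
  have B1: "1 <= B" by (simp add: B_def)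
  have g_borel[measurable]: "g \<in> borel_measurable borel" unfolding g_def[abs_def] using test_continuous_grad[OF phi, of UNIV]
   by (intro borel_measurable_continuous_onI continuous_intros)
  have [measurable]: "phi \<in> borel_measurable borel" using test_continuous[OF phi, of UNIV] by (rule borel_measurable_continuous_onI)
  have g: "bdd_borel B g" using gB by (simp add: bdd_borel_def)
  \<comment> \<open>\<open>g1\<close> has no values strictly between 0 and 1, as
    \<open>key_estimate\<close> demands, and \<open>g2\<close> stays below 1, as
    \<open>powr_p_inf_le\<close> demands.\<close>
  define g1 where "g1 x = (if 1 <= g x then g x else 0)" for x
  define g2 where "g2 x = (if 1 <= g x then 0 else g x)" for x
  have g1: "bdd_borel B g1" and g1_01: "!!x. g1 x = 0 \<or> 1 <= g1 x" using gB B1 unfolding bdd_borel_def g1_def by (auto intro: order_trans[OF zero_le_one])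
  have g2: "bdd_borel 1 g2" using gB unfolding bdd_borel_def g2_def by auto
  have g12: "g = (%x. g1 x + g2 x)" by (auto simp: g1_def g2_def)
  define f1 where "f1 = (%y. g1 y powr (p y / pm))"
  have r: "1 <= p y / pm" "p y / pm <= pp" for y using p_ge[of y] p_le[of y] p_gt_1[of y] pm_gt_1 frac_le[of "p y" "p y" 1 pm] by auto
  note [measurable] = bdd_borelD(1)[OF g1] bdd_borelD(1)[OF g2]
  have f1: "bdd_borel (B powr pp) f1" unfolding bdd_borel_def proof (intro conjI allI)
   show "f1 \<in> borel_measurable borel" unfolding f1_def by measurable
   fix x
   show "0 <= f1 x" by (simp add: f1_def)
   have "f1 x <= B powr (p x / pm)" unfolding f1_def using bdd_borelD[OF g1] r(1)[of x] by (intro powr_mono2) auto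
   also have "... <= B powr pp" using r B1 by (intro powr_mono) auto
   finally show "f1 x <= B powr pp" .
  qed
  have f1_pm: "f1 y powr pm = g1 y powr p y" for y using pm_gt_1 by (simp add: f1_def powr_powr)
  have int1: "BI (%y. g1 y powr p y) <= 1" by (rule order_trans[OF nn_integral_mono int]) (auto simp: g1_def g_def)
  have int2: "BI (%y. g2 y powr p y) <= 1" by (rule order_trans[OF nn_integral_mono int]) (auto simp: g2_def g_def)
  have int2': "BI (%y. g2 y powr p_inf) <= ennreal J2" proof -
   have "BI (%y. g2 y powr p_inf)
     <= BN (%y. ennreal E1 * ennreal (g2 y powr p y) + ennreal (decay y))" proof (rule nn_integral_mono)
    fix y
    have "ennreal (g2 y powr p_inf) <= ennreal (E1 * g2 y powr p y + decay y)" using E1(2)[of "g2 y" y] bdd_borelD[OF g2] by (intro ennreal_leI) auto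
    then show "ennreal (g2 y powr p_inf) <= ennreal E1 * ennreal (g2 y powr p y) + ennreal (decay y)" using E1(1) decay_nonneg[of y] by (simp add: ennreal_mult)
   qed
   also have "... = ennreal E1 * BI (%y. g2 y powr p y) + ennreal dec" by (subst nn_integral_add) (auto simp: nn_integral_cmult dec)
   also have "... <= ennreal E1 * 1 + ennreal dec" using int2 by (intro add_right_mono mult_left_mono) auto
   finally show ?thesis using E1 dec by (simp add: J2_def)
  qed
  have pm_powr: "bdd_borel ((B powr pp) powr pm) (%y. f1 y powr pm)" using pm_gt_1 by (intro bdd_borel_powr[OF f1]) auto
  define F1 where "F1 = maximal f1"
  define F2 where "F2 = maximal g2"
  have F: "0 <= F1 x" "0 <= F2 x" "F2 x <= 1" for x unfolding F1_def F2_def using maximal_nonneg[OF f1] maximal_nonneg[OF g2] maximal_le_bound[OF g2] by auto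
  have pot1: "BN (%s. ennreal (ball_avg g1 x s) * indicator {0<..} s)
    <= ennreal (D1 * F1 x powr (pm / ps x))" for x proof -
   have key: "ball_avg g1 x s powr (p x / pm) <= c * ball_avg f1 x s" if "0 < s" for s
    unfolding f1_def using f1 by (intro c(2)[OF g1 g1_01 _ int1 that]) (simp add: f1_def)
   have "BN (%s. ennreal (ball_avg g1 x s) * indicator {0<..} s)
    <= ennreal (c1 * (1 + pp / (dm - pp)) * F1 x powr (pm * (1 / p x - 1 / dm)))" proof (rule Hedberg)
    fix s :: real assume s: "0 < s"
    have a0: "0 <= ball_avg g1 x s" "0 <= ball_avg f1 x s" using ball_avg_nonneg g1 f1 by blast+
    have a: "ball_avg g1 x s = (ball_avg g1 x s powr (p x / pm)) powr (pm / p x)" using a0 p_gt_1[of x] pm_gt_1 by (simp add: powr_powr)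
    have "ball_avg g1 x s powr (p x / pm) <= c1 * F1 x" using key[OF s] ball_avg_le_maximal[OF f1 s, of x] c1 c(1) a0 F(1)[of x]
      mult_mono[of c c1 "ball_avg f1 x s" "F1 x"] by (simp add: F1_def)
    then show "ball_avg g1 x s <= (c1 * F1 x) powr (pm / p x)" using p_gt_1[of x] pm_gt_1 by (subst a) (intro powr_mono2, auto)
    have "ball_avg g1 x s powr p x = (ball_avg g1 x s powr (p x / pm)) powr pm" using pm_gt_1 by (simp add: powr_powr)
    also have "... <= (c * ball_avg f1 x s) powr pm" using key[OF s] pm_gt_1 by (intro powr_mono2) auto
    also have "... = c powr pm * ball_avg f1 x s powr pm" by (simp add: powr_mult)
    also have "... <= c powr pm * ball_avg (%y. f1 y powr pm) x s" using pm_gt_1 by (intro mult_left_mono ball_avg_Jensen[OF f1]) auto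
    also have "... <= c powr pm * (1 / V * s powr (- dm))" unfolding V_def dm_def using s int1
     by (intro mult_left_mono ball_avg_le_integral[OF pm_powr]) (auto simp: f1_pm)
    also have "... <= c1 * s powr (- dm)" unfolding mult.assoc[symmetric] by (intro mult_right_mono c1(3)) simp
    finally have "(ball_avg g1 x s powr p x) powr (1 / p x) <= (c1 * s powr (- dm)) powr (1 / p x)" using p_gt_1[of x] by (intro powr_mono2) auto
    then show "ball_avg g1 x s <= (c1 * s powr (- dm)) powr (1 / p x)" using a0 p_gt_1[of x] by (simp add: powr_powr)
   qed (use c1 F p_gt_1[of x] p_le[of x] p_ge[of x] pp_less pm_gt_1 in auto)
   \<comment> \<open>The exponent is such that the power \<open>ps x\<close> of the bound is exactly
     \<open>F1 x powr pm\<close>, which the maximal inequality controls.\<close>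
   also have "pm * (1 / p x - 1 / dm) = pm / ps x" by (simp add: inverse_ps[symmetric])
   finally show ?thesis by (simp add: D1_def L_def)
  qed
  have pot2: "BN (%s. ennreal (ball_avg g2 x s) * indicator {0<..} s)
    <= ennreal (D2 * F2 x powr (p_inf / q_inf))" for x proof -
   have "BN (%s. ennreal (ball_avg g2 x s) * indicator {0<..} s)
    <= ennreal (c2 * (1 + pp / (dm - pp)) * F2 x powr (p_inf * (1 / p_inf - 1 / dm)))" proof (rule Hedberg)
    fix s :: real assume s: "0 < s"
    have a0: "0 <= ball_avg g2 x s" using ball_avg_nonneg g2 by blast
    have "ball_avg g2 x s <= F2 x" unfolding F2_def by (rule ball_avg_le_maximal[OF g2 s])
    also have "... <= c2 * F2 x" using c2 F(2)[of x] mult_right_mono[of 1 c2 "F2 x"] by simp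
    finally show "ball_avg g2 x s <= (c2 * F2 x) powr (p_inf / p_inf)" using p_inf_gt_1 c2 F(2)[of x] by simp
    have "ball_avg g2 x s powr p_inf <= ball_avg (%y. g2 y powr p_inf) x s" using p_inf_gt_1 by (intro ball_avg_Jensen[OF g2]) auto
    also have "... <= J2 / V * s powr (- dm)" unfolding V_def dm_def using p_inf_gt_1 J2 s by (intro ball_avg_le_integral[OF bdd_borel_powr[OF g2] int2']) auto
    also have "... <= c2 * s powr (- dm)" by (intro mult_right_mono c2(2)) simp
    finally have "(ball_avg g2 x s powr p_inf) powr (1 / p_inf) <= (c2 * s powr (- dm)) powr (1 / p_inf)" using p_inf_gt_1 by (intro powr_mono2) auto
    then show "ball_avg g2 x s <= (c2 * s powr (- dm)) powr (1 / p_inf)" using a0 p_inf_gt_1 by (simp add: powr_powr)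
   qed (use c2 F p_inf_gt_1 p_inf_le pp_less in auto)
   also have "p_inf * (1 / p_inf - 1 / dm) = p_inf / q_inf" using p_inf_gt_1 by (simp add: ratio_inf right_diff_distrib)
   finally show ?thesis by (simp add: D2_def L_def)
  qed
  have pt: "\<bar>phi x\<bar> <= D1 * F1 x powr (pm / ps x) + D2 * F2 x powr (p_inf / q_inf)" for x proof -
   have nn: "0 <= D1 * F1 x powr (pm / ps x)" "0 <= D2 * F2 x powr (p_inf / q_inf)" using D by (auto intro!: mult_nonneg_nonneg)
   note [measurable] = ball_avg_borel[OF g1] ball_avg_borel[OF g2]
   have "ennreal \<bar>phi x\<bar> <= BN (%s. ennreal (ball_avg g x s) * indicator {0<..} s)" using potential_estimate[OF phi, of B] g by (simp add: g_def[abs_def])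
   also have "... = BN (%s. ennreal (ball_avg g1 x s) * indicator {0<..} s
     + ennreal (ball_avg g2 x s) * indicator {0<..} s)" unfolding g12 ball_avg_add[OF g1 g2]
    using ball_avg_nonneg[OF g1] ball_avg_nonneg[OF g2] by (simp add: distrib_right)
   also have "... = BN (%s. ennreal (ball_avg g1 x s) * indicator {0<..} s)
     + BN (%s. ennreal (ball_avg g2 x s) * indicator {0<..} s)" by (rule nn_integral_add) measurable
   also have "... <= ennreal (D1 * F1 x powr (pm / ps x)) + ennreal (D2 * F2 x powr (p_inf / q_inf))" by (intro add_mono pot1 pot2)
   also have "... = ennreal (D1 * F1 x powr (pm / ps x) + D2 * F2 x powr (p_inf / q_inf))" using nn by simp
   finally show ?thesis using nn by (subst (asm) ennreal_le_iff) auto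
  qed
  \<comment> \<open>Since \<open>Y <= 1\<close>, its power \<open>ps x\<close> is compared with
    \<open>Y powr q_inf = F2 x powr p_inf\<close> up to \<open>decay\<close>; the factor 2 comes
    from bounding a sum by twice the larger term.\<close>
  have pt2: "\<bar>phi x\<bar> powr ps x <= (2 * D1) powr psp * F1 x powr pm
    + (2 * D2) powr psp * (E2 * F2 x powr p_inf + decay x)" for x proof -
   define X where "X = F1 x powr (pm / ps x)"
   define Y where "Y = F2 x powr (p_inf / q_inf)"
   have XY: "0 <= X" "0 <= Y" "Y <= 1" unfolding X_def Y_def using F[of x] p_inf_gt_1 q_inf_gt_1 by (auto intro!: powr_le1)
   have Xp: "X powr ps x = F1 x powr pm" using ps_gt_1[of x] by (simp add: X_def powr_powr)
   have Yp: "Y powr q_inf = F2 x powr p_inf" using q_inf_gt_1 by (simp add: Y_def powr_powr)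
   have "\<bar>phi x\<bar> powr ps x <= (D1 * X + D2 * Y) powr ps x" using pt[of x] ps_gt_1[of x] by (intro powr_mono2) (auto simp: X_def Y_def)
   also have "... <= (2 * (D1 * X)) powr ps x + (2 * (D2 * Y)) powr ps x" using XY D ps_gt_1[of x] by (intro powr_add_le_two) auto
   also have "... = (2 * D1) powr ps x * X powr ps x + (2 * D2) powr ps x * Y powr ps x" by (simp only: mult.assoc[symmetric] powr_mult)
   also have "... <= (2 * D1) powr psp * X powr ps x + (2 * D2) powr psp * (E2 * Y powr q_inf + decay x)" using D ps_le[of x] E2(2)[OF XY(2,3), of x] XY
    by (intro add_mono mult_mono powr_mono mult_right_mono) auto
   finally show ?thesis by (simp only: Xp Yp)
  qed
  have [measurable]: "F1 \<in> borel_measurable borel" "F2 \<in> borel_measurable borel" unfolding F1_def F2_def using borel_measurable_maximal f1 g2 by blast+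
  have I1: "BI (%x. F1 x powr pm) <= ennreal K1" proof -
   have "BI (%x. f1 x) < top" proof (rule nn_integral_bounded_support)
    show "f1 x <= B powr pp" for x using bdd_borelD[OF f1] by simp
    show "f1 x = 0" if "R <= norm x" for x using R(2)[OF that] by (simp add: f1_def g1_def g_def)
   qed
   then have "BI (%x. F1 x powr pm) <= ennreal K1 * BI (%x. f1 x powr pm)" unfolding F1_def K1_def by (intro maximal_strong_type[OF f1] pm_gt_1)
   also have "... <= ennreal K1 * 1" using int1 unfolding f1_pm by (intro mult_left_mono) auto
   finally show ?thesis by simp
  qed
  have I2: "BI (%x. F2 x powr p_inf) <= ennreal (K2 * J2)" proof -
   have "BI (%x. g2 x) < top" proof (rule nn_integral_bounded_support)
    show "g2 x <= 1" for x using bdd_borelD[OF g2] by simp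
    show "g2 x = 0" if "R <= norm x" for x using R(2)[OF that] by (simp add: g2_def g_def)
   qed
   then have "BI (%x. F2 x powr p_inf) <= ennreal K2 * BI (%x. g2 x powr p_inf)" unfolding F2_def K2_def by (intro maximal_strong_type[OF g2] p_inf_gt_1)
   also have "... <= ennreal K2 * ennreal J2" using int2' by (intro mult_left_mono) auto
   finally show ?thesis using K J2 by (simp add: ennreal_mult)
  qed
  define A1 where "A1 = (2 * D1) powr psp"
  define A2 where "A2 = (2 * D2) powr psp"
  have A: "0 <= A1" "0 <= A2" by (simp_all add: A1_def A2_def)
  have "BI (%x. \<bar>phi x\<bar> powr ps x)
   <= BN (%x. ennreal A1 * ennreal (F1 x powr pm) + ennreal A2 * (ennreal E2 * ennreal (F2 x powr p_inf) + ennreal (decay x)))" proof (rule nn_integral_mono)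
   fix x
   have "ennreal (\<bar>phi x\<bar> powr ps x) <= ennreal (A1 * F1 x powr pm + A2 * (E2 * F2 x powr p_inf + decay x))"
    using pt2[of x] unfolding A1_def A2_def by (rule ennreal_leI)
   then show "ennreal (\<bar>phi x\<bar> powr ps x) <= ennreal A1 * ennreal (F1 x powr pm)
     + ennreal A2 * (ennreal E2 * ennreal (F2 x powr p_inf) + ennreal (decay x))" using A E2 decay_nonneg[of x] by (simp add: ennreal_mult)
  qed
  also have "... = ennreal A1 * BI (%x. F1 x powr pm)
   + ennreal A2 * (ennreal E2 * BI (%x. F2 x powr p_inf) + ennreal dec)" by (simp add: nn_integral_add nn_integral_cmult dec)
  also have "... <= ennreal A1 * ennreal K1 + ennreal A2 * (ennreal E2 * ennreal (K2 * J2) + ennreal dec)" by (intro add_mono mult_left_mono I1 I2) auto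
  also have "... = ennreal (A1 * K1 + A2 * (E2 * (K2 * J2) + dec))" using A K J2 E2 dec by (simp add: ennreal_mult)
  also have "... <= ennreal C" unfolding C_def A1_def A2_def by (intro ennreal_leI) simp
  finally show ?thesis .
 qed
 show thesis by (rule that[OF C main])
qed

end

section \<open>Vague compactness of bounded sequences of measures\<close>

text \<open>
 Schoenberg's space filling curve has a Borel section.  Hence bounded measures on \<open>\<real>\<^sup>N\<close> can be
 lifted to the real line, where Helly's selection theorem is available.
\<close>

definition tent :: "real => real"
 where "tent t = min 1 (max 0 (3 * arccos (cos (pi * t)) / pi - 1))"

lemma continuous_on_tent: "continuous_on A tent" unfolding tent_def[abs_def] by (intro continuous_intros) auto

lemma tent_bounds: "0 <= tent t" "tent t <= 1" by (auto simp: tent_def)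

lemma tent_even_int:
 assumes "0 <= s" "s <= 1"
 shows "tent (2 * of_int m + s) = min 1 (max 0 (3 * s - 1))" proof -
 have "cos (pi * (2 * of_int m + s)) = cos (2 * pi * of_int m + pi * s)" by (simp add: algebra_simps)
 also have "... = cos (pi * s)" unfolding cos_add cos_int_2pin sin_int_2pin by simp
 finally have "cos (pi * (2 * of_int m + s)) = cos (pi * s)" .
 moreover have "arccos (cos (pi * s)) = pi * s" using assms by (intro arccos_cos) (auto simp: mult_left_le)
 ultimately show ?thesis by (simp add: tent_def)
qed

text \<open>The point of the Cantor set with ternary digits \<open>2 * b m\<close>.\<close>

definition ternary :: "(nat => real) => real"
 where "ternary b = (\<Sum>m. 2 * b m / 3 ^ (m + 1))"

lemma summable_ternary:
 assumes "!!m. b m = 0 \<or> b m = (1::real)"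
 shows "summable (%m. 2 * b m / 3 ^ (m + 1))" proof (rule summable_comparison_test')
 show "summable (%m. 2 / 3 * (1 / 3) ^ m :: real)" by (intro summable_mult summable_geometric) auto
 show "norm (2 * b m / 3 ^ (m + 1)) <= 2 / 3 * (1 / 3) ^ m" for m using assms[of m] by (auto simp: power_one_over)
qed

lemma ternary_bounds:
 assumes "!!m. b m = 0 \<or> b m = (1::real)"
 shows "0 <= ternary b" "ternary b <= 1" proof -
 have b: "0 <= b m" "b m <= 1" for m using assms[of m] by auto
 show "0 <= ternary b" unfolding ternary_def using b by (intro suminf_nonneg summable_ternary assms) auto
 have "ternary b <= (\<Sum>m. 2 / 3 * (1 / 3) ^ m)" unfolding ternary_def using b
  by (intro suminf_le summable_ternary assms summable_mult summable_geometric) (auto simp: power_one_over field_simps)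
 also have "... = 1" by (subst suminf_mult) (auto simp: suminf_geometric intro!: summable_geometric)
 finally show "ternary b <= 1" .
qed

lemma ternary_Suc:
 assumes "!!m. b m = 0 \<or> b m = (1::real)"
 shows "3 * ternary b = 2 * b 0 + ternary (%m. b (Suc m))" proof -
 have "ternary b = (\<Sum>m. 2 * b (Suc m) / 3 ^ (Suc m + 1)) + 2 * b 0 / 3 ^ (0 + 1)"
  using suminf_split_head[OF summable_ternary[of b, OF assms]] by (simp add: ternary_def)
 also have "(\<Sum>m. 2 * b (Suc m) / 3 ^ (Suc m + 1)) = (\<Sum>m. 1 / 3 * (2 * b (Suc m) / 3 ^ (m + 1)))" by simp
 also have "... = 1 / 3 * ternary (%m. b (Suc m))" unfolding ternary_def using assms by (intro suminf_mult summable_ternary)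
 finally show ?thesis by simp
qed

text \<open>Multiplication by \<open>3 ^ j\<close> shifts the ternary digits; all digits being 0 or
  2, the part before the point is an even integer, and \<open>tent\<close> has period 2. On what
  remains, \<open>tent\<close> is 0 up to 1/3 and 1 from 2/3 to 1, so it reads off the first
  digit.\<close>

lemma tent_ternary:
 assumes "!!m. b m = 0 \<or> b m = (1::real)"
 shows "tent (3 ^ j * ternary b) = b j" proof -
 have shift: "\<exists>k::int. 3 ^ j * ternary b = 2 * of_int k + ternary (%m. b (m + j))" proof (induction j)
  case 0 then show ?case by (auto intro: exI[of _ 0])
 next
  case (Suc j)
  then obtain k :: int where k: "3 ^ j * ternary b = 2 * of_int k + ternary (%m. b (m + j))" by blast
  obtain i :: int where i: "b j = of_int i" using assms[of j] by (metis of_int_0 of_int_1)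
  have "3 ^ Suc j * ternary b = 3 * (2 * of_int k) + 3 * ternary (%m. b (m + j))" using k by simp
  also have "3 * ternary (%m. b (m + j)) = 2 * b j + ternary (%m. b (m + Suc j))" using ternary_Suc[of "%m. b (m + j)"] assms by simp
  finally have "3 ^ Suc j * ternary b = 2 * of_int (3 * k + i) + ternary (%m. b (m + Suc j))" by (simp add: i)
  then show ?case by blast
 qed
 obtain k :: int where k: "3 ^ j * ternary b = 2 * of_int k + ternary (%m. b (m + j))" using shift by blast
 define c where "c = (%m. b (m + j))"
 have c: "c m = 0 \<or> c m = 1" for m using assms by (simp add: c_def)
 have t: "3 * ternary c = 2 * c 0 + ternary (%m. c (Suc m))" using c by (rule ternary_Suc)
 have s: "0 <= ternary (%m. c (Suc m))" "ternary (%m. c (Suc m)) <= 1" using ternary_bounds[of "%m. c (Suc m)"] c by auto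
 have "tent (3 ^ j * ternary b) = min 1 (max 0 (3 * ternary c - 1))" unfolding k c_def[symmetric] using c by (intro tent_even_int ternary_bounds)
 also have "... = c 0" unfolding t using c[of 0] s by auto
 finally show ?thesis by (simp add: c_def)
qed

definition binary_digit :: "nat => real => real"
 where "binary_digit k y = of_int (\<lfloor>2 ^ (k + 1) * y\<rfloor> mod 2)"

lemma binary_digit_01: "binary_digit k y = 0 \<or> binary_digit k y = 1" by (auto simp: binary_digit_def)

lemma binary_digit_sums:
 assumes "0 <= y" "y < 1"
 shows "(%k. (1 / 2) ^ (k + 1) * binary_digit k y) sums y" proof -
 have part: "(\<Sum>k<n. (1 / 2) ^ (k + 1) * binary_digit k y) = of_int \<lfloor>2 ^ n * y\<rfloor> / 2 ^ n" for n proof (induction n)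
  case 0
  have "\<lfloor>y\<rfloor> = 0" using assms by (simp add: floor_eq_iff)
  then show ?case by simp
 next
  case (Suc n)
  define z where "z = 2 ^ n * y"
  have "\<lfloor>2 * z\<rfloor> div 2 = \<lfloor>z\<rfloor>" by (simp add: floor_divide_real_eq_div[symmetric])
  then have "\<lfloor>2 * z\<rfloor> = 2 * \<lfloor>z\<rfloor> + \<lfloor>2 * z\<rfloor> mod 2" by presburger
  then have "real_of_int \<lfloor>2 * z\<rfloor> = of_int (2 * \<lfloor>z\<rfloor> + \<lfloor>2 * z\<rfloor> mod 2)" by (rule arg_cong)
  moreover have "2 ^ (n + 1) * y = 2 * z" by (simp add: z_def)
  ultimately have e: "real_of_int \<lfloor>2 * z\<rfloor> = 2 * of_int \<lfloor>z\<rfloor> + binary_digit n y"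
   by (simp only: binary_digit_def of_int_add of_int_mult of_int_numeral)
  have "(\<Sum>k<Suc n. (1 / 2) ^ (k + 1) * binary_digit k y) = of_int \<lfloor>z\<rfloor> / 2 ^ n + (1 / 2) ^ (n + 1) * binary_digit n y" using Suc by (simp add: z_def)
  also have "... = real_of_int \<lfloor>2 * z\<rfloor> / 2 ^ Suc n" unfolding e by (simp add: power_one_over field_simps)
  finally show ?case by (simp add: z_def mult.assoc)
 qed
 have "(%n. of_int \<lfloor>2 ^ n * y\<rfloor> / 2 ^ n) ----> y" proof (rule tendsto_sandwich)
  show "eventually (%n. y - (1 / 2) ^ n <= of_int \<lfloor>2 ^ n * y\<rfloor> / 2 ^ n) sequentially" proof (intro always_eventually allI)
   fix n
   have "2 ^ n * y - 1 <= of_int \<lfloor>2 ^ n * y\<rfloor>" by linarith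
   then have "(2 ^ n * y - 1) / 2 ^ n <= of_int \<lfloor>2 ^ n * y\<rfloor> / 2 ^ n" by (intro divide_right_mono) auto
   then show "y - (1 / 2) ^ n <= of_int \<lfloor>2 ^ n * y\<rfloor> / 2 ^ n" by (simp add: diff_divide_distrib power_one_over)
  qed
  show "eventually (%n. of_int \<lfloor>2 ^ n * y\<rfloor> / 2 ^ n <= y) sequentially" by (intro always_eventually allI) (simp add: divide_le_eq mult.commute)
  have "(%n. y - (1 / 2) ^ n) ----> y - 0" by (intro tendsto_intros LIMSEQ_realpow_zero) auto
  then show "(%n. y - (1 / 2) ^ n) ----> y" by simp
 qed auto
 then show ?thesis unfolding sums_def part .
qed

text \<open>\<open>c\<close> interleaves the binary digits of the \<open>N\<close> coordinates as
  ternary digits of one number. Coordinate \<open>i\<close> of Schoenberg's curve \<open>d\<close>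
  reads the digits at places congruent to \<open>i\<close> modulo \<open>N\<close> and reassembles
  them. Digits are Borel functions, hence so is the section \<open>c\<close>.\<close>

lemma space_filling_curve:
 obtains d :: "real => 'a::euclidean_space" and c :: "'a => real"
 where "continuous_on UNIV d" "c \<in> borel_measurable borel" "!!x. 0 <= c x" "!!x. c x <= 1"
  "!!x. (!!b. b \<in> Basis ==> 0 < x \<bullet> b & x \<bullet> b < 1) ==> d (c x) = x" proof -
 define N where "N = DIM('a)"
 have N: "0 < N" by (simp add: N_def)
 obtain e :: "nat => 'a" where e: "bij_betw e {0..<N} Basis" using ex_bij_betw_nat_finite[OF finite_Basis] unfolding N_def by blast
 define c where "c x = ternary (%m. binary_digit (m div N) (x \<bullet> e (m mod N)))" for x
 define h where "h i t = (\<Sum>k. (1 / 2) ^ (k + 1) * tent (3 ^ (k * N + i) * t))" for i t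
 define d where "d t = (\<Sum>i<N. h i t *\<^sub>R e i)" for t
 have "continuous_on UNIV (h i)" for i proof -
  have "uniform_limit UNIV (%n t. \<Sum>k<n. (1 / 2) ^ (k + 1) * tent (3 ^ (k * N + i) * t)) (h i) sequentially" unfolding h_def proof (rule Weierstrass_m_test)
   show "summable (%k. (1 / 2) ^ (k + 1) :: real)" by (simp add: summable_mult summable_geometric)
   show "norm ((1 / 2) ^ (k + 1) * tent (3 ^ (k * N + i) * t)) <= (1 / 2) ^ (k + 1)" for k t
    using tent_bounds[of "3 ^ (k * N + i) * t"] by (simp add: abs_mult mult_left_le)
  qed
  then show ?thesis by (rule uniform_limit_theorem[rotated]) (auto intro!: always_eventually continuous_intros continuous_on_compose2[OF continuous_on_tent])
 qed
 then have dc: "continuous_on UNIV d" unfolding d_def by (intro continuous_intros) auto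
 have "(%x. binary_digit (m div N) (x \<bullet> e (m mod N))) \<in> borel_measurable borel" for m unfolding binary_digit_def by measurable
 then have "c \<in> borel_measurable borel" unfolding c_def[abs_def] ternary_def by measurable
 moreover have "0 <= c x" "c x <= 1" for x unfolding c_def using binary_digit_01 by (auto intro!: ternary_bounds)
 moreover have "d (c x) = x" if x: "!!b. b \<in> Basis ==> 0 < x \<bullet> b & x \<bullet> b < 1" for x proof -
  have "h i (c x) = x \<bullet> e i" if i: "i < N" for i proof -
   have "e i \<in> Basis" using e i by (auto simp: bij_betw_def)
   then have "(%k. (1 / 2) ^ (k + 1) * binary_digit k (x \<bullet> e i)) sums (x \<bullet> e i)" using x[of "e i"] by (intro binary_digit_sums) auto
   moreover have "tent (3 ^ (k * N + i) * c x) = binary_digit k (x \<bullet> e i)" for k unfolding c_def using i by (subst tent_ternary) (auto simp: binary_digit_01)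
   ultimately show ?thesis by (simp add: h_def sums_iff)
  qed
  then have "d (c x) = (\<Sum>i<N. (x \<bullet> e i) *\<^sub>R e i)" by (simp add: d_def)
  also have "... = (\<Sum>b\<in>Basis. (x \<bullet> b) *\<^sub>R b)" using e by (intro sum.reindex_bij_betw) (simp add: lessThan_atLeast0)
  finally show ?thesis by (simp add: euclidean_representation)
 qed
 ultimately show thesis using dc that by blast
qed

section \<open>Transport of measures between the space and the line\<close>

lemma open_cube_homeomorphism:
 obtains kp kp' :: "'a::euclidean_space => 'a" and Q
 where "open Q" "continuous_on UNIV kp" "continuous_on Q kp'" "!!x. kp x \<in> Q" "!!x. kp' (kp x) = x"
  "!!y. y \<in> Q ==> kp (kp' y) = y" "!!y b. y \<in> Q ==> b \<in> Basis ==> 0 < y \<bullet> b & y \<bullet> b < 1" proof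
 let ?Q = "box 0 One :: 'a set"
 let ?k = "%x::'a. \<Sum>b\<in>Basis. (1 / 2 + arctan (x \<bullet> b) / pi) *\<^sub>R b"
 let ?k' = "%y::'a. \<Sum>b\<in>Basis. tan (pi * (y \<bullet> b - 1 / 2)) *\<^sub>R b"
 have Q: "y \<in> ?Q \<longleftrightarrow> (\<forall>b\<in>Basis. 0 < y \<bullet> b & y \<bullet> b < 1)" for y by (auto simp: mem_box)
 have rng: "- (pi / 2) < pi * (y \<bullet> b - 1 / 2)" "pi * (y \<bullet> b - 1 / 2) < pi / 2"
  if "y \<in> ?Q" "b \<in> Basis" for y b using that unfolding Q by (auto simp: algebra_simps)
 have cne: "cos (pi * (y \<bullet> b - 1 / 2)) ~= 0" if "y \<in> ?Q" "b \<in> Basis" for y b using cos_gt_zero_pi[OF rng[OF that]] by simp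
 have half: "0 < 1 / 2 + arctan t / pi & 1 / 2 + arctan t / pi < 1" for t proof -
  have "- (1 / 2) < arctan t / pi" using arctan_lbound[of t] pi_gt_zero by (simp add: less_divide_eq)
  moreover have "arctan t / pi < 1 / 2" using arctan_ubound[of t] pi_gt_zero by (simp add: divide_less_eq)
  ultimately show ?thesis by linarith
 qed
 show "open ?Q" by (rule open_box)
 show "continuous_on UNIV ?k" by (intro continuous_intros) auto
 show "continuous_on ?Q ?k'" unfolding tan_def by (intro continuous_intros ballI cne)
 show "?k x \<in> ?Q" for x unfolding Q proof
  fix b :: 'a assume "b \<in> Basis"
  then show "0 < ?k x \<bullet> b & ?k x \<bullet> b < 1" using half[of "x \<bullet> b"] by (simp only: inner_sum_left_Basis)
 qed
 show "?k' (?k x) = x" for x by (rule euclidean_eqI) (simp add: inner_sum_left_Basis tan_arctan)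
 show "?k (?k' y) = y" if "y \<in> ?Q" for y proof (rule euclidean_eqI)
  fix b :: 'a assume b: "b \<in> Basis"
  then show "?k (?k' y) \<bullet> b = y \<bullet> b" using rng[OF that b] by (simp add: inner_sum_left_Basis arctan_tan)
 qed
 show "0 < y \<bullet> b & y \<bullet> b < 1" if "y \<in> ?Q" "b \<in> Basis" for y b using that unfolding Q by blast
qed

text \<open>The function is continuous on the open set \<open>Q\<close> and zero on the complement
  of the compact image of \<open>K\<close>; these two open sets cover the space.\<close>

lemma continuous_extend_by_zero:
 fixes f :: "'a::euclidean_space => real" and kp kp' :: "'a => 'a"
 assumes Q: "open Q" "continuous_on UNIV kp" "continuous_on Q kp'" "!!x. kp x \<in> Q"
  "!!y. y \<in> Q ==> kp (kp' y) = y"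
  and f: "continuous_on UNIV f" "compact K" "!!x. x \<notin> K ==> f x = 0"
 shows "continuous_on UNIV (%y. if y \<in> Q then f (kp' y) else 0)" (is "continuous_on UNIV ?G") proof -
 have "compact (kp ` K)" using f(2) Q(2) continuous_on_subset by (intro compact_continuous_image) auto
 then have op: "open (- kp ` K)" by (simp add: compact_imp_closed open_Compl)
 have 1: "continuous_on Q ?G" proof (rule continuous_on_eq)
  show "continuous_on Q (%y. f (kp' y))" by (rule continuous_on_compose2[OF f(1) Q(3)]) auto
 qed simp
 have 2: "continuous_on (- kp ` K) ?G" proof (rule continuous_on_eq)
  show "0 = ?G y" if y: "y \<in> - kp ` K" for y proof (cases "y \<in> Q")
   case True
   then have "kp' y \<notin> K" using y Q(5)[of y] by (metis ComplD imageI)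
   then show ?thesis using f(3) by simp
  qed simp
 qed simp
 have "Q \<union> - kp ` K = UNIV" using Q(4) by auto
 then show ?thesis using continuous_on_open_Un[OF Q(1) op 1 2] by simp
qed

text \<open>The map \<open>lift\<close> sends all measures into the unit interval, so tightness is
  immediate and a weak limit \<open>M\<close> on the line exists. A function \<open>f\<close> of
  compact support corresponds to the bounded continuous function \<open>F\<close> on the line, which
  satisfies \<open>F (lift x) = f x\<close>; thus weak convergence there is vague convergence
  here.\<close>

lemma vague_compactness_prob:
 fixes P :: "nat => 'a::euclidean_space measure"
 assumes P: "!!n. prob_space (P n)" and meas: "!!n. (%x. x) \<in> measurable (P n) borel"
 shows "\<exists>k \<mu>. strict_mono (k :: nat => nat) & sets \<mu> = sets borel & finite_measure \<mu> &
  weakly_converges_measure (%n. P (k n)) \<mu>" proof -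
 obtain d :: "real => 'a" and c where d: "continuous_on UNIV d" and c[measurable]: "c \<in> borel_measurable borel"
  and c01: "!!x. 0 <= c x" "!!x. c x <= 1"
  and dc: "!!x. (!!b. b \<in> Basis ==> 0 < x \<bullet> b & x \<bullet> b < 1) ==> d (c x) = x" by (rule space_filling_curve) blast
 obtain kp kp' :: "'a => 'a" and Q where Q: "open Q" "continuous_on UNIV kp" "continuous_on Q kp'"
  "!!x. kp x \<in> Q" "!!x. kp' (kp x) = x" "!!y. y \<in> Q ==> kp (kp' y) = y"
  "!!y b. y \<in> Q ==> b \<in> Basis ==> 0 < y \<bullet> b & y \<bullet> b < 1" by (rule open_cube_homeomorphism) blast
 have [measurable]: "kp \<in> borel_measurable borel" using Q(2) by (rule borel_measurable_continuous_onI)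
 have [measurable]: "d \<in> borel_measurable borel" using d by (rule borel_measurable_continuous_onI)
 have [measurable]: "Q \<in> sets borel" using Q(1) by simp
 define lift where "lift x = c (kp x)" for x
 have d_lift: "d (lift x) = kp x" for x unfolding lift_def using Q(4,7) by (intro dc) blast
 have lift[measurable]: "lift \<in> borel_measurable borel" unfolding lift_def[abs_def] by measurable
 have liftP[measurable]: "lift \<in> borel_measurable (P n)" for n using measurable_compose[OF meas lift] by simp
 define R where "R n = distr (P n) borel lift" for n
 have R: "real_distribution (R n)" for n unfolding R_def real_distribution_def real_distribution_axioms_def using prob_space.prob_space_distr[OF P liftP] by simp
 have "tight R" unfolding tight_def proof (intro conjI allI impI)
  fix eps :: real assume e: "0 < eps"
  have "measure (R n) {-1<..1} = 1" for n proof -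
   interpret real_distribution "R n" by (rule R)
   have "AE x in P n. lift x \<in> {-1<..1}" using c01 by (intro AE_I2) (auto simp: lift_def intro: less_le_trans[of "-1" 0])
   then have "AE x in R n. x \<in> {-1<..1}" unfolding R_def by (subst AE_distr_iff) auto
   then show ?thesis by (subst prob_eq_1) auto
  qed
  then show "\<exists>a b. a < b & (\<forall>n. 1 - eps < measure (R n) {a<..b})" using e by (intro exI[of _ "-1"] exI[of _ 1]) auto
 qed (rule R)
 from tight_imp_convergent_subsubsequence[OF this strict_mono_id]
 obtain k M where k: "strict_mono k" and M: "real_distribution M" and conv: "weak_conv_m (%n. R (k n)) M" by (auto simp: comp_def)
 interpret M: real_distribution M by (rule M)
 define E where "E = d -` Q"
 have E[measurable]: "E \<in> sets borel" unfolding E_def using d Q(1) by (simp add: borel_open open_vimage continuous_on_eq_continuous_at)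
 define T where "T t = (if t \<in> E then kp' (d t) else 0)" for t
 have T[measurable]: "T \<in> borel_measurable borel" proof -
  have "continuous_on E (%t. kp' (d t))" by (rule continuous_on_compose2[OF Q(3) continuous_on_subset[OF d]]) (auto simp: E_def)
  then have "(%t. if t \<in> E then kp' (d t) else 0) \<in> borel_measurable borel" by (intro borel_measurable_continuous_on_if E) auto
  then show ?thesis by (simp add: T_def[abs_def])
 qed
 \<comment> \<open>Limit mass outside \<open>E\<close> sits over the boundary of the cube, that is,
   at infinity. It is dropped, and every \<open>F\<close> vanishes there.\<close>
 define \<mu> where "\<mu> = distr (density M (indicator E)) borel T"
 have "emeasure \<mu> (space \<mu>) <= 1" proof -
  have "emeasure \<mu> (space \<mu>) = (\<integral>\<^sup>+t. indicator E t \<partial>M)" unfolding \<mu>_def by (simp add: emeasure_distr emeasure_density)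
  also have "... = emeasure M E" by simp
  finally show ?thesis using M.emeasure_le_1 by simp
 qed
 then have fin: "finite_measure \<mu>" by (intro finite_measureI) (auto simp: top_unique)
 have "weakly_converges_measure (%n. P (k n)) \<mu>" unfolding weakly_converges_measure_def proof (intro allI impI, elim conjE)
  fix f :: "'a => real" assume f: "continuous_on UNIV f" and K: "compact (closure {x. f x ~= 0})"
  define K where "K = closure {x. f x ~= 0}"
  have fK: "f x = 0" if "x \<notin> K" for x using that closure_subset[of "{x. f x ~= 0}"] by (auto simp: K_def)
  have [measurable]: "f \<in> borel_measurable borel" using f by (rule borel_measurable_continuous_onI)
  define G where "G y = (if y \<in> Q then f (kp' y) else 0)" for y
  have G: "continuous_on UNIV G" unfolding G_def using K by (intro continuous_extend_by_zero[OF Q(1-4,6) f _ fK]) (auto simp: K_def)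
  obtain B where B: "!!x. \<bar>f x\<bar> <= B" proof -
   have "bounded (f ` K)" using K f continuous_on_subset by (intro compact_imp_bounded compact_continuous_image) (auto simp: K_def)
   then obtain b where "0 < b" "\<forall>y\<in>f ` K. norm y <= b" using bounded_pos by blast
   then have "\<bar>f x\<bar> <= b" for x using fK[of x] by (cases "x \<in> K") auto
   then show thesis by (rule that)
  qed
  have B0: "0 <= B" using B[of 0] by linarith
  define F where "F t = G (d t)" for t
  have cF: "isCont F t" for t unfolding F_def using continuous_on_compose2[OF G d] by (simp add: continuous_on_eq_continuous_at)
  have FB: "norm (F t) <= B" for t using B B0 by (auto simp: F_def G_def)
  have "(%n. integral\<^sup>L (R (k n)) F) ----> integral\<^sup>L M F" by (rule weak_conv_imp_integral_bdd_continuous_conv[OF R M conv cF FB])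
  moreover have "integral\<^sup>L (R n) F = integral\<^sup>L (P n) f" for n proof -
   have [measurable]: "F \<in> borel_measurable borel" using cF by (intro borel_measurable_continuous_onI continuous_at_imp_continuous_on) auto
   have "integral\<^sup>L (R n) F = (\<integral>x. F (lift x) \<partial>P n)" unfolding R_def by (rule integral_distr) measurable
   also have "(%x. F (lift x)) = f" by (auto simp: F_def d_lift G_def Q)
   finally show ?thesis .
  qed
  moreover have "integral\<^sup>L \<mu> f = integral\<^sup>L M F" proof -
   have "integral\<^sup>L \<mu> f = (\<integral>t. f (T t) \<partial>density M (%t. ennreal (indicator E t)))"
    unfolding \<mu>_def ennreal_indicator by (rule integral_distr) measurable
   also have "... = (\<integral>t. indicator E t *\<^sub>R f (T t) \<partial>M)" by (rule integral_density) auto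
   also have "(%t. indicator E t *\<^sub>R f (T t)) = F" by (auto simp: fun_eq_iff F_def G_def T_def E_def indicator_def)
   finally show ?thesis .
  qed
  ultimately show "(%n. integral\<^sup>L (P (k n)) f) ----> integral\<^sup>L \<mu> f" by simp
 qed
 moreover have "sets \<mu> = sets borel" by (simp add: \<mu>_def)
 ultimately show ?thesis using k fin by blast
qed

text \<open>The total masses converge along a subsequence. If their limit is 0 the null measure is
  the limit; otherwise the measures are normalised and the limit is scaled back by
  \<open>l\<close>.\<close>

lemma vague_compactness:
 fixes M :: "nat => 'a::euclidean_space measure"
 assumes meas: "!!n. (%x. x) \<in> measurable (M n) borel" and C: "!!n. emeasure (M n) (space (M n)) <= ennreal C"
 shows "\<exists>k \<mu>. strict_mono (k :: nat => nat) & sets \<mu> = sets borel & finite_measure \<mu> &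
  weakly_converges_measure (%n. M (k n)) \<mu>" proof -
 define a where "a n = measure (M n) (space (M n))" for n
 have fin: "finite_measure (M n)" for n using C[of n] by (intro finite_measureI) (auto simp: top_unique)
 have a_em: "emeasure (M n) (space (M n)) = ennreal (a n)" for n using finite_measure.emeasure_eq_measure[OF fin] by (simp add: a_def)
 have a: "0 <= a n" "a n <= max C 0" for n using C[of n] unfolding a_em by (auto simp: a_def ennreal_le_iff2)
 have "bounded (range a)" using a by (intro boundedI[of _ "max C 0"]) (auto simp: abs_of_nonneg)
 then obtain l k1 where k1: "strict_mono k1" "(a \<circ> k1) ----> l" using bounded_imp_convergent_subsequence by blast
 have l: "0 <= l" using k1(2) a(1) by (intro LIMSEQ_le_const[OF k1(2)]) auto
 have mf: "f \<in> borel_measurable (M n)" if "continuous_on UNIV f" for f :: "'a => real" and n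
  using measurable_compose[OF meas borel_measurable_continuous_onI[OF that]] by simp
 have bnd: "\<exists>B. \<forall>x. \<bar>f x\<bar> <= B" if "continuous_on UNIV f" "compact (closure {x. f x ~= 0})" for f :: "'a => real" proof -
  have "bounded (f ` closure {x. f x ~= 0})" using that continuous_on_subset by (intro compact_imp_bounded compact_continuous_image) auto
  then obtain b where b: "0 < b" "\<forall>y\<in>f ` closure {x. f x ~= 0}. norm y <= b" using bounded_pos by blast
  have "\<bar>f x\<bar> <= b" for x using b closure_subset[of "{x. f x ~= 0}"] by (cases "f x = 0") auto
  then show ?thesis by blast
 qed
 show ?thesis proof (cases "l = 0")
  case True
  have "weakly_converges_measure (%n. M (k1 n)) (null_measure borel)" unfolding weakly_converges_measure_def proof (intro allI impI, elim conjE)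
   fix f :: "'a => real" assume f: "continuous_on UNIV f" "compact (closure {x. f x ~= 0})"
   obtain B where B: "!!x. \<bar>f x\<bar> <= B" using bnd[OF f] by blast
   have "(%n. integral\<^sup>L (M (k1 n)) f) ----> 0" proof (rule Lim_null_comparison)
    show "(%n. B * a (k1 n)) ----> 0" using tendsto_mult_left[OF k1(2), of B] True by (simp add: comp_def)
    show "eventually (%n. norm (integral\<^sup>L (M (k1 n)) f) <= B * a (k1 n)) sequentially" proof (intro always_eventually allI)
     fix n
     interpret finite_measure "M (k1 n)" by (rule fin)
     have "norm (integral\<^sup>L (M (k1 n)) f) <= (\<integral>x. B \<partial>M (k1 n))" proof (rule order_trans[OF integral_norm_bound])
      have "integrable (M (k1 n)) f" using B by (intro integrable_const_bound[of _ B] mf[OF f(1)]) auto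
      then show "(\<integral>x. norm (f x) \<partial>M (k1 n)) <= (\<integral>x. B \<partial>M (k1 n))" using B by (intro integral_mono) auto
     qed
     then show "norm (integral\<^sup>L (M (k1 n)) f) <= B * a (k1 n)" by (simp add: a_def mult.commute)
    qed
   qed
   moreover have "integral\<^sup>L (null_measure borel) f = 0" by (intro integral_eq_zero_AE) (auto simp: null_sets_def eventually_ae_filter intro!: bexI[of _ UNIV])
   ultimately show "(%n. integral\<^sup>L (M (k1 n)) f) ----> integral\<^sup>L (null_measure borel) f" by simp
  qed
  moreover have "finite_measure (null_measure borel :: 'a measure)" by (intro finite_measureI) simp
  ultimately show ?thesis using k1(1) by (intro exI[of _ k1] exI[of _ "null_measure borel"]) simp
 next
  case False
  then have "0 < l" using l by simp
  then have "eventually (%n. 0 < a (k1 n)) sequentially" using order_tendstoD(1)[OF k1(2)] by (simp add: comp_def)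
  then obtain n0 where n0: "!!n. n0 <= n ==> 0 < a (k1 n)" by (auto simp: eventually_sequentially)
  define k2 where "k2 n = k1 (n + n0)" for n
  have k2: "strict_mono k2" "!!n. 0 < a (k2 n)" unfolding k2_def using k1(1) n0 by (auto simp: strict_mono_def)
  have lim: "(%n. a (k2 n)) ----> l" using LIMSEQ_ignore_initial_segment[OF k1(2), of n0] by (simp add: k2_def comp_def)
  define P where "P n = density (M (k2 n)) (%_. ennreal (1 / a (k2 n)))" for n
  have "prob_space (P n)" for n proof
   have "emeasure (P n) (space (P n)) = ennreal (1 / a (k2 n)) * ennreal (a (k2 n))" unfolding P_def by (simp add: emeasure_density nn_integral_cmult_indicator a_em)
   also have "... = 1" using k2(2)[of n] by (simp add: ennreal_mult[symmetric])
   finally show "emeasure (P n) (space (P n)) = 1" .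
  qed
  moreover have "(%x. x) \<in> measurable (P n) borel" for n using meas by (simp add: P_def)
  ultimately obtain k3 \<mu> where k3: "strict_mono (k3 :: nat => nat)" and \<mu>: "sets \<mu> = sets borel" "finite_measure \<mu>"
   "weakly_converges_measure (%n. P (k3 n)) \<mu>" using vague_compactness_prob[of P] by blast
  define \<nu> where "\<nu> = density \<mu> (%_. ennreal l)"
  have f\<nu>: "finite_measure \<nu>" proof (rule finite_measureI)
   interpret finite_measure \<mu> by (rule \<mu>)
   show "emeasure \<nu> (space \<nu>) ~= \<infinity>" unfolding \<nu>_def by (simp add: emeasure_density nn_integral_cmult_indicator ennreal_mult_eq_top_iff)
  qed
  have "weakly_converges_measure (%n. M (k2 (k3 n))) \<nu>" unfolding weakly_converges_measure_def proof (intro allI impI, elim conjE)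
   fix f :: "'a => real" assume f: "continuous_on UNIV f" "compact (closure {x. f x ~= 0})"
   have "(%n. integral\<^sup>L (P (k3 n)) f) ----> integral\<^sup>L \<mu> f" using \<mu>(3) f by (auto simp: weakly_converges_measure_def)
   moreover have "(%n. a (k2 (k3 n))) ----> l" using LIMSEQ_subseq_LIMSEQ[OF lim k3] by (simp add: comp_def)
   ultimately have "(%n. a (k2 (k3 n)) * integral\<^sup>L (P (k3 n)) f) ----> l * integral\<^sup>L \<mu> f" by (intro tendsto_mult)
   moreover have "a (k2 n) * integral\<^sup>L (P n) f = integral\<^sup>L (M (k2 n)) f" for n unfolding P_def using mf[OF f(1)] k2(2)[of n]
    by (subst integral_density) (auto simp: less_imp_le)
   moreover have "l * integral\<^sup>L \<mu> f = integral\<^sup>L \<nu> f" proof -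
    have "f \<in> borel_measurable \<mu>" using borel_measurable_continuous_onI[OF f(1)] \<mu>(1) by (simp cong: measurable_cong_sets)
    then show ?thesis unfolding \<nu>_def using l by (subst integral_density) auto
   qed
   ultimately show "(%n. integral\<^sup>L (M (k2 (k3 n))) f) ----> integral\<^sup>L \<nu> f" by simp
  qed
  moreover have "strict_mono (%n. k2 (k3 n))" using k2(1) k3 by (simp add: strict_mono_def)
  moreover have "sets \<nu> = sets borel" by (simp add: \<nu>_def \<mu>)
  ultimately show ?thesis using f\<nu> by blast
 qed
qed

section \<open>Functions in \<open>D\<^sup>1\<close>\<close>

lemma modular_UNIV: "modular r UNIV u = Mod r u" by (simp add: modular_def lebesgue_on_UNIV_eq)

lemma Lnorm_le:
 assumes "0 < s" "modular r U (%x. u x /\<^sub>R s) <= 1"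
 shows "Lnorm r U u <= ennreal s" unfolding Lnorm_def using assms by (intro INF_lower2[of s]) auto

lemma modular_le_1_if_Lnorm_less:
 assumes "Lnorm r U u < ennreal s" "!!x. 0 <= r x"
 shows "modular r U (%x. u x /\<^sub>R s) <= 1" proof -
 obtain t where t: "0 < t" "modular r U (%x. u x /\<^sub>R t) <= 1" "ennreal t < ennreal s" using assms(1) unfolding Lnorm_def INF_less_iff by auto
 then have ts: "t < s" by (simp add: ennreal_less_iff)
 have "modular r U (%x. u x /\<^sub>R s) <= modular r U (%x. u x /\<^sub>R t)" unfolding modular_def proof (intro nn_integral_mono ennreal_leI powr_mono2 assms)
  fix x show "norm (u x /\<^sub>R s) <= norm (u x /\<^sub>R t)" using t(1) ts by (auto intro!: mult_right_mono le_imp_inverse_le)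
 qed simp
 then show ?thesis using t(2) by (rule order_trans)
qed

lemma C_k_translate: "C_k k f ==> C_k k (%x. f (x + a))" proof (induction k arbitrary: f)
 case 0
 then show ?case by (auto intro!: continuous_on_compose2[of UNIV f] continuous_intros)
next
 case (Suc k)
 have D: "((%x. f (x + a)) has_derivative frechet_derivative f (at (x + a))) (at x)" for x proof -
  have "((%x. x + a) has_derivative (%h. h)) (at x)" by (auto intro!: derivative_eq_intros)
  moreover have "(f has_derivative frechet_derivative f (at (x + a))) (at (x + a))" using Suc.prems by (simp add: frechet_derivative_works[symmetric])
  ultimately show ?thesis using has_derivative_compose by blast
 qed
 then show ?case using Suc by (auto simp: frechet_derivative_eqI[OF D] differentiable_def)
qed

lemma test_translate:
 assumes "phi \<in> tests"
 shows "(%x. phi (x + a)) \<in> tests" proof -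
 obtain K where K: "compact K" "!!x. x \<notin> K ==> phi x = 0" using test_functionsE[OF assms] by metis
 show ?thesis proof (rule test_functionsI)
  show "C_k k (%x. phi (x + a))" for k using test_C_k[OF assms] by (rule C_k_translate)
  show "compact ((+) (- a) ` K)" using K(1) by (rule compact_translation)
  show "phi (x + a) = 0" if "x \<notin> (+) (- a) ` K" for x proof (rule K(2))
   show "x + a \<notin> K" using that image_iff[of x "(+) (- a)" K] by (metis add.commute add_minus_cancel)
  qed
 qed simp
qed

lemma midpoint_powr:
 fixes a b r :: real
 assumes "0 <= a" "0 <= b" "1 <= r"
 shows "((a + b) / 2) powr r <= (a powr r + b powr r) / 2" proof (cases "a + b = 0")
 case True then show ?thesis using assms by simp
next
 case False
 then have "0 < (a + b) / 2" using assms by auto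
 from powr_above_tangent[OF assms(1) this assms(3)] powr_above_tangent[OF assms(2) this assms(3)]
 show ?thesis by (simp add: field_simps)
qed

lemma le_eps_add_powr:
 fixes t eps r b :: real
 assumes "0 <= t" "0 < eps" "eps <= 1" "1 <= r" "r <= b"
 shows "t <= eps + eps powr (- b) * t powr r" proof (cases "t <= eps")
 case True
 then show ?thesis by (simp add: add_increasing2)
next
 case False
 have "t = t powr r * t powr (1 - r)" using False assms by (simp flip: powr_add)
 also have "... <= t powr r * eps powr (1 - r)" using False assms by (intro mult_left_mono powr_mono2') auto
 also have "... <= t powr r * eps powr (- b)" using assms by (intro mult_left_mono powr_mono') auto
 finally show ?thesis using assms by (simp add: mult.commute add_increasing)
qed

lemma loc_integrable_measurable:
 fixes f :: "'a::euclidean_space => 'b::euclidean_space"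
 assumes "loc_integrable UNIV f"
 shows "f \<in> lmeas" proof (rule borel_measurable_LIMSEQ_metric)
 show "(%x. indicator (cball 0 (real n)) x *\<^sub>R f x) \<in> lmeas" for n
  by (rule borel_measurable_integrable) (use assms in \<open>auto simp: loc_integrable_def set_integrable_def\<close>)
 show "(%n. indicator (cball 0 (real n)) x *\<^sub>R f x) ----> f x" for x proof -
  obtain N where "norm x <= real N" using real_arch_simple by blast
  then have "eventually (%n. indicator (cball 0 (real n)) x *\<^sub>R f x = f x) sequentially" by (intro eventually_sequentiallyI[of N]) auto
  then show ?thesis by (rule tendsto_eventually)
 qed
qed

text \<open>As a function of the translation \<open>t\<close>, the integral has derivative equal to
  the integral of \<open>w\<close> against a partial derivative of a test function, hence 0.\<close>

lemma weak_gradient_zero_translate: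
 fixes w :: "'a::euclidean_space => real"
 assumes w: "loc_integrable UNIV w" and b: "b \<in> Basis"
  and 0: "!!phi. phi \<in> tests ==> LB (%x. w x * frechet_derivative phi (at x) b) = 0"
  and phi: "phi \<in> tests"
 shows "LB (%x. w x * phi (x + t *\<^sub>R b)) = LB (%x. w x * phi x)" proof -
 have int: "integrable lebesgue (%x. w x * zt x)" if "zt \<in> tests" for zt using loc_integrable_test(1)[OF w that] by simp
 define F where "F t = LB (%x. w x * phi (x + t *\<^sub>R b))" for t
 have deriv: "(F has_real_derivative 0) (at t)" for t unfolding has_field_derivative_iff tendsto_at_iff_sequentially comp_def proof (intro allI impI)
  fix k :: "nat => real" assume k: "\<forall>i. k i \<in> UNIV - {t}" "k ----> t"
  define h where "h n = k n - t" for n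
  have h: "\<forall>i. h i \<in> UNIV - {0}" "h ----> 0" using k LIM_zero[of k t sequentially] by (auto simp: h_def[abs_def])
  define zt where "zt x = phi (x + t *\<^sub>R b)" for x
  have zt: "zt \<in> tests" unfolding zt_def by (rule test_translate[OF phi])
  obtain R where R: "0 < R" "!!x. R <= norm x ==> zt x = 0" using test_support_ball[OF zt] by metis
  obtain B where B: "0 < B" "!!x. norm (grad zt x) <= B" using test_bounded[OF zt] by metis
  define Q where "Q n x = (zt (x + h n *\<^sub>R b) - zt x) / h n" for n x
  have hne: "h n ~= 0" for n using h(1) by simp
  have "Bseq h" using h(2) by (intro convergent_imp_Bseq) (auto simp: convergent_def)
  then obtain H where H: "0 < H" "!!n. \<bar>h n\<bar> <= H" unfolding Bseq_def by auto
  have Q_bound: "\<bar>Q n x\<bar> <= B * indicator (cball 0 (R + H)) x" for n x proof (cases "norm x <= R + H")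
   case True
   have "\<bar>zt (x + h n *\<^sub>R b) - zt x\<bar> <= B * \<bar>h n\<bar>" using test_Lipschitz[OF zt B(2), of "x + h n *\<^sub>R b" x] b by simp
   then show ?thesis using True hne[of n] by (simp add: Q_def divide_le_eq)
  next
   case False
   have "norm (h n *\<^sub>R b) <= H" using H(2)[of n] b by simp
   then have "R <= norm (x + h n *\<^sub>R b)" using False norm_diff_ineq[of x "h n *\<^sub>R b"] by linarith
   moreover have "R <= norm x" using False H by linarith
   ultimately show ?thesis using R B(1) by (simp add: Q_def)
  qed
  have [measurable]: "w \<in> lmeas" by (rule loc_integrable_measurable[OF w])
  have [measurable]: "Q n \<in> lmeas" for n unfolding Q_def[abs_def]
   by (intro borel_measurable_lebesgue_continuous continuous_intros continuous_on_compose2[OF test_continuous[OF zt, of UNIV]]) (auto simp: hne)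
  have [measurable]: "(%x. frechet_derivative zt (at x) b) \<in> lmeas" by (intro borel_measurable_lebesgue_continuous test_partial[OF zt])
  have intw: "integrable lebesgue (%x. indicator (cball 0 (R + H)) x *\<^sub>R w x)" using w by (auto simp: loc_integrable_def set_integrable_def)
  have "(%n. \<integral>x. w x * Q n x \<partial>lebesgue) ----> LB (%x. w x * frechet_derivative zt (at x) b)"
  proof (rule integral_dominated_convergence[where w = "%x. B * \<bar>indicator (cball 0 (R + H)) x *\<^sub>R w x\<bar>"])
   show "integrable lebesgue (%x. B * \<bar>indicator (cball 0 (R + H)) x *\<^sub>R w x\<bar>)" using intw by (intro integrable_mult_right integrable_abs)
   show "AE x in lebesgue. (%n. w x * Q n x) ----> w x * frechet_derivative zt (at x) b" unfolding Q_def using hne h(2)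
    by (intro AE_I2 tendsto_mult tendsto_const difference_quotient_tendsto test_differentiable[OF zt])
   show "AE x in lebesgue. norm (w x * Q n x) <= B * \<bar>indicator (cball 0 (R + H)) x *\<^sub>R w x\<bar>" for n proof (rule AE_I2)
    fix x
    show "norm (w x * Q n x) <= B * \<bar>indicator (cball 0 (R + H)) x *\<^sub>R w x\<bar>"
     using mult_left_mono[OF Q_bound[of n x], of "\<bar>w x\<bar>"] by (simp add: abs_mult mult_ac)
   qed
  qed auto
  moreover have "LB (%x. w x * frechet_derivative zt (at x) b) = 0" by (rule 0[OF zt])
  moreover have "LB (%x. w x * Q n x) = (F (t + h n) - F t) / (t + h n - t)" for n proof -
   have "(%x. zt (x + h n *\<^sub>R b)) \<in> tests" by (rule test_translate[OF zt])
   note I = int[OF this] int[OF zt]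
   have "LB (%x. w x * Q n x) = LB (%x. (w x * zt (x + h n *\<^sub>R b) - w x * zt x) / h n)" by (simp add: Q_def right_diff_distrib)
   also have "... = (LB (%x. w x * zt (x + h n *\<^sub>R b)) - LB (%x. w x * zt x)) / h n" using I by simp
   also have "(%x. w x * zt (x + h n *\<^sub>R b)) = (%x. w x * phi (x + (t + h n) *\<^sub>R b))" by (simp add: zt_def algebra_simps)
   finally show ?thesis by (simp add: F_def zt_def)
  qed
  ultimately have "(%n. (F (t + h n) - F t) / (t + h n - t)) ----> 0" by simp
  then show "(%n. (F (k n) - F t) / (k n - t)) ----> 0" by (simp add: h_def)
 qed
 then have "F t = F 0" using DERIV_isconst_all[of F] by blast
 then show ?thesis by (simp add: F_def)
qed

lemma powr_add_le:
 fixes a b r B :: real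
 assumes "0 <= a" "0 <= b" "1 <= r" "r <= B"
 shows "(a + b) powr r <= 2 powr B * (a powr r + b powr r)" proof -
 have "2 * ((a + b) / 2) = a + b" by simp
 then have "(a + b) powr r = 2 powr r * ((a + b) / 2) powr r" unfolding powr_mult[symmetric] by (simp only:)
 also have "... <= 2 powr r * ((a powr r + b powr r) / 2)" using assms by (intro mult_left_mono midpoint_powr) auto
 also have "... <= 2 powr B * (a powr r + b powr r)" using assms by (intro mult_mono powr_mono) auto
 finally show ?thesis .
qed

text \<open>The integral of \<open>w\<close> against a test function does not change when the test
  function is moved to infinity along \<open>b\<close>, yet it tends to 0 there because
  \<open>\<bar>w\<bar> powr r\<close> is integrable. This is what excludes nonzero
  constants.\<close>

lemma weak_gradient_zero:
 fixes w :: "'a::euclidean_space => real" and r :: "'a => real"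
 assumes w: "loc_integrable UNIV w"
  and 0: "!!phi b. phi \<in> tests ==> b \<in> Basis ==> LB (%x. w x * frechet_derivative phi (at x) b) = 0"
  and r: "r \<in> borel_measurable borel" "!!x. 1 <= r x" "!!x. r x <= B"
  and fin: "Mda r w < top"
 shows "AE x in lebesgue. w x = 0" proof -
 note [measurable] = loc_integrable_measurable[OF w]
 have [measurable]: "r \<in> lmeas" by (rule measurable_completion) (use r(1) in simp)
 have intr: "integrable lebesgue (%x. \<bar>w x\<bar> powr r x)" using fin by (intro integrableI_nonneg) auto
 have "LB (%x. w x * phi x) = 0" if phi: "phi \<in> tests" for phi proof -
  obtain b :: 'a where b: "b \<in> Basis" using nonempty_Basis by blast
  obtain R where R: "0 < R" "!!x. R <= norm x ==> phi x = 0" using test_support_ball[OF phi] by metis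
  obtain A where A: "0 < A" "!!x. \<bar>phi x\<bar> <= A" using test_bounded[OF phi] by metis
  define K where "K n = cball (- (real n *\<^sub>R b)) R" for n
  have const: "LB (%x. w x * phi x) = LB (%x. w x * phi (x + real n *\<^sub>R b))" for n using weak_gradient_zero_translate[OF w b 0[OF _ b] phi] by simp
  have K0: "phi (x + real n *\<^sub>R b) = 0" if "x \<notin> K n" for x n
   using that R(2)[of "x + real n *\<^sub>R b"] by (auto simp: K_def dist_norm norm_minus_commute add.commute)
  have mK: "measure lebesgue (K n) = measure lebesgue (cball (0::'a) R)" for n using R by (simp add: K_def content_cball)
  define V where "V = measure lebesgue (cball (0::'a) R)"
  have [measurable]: "K n \<in> sets lebesgue" for n by (simp add: K_def)
  define T where "T n = LB (%x. \<bar>w x\<bar> powr r x * indicator (K n) x)" for n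
  have T: "T ----> 0" proof -
   have "T ----> (\<integral>x. 0 \<partial>(lebesgue :: 'a measure))" unfolding T_def proof (rule integral_dominated_convergence[OF _ _ intr])
    show "AE x in lebesgue. (%n. \<bar>w x\<bar> powr r x * indicator (K n) x) ----> 0" proof (rule AE_I2)
     fix x :: 'a
     obtain N where N: "norm x + R < real N" using reals_Archimedean2 by blast
     have "x \<notin> K n" if "N <= n" for n proof -
      have "real N <= norm (real n *\<^sub>R b)" using that b by simp
      moreover have "norm (real n *\<^sub>R b) <= norm (x + real n *\<^sub>R b) + norm x" using norm_triangle_ineq4[of "x + real n *\<^sub>R b" x] by simp
      ultimately show ?thesis using N by (simp add: K_def dist_norm norm_minus_commute add.commute)
     qed
     then have "eventually (%n. \<bar>w x\<bar> powr r x * indicator (K n) x = 0) sequentially" by (intro eventually_sequentiallyI[of N]) auto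
     then show "(%n. \<bar>w x\<bar> powr r x * indicator (K n) x) ----> 0" by (rule tendsto_eventually)
    qed
    show "AE x in lebesgue. norm (\<bar>w x\<bar> powr r x * indicator (K n) x) <= \<bar>w x\<bar> powr r x" for n by (auto simp: indicator_def)
   qed auto
   then show ?thesis by simp
  qed
  define c where "c = \<bar>\<integral>x. w x * phi x \<partial>lebesgue\<bar>"
  \<comment> \<open>On the moved ball \<open>\<bar>w\<bar>\<close> is at most \<open>eps\<close>
    plus a multiple of its power \<open>r\<close>. First \<open>n\<close> tends to infinity, which
    removes the second term, and then \<open>eps\<close> to 0.\<close>
  have c_le: "c <= A * (eps * V + eps powr (- B) * T n)" if e: "0 < eps" "eps <= 1" for eps n proof -
   have i1: "integrable lebesgue (%x. \<bar>w x\<bar> powr r x * indicator (K n) x)" by (rule integrable_real_mult_indicator[OF _ intr]) simp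
   have i2: "integrable lebesgue (indicat_real (K n))" using emeasure_bounded_finite[OF bounded_cball, of "- (real n *\<^sub>R b)" R]
    by (intro integrable_real_indicator) (auto simp: K_def)
   have "c <= LB (%x. A * (eps * indicator (K n) x + eps powr (- B) * (\<bar>w x\<bar> powr r x * indicator (K n) x)))" unfolding c_def const[of n]
   proof (rule Bochner_Integration.integral_abs_bound_integral)
    show "integrable lebesgue (%x. w x * phi (x + real n *\<^sub>R b))" using loc_integrable_test(1)[OF w test_translate[OF phi]] by simp
    show "integrable lebesgue (%x. A * (eps * indicator (K n) x + eps powr (- B) * (\<bar>w x\<bar> powr r x * indicator (K n) x)))"
     using i1 i2 by (intro integrable_mult_right integrable_add) auto
    fix x
    show "\<bar>w x * phi (x + real n *\<^sub>R b)\<bar>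
     <= A * (eps * indicator (K n) x + eps powr (- B) * (\<bar>w x\<bar> powr r x * indicator (K n) x))" proof (cases "x \<in> K n")
     case True
     have "\<bar>w x\<bar> * \<bar>phi (x + real n *\<^sub>R b)\<bar> <= (eps + eps powr (- B) * \<bar>w x\<bar> powr r x) * A"
      using le_eps_add_powr[of "\<bar>w x\<bar>" eps "r x" B] e r A by (intro mult_mono) auto
     then show ?thesis using True by (simp add: abs_mult mult.commute)
    qed (simp add: K0)
   qed
   also have "... = A * (eps * measure lebesgue (K n) + eps powr (- B) * T n)" unfolding T_def using i1 i2 by simp
   finally show ?thesis by (simp add: mK V_def)
  qed
  have c_le': "c <= A * (eps * V)" if e: "0 < eps" "eps <= 1" for eps proof (rule LIMSEQ_le_const)
   have "(%n. A * (eps * V + eps powr (- B) * T n)) ----> A * (eps * V + eps powr (- B) * 0)" by (intro tendsto_intros T)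
   then show "(%n. A * (eps * V + eps powr (- B) * T n)) ----> A * (eps * V)" by simp
   show "\<exists>N. \<forall>n\<ge>N. c <= A * (eps * V + eps powr (- B) * T n)" using c_le[OF e] by blast
  qed
  have "c <= 0" proof (rule LIMSEQ_le_const)
   have "(%n. A * (inverse (real (Suc n)) * V)) ----> A * (0 * V)" by (intro tendsto_intros LIMSEQ_inverse_real_of_nat)
   then show "(%n. A * (inverse (real (Suc n)) * V)) ----> 0" by simp
   have "c <= A * (inverse (real (Suc n)) * V)" for n by (rule c_le') (auto simp: inverse_eq_divide divide_le_eq)
   then show "\<exists>N. \<forall>n\<ge>N. c <= A * (inverse (real (Suc n)) * V)" by blast
  qed
  then show ?thesis by (simp add: c_def)
 qed
 then have "AE x in lebesgue. x \<in> UNIV --> w x = 0" by (intro fundamental_lemma[OF open_UNIV w]) (simp add: set_lebesgue_integral_def)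
 then show ?thesis by simp
qed

lemma nn_integral_Fatou_le:
 assumes [measurable]: "!!j::nat. F j \<in> borel_measurable M"
  and lim: "AE x in M. (%j. F j x) ----> f x"
  and le: "eventually (%j. (\<integral>\<^sup>+x. F j x \<partial>M) <= C) sequentially"
 shows "(\<integral>\<^sup>+x. f x \<partial>M) <= C" proof -
 have "(\<integral>\<^sup>+x. f x \<partial>M) = (\<integral>\<^sup>+x. liminf (%j. F j x) \<partial>M)"
  using lim by (intro nn_integral_cong_AE) (auto elim!: eventually_mono simp: lim_imp_Liminf)
 also have "... <= liminf (%j. \<integral>\<^sup>+x. F j x \<partial>M)" by (rule nn_integral_liminf) measurable
 also have "... <= limsup (%j. \<integral>\<^sup>+x. F j x \<partial>M)" by (rule Liminf_le_Limsup) simp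
 also have "... <= C" using le by (rule Limsup_bounded)
 finally show ?thesis .
qed

text \<open>Since \<open>t <= 1 + t powr r\<close>, a modular bounded at scale \<open>l\<close>
  controls the L1 norm on sets of finite measure, and the bound is proportional to
  \<open>l\<close>.\<close>

lemma nn_integral_le_modular:
 fixes f :: "'a::euclidean_space => 'b::{real_normed_vector, second_countable_topology}"
 assumes f[measurable]: "f \<in> lmeas" and r: "!!x. 1 <= r x" and l: "0 < l"
  and le: "LI (%x. (norm (f x) / l) powr r x) <= ennreal C" "0 <= C"
  and B[measurable]: "B \<in> sets lebesgue" and V: "emeasure lebesgue B = ennreal V" "0 <= V"
  and rm[measurable]: "r \<in> lmeas"
 shows "LN (%x. ennreal (norm (f x)) * indicator B x) <= ennreal (l * (V + C))" proof -
 have "LN (%x. ennreal (norm (f x)) * indicator B x)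
   <= LN (%x. ennreal l * (indicator B x + ennreal ((norm (f x) / l) powr r x)))" proof (rule nn_integral_mono)
  fix x
  define t where "t = norm (f x) / l"
  have "t <= 1 + t powr r x" proof (cases "t <= 1")
   case False
   then have "t powr 1 <= t powr r x" using r by (intro powr_mono) auto
   then show ?thesis using False by simp
  qed (simp add: add_increasing2)
  then have "l * t <= l * (1 + t powr r x)" using l by (intro mult_left_mono) auto
  then have "ennreal (norm (f x)) <= ennreal (l * (1 + t powr r x))" using l by (intro ennreal_leI) (simp add: t_def)
  also have "... = ennreal l * (1 + ennreal (t powr r x))" using l by (simp add: ennreal_mult flip: ennreal_1)
  finally show "ennreal (norm (f x)) * indicator B x <= ennreal l * (indicator B x + ennreal ((norm (f x) / l) powr r x))" by (cases "x \<in> B") (auto simp: t_def)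
 qed
 also have "... = ennreal l * (ennreal V + LI (%x. (norm (f x) / l) powr r x))" by (subst nn_integral_cmult, measurable, subst nn_integral_add) (auto simp: V)
 also have "... <= ennreal l * (ennreal V + ennreal C)" by (intro mult_left_mono add_left_mono le) auto
 also have "... = ennreal (l * (V + C))" using l V le by (simp add: ennreal_mult)
 finally show ?thesis .
qed

lemma emeasure_cball_finite:
 obtains V where "emeasure lebesgue (cball (c::'a::euclidean_space) R) = ennreal V" "0 <= V" proof -
 have "emeasure lebesgue (cball c R) < top" using emeasure_bounded_finite[OF bounded_cball, of c R] by simp
 then show thesis by (cases "emeasure lebesgue (cball c R)") (auto intro: that)
qed

text \<open>The Riesz--Fischer argument on each ball: geometrically bounded increments have an
  almost everywhere finite sum.\<close>

lemma AE_lim_if_summable_loc: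
 fixes psi :: "nat => 'a::euclidean_space => real"
 assumes [measurable]: "!!k. psi k \<in> lmeas"
  and le: "!!n k. LN (%x. ennreal \<bar>psi (Suc k) x - psi k x\<bar> * indicator (cball 0 (real n)) x) <= ennreal (c n * (1/2) ^ k)"
  and c: "!!n. 0 <= c n"
 shows "AE x in lebesgue. (%k. psi k x) ----> lim (%k. psi k x)" proof -
 have "AE x in lebesgue. x \<in> cball 0 (real n) --> convergent (%k. psi k x)" for n proof -
  have [measurable]: "cball (0::'a) (real n) \<in> sets lebesgue" by simp
  have "LN (%x. (\<Sum>k. ennreal \<bar>psi (Suc k) x - psi k x\<bar> * indicator (cball 0 (real n)) x))
    = (\<Sum>k. \<integral>\<^sup>+x. ennreal \<bar>psi (Suc k) x - psi k x\<bar> * indicator (cball 0 (real n)) x \<partial>lebesgue)"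
   by (rule nn_integral_suminf) measurable
  also have "... <= (\<Sum>k. ennreal (c n * (1/2) ^ k))" by (intro suminf_le le) auto
  also have "... < top" using c[of n] by (subst suminf_ennreal2) (auto intro!: summable_mult summable_geometric)
  finally have "AE x in lebesgue. (\<Sum>k. ennreal \<bar>psi (Suc k) x - psi k x\<bar> * indicator (cball 0 (real n)) x) ~= \<infinity>"
   by (intro nn_integral_PInf_AE) (auto simp: top_unique less_top)
  then show ?thesis proof eventually_elim
   case (elim x)
   show ?case proof
    assume x: "x \<in> cball 0 (real n)"
    have "summable (%k. \<bar>psi (Suc k) x - psi k x\<bar>)" using elim x by (intro summable_suminf_not_top) auto
    then have "summable (%k. psi (Suc k) x - psi k x)" by (rule summable_rabs_cancel)
    then have "convergent (%n. \<Sum>k<n. psi (Suc k) x - psi k x)" by (simp add: summable_iff_convergent)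
    then have "convergent (%n. psi n x - psi 0 x)" by (simp add: sum_lessThan_telescope[of "%k. psi k x"])
    then obtain L where "(%n. psi n x - psi 0 x) ----> L" by (auto simp: convergent_def)
    then have "(%n. psi n x - psi 0 x + psi 0 x) ----> L + psi 0 x" by (intro tendsto_intros)
    then show "convergent (%k. psi k x)" by (auto simp: convergent_def)
   qed
  qed
 qed
 then have "AE x in lebesgue. \<forall>n. x \<in> cball 0 (real n) --> convergent (%k. psi k x)" unfolding AE_all_countable by blast
 then show ?thesis proof eventually_elim
  case (elim x)
  obtain n where n: "norm x <= real n" using real_arch_simple by blast
  have "convergent (%k. psi k x)" using elim[rule_format, of n] n by simp
  then show ?case by (simp only: convergent_LIMSEQ_iff)
 qed
qed

lemma borel_lebesgue: "f \<in> borel_measurable borel ==> f \<in> lmeas" by (rule measurable_completion) simp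

lemma test_lebesgue:
 assumes "phi \<in> test_functions U"
 shows "phi \<in> lmeas" "grad phi \<in> lmeas" using test_continuous[OF assms, of UNIV] test_continuous_grad[OF assms, of UNIV]
 by (auto intro: borel_measurable_lebesgue_continuous)

lemma modular_add_le:
 fixes f g :: "'a::euclidean_space => 'b::{real_normed_vector, second_countable_topology}"
 assumes [measurable]: "f \<in> lmeas" "g \<in> lmeas" "r \<in> lmeas"
  and r: "!!x. 1 <= r x" "!!x. r x <= B"
 shows "Mod r (%x. f x + g x) <= ennreal (2 powr B) * (Mod r f + Mod r g)"
  "Mod r (%x. f x - g x) <= ennreal (2 powr B) * (Mod r f + Mod r g)" proof -
 have pt: "ennreal (t powr r x) <= ennreal (2 powr B) * (ennreal (norm (f x) powr r x) + ennreal (norm (g x) powr r x))"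
  if "0 <= t" "t <= norm (f x) + norm (g x)" for t x proof -
  have "t powr r x <= (norm (f x) + norm (g x)) powr r x" using that r(1)[of x] by (intro powr_mono2) auto
  also have "... <= 2 powr B * (norm (f x) powr r x + norm (g x) powr r x)" using r by (intro powr_add_le) auto
  finally show ?thesis by (simp add: ennreal_leI flip: ennreal_plus ennreal_mult)
 qed
 have eq: "ennreal (2 powr B) * (Mod r f + Mod r g)
  = LN (%x. ennreal (2 powr B) * (ennreal (norm (f x) powr r x) + ennreal (norm (g x) powr r x)))" by (subst nn_integral_cmult, measurable, subst nn_integral_add) auto
 show "Mod r (%x. f x + g x) <= ennreal (2 powr B) * (Mod r f + Mod r g)"
  "Mod r (%x. f x - g x) <= ennreal (2 powr B) * (Mod r f + Mod r g)" unfolding eq by (rule nn_integral_mono, rule pt, auto simp: norm_triangle_ineq norm_triangle_ineq4)+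
qed

lemma weighted_integral_bound:
 fixes f h :: "'a::euclidean_space => real"
 assumes [measurable]: "f \<in> lmeas" "h \<in> lmeas" and h: "!!x. \<bar>h x\<bar> <= B" "!!x. R < norm x ==> h x = 0"
  and L: "L1ball R f <= ennreal L" "0 <= L"
 shows "integrable lebesgue (%x. f x * h x)" "\<bar>\<integral>x. f x * h x \<partial>lebesgue\<bar> <= B * L" proof -
 have B: "0 <= B" using h(1)[of 0] by linarith
 have [measurable]: "cball (0::'a) R \<in> sets lebesgue" by simp
 have "LI (%x. norm (f x * h x)) <= LN (%x. ennreal B * (ennreal \<bar>f x\<bar> * indicator (cball 0 R) x))" proof (rule nn_integral_mono)
  fix x show "ennreal (norm (f x * h x)) <= ennreal B * (ennreal \<bar>f x\<bar> * indicator (cball 0 R) x)" using h(1)[of x] h(2)[of x] B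
   by (cases "norm x <= R") (auto simp: abs_mult mult.commute[of B] intro!: ennreal_leI mult_left_mono simp flip: ennreal_mult)
 qed
 also have "... = ennreal B * L1ball R f" by (rule nn_integral_cmult) measurable
 also have "... <= ennreal (B * L)" using L B by (simp add: ennreal_mult mult_left_mono)
 finally have le: "LI (%x. norm (f x * h x)) <= ennreal (B * L)" .
 then show i: "integrable lebesgue (%x. f x * h x)" by (intro integrableI_bounded) (auto intro: order_le_less_trans)
 show "\<bar>\<integral>x. f x * h x \<partial>lebesgue\<bar> <= B * L" using order_trans[OF integral_norm_bound_ennreal[OF i] le] B L by simp
qed

lemma modular_scale_le:
 fixes f :: "'a::euclidean_space => 'b::{real_normed_vector, second_countable_topology}"
 assumes [measurable]: "f \<in> lmeas" "r \<in> lmeas" and r: "!!x. 1 <= r x" "!!x. r x <= B" and l: "0 < l"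
 shows "Mod r f <= ennreal (max 1 l powr B) * LI (%x. (norm (f x) / l) powr r x)" proof -
 have "Mod r f <= LN (%x. ennreal (max 1 l powr B) * ennreal ((norm (f x) / l) powr r x))" proof (rule nn_integral_mono)
  fix x
  have "norm (f x) powr r x = l powr r x * (norm (f x) / l) powr r x" using l by (simp flip: powr_mult)
  also have "l powr r x <= max 1 l powr r x" using l r(1)[of x] by (intro powr_mono2) auto
  also have "... <= max 1 l powr B" using r by (intro powr_mono) auto
  finally show "ennreal (norm (f x) powr r x) <= ennreal (max 1 l powr B) * ennreal ((norm (f x) / l) powr r x)"
   by (simp add: mult_right_mono ennreal_leI flip: ennreal_mult)
 qed
 also have "... = ennreal (max 1 l powr B) * LI (%x. (norm (f x) / l) powr r x)" by (rule nn_integral_cmult) measurable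
 finally show ?thesis .
qed

lemma test_modular_finite:
 assumes phi: "phi \<in> test_functions U" and r: "!!x. 1 <= r x" "!!x. r x <= B"
 shows "Mod r phi < top" "Mod r (grad phi) < top" proof -
 obtain A where A: "0 < A" "!!x. \<bar>phi x\<bar> <= A" "!!x. norm (grad phi x) <= A" using test_bounded[OF phi] by metis
 obtain R where R: "!!x. R <= norm x ==> phi x = 0" "!!x. R <= norm x ==> grad phi x = 0" using test_support_ball[OF phi] by metis
 have "s powr r x <= max 1 A powr B" if "0 <= s" "s <= A" for s x proof -
  have "s powr r x <= max 1 A powr r x" using that r(1)[of x] by (intro powr_mono2) auto
  also have "... <= max 1 A powr B" using r by (intro powr_mono) auto
  finally show ?thesis .
 qed
 then show "Mod r phi < top" "Mod r (grad phi) < top" unfolding nn_integral_completion using A R by (intro nn_integral_bounded_support[of _ "max 1 A powr B" R]; simp)+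
qed

section \<open>The Sobolev inequality on the homogeneous space\<close>

context exponents
begin

lemma lebesgue_exponents[measurable]:
 "p \<in> lmeas" "q \<in> lmeas" "ps \<in> lmeas" by (auto intro: borel_lebesgue borel_p borel_q borel_ps)

lemma D1_D:
 assumes "u \<in> D1 p"
 shows "has_weak_gradient UNIV u (wgr u)" "u \<in> lmeas"
  "wgr u \<in> lmeas"
  "Mod p (wgr u) < top"
  "Mda ps u < top" using assms has_weak_gradient_wgrad[of u UNIV] by (auto simp: D1_def Lvar_def modular_UNIV lebesgue_on_UNIV_eq)

lemma D1_grad_approx:
 assumes u: "u \<in> D1 p" and d: "0 < dl"
 obtains phi where "phi \<in> tests"
  "LI (%x. (norm (wgr u x - grad phi x) / dl) powr p x) <= 1" proof -
 obtain phi where phi: "phi \<in> tests" "Dnorm p (%x. u x - phi x) < ennreal dl" using u d by (auto simp: D1_def)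
 have "has_weak_gradient UNIV (%x. u x - phi x) (%x. wgr u x - grad phi x)"
  using has_weak_gradient_lin[OF D1_D(1)[OF u] has_weak_gradient_test_function[OF phi(1), of UNIV], of 1 "-1"] by simp
 from wgrad_AE_eq[OF open_UNIV this]
 have eq: "AE x in lebesgue. wgr (%x. u x - phi x) x = wgr u x - grad phi x" by simp
 have "modular p UNIV (%x. wgr (%x. u x - phi x) x /\<^sub>R dl) <= 1"
  using phi(2) p_gt_1 unfolding Dnorm_def by (intro modular_le_1_if_Lnorm_less) (auto simp: less_imp_le[OF less_trans[OF zero_less_one]])
 also have "modular p UNIV (%x. wgr (%x. u x - phi x) x /\<^sub>R dl)
  = LI (%x. (norm (wgr u x - grad phi x) / dl) powr p x)" unfolding modular_UNIV using eq d
  by (intro nn_integral_cong_AE) (auto elim!: eventually_mono simp: divide_inverse_commute)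
 finally show thesis using phi that by blast
qed

lemma sobolev_ps_scaled:
 assumes C: "!!phi. phi \<in> tests ==>
  BI (%x. norm (grad phi x) powr p x) <= 1 ==>
  BI (%x. \<bar>phi x\<bar> powr ps x) <= ennreal C"
  and phi: "phi \<in> tests" and l: "0 < l"
  and le: "LI (%x. (norm (grad phi x) / l) powr p x) <= 1"
 shows "LI (%x. (\<bar>phi x\<bar> / l) powr ps x) <= ennreal C" proof -
 have t: "(%x. inverse l * phi x) \<in> tests" by (rule test_cmult[OF phi])
 have g: "grad (%x. inverse l * phi x) x = inverse l *\<^sub>R grad phi x" for x by (rule grad_cmult[OF test_differentiable[OF phi]])
 have "BI (%x. \<bar>inverse l * phi x\<bar> powr ps x) <= ennreal C" using le l by (intro C[OF t]) (simp add: g nn_integral_completion divide_inverse_commute)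
 then show ?thesis using l by (simp add: nn_integral_completion abs_mult divide_inverse_commute)
qed

text \<open>Only the gradients of the approximating test functions \<open>psi k\<close> are known to
  converge. The inequality for test functions makes \<open>psi k\<close> converge to some
  \<open>v\<close> with the desired bound. The difference \<open>w = u - v\<close> has weak gradient
  0 and finite \<open>ps\<close>-modular, so it vanishes by \<open>weak_gradient_zero\<close>, and
  the bound for \<open>v\<close> is one for \<open>u\<close>.\<close>

lemma D1_sobolev:
 obtains C where "0 < C" "!!u phi dl. u \<in> D1 p ==> phi \<in> tests ==> 0 < dl ==>
  LI (%x. (norm (wgr u x - grad phi x) / dl) powr p x) <= 1 ==>
  LI (%x. (\<bar>u x - phi x\<bar> / (2 * dl)) powr ps x) <= ennreal C" proof -
 obtain C where C: "0 < C" "!!phi. phi \<in> tests ==>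
  BI (%x. norm (grad phi x) powr p x) <= 1 ==> BI (%x. \<bar>phi x\<bar> powr ps x) <= ennreal C" using sobolev_ps by blast
 have "LI (%x. (\<bar>u x - phi x\<bar> / (2 * dl)) powr ps x) <= ennreal C"
  if u: "u \<in> D1 p" and phi: "phi \<in> tests" and d: "0 < dl"
   and le: "LI (%x. (norm (wgr u x - grad phi x) / dl) powr p x) <= 1" for u phi dl proof -
  note [measurable] = D1_D(2,3)[OF u]
  define dlk where "dlk k = dl * (1/2) ^ k" for k
  have dk: "0 < dlk k" for k using d by (simp add: dlk_def)
  have "\<exists>phi. phi \<in> tests & LI (%x. (norm (wgr u x - grad phi x) / dlk k) powr p x) <= 1" for k using D1_grad_approx[OF u dk[of k]] by metis
  then obtain phi' where phi': "!!k. phi' k \<in> tests"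
   "!!k. LI (%x. (norm (wgr u x - grad (phi' k) x) / dlk k) powr p x) <= 1" by metis
  \<comment> \<open>The sequence starts with the given \<open>phi\<close>, so that the estimate at
    \<open>k = 0\<close> is the claim.\<close>
  define psi where "psi k = (if k = 0 then phi else phi' k)" for k
  define H where "H k x = wgr u x - grad (psi k) x" for k x
  have psi: "psi k \<in> tests" "LI (%x. (norm (H k x) / dlk k) powr p x) <= 1" for k using phi' phi le by (auto simp: psi_def dlk_def H_def)
  note [measurable] = test_lebesgue[OF psi(1)]
  have H_meas[measurable]: "H k \<in> lmeas" for k unfolding H_def[abs_def] by measurable
  \<comment> \<open>The doubled scale turns the sum of two gradient errors into their mean, and by
    convexity the modular of the mean is at most 1. This is the origin of the factor 2 in the
    statement.\<close>
  have diff: "LI (%x. (\<bar>psi k x - psi j x\<bar> / (2 * dlk k)) powr ps x) <= ennreal C" if kj: "k <= j" for k j proof (rule sobolev_ps_scaled[OF C(2)])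
   show "(%x. psi k x - psi j x) \<in> tests" by (intro test_diff psi)
   have "LI (%x. (norm (grad (%x. psi k x - psi j x) x) / (2 * dlk k)) powr p x)
    <= LN (%x. ennreal (1/2) * (ennreal ((norm (H k x) / dlk k) powr p x) + ennreal ((norm (H j x) / dlk j) powr p x)))" proof (rule nn_integral_mono)
    fix x
    define a b where "a = norm (H k x) / dlk k" and "b = norm (H j x) / dlk j"
    have "dlk j <= dlk k" using kj d by (auto simp: dlk_def intro!: mult_left_mono power_decreasing)
    then have b: "norm (H j x) / dlk k <= b" unfolding b_def using dk by (intro divide_left_mono) (auto intro: mult_pos_pos)
    have "grad (%x. psi k x - psi j x) x = H j x - H k x" by (simp add: H_def grad_diff test_differentiable[OF psi(1)])
    then have "norm (grad (%x. psi k x - psi j x) x) / (2 * dlk k) <= (norm (H j x) + norm (H k x)) / (2 * dlk k)"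
     using norm_triangle_ineq4[of "H j x" "H k x"] dk[of k] by (intro divide_right_mono) auto
    also have "... = (norm (H j x) / dlk k + a) / 2" by (simp add: add_divide_distrib a_def)
    finally have "(norm (grad (%x. psi k x - psi j x) x) / (2 * dlk k)) powr p x <= ((a + b) / 2) powr p x" using b p_gt_1[of x] dk[of k] by (intro powr_mono2) auto
    also have "... <= (a powr p x + b powr p x) / 2" using p_gt_1[of x] dk by (intro midpoint_powr) (auto simp: a_def b_def less_imp_le)
    finally show "ennreal ((norm (grad (%x. psi k x - psi j x) x) / (2 * dlk k)) powr p x)
     <= ennreal (1/2) * (ennreal ((norm (H k x) / dlk k) powr p x) + ennreal ((norm (H j x) / dlk j) powr p x))" unfolding a_def[symmetric] b_def[symmetric]
     by (subst ennreal_plus[symmetric], simp, simp, subst ennreal_mult[symmetric]) (auto intro!: ennreal_leI)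
   qed
   also have "... = ennreal (1/2) * (LI (%x. (norm (H k x) / dlk k) powr p x) + LI (%x. (norm (H j x) / dlk j) powr p x))"
    by (subst nn_integral_cmult, measurable, subst nn_integral_add) auto
   also have "... <= ennreal (1/2) * (1 + 1)" by (intro mult_left_mono add_mono psi(2)) auto
   also have "ennreal (1/2) * (1 + 1) = ennreal (1/2) * ennreal 2" by simp
   also have "... = 1" by (subst ennreal_mult[symmetric]) auto
   finally show "LI (%x. (norm (grad (%x. psi k x - psi j x) x) / (2 * dlk k)) powr p x) <= 1" .
  qed (use dk in auto)
  have "\<exists>V. emeasure lebesgue (cball (0::'a) (real n)) = ennreal V & 0 <= V" for n using emeasure_cball_finite[of "0::'a" "real n"] by metis
  then obtain V where V: "!!n. emeasure lebesgue (cball (0::'a) (real n)) = ennreal (V n)" "!!n. 0 <= V n" by metis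
  define v where "v x = lim (%k. psi k x)" for x
  have [measurable]: "v \<in> lmeas" unfolding v_def[abs_def] by (rule borel_measurable_lim_metric) measurable
  have ps1: "1 <= ps x" for x using ps_gt_1[of x] by simp
  have v_lim: "AE x in lebesgue. (%k. psi k x) ----> v x" unfolding v_def proof (rule AE_lim_if_summable_loc[where c = "%n. 2 * dl * (V n + C)"])
   show "L1ball (real n) (%x. psi (Suc k) x - psi k x) <= ennreal (2 * dl * (V n + C) * (1/2) ^ k)" for n k proof -
    have "2 * dlk k * (V n + C) = 2 * dl * (V n + C) * (1/2) ^ k" by (simp add: dlk_def)
    moreover have "L1ball (real n) (%x. psi k x - psi (Suc k) x) <= ennreal (2 * dlk k * (V n + C))"
     using nn_integral_le_modular[OF _ ps1 _ diff[of k "Suc k", folded real_norm_def] _ _ V, of n] dk[of k] C(1) by simp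
    ultimately show ?thesis by (simp only: abs_minus_commute)
   qed
   show "0 <= 2 * dl * (V n + C)" for n using d V(2)[of n] C(1) by simp
  qed measurable
  have diff_v: "LI (%x. (\<bar>psi k x - v x\<bar> / (2 * dlk k)) powr ps x) <= ennreal C" for k proof (rule nn_integral_Fatou_le)
   show "eventually (%j. LI (%x. (\<bar>psi k x - psi j x\<bar> / (2 * dlk k)) powr ps x) <= ennreal C) sequentially" using diff by (intro eventually_sequentiallyI[of k])
   show "AE x in lebesgue. (%j. ennreal ((\<bar>psi k x - psi j x\<bar> / (2 * dlk k)) powr ps x))
     ----> ennreal ((\<bar>psi k x - v x\<bar> / (2 * dlk k)) powr ps x)" using v_lim proof eventually_elim
    case (elim x)
    show ?case using elim ps_gt_1[of x] dk[of k] by (intro tendsto_ennrealI tendsto_powr' tendsto_intros) (auto intro!: always_eventually)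
   qed
  qed measurable
  define w where "w x = u x - v x" for x
  have ball_v: "L1ball (real n) (%x. psi k x - v x) <= ennreal (2 * dlk k * (V n + C))" for n k
   using nn_integral_le_modular[OF _ ps1 _ diff_v[of k, folded real_norm_def] _ _ V, of n] dk[of k] C(1) by simp
  have ball_H: "LN (%x. ennreal (norm (H k x)) * indicator (cball 0 (real n)) x) <= ennreal (dlk k * (V n + 1))" for n k
   using nn_integral_le_modular[of "H k" p "dlk k" 1, OF _ _ _ _ _ _ V, of n] psi(2)[of k] dk[of k] ge1 by simp
  have loc_v: "loc_integrable UNIV (%x. psi 0 x - v x)" unfolding loc_integrable_def proof safe
   fix K :: "'a set" assume K: "compact K"
   then obtain b where b: "\<forall>x\<in>K. norm x <= b" using compact_imp_bounded[OF K] bounded_iff by blast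
   obtain n where "b <= real n" using real_arch_simple by blast
   then have n: "indicator K x = (0::real)" if "real n < norm x" for x using that b by (force simp: indicator_def)
   have [measurable]: "indicat_real K \<in> lmeas" using K by (intro borel_measurable_indicator) (simp add: borel_compact)
   have "integrable lebesgue (%x. (psi 0 x - v x) * indicator K x)" proof (rule weighted_integral_bound(1))
    show "\<bar>indicat_real K x\<bar> <= 1" "real n < norm x ==> indicat_real K x = 0" for x using n by (auto simp: indicator_def)
    show "L1ball (real n) (%x. psi 0 x - v x) <= ennreal (2 * dlk 0 * (V n + C))" by (rule ball_v)
   qed (use dk[of 0] V(2)[of n] C(1) in auto)
   then show "set_integrable lebesgue K (%x. psi 0 x - v x)" by (simp add: set_integrable_def mult.commute)
  qed
  have loc_u: "loc_integrable UNIV u" using D1_D(1)[OF u] by (simp add: has_weak_gradient_def)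
  have loc_uv: "loc_integrable UNIV (%x. u x - psi k x)" for k
   using loc_integrable_lin[OF loc_u loc_integrable_continuous[OF test_continuous[OF psi(1)[of k]]], of 1 "-1"] by simp
  have loc_w: "loc_integrable UNIV w" using loc_integrable_lin[OF loc_uv[of 0] loc_v, of 1 1] by (simp add: w_def[abs_def])
  have w0: "LB (%x. w x * frechet_derivative eta (at x) b) = 0"
   if eta: "eta \<in> tests" and b: "b \<in> Basis" for eta b proof -
   obtain R where R: "0 < R" "!!x. R <= norm x ==> eta x = 0" "!!x. R <= norm x ==> grad eta x = 0" using test_support_ball[OF eta] by metis
   obtain n where n: "R <= real n" using real_arch_simple by blast
   obtain A where A: "0 < A" "!!x. \<bar>eta x\<bar> <= A" "!!x. norm (grad eta x) <= A" using test_bounded[OF eta] by metis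
   note [measurable] = test_lebesgue[OF eta]
   let ?D = "%x. grad eta x \<bullet> b"
   have D: "frechet_derivative eta (at x) b = ?D x" for x by (rule frechet_derivative_eq_grad[OF test_differentiable[OF eta]])
   have DA: "\<bar>?D x\<bar> <= A" for x using Basis_le_norm[OF b, of "grad eta x"] A(3)[of x] by linarith
   have D0: "?D x = 0" "eta x = 0" if "real n < norm x" for x using that n R(2,3)[of x] by auto
   \<comment> \<open>Here \<open>w\<close> is split as \<open>(u - psi k) + (psi k - v)\<close>. The
     first part has weak gradient \<open>H k\<close>, and both \<open>H k\<close> and the second
     part are of order \<open>dlk k\<close> in L1 on the ball, so the bound tends to 0.\<close>
   have bound: "\<bar>\<integral>x. w x * ?D x \<partial>lebesgue\<bar> <= A * (dlk k * (V n + 1)) + A * (2 * dlk k * (V n + C))" for k proof -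
    have i2: "integrable lebesgue (%x. (u x - psi k x) * ?D x)" using loc_integrable_test(2)[OF loc_uv[of k] eta, of b] by (simp add: D)
    have "has_weak_gradient UNIV (%x. u x - psi k x) (H k)"
     using has_weak_gradient_lin[OF D1_D(1)[OF u] has_weak_gradient_test_function[OF psi(1)[of k], of UNIV], of 1 "-1"] by (simp add: H_def[abs_def])
    then have eq: "LB (%x. (u x - psi k x) * ?D x) = - LB (%x. (H k x \<bullet> b) * eta x)"
     using eta b unfolding D[symmetric] by (auto simp: has_weak_gradient_def set_lebesgue_integral_def)
    have "L1ball (real n) (%x. H k x \<bullet> b) <= ennreal (dlk k * (V n + 1))"
     by (rule order_trans[OF nn_integral_mono ball_H]) (auto simp: Basis_le_norm[OF b] intro!: mult_right_mono ennreal_leI)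
    then have e1: "\<bar>\<integral>x. (H k x \<bullet> b) * eta x \<partial>lebesgue\<bar> <= A * (dlk k * (V n + 1))"
     using A(2) D0(2) dk[of k] V(2)[of n] by (intro weighted_integral_bound(2)) auto
    have e2: "integrable lebesgue (%x. (psi k x - v x) * ?D x)"
     "\<bar>\<integral>x. (psi k x - v x) * ?D x \<partial>lebesgue\<bar> <= A * (2 * dlk k * (V n + C))"
     using weighted_integral_bound[of "%x. psi k x - v x" ?D, OF _ _ DA D0(1) ball_v] dk[of k] V(2)[of n] C(1) by simp_all
    have "LB (%x. w x * ?D x) = LB (%x. (u x - psi k x) * ?D x + (psi k x - v x) * ?D x)" by (intro Bochner_Integration.integral_cong) (auto simp: w_def algebra_simps)
    also have "... = - LB (%x. (H k x \<bullet> b) * eta x) + LB (%x. (psi k x - v x) * ?D x)" using e2(1) i2 eq by simp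
    finally show ?thesis using e1 e2(2) by linarith
   qed
   have "dlk ----> dl * 0" unfolding dlk_def by (intro tendsto_intros LIMSEQ_realpow_zero) auto
   then have "(%k. A * (dlk k * (V n + 1)) + A * (2 * dlk k * (V n + C))) ----> A * (0 * (V n + 1)) + A * (2 * 0 * (V n + C))" by (intro tendsto_intros) auto
   then have "\<bar>\<integral>x. w x * ?D x \<partial>lebesgue\<bar> <= A * (0 * (V n + 1)) + A * (2 * 0 * (V n + C))" using bound by (intro LIMSEQ_le_const) auto
   then show ?thesis by (simp add: D)
  qed
  have fin: "Mda ps w < top" proof -
   note [measurable] = test_lebesgue(1)[OF phi]
   have w: "w = (%x. (u x - phi x) + (psi 0 x - v x))" by (auto simp: w_def psi_def)
   have "Mod ps w <= ennreal (2 powr psp) * (Mod ps (%x. u x - phi x) + Mod ps (%x. psi 0 x - v x))"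
    unfolding w by (rule modular_add_le(1)[OF _ _ _ ps1 ps_le]) measurable
   also have "... <= ennreal (2 powr psp) * (ennreal (2 powr psp) * (Mod ps u + Mod ps phi)
     + ennreal (max 1 (2 * dlk 0) powr psp) * ennreal C)" using dk[of 0] by (intro mult_left_mono add_mono modular_add_le(2)[OF _ _ _ ps1 ps_le]
      order_trans[OF modular_scale_le[where l = "2 * dlk 0", OF _ _ ps1 ps_le] mult_left_mono[OF diff_v[of 0, folded real_norm_def]]]) auto
   also have "... < top" using D1_D(5)[OF u] test_modular_finite(1)[OF phi ps1 ps_le] by (simp add: ennreal_mult_less_top flip: ennreal_mult)
   finally show ?thesis by simp
  qed
  have "AE x in lebesgue. w x = 0" using loc_w w0 borel_ps ps1 ps_le fin by (rule weak_gradient_zero)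
  then have "LI (%x. (\<bar>u x - phi x\<bar> / (2 * dl)) powr ps x)
    = LI (%x. (\<bar>psi 0 x - v x\<bar> / (2 * dlk 0)) powr ps x)"
   by (intro nn_integral_cong_AE) (auto elim!: eventually_mono simp: w_def psi_def dlk_def abs_minus_commute)
  also have "... <= ennreal C" by (rule diff_v)
  finally show ?thesis .
 qed
 then show thesis using C(1) that by blast
qed

end

lemma powr_div_le:
 fixes t l r :: real
 assumes "0 <= t" "0 < l" "l <= 1" "1 <= r"
 shows "t powr r <= l * (t / l) powr r" proof -
 have "t powr r = l powr r * (t / l) powr r" unfolding powr_mult[symmetric] using assms by simp
 also have "... <= l * (t / l) powr r" using assms powr_mono'[of 1 r l] by (intro mult_right_mono) auto
 finally show ?thesis .
qed

lemma nn_integral_powr_scale: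
 fixes f :: "'a::euclidean_space => 'b::{real_normed_vector, second_countable_topology}"
 assumes [measurable]: "f \<in> lmeas" "r \<in> lmeas"
  and "!!x. 1 <= r x" "0 < l" "l <= 1"
  and le: "LI (%x. (norm (f x) / l) powr r x) <= ennreal C" and "0 <= C"
 shows "Mod r f <= ennreal (l * C)" proof -
 have "Mod r f
  <= LN (%x. ennreal l * ennreal ((norm (f x) / l) powr r x))"
  using assms by (intro nn_integral_mono) (auto simp: ennreal_mult[symmetric] intro!: ennreal_leI powr_div_le)
 also have "... = ennreal l * LI (%x. (norm (f x) / l) powr r x)" by (rule nn_integral_cmult) measurable
 also have "... <= ennreal l * ennreal C" by (intro mult_left_mono le) auto
 finally show ?thesis using assms by (simp add: ennreal_mult)
qed

context exponents
begin

text \<open>The bound is not proportional to \<open>C\<close>, since \<open>decay\<close>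
  contributes a constant. Smallness is obtained later by rescaling, with
  \<open>nn_integral_powr_scale\<close>.\<close>

lemma sobolev_q_of_ps:
 assumes "0 <= C"
 obtains C' where "0 < C'" "!!t. t \<in> lmeas ==> (!!x. 0 <= t x) ==>
  LI (%x. t x powr ps x) <= ennreal C ==>
  LI (%x. t x powr q x) <= ennreal C'" proof -
 obtain E where E: "0 <= E" "!!t y. 0 <= t ==> t powr q y <= E * t powr ps y + decay y" using powr_q_le by metis
 define dec where "dec = enn2real (BI (%y. decay (y::'a)))"
 have dec: "BI (%y. decay (y::'a)) = ennreal dec" "0 <= dec" using nn_integral_decay[where 'a='a] by (auto simp: dec_def)
 have dec': "LI (%y. decay (y::'a)) = ennreal dec" by (simp add: nn_integral_completion dec)
 have [measurable]: "(decay :: 'a => real) \<in> lmeas" unfolding decay_def[abs_def] by (intro borel_lebesgue) measurable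
 have "LI (%x. t x powr q x) <= ennreal (E * C + dec + 1)"
  if t[measurable]: "t \<in> lmeas" and t0: "!!x. 0 <= t x"
   and le: "LI (%x. t x powr ps x) <= ennreal C" for t proof -
  have "LI (%x. t x powr q x)
    <= LN (%x. ennreal E * ennreal (t x powr ps x) + ennreal (decay x))" proof (rule nn_integral_mono)
   fix x
   have "ennreal (t x powr q x) <= ennreal (E * t x powr ps x + decay x)" using E(2)[OF t0] by (rule ennreal_leI)
   then show "ennreal (t x powr q x) <= ennreal E * ennreal (t x powr ps x) + ennreal (decay x)" using E(1) decay_nonneg[of x] by (simp add: ennreal_mult)
  qed
  also have "... = ennreal E * LI (%x. t x powr ps x) + ennreal dec" by (subst nn_integral_add) (auto simp: nn_integral_cmult dec')
  also have "... <= ennreal E * ennreal C + ennreal dec" by (intro add_right_mono mult_left_mono le) auto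
  also have "... <= ennreal (E * C + dec + 1)" using E dec assms by (simp add: ennreal_mult[symmetric] ennreal_plus[symmetric] ennreal_leI del: ennreal_plus)
  finally show ?thesis .
 qed
 moreover have "0 < E * C + dec + 1" using E dec assms by (simp add: add_nonneg_pos)
 ultimately show thesis using that by blast
qed

lemma D1_sobolev_zero:
 obtains C where "0 < C" "!!u dl. u \<in> D1 p ==> 0 < dl ==>
  LI (%x. (norm (wgr u x) / dl) powr p x) <= 1 ==>
  LI (%x. (\<bar>u x\<bar> / (2 * dl)) powr ps x) <= ennreal C" proof -
 obtain C where C: "0 < C" "!!u phi dl. u \<in> D1 p ==> phi \<in> tests ==> 0 < dl ==>
  LI (%x. (norm (wgr u x - grad phi x) / dl) powr p x) <= 1 ==>
  LI (%x. (\<bar>u x - phi x\<bar> / (2 * dl)) powr ps x) <= ennreal C" using D1_sobolev by blast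
 show thesis using C(1) C(2)[OF _ test_zero] that[of C] by (simp add: grad_const)
qed

text \<open>At scale \<open>dl\<close> or \<open>2 * dl\<close> the modulars are bounded by fixed
  constants; returning to scale 1 multiplies them by at most that scale, because all exponents are
  at least 1. So \<open>dl\<close> only has to be small against these constants.\<close>

lemma D1_approx:
 assumes u: "u \<in> D1 p" and e: "0 < eps"
 obtains phi where "phi \<in> tests"
  "LI (%x. norm (wgr u x - grad phi x) powr p x) <= ennreal eps"
  "LI (%x. \<bar>u x - phi x\<bar> powr ps x) <= ennreal eps"
  "LI (%x. \<bar>u x - phi x\<bar> powr q x) <= ennreal eps" proof -
 obtain C where C: "0 < C" "!!u phi dl. u \<in> D1 p ==> phi \<in> tests ==> 0 < dl ==>
  LI (%x. (norm (wgr u x - grad phi x) / dl) powr p x) <= 1 ==>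
  LI (%x. (\<bar>u x - phi x\<bar> / (2 * dl)) powr ps x) <= ennreal C" using D1_sobolev by blast
 obtain C' where C': "0 < C'" "!!t. t \<in> lmeas ==> (!!x. 0 <= t x) ==>
  LI (%x. t x powr ps x) <= ennreal C ==>
  LI (%x. t x powr q x) <= ennreal C'" by (rule sobolev_q_of_ps[OF less_imp_le[OF C(1)]]) blast
 define dl where "dl = min (1/2) (min eps (min (eps / (2 * C)) (eps / (2 * C'))))"
 have d: "0 < dl" "dl <= eps" "dl <= 1/2" "dl <= eps / (2 * C)" "dl <= eps / (2 * C')" using e C(1) C'(1) by (auto simp: dl_def min_le_iff_disj)
 then have d': "2 * dl * C <= eps" "2 * dl * C' <= eps" using C(1) C'(1) by (auto simp: field_simps)
 obtain phi where phi: "phi \<in> tests"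
  "LI (%x. (norm (wgr u x - grad phi x) / dl) powr p x) <= 1" using D1_grad_approx[OF u d(1)] by metis
 note [measurable] = D1_D(2,3)[OF u] test_lebesgue[OF phi(1)]
 have ps: "LI (%x. (\<bar>u x - phi x\<bar> / (2 * dl)) powr ps x) <= ennreal C" by (rule C(2)[OF u phi(1) d(1) phi(2)])
 have q: "LI (%x. (\<bar>u x - phi x\<bar> / (2 * dl)) powr q x) <= ennreal C'" using d(1) by (intro C'(2) ps) auto
 show thesis proof (rule that[OF phi(1)])
  have "LI (%x. norm (wgr u x - grad phi x) powr p x) <= ennreal (dl * 1)" using d ge1 phi(2) by (intro nn_integral_powr_scale) auto
  also have "... <= ennreal eps" using d by (intro ennreal_leI) simp
  finally show "LI (%x. norm (wgr u x - grad phi x) powr p x) <= ennreal eps" .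
  have "LI (%x. norm (u x - phi x) powr ps x) <= ennreal (2 * dl * C)" using d ps_gt_1 ps C(1) by (intro nn_integral_powr_scale) (auto simp: less_imp_le)
  also have "... <= ennreal eps" using d' by (intro ennreal_leI)
  finally show "LI (%x. \<bar>u x - phi x\<bar> powr ps x) <= ennreal eps" by simp
  have "LI (%x. norm (u x - phi x) powr q x) <= ennreal (2 * dl * C')" using d q_ge_1 q C'(1) by (intro nn_integral_powr_scale) auto
  also have "... <= ennreal eps" using d' by (intro ennreal_leI)
  finally show "LI (%x. \<bar>u x - phi x\<bar> powr q x) <= ennreal eps" by simp
 qed
qed

text \<open>The claim for every \<open>s\<close> above the norm leaves open whether the infimum is
  attained; \<open>dual_boundI\<close> lets \<open>s\<close> decrease to the norm.\<close>

lemma Dnorm_eq: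
 assumes u: "u \<in> D1 p"
 obtains d where "Dnorm p u = ennreal d" "0 <= d"
  "!!s. d < s ==> LI (%x. (norm (wgr u x) / s) powr p x) <= 1" proof -
 have scale: "modular p UNIV (%x. wgr u x /\<^sub>R s) = LI (%x. (norm (wgr u x) / s) powr p x)"
  if "0 < s" for s using that by (simp add: modular_UNIV divide_inverse_commute)
 define M where "M = enn2real (Mod p (wgr u))"
 have M: "Mod p (wgr u) = ennreal M" "0 <= M" using D1_D(4)[OF u] by (auto simp: M_def)
 define s where "s = max 1 M"
 have s1: "1 <= s" by (simp add: s_def)
 note [measurable] = D1_D(3)[OF u]
 have "LI (%x. (norm (wgr u x) / s) powr p x) <= ennreal (1 / s * M)" proof -
  have "LI (%x. norm (wgr u x /\<^sub>R s) powr p x) <= ennreal (1 / s * M)" proof (rule nn_integral_powr_scale)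
   have "norm (wgr u x /\<^sub>R s) / (1 / s) = norm (wgr u x)" for x using s1 by (simp add: divide_inverse)
   then show "LI (%x. (norm (wgr u x /\<^sub>R s) / (1 / s)) powr p x) <= ennreal M" using M(1) by (simp only:)
  qed (use s1 M ge1 in auto)
  moreover have "norm (wgr u x /\<^sub>R s) = norm (wgr u x) / s" for x using s1 by (simp add: divide_inverse_commute)
  ultimately show ?thesis by (simp only:)
 qed
 also have "... <= 1" using M(2) by (simp add: s_def divide_le_eq)
 finally have "Dnorm p u <= ennreal s" unfolding Dnorm_def by (intro Lnorm_le) (auto simp: scale s_def)
 then obtain d where d: "Dnorm p u = ennreal d" "0 <= d" by (cases "Dnorm p u") (auto simp: top_unique)
 show thesis proof (rule that[OF d])
  fix t assume t: "d < t"
  then have "modular p UNIV (%x. wgr u x /\<^sub>R t) <= 1" using d p_gt_1 unfolding Dnorm_def[symmetric]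
   by (intro modular_le_1_if_Lnorm_less) (auto simp: Dnorm_def[symmetric] ennreal_less_iff less_imp_le[OF less_trans[OF zero_less_one]])
  then show "LI (%x. (norm (wgr u x) / t) powr p x) <= 1" using t d by (simp add: scale)
 qed
qed

lemma dual_boundI:
 assumes u: "u \<in> D1 p" and C: "0 <= C"
  and le: "!!s. 0 < s ==> LI (%x. (norm (wgr u x) / s) powr p x) <= 1 ==> \<bar>l\<bar> <= C * s"
 shows "ennreal \<bar>l\<bar> <= ennreal C * Dnorm p u" proof -
 obtain d where d: "Dnorm p u = ennreal d" "0 <= d"
  "!!s. d < s ==> LI (%x. (norm (wgr u x) / s) powr p x) <= 1" using Dnorm_eq[OF u] by metis
 have "\<bar>l\<bar> <= C * (d + inverse (real (Suc n)))" for n using d by (intro le d(3)) (auto simp: add_nonneg_pos)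
 moreover have "(%n. C * (d + inverse (real (Suc n)))) ----> C * (d + 0)" by (intro tendsto_intros LIMSEQ_inverse_real_of_nat)
 ultimately have "\<bar>l\<bar> <= C * (d + 0)" by (intro LIMSEQ_le_const) auto
 then show ?thesis unfolding d(1) using C d(2) by (simp add: ennreal_mult[symmetric] ennreal_leI)
qed

lemma D1_lin:
 assumes "u \<in> D1 p" "v \<in> D1 p"
 shows "AE x in lebesgue. wgr (%x. a * u x + b * v x) x = a *\<^sub>R wgr u x + b *\<^sub>R wgr v x"
 using wgrad_AE_eq[OF open_UNIV has_weak_gradient_lin[OF D1_D(1)[OF assms(1)] D1_D(1)[OF assms(2)]], of a b] by simp

lemma Young_norm:
 fixes h g :: "'b::real_inner"
 assumes "0 < s" "1 < r"
 shows "\<bar>h \<bullet> g\<bar> <= s * (norm h powr (r / (r - 1)) + (norm g / s) powr r)" proof -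
 have "\<bar>h \<bullet> g\<bar> <= norm h * norm g" by (rule Cauchy_Schwarz_ineq2)
 also have "... = s * (norm h * (norm g / s))" using assms by simp
 also have "norm h * (norm g / s) <= norm h powr (r / (r - 1)) / (r / (r - 1)) + (norm g / s) powr r / r"
  using assms by (intro Youngs_inequality) (auto simp: field_simps)
 also have "... <= norm h powr (r / (r - 1)) / 1 + (norm g / s) powr r / 1" using assms by (intro add_mono divide_left_mono) (auto simp: field_simps)
 finally show ?thesis using assms by (simp add: mult_left_mono)
qed

text \<open>Hoelder's inequality in modular form, from Young's inequality at scale \<open>s\<close>.
  These functionals are how weak convergence is tested on gradients, both for boundedness and for
  lower semicontinuity.\<close>

lemma gradient_functional:
 fixes h :: "'a => 'a"
 assumes h[measurable]: "h \<in> lmeas"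
  and A: "LI (%x. norm (h x) powr (p x / (p x - 1))) <= ennreal A" "0 <= A"
 defines "l \<equiv> %u. \<integral>x. h x \<bullet> wgr u x \<partial>lebesgue"
 shows "!!u v a b. u \<in> D1 p ==> v \<in> D1 p ==> l (%x. a * u x + b * v x) = a * l u + b * l v"
  "!!u. u \<in> D1 p ==> ennreal \<bar>l u\<bar> <= ennreal (A + 1) * Dnorm p u"
  "!!u. u \<in> D1 p ==> integrable lebesgue (%x. h x \<bullet> wgr u x)"
  "l \<in> D1_dual p" proof -
 have bound: "LN (%x. ennreal \<bar>h x \<bullet> wgr u x\<bar>) <= ennreal ((A + 1) * s)"
  if u: "u \<in> D1 p" and s: "0 < s" and le: "LI (%x. (norm (wgr u x) / s) powr p x) <= 1" for u s proof -
  note [measurable] = D1_D(3)[OF u]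
  have "LN (%x. ennreal \<bar>h x \<bullet> wgr u x\<bar>)
   <= LN (%x. ennreal s * (ennreal (norm (h x) powr (p x / (p x - 1))) + ennreal ((norm (wgr u x) / s) powr p x)))" proof (rule nn_integral_mono)
   fix x
   have "ennreal \<bar>h x \<bullet> wgr u x\<bar> <= ennreal (s * (norm (h x) powr (p x / (p x - 1)) + (norm (wgr u x) / s) powr p x))"
    using Young_norm[OF s p_gt_1] by (rule ennreal_leI)
   then show "ennreal \<bar>h x \<bullet> wgr u x\<bar> <= ennreal s * (ennreal (norm (h x) powr (p x / (p x - 1))) + ennreal ((norm (wgr u x) / s) powr p x))"
    using s by (simp add: ennreal_mult)
  qed
  also have "... = ennreal s * (LI (%x. norm (h x) powr (p x / (p x - 1))) + LI (%x. (norm (wgr u x) / s) powr p x))"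
   by (subst nn_integral_cmult, measurable, subst nn_integral_add) auto
  also have "... <= ennreal s * (ennreal A + 1)" by (intro mult_left_mono add_mono A le) auto
  also have "... = ennreal ((A + 1) * s)" using A s by (simp add: ennreal_mult mult.commute flip: ennreal_1)
  finally show ?thesis .
 qed
 have int: "integrable lebesgue (%x. h x \<bullet> wgr u x)" if u: "u \<in> D1 p" for u proof -
  note [measurable] = D1_D(3)[OF u]
  obtain d where d: "0 <= d" "!!s. d < s ==> LI (%x. (norm (wgr u x) / s) powr p x) <= 1" using Dnorm_eq[OF u] by metis
  have "LN (%x. ennreal \<bar>h x \<bullet> wgr u x\<bar>) < top" using bound[OF u _ d(2)[of "d + 1"]] d(1) le_less_trans[OF _ ennreal_less_top] by auto
  then show ?thesis by (intro integrableI_bounded) auto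
 qed
 show "integrable lebesgue (%x. h x \<bullet> wgr u x)" if "u \<in> D1 p" for u by (rule int[OF that])
 show lin: "l (%x. a * u x + b * v x) = a * l u + b * l v" if u: "u \<in> D1 p" and v: "v \<in> D1 p" for u v a b proof -
  note [measurable] = D1_D(3)[OF u] D1_D(3)[OF v]
  have [measurable]: "wgr (%x. a * u x + b * v x) \<in> lmeas" proof -
   have "has_weak_gradient UNIV (%x. a * u x + b * v x) (wgr (%x. a * u x + b * v x))" using has_weak_gradient_lin[OF D1_D(1)[OF u] D1_D(1)[OF v]]
    by (intro has_weak_gradient_wgrad) (auto simp: W11loc_def)
   then show ?thesis by (intro loc_integrable_measurable) (auto simp: has_weak_gradient_def)
  qed
  have "l (%x. a * u x + b * v x) = LB (%x. a * (h x \<bullet> wgr u x) + b * (h x \<bullet> wgr v x))" unfolding l_def using D1_lin[OF u v, of a b]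
   by (intro integral_cong_AE) (auto elim!: eventually_mono simp: inner_add_right)
  also have "... = a * l u + b * l v" unfolding l_def using int[OF u] int[OF v] by simp
  finally show ?thesis .
 qed
 show bd: "ennreal \<bar>l u\<bar> <= ennreal (A + 1) * Dnorm p u" if u: "u \<in> D1 p" for u proof (rule dual_boundI[OF u])
  fix s :: real assume s: "0 < s" "LI (%x. (norm (wgr u x) / s) powr p x) <= 1"
  have "ennreal \<bar>l u\<bar> <= LN (%x. ennreal \<bar>h x \<bullet> wgr u x\<bar>)" unfolding l_def using integral_norm_bound_ennreal[OF int[OF u]] by simp
  also have "... <= ennreal ((A + 1) * s)" by (rule bound[OF u s])
  finally show "\<bar>l u\<bar> <= (A + 1) * s" using A s by (subst (asm) ennreal_le_iff) auto
 qed (use A in simp)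
 show "l \<in> D1_dual p" unfolding D1_dual_def using lin bd by blast
qed

text \<open>The Sobolev inequality bounds the local L1 norm by the gradient norm, so integration
  against \<open>k\<close> is continuous. Through it, weak convergence yields convergence of ball
  averages.\<close>

lemma weighted_integral_functional:
 assumes k[measurable]: "k \<in> lmeas" and B: "!!x. \<bar>k x\<bar> <= B" "!!x. R < norm x ==> k x = 0"
 shows "(%u. \<integral>x. u x * k x \<partial>lebesgue) \<in> D1_dual p"
  "!!u. u \<in> D1 p ==> integrable lebesgue (%x. u x * k x)" proof -
 obtain C where C: "0 < C" "!!u dl. u \<in> D1 p ==> 0 < dl ==>
  LI (%x. (norm (wgr u x) / dl) powr p x) <= 1 ==>
  LI (%x. (\<bar>u x\<bar> / (2 * dl)) powr ps x) <= ennreal C" using D1_sobolev_zero by blast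
 obtain V where V: "emeasure lebesgue (cball (0::'a) R) = ennreal V" "0 <= V" using emeasure_cball_finite by metis
 have B0: "0 <= B" using B(1)[of 0] by linarith
 have bound: "integrable lebesgue (%x. u x * k x)" "\<bar>\<integral>x. u x * k x \<partial>lebesgue\<bar> <= B * (2 * s * (V + C))"
  if u: "u \<in> D1 p" and s: "0 < s" and le: "LI (%x. (norm (wgr u x) / s) powr p x) <= 1" for u s proof -
  note [measurable] = D1_D(2)[OF u]
  have 1: "L1ball R u <= ennreal (2 * s * (V + C))" unfolding real_norm_def[symmetric] using C(2)[OF u s le] ps_gt_1 s C(1) V
   by (intro nn_integral_le_modular[where r = ps]) (auto simp: less_imp_le)
  show "integrable lebesgue (%x. u x * k x)" "\<bar>\<integral>x. u x * k x \<partial>lebesgue\<bar> <= B * (2 * s * (V + C))"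
   using weighted_integral_bound[OF D1_D(2)[OF u] k B(1) B(2) 1] s V C(1) by simp_all
 qed
 have int: "integrable lebesgue (%x. u x * k x)" if u: "u \<in> D1 p" for u proof -
  obtain d where d: "0 <= d" "!!s. d < s ==> LI (%x. (norm (wgr u x) / s) powr p x) <= 1" using Dnorm_eq[OF u] by metis
  show ?thesis using d by (intro bound(1)[OF u _ d(2), of "d + 1"]) auto
 qed
 then show "!!u. u \<in> D1 p ==> integrable lebesgue (%x. u x * k x)" by blast
 have lin: "LB (%x. (a * u x + b * v x) * k x) = a * LB (%x. u x * k x) + b * LB (%x. v x * k x)"
  if u: "u \<in> D1 p" and v: "v \<in> D1 p" for u v a b using int[OF u] int[OF v] by (simp add: distrib_right mult.assoc)
 have "ennreal \<bar>\<integral>x. u x * k x \<partial>lebesgue\<bar> <= ennreal (B * (2 * (V + C))) * Dnorm p u" if u: "u \<in> D1 p" for u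
by (rule dual_boundI[OF u]) (use bound(2)[OF u] B0 V C(1) in \<open>auto simp: mult_ac\<close>)
 then show "(%u. \<integral>x. u x * k x \<partial>lebesgue) \<in> D1_dual p" unfolding D1_dual_def using lin by blast
qed

end

section \<open>Consequences of weak convergence\<close>

context exponents
begin

definition unit_dual :: "(('a => real) => real) set" where
 "unit_dual = {l. (\<forall>u\<in>D1 p. \<forall>v\<in>D1 p. \<forall>a b. l (%x. a * u x + b * v x) = a * l u + b * l v) &
  (\<forall>u\<in>D1 p. ennreal \<bar>l u\<bar> <= Dnorm p u)}"

lemma unit_dual_bound:
 assumes "u \<in> D1 p"
 obtains d where "!!l. l \<in> unit_dual ==> \<bar>l u\<bar> <= d" proof -
 obtain d where d: "Dnorm p u = ennreal d" "0 <= d" using Dnorm_eq[OF assms] by metis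
 have "\<bar>l u\<bar> <= d" if "l \<in> unit_dual" for l proof -
  have "ennreal \<bar>l u\<bar> <= ennreal d" using that assms d by (auto simp: unit_dual_def)
  then show ?thesis using d by simp
 qed
 then show thesis by (rule that)
qed

lemma unit_dual_series:
 fixes c :: "nat => real" and h :: "nat => ('a => real) => real"
 assumes h: "!!k. h k \<in> unit_dual" and c: "!!k. \<bar>c k\<bar> <= (1/3) ^ Suc k"
 defines "L \<equiv> %u. \<Sum>k. c k * h k u"
 shows "L \<in> D1_dual p" "!!u. u \<in> D1 p ==> summable (%k. c k * h k u)" proof -
 have geo: "summable (%k. (1/3::real) ^ Suc k)" by (simp add: summable_mult summable_geometric)
 have bd: "\<bar>c k * h k u\<bar> <= d * (1/3) ^ Suc k" if "u \<in> D1 p" "\<forall>l\<in>unit_dual. \<bar>l u\<bar> <= d" for u d k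
  using mult_mono[OF c[of k] bspec[OF that(2) h[of k]]] by (simp add: abs_mult mult.commute)
 have sm: "summable (%k. c k * h k u)" if u: "u \<in> D1 p" for u proof -
  obtain d where "!!l. l \<in> unit_dual ==> \<bar>l u\<bar> <= d" using unit_dual_bound[OF u] by metis
  then have d: "\<forall>l\<in>unit_dual. \<bar>l u\<bar> <= d" by blast
  show ?thesis by (rule summable_comparison_test'[OF summable_mult[OF geo, of d]]) (use bd[OF u d] in auto)
 qed
 then show "!!u. u \<in> D1 p ==> summable (%k. c k * h k u)" by blast
 have lin: "L (%x. a * u x + b * v x) = a * L u + b * L v" if u: "u \<in> D1 p" and v: "v \<in> D1 p" for u v a b proof -
  have "h k (%x. a * u x + b * v x) = a * h k u + b * h k v" for k using h[of k] u v by (auto simp: unit_dual_def)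
  then have "L (%x. a * u x + b * v x) = (\<Sum>k. a * (c k * h k u) + b * (c k * h k v))" by (simp add: L_def algebra_simps)
  also have "... = a * L u + b * L v" unfolding L_def using sm[OF u] sm[OF v] by (simp add: suminf_add[symmetric] summable_mult suminf_mult)
  finally show ?thesis .
 qed
 have "ennreal \<bar>L u\<bar> <= ennreal 1 * Dnorm p u" if u: "u \<in> D1 p" for u proof -
  obtain d where d: "Dnorm p u = ennreal d" "0 <= d" using Dnorm_eq[OF u] by metis
  have hd: "\<forall>l\<in>unit_dual. \<bar>l u\<bar> <= d" proof
   fix l assume "l \<in> unit_dual"
   then have "ennreal \<bar>l u\<bar> <= ennreal d" using u d by (auto simp: unit_dual_def)
   then show "\<bar>l u\<bar> <= d" using d by simp
  qed
  have s: "summable (%k. \<bar>c k * h k u\<bar>)" by (rule summable_comparison_test'[OF summable_mult[OF geo, of d]]) (use bd[OF u hd] in auto)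
  have "\<bar>L u\<bar> <= (\<Sum>k. \<bar>c k * h k u\<bar>)" unfolding L_def by (rule summable_rabs[OF s])
  also have "... <= (\<Sum>k. d * (1/3) ^ Suc k)" by (intro suminf_le s summable_mult geo bd[OF u hd])
  also have "... = d * (\<Sum>k. (1/3) ^ Suc k)" by (rule suminf_mult[OF geo])
  also have "(\<Sum>k. (1/3::real) ^ Suc k) = 1/2" using suminf_mult[OF summable_geometric[of "1/3::real"], of "1/3"] by (simp add: suminf_geometric)
  finally have "\<bar>L u\<bar> <= d" using d by simp
  then show ?thesis unfolding d(1) by (simp add: ennreal_leI)
 qed
 then show "L \<in> D1_dual p" unfolding D1_dual_def using lin by blast
qed

text \<open>By a gliding hump.\<close>

lemma uniform_boundedness:
 assumes u: "!!n. u n \<in> D1 p" and bdd: "!!l. l \<in> D1_dual p ==> Bseq (%n::nat. l (u n))"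
 obtains K where "!!n l. l \<in> unit_dual ==> \<bar>l (u n)\<bar> <= K" proof -
 have ne: "(%_. 0) \<in> unit_dual" by (simp add: unit_dual_def)
 define N where "N n = (SUP l\<in>unit_dual. \<bar>l (u n)\<bar>)" for n
 have bd: "bdd_above ((%l. \<bar>l (u n)\<bar>) ` unit_dual)" for n using unit_dual_bound[OF u[of n]] by (metis bdd_aboveI2)
 have N_ge: "\<bar>l (u n)\<bar> <= N n" if "l \<in> unit_dual" for l n unfolding N_def by (rule cSUP_upper[OF that bd])
 have N0: "0 <= N n" for n using N_ge[OF ne, of n] by simp
 have "\<exists>K. \<forall>n. N n <= K" proof (rule ccontr)
  assume "\<not> ?thesis"
  \<comment> \<open>With weight \<open>(1/3) ^ Suc k\<close>, a term of size at least 3/4 of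
    \<open>N (m k)\<close> beats the later terms, whose sum is at most half of it; a quarter
    remains, and a quarter of \<open>12 * 4 ^ k\<close> times the weight is
    \<open>(4/3) ^ k\<close>.\<close>
  then have "\<exists>n. 12 * 4 ^ k < N n" for k :: nat by (meson not_le)
  then obtain m where m: "!!k::nat. 12 * 4 ^ k < N (m k)" by metis
  have "\<exists>l\<in>unit_dual. 3/4 * N (m k) < \<bar>l (u (m k))\<bar>" for k proof -
   have "0 < N (m k)" using m[of k] by (smt (verit) zero_less_power)
   then have "3/4 * N (m k) < N (m k)" by simp
   then show ?thesis unfolding N_def[of "m k"] using ne by (subst (asm) less_cSUP_iff) (auto intro: bd)
  qed
  then obtain h where h: "!!k. h k \<in> unit_dual" "!!k. 3/4 * N (m k) < \<bar>h k (u (m k))\<bar>" by metis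
  \<comment> \<open>The sign makes the new term reinforce the partial sum at the chosen element, so
    earlier terms cannot cancel it.\<close>
  define \<sigma> where "\<sigma> g k = (if (0 <= g (u (m k))) = (0 <= h k (u (m k))) then 1 else -1::real)" for g :: "('a => real) => real" and k
  define G where "G = rec_nat (%_. 0) (%k g v. g v + \<sigma> g k * (1/3) ^ Suc k * h k v)"
  have G0: "G 0 v = 0" and GS: "G (Suc k) v = G k v + \<sigma> (G k) k * (1/3) ^ Suc k * h k v" for k v by (simp_all add: G_def)
  define c where "c k = \<sigma> (G k) k * (1/3) ^ Suc k" for k
  have c: "\<bar>c k\<bar> = (1/3) ^ Suc k" for k by (simp add: c_def \<sigma>_def abs_mult)
  have G: "G k v = (\<Sum>j<k. c j * h j v)" for k v by (induction k) (auto simp: G0 GS c_def)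
  define L where "L v = (\<Sum>k. c k * h k v)" for v
  have L: "L \<in> D1_dual p" unfolding L_def using h(1) c by (intro unit_dual_series) auto
  have sm: "summable (%k. c k * h k v)" if "v \<in> D1 p" for v using h(1) c that by (intro unit_dual_series(2)) auto
  have big: "(4/3) ^ k <= \<bar>L (u (m k))\<bar>" for k proof -
   define v where "v = u (m k)"
   define M where "M = N (m k)"
   have v: "v \<in> D1 p" using u by (simp add: v_def)
   have head: "(1/3) ^ Suc k * \<bar>h k v\<bar> <= \<bar>G (Suc k) v\<bar>" proof -
    define b where "b = (1/3) ^ Suc k * h k v"
    have "0 < (1/3::real) ^ Suc k" by simp
    then have sgn: "0 <= h k v \<longleftrightarrow> 0 <= b" unfolding b_def zero_le_mult_iff by linarith
    have "\<bar>G (Suc k) v\<bar> = \<bar>G k v\<bar> + \<bar>b\<bar>" unfolding GS mult.assoc b_def[symmetric] \<sigma>_def v_def[symmetric]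
     using sgn by (auto simp: abs_if)
    then show ?thesis by (simp add: b_def abs_mult)
   qed
   have sm': "summable (%j. c (j + Suc k) * h (j + Suc k) v)" using sm[OF v] by (rule summable_ignore_initial_segment)
   have geo: "summable (%j. (1/3::real) ^ j)" by (intro summable_geometric) simp
   have tb: "\<bar>c (j + Suc k) * h (j + Suc k) v\<bar> <= (1/3) ^ (Suc (Suc k)) * M * (1/3) ^ j" for j proof -
    have "\<bar>c (j + Suc k) * h (j + Suc k) v\<bar> <= (1/3) ^ Suc (j + Suc k) * M" unfolding abs_mult c M_def v_def using N_ge[OF h(1)] by (intro mult_left_mono) auto
    also have "... = (1/3) ^ (Suc (Suc k)) * M * (1/3) ^ j" by (simp add: power_add)
    finally show ?thesis .
   qed
   have st: "summable (%j. \<bar>c (j + Suc k) * h (j + Suc k) v\<bar>)"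
    by (rule summable_comparison_test'[OF summable_mult[OF geo, of "(1/3) ^ (Suc (Suc k)) * M"]]) (use tb in simp)
   have "\<bar>\<Sum>j. c (j + Suc k) * h (j + Suc k) v\<bar> <= (\<Sum>j. \<bar>c (j + Suc k) * h (j + Suc k) v\<bar>)" by (rule summable_rabs[OF st])
   also have "... <= (\<Sum>j. (1/3) ^ (Suc (Suc k)) * M * (1/3) ^ j)" by (intro suminf_le tb st summable_mult geo)
   also have "... = (1/3) ^ (Suc (Suc k)) * M * (\<Sum>j. (1/3) ^ j)" by (rule suminf_mult[OF geo])
   also have "(\<Sum>j. (1/3::real) ^ j) = 3/2" by (subst suminf_geometric) auto
   finally have tail: "\<bar>\<Sum>j. c (j + Suc k) * h (j + Suc k) v\<bar> <= (1/3) ^ Suc k * (M / 2)" by (simp add: mult.commute)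
   have Lsplit: "L v = (\<Sum>j. c (j + Suc k) * h (j + Suc k) v) + G (Suc k) v" unfolding L_def G by (rule suminf_split_initial_segment[OF sm[OF v]])
   have "(1/3) ^ Suc k * (3/4 * M) <= (1/3) ^ Suc k * \<bar>h k v\<bar>" using h(2)[of k] by (intro mult_left_mono) (auto simp: M_def v_def less_imp_le)
   then have a: "(1/3) ^ Suc k * (3/4 * M) - (1/3) ^ Suc k * (M / 2) <= \<bar>L v\<bar>" using head tail Lsplit by linarith
   have b: "(1/3) ^ Suc k * (3/4 * M) - (1/3) ^ Suc k * (M / 2) = (1/3) ^ Suc k * (M / 4)" by (simp add: algebra_simps)
   have c: "(1/3) ^ Suc k * (12 * 4 ^ k / 4) <= (1/3) ^ Suc k * (M / 4)" using m[of k] by (intro mult_left_mono) (auto simp: M_def)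
   have d: "(1/3) ^ Suc k * (12 * 4 ^ k / 4) = (4/3::real) ^ k" by (simp add: power_divide)
   show ?thesis using order_trans[OF c[unfolded d] a[unfolded b]] by (simp add: v_def)
  qed
  obtain B where B: "!!n. \<bar>L (u n)\<bar> <= B" using bdd[OF L] by (auto simp: Bseq_def)
  obtain k where "B < (4/3::real) ^ k" using real_arch_pow[of "4/3" B] by auto
  then show False using big[of k] B[of "m k"] by linarith
 qed
 then obtain K where "!!n. N n <= K" by blast
 then show thesis using that N_ge order_trans by metis
qed

text \<open>Duality: the field \<open>h\<close>, equal to \<open>norm G powr (p - 2)\<close> times
  \<open>G\<close> over \<open>lam\<close>, pairs with \<open>G\<close> to \<open>M / lam\<close>.
  For \<open>M > 1\<close> the choice \<open>lam = M powr ((pp - 1) / pp)\<close> makes the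
  conjugate modular of \<open>h\<close> at most 1 for every value of \<open>p\<close>, and still
  \<open>M / lam = M powr (1 / pp)\<close>, which uniform boundedness controls.\<close>

lemma weak_imp_bounded:
 assumes conv: "weakly_converges_D1 p u u0"
 obtains K where "0 <= K" "!!n. LI (%x. norm (wgr (u n) x) powr p x) <= ennreal K" proof -
 have u: "u n \<in> D1 p" for n using conv by (auto simp: weakly_converges_D1_def)
 have "Bseq (%n. l (u n))" if "l \<in> D1_dual p" for l using conv that by (intro convergent_imp_Bseq) (auto simp: weakly_converges_D1_def convergent_def)
 then obtain K where K: "!!n l. l \<in> unit_dual ==> \<bar>l (u n)\<bar> <= K" using uniform_boundedness[where u = u, OF u] by blast
 define K' where "K' = max 1 ((2 * \<bar>K\<bar>) powr pp)"
 have "LI (%x. norm (wgr (u n) x) powr p x) <= ennreal K'" for n proof -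
  define G where "G = wgr (u n)"
  have [measurable]: "G \<in> lmeas" using D1_D(3)[OF u[of n]] by (simp add: G_def)
  define M where "M = enn2real (Mod p G)"
  have M: "Mod p G = ennreal M" "0 <= M" using D1_D(4)[OF u[of n]] by (auto simp: M_def G_def)
  have "M <= K'" proof (cases "M <= 1")
   case False
   then have M1: "1 < M" by simp
   define tht where "tht = (pp - 1) / pp"
   have pp1: "1 < pp" using pm_gt_1 pm_le_pp by linarith
   define lam where "lam = M powr tht"
   have l: "0 < lam" using M1 by (simp add: lam_def)
   define h where "h x = (norm (G x) powr (p x - 2) / lam) *\<^sub>R G x" for x
   have [measurable]: "h \<in> lmeas" unfolding h_def[abs_def] by measurable
   have nh: "norm (h x) = norm (G x) powr (p x - 1) / lam" for x proof (cases "G x = 0")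
    case False
    then have "norm (G x) powr (p x - 2) * norm (G x) = norm (G x) powr (p x - 1)" using powr_add[of "norm (G x)" "p x - 2" 1] by simp
    then show ?thesis using l by (simp add: h_def)
   qed (simp add: h_def)
   have hp: "norm (h x) powr (p x / (p x - 1)) <= norm (G x) powr p x / M" for x proof -
    have "norm (h x) powr (p x / (p x - 1)) = norm (G x) powr p x / lam powr (p x / (p x - 1))" unfolding nh powr_divide using p_gt_1[of x] by (simp add: powr_powr)
    also have "... <= norm (G x) powr p x / M" proof (intro divide_left_mono)
     have "1 <= tht * (p x / (p x - 1))" using pp1 p_gt_1[of x] p_le[of x] by (simp add: tht_def field_simps)
     then have "M powr 1 <= M powr (tht * (p x / (p x - 1)))" using M1 by (intro powr_mono) auto
     then show "M <= lam powr (p x / (p x - 1))" using M1 by (simp add: lam_def powr_powr)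
    qed (use M1 l in auto)
    finally show ?thesis .
   qed
   have A: "LI (%x. norm (h x) powr (p x / (p x - 1))) <= ennreal 1" proof -
    have "LI (%x. norm (h x) powr (p x / (p x - 1)))
     <= LN (%x. ennreal (1 / M) * ennreal (norm (G x) powr p x))" using hp M1 by (intro nn_integral_mono) (auto simp: ennreal_mult[symmetric] intro!: ennreal_leI)
    also have "... = ennreal (1 / M) * ennreal M" by (subst nn_integral_cmult) (auto simp: M)
    also have "... = ennreal 1" using M1 by (subst ennreal_mult[symmetric]) auto
    finally show ?thesis by simp
   qed
   have h_meas: "h \<in> lmeas" by measurable
   note gf = gradient_functional[OF h_meas A zero_le_one]
   \<comment> \<open>Halved, because \<open>gradient_functional\<close> with \<open>A = 1\<close>
     gives the norm bound 2.\<close>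
   define l where "l v = LB (%x. h x \<bullet> wgr v x) / 2" for v
   have "l \<in> unit_dual" unfolding unit_dual_def proof (intro CollectI conjI ballI allI)
    fix v w a b assume "v \<in> D1 p" "w \<in> D1 p"
    then show "l (%x. a * v x + b * w x) = a * l v + b * l w" unfolding l_def by (subst gf(1)) (auto simp: add_divide_distrib)
   next
    fix v assume v: "v \<in> D1 p"
    obtain d where d: "Dnorm p v = ennreal d" "0 <= d" using Dnorm_eq[OF v] by metis
    have "ennreal \<bar>\<integral>x. h x \<bullet> wgr v x \<partial>lebesgue\<bar> <= ennreal (1 + 1) * ennreal d" using gf(2)[OF v] d by simp
    also have "... = ennreal (2 * d)" using d by (subst ennreal_mult[symmetric]) auto
    finally have "\<bar>\<integral>x. h x \<bullet> wgr v x \<partial>lebesgue\<bar> <= 2 * d" using d by (subst (asm) ennreal_le_iff) auto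
    then show "ennreal \<bar>l v\<bar> <= Dnorm p v" unfolding d(1) l_def by (intro ennreal_leI) simp
   qed
   then have "\<bar>l (u n)\<bar> <= K" by (rule K)
   moreover have "l (u n) = M / lam / 2" proof -
    have "h x \<bullet> G x = norm (G x) powr p x / lam" for x proof (cases "G x = 0")
     case False
     then have "norm (G x) powr (p x - 2) * (norm (G x) * norm (G x)) = norm (G x) powr p x" using powr_add[of "norm (G x)" "p x - 2" 2] by (simp add: power2_eq_square)
     then show ?thesis by (simp add: h_def power2_norm_eq_inner[symmetric] power2_eq_square)
    qed (simp add: h_def)
    moreover have "LB (%x. norm (G x) powr p x) = M" using M by (subst integral_eq_nn_integral) auto
    ultimately show ?thesis by (simp add: l_def G_def[symmetric])
   qed
   moreover have "M / lam = M powr (1 / pp)" proof -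
    have "M / lam = M powr (1 - tht)" using M1 by (simp add: lam_def powr_diff)
    also have "1 - tht = 1 / pp" using pp1 by (simp add: tht_def field_simps)
    finally show ?thesis .
   qed
   ultimately have "M powr (1 / pp) <= 2 * \<bar>K\<bar>" by simp
   then have "(M powr (1 / pp)) powr pp <= (2 * \<bar>K\<bar>) powr pp" using pp1 by (intro powr_mono2) auto
   then show ?thesis using pp1 M1 by (simp add: powr_powr K'_def)
  qed (simp add: K'_def)
  then show ?thesis using M unfolding G_def by (simp add: ennreal_leI)
 qed
 then show thesis by (intro that[of K']) (auto simp: K'_def)
qed

section \<open>Weak lower semicontinuity of gradient modulars\<close>

lemma norm_powr_above_tangent:
 fixes a b :: "'b::real_inner"
 assumes "1 < r"
 shows "norm b powr r + r * norm b powr (r - 2) * (b \<bullet> (a - b)) <= norm a powr r" proof (cases "b = 0")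
 case False
 have "norm b powr r + r * norm b powr (r - 1) * (norm a - norm b) <= norm a powr r" using False assms by (intro powr_above_tangent) auto
 moreover have "norm b powr (r - 2) * (b \<bullet> (a - b)) <= norm b powr (r - 1) * (norm a - norm b)" proof -
  have "b \<bullet> (a - b) <= norm b * (norm a - norm b)"
   using norm_cauchy_schwarz[of b a] by (simp add: inner_diff_right right_diff_distrib power2_norm_eq_inner[symmetric] power2_eq_square)
  then have "norm b powr (r - 2) * (b \<bullet> (a - b)) <= norm b powr (r - 2) * (norm b * (norm a - norm b))" by (intro mult_left_mono) auto
  also have "norm b powr (r - 2) * norm b = norm b powr (r - 1)" using False powr_add[of "norm b" "r - 2" 1] by simp
  then have "norm b powr (r - 2) * (norm b * (norm a - norm b)) = norm b powr (r - 1) * (norm a - norm b)" by (simp add: mult.assoc[symmetric])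
  finally show ?thesis .
 qed
 then have "r * (norm b powr (r - 2) * (b \<bullet> (a - b))) <= r * (norm b powr (r - 1) * (norm a - norm b))" using assms by (intro mult_left_mono) auto
 ultimately show ?thesis unfolding mult.assoc by linarith
qed (use assms in simp)

text \<open>The tangent inequality at \<open>G\<close>, multiplied by \<open>f\<close> and
  integrated, leaves a linear term with density \<open>h\<close>. Its conjugate modular is finite,
  so the linear term is a functional in \<open>D1_dual\<close> and its increment tends to 0 by weak
  convergence.\<close>

lemma gradient_lower_semicontinuous:
 fixes f :: "'a => real"
 assumes conv: "weakly_converges_D1 p u u0" and f[measurable]: "f \<in> lmeas"
  and f01: "!!x. 0 <= f x" "!!x. f x <= 1" and k: "strict_mono k"
  and lim: "(%n. \<integral>x. f x * norm (wgr (u (k n)) x) powr p x \<partial>lebesgue) ----> L"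
 shows "LB (%x. f x * norm (wgr u0 x) powr p x) <= L" proof -
 have u: "u n \<in> D1 p" and u0: "u0 \<in> D1 p" for n using conv by (auto simp: weakly_converges_D1_def)
 define G where "G = wgr u0"
 note [measurable] = D1_D(3)[OF u] D1_D(3)[OF u0, folded G_def]
 have int: "integrable lebesgue (%x. f x * norm (wgr v x) powr p x)" if v: "v \<in> D1 p" for v proof -
  note [measurable] = D1_D(3)[OF v]
  have "integrable lebesgue (%x. norm (wgr v x) powr p x)" using D1_D(4)[OF v] by (intro integrableI_nonneg) auto
  then show ?thesis by (rule Bochner_Integration.integrable_bound) (use f01 in \<open>auto simp: abs_mult intro!: mult_left_le_one_le\<close>)
 qed
 define h where "h x = (f x * p x * norm (G x) powr (p x - 2)) *\<^sub>R G x" for x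
 have h_meas: "h \<in> lmeas" unfolding h_def[abs_def] by measurable
 \<comment> \<open>\<open>p / (p - 1)\<close> decreases in \<open>p\<close>, so its largest value is
   the one at \<open>pm\<close>.\<close>
 define c where "c = max 1 pp powr (pm / (pm - 1))"
 have nh: "norm (h x) <= pp * norm (G x) powr (p x - 1)" for x proof (cases "G x = 0")
  case False
  have "norm (G x) powr (p x - 2) * norm (G x) = norm (G x) powr (p x - 1)" using False powr_add[of "norm (G x)" "p x - 2" 1] by simp
  then have "norm (h x) = f x * p x * norm (G x) powr (p x - 1)" using f01 p_gt_1[of x] by (simp add: h_def abs_mult mult.assoc)
  also have "... <= 1 * pp * norm (G x) powr (p x - 1)" using f01 p_gt_1[of x] p_le[of x] by (intro mult_right_mono mult_mono) auto
  finally show ?thesis by simp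
 qed (simp add: h_def)
 have hp: "norm (h x) powr (p x / (p x - 1)) <= c * norm (G x) powr p x" for x proof -
  have "norm (h x) powr (p x / (p x - 1)) <= (pp * norm (G x) powr (p x - 1)) powr (p x / (p x - 1))" using nh[of x] p_gt_1[of x] by (intro powr_mono2) auto
  also have "... = pp powr (p x / (p x - 1)) * norm (G x) powr p x" using p_gt_1[of x] by (simp add: powr_mult powr_powr)
  also have "pp powr (p x / (p x - 1)) <= c" proof -
   have e: "p x / (p x - 1) <= pm / (pm - 1)" using p_gt_1[of x] p_ge[of x] pm_gt_1 by (simp add: field_simps)
   have "pp powr (p x / (p x - 1)) <= max 1 pp powr (p x / (p x - 1))" using p_gt_1[of x] p_le[of x] by (intro powr_mono2) auto
   also have "... <= c" unfolding c_def using e by (intro powr_mono) auto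
   finally show ?thesis .
  qed
  finally show ?thesis by (simp add: mult_right_mono)
 qed
 define M where "M = enn2real (Mod p G)"
 have M: "Mod p G = ennreal M" "0 <= M" using D1_D(4)[OF u0] by (auto simp: M_def G_def)
 have c0: "0 <= c" by (simp add: c_def)
 have A: "LI (%x. norm (h x) powr (p x / (p x - 1))) <= ennreal (c * M)" proof -
  have "LI (%x. norm (h x) powr (p x / (p x - 1)))
   <= LN (%x. ennreal c * ennreal (norm (G x) powr p x))" using hp c0 by (intro nn_integral_mono) (auto simp: ennreal_mult[symmetric] intro!: ennreal_leI)
  also have "... = ennreal c * ennreal M" by (subst nn_integral_cmult) (auto simp: M)
  finally show ?thesis using c0 M by (simp add: ennreal_mult)
 qed
 have cM: "0 <= c * M" using c0 M by simp
 note gf = gradient_functional[OF h_meas A cM]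
 have "(%n. \<integral>x. h x \<bullet> wgr (u n) x \<partial>lebesgue) ----> LB (%x. h x \<bullet> wgr u0 x)" using conv gf(4) by (auto simp: weakly_converges_D1_def)
 from LIMSEQ_subseq_LIMSEQ[OF this k]
 have hl: "(%n. \<integral>x. h x \<bullet> wgr (u (k n)) x \<partial>lebesgue) ----> LB (%x. h x \<bullet> wgr u0 x)" by (simp add: comp_def)
 define I where "I = LB (%x. f x * norm (G x) powr p x)"
 have le: "I + (LB (%x. h x \<bullet> wgr (u n) x) - LB (%x. h x \<bullet> wgr u0 x))
   <= LB (%x. f x * norm (wgr (u n) x) powr p x)" for n proof -
  have "I + (LB (%x. h x \<bullet> wgr (u n) x) - LB (%x. h x \<bullet> wgr u0 x))
   = LB (%x. f x * norm (G x) powr p x + (h x \<bullet> wgr (u n) x - h x \<bullet> wgr u0 x))" unfolding I_def G_def using int[OF u0] gf(3)[OF u] gf(3)[OF u0] by simp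
  also have "... <= LB (%x. f x * norm (wgr (u n) x) powr p x)" proof (rule integral_mono)
   show "integrable lebesgue (%x. f x * norm (G x) powr p x + (h x \<bullet> wgr (u n) x - h x \<bullet> wgr u0 x))"
    unfolding G_def using int[OF u0] gf(3)[OF u] gf(3)[OF u0] by simp
   show "integrable lebesgue (%x. f x * norm (wgr (u n) x) powr p x)" by (rule int[OF u])
   fix x
   have "f x * (norm (G x) powr p x + p x * norm (G x) powr (p x - 2) * (G x \<bullet> (wgr (u n) x - G x)))
    <= f x * norm (wgr (u n) x) powr p x" using f01 p_gt_1 by (intro mult_left_mono norm_powr_above_tangent) auto
   then show "f x * norm (G x) powr p x + (h x \<bullet> wgr (u n) x - h x \<bullet> wgr u0 x)
    <= f x * norm (wgr (u n) x) powr p x" by (simp add: h_def G_def[symmetric] inner_diff_right algebra_simps)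
  qed
  finally show ?thesis .
 qed
 have "I + (LB (%x. h x \<bullet> wgr u0 x) - LB (%x. h x \<bullet> wgr u0 x)) <= L"
  using le by (intro LIMSEQ_le[OF tendsto_add[OF tendsto_const tendsto_diff[OF hl tendsto_const]] lim]) auto
 then show ?thesis by (simp add: I_def G_def)
qed

end

section \<open>Local strong convergence from weak convergence\<close>

lemma ennreal_tendsto_0I:
 fixes X :: "nat => ennreal"
 assumes "!!e. 0 < e ==> eventually (%n. X n <= ennreal e) sequentially"
 shows "X ----> 0" proof (rule order_tendstoI)
 fix a :: ennreal assume "0 < a"
 obtain e where e: "0 < e" "ennreal e < a" proof (cases a)
  case (real r)
  then have "0 < r" using \<open>0 < a\<close> by simp
  then show thesis using real by (intro that[of "r / 2"]) (auto simp: ennreal_less_iff)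
 next
  case top
  then show thesis by (intro that[of 1]) auto
 qed
 show "eventually (%n. X n < a) sequentially" using assms[OF e(1)] by eventually_elim (use e(2) in simp)
qed simp

lemma nn_integral_translate:
 fixes f :: "'a::euclidean_space => ennreal"
 assumes "f \<in> borel_measurable borel"
 shows "BN (%x. f (x + a)) = BN (%x. f x)" proof -
 have "integral\<^sup>N (distr lborel borel ((+) a)) f = BN (%x. f (a + x))" using assms by (intro nn_integral_distr) auto
 then show ?thesis by (simp add: lborel_distr_plus add.commute)
qed

text \<open>The difference to the value at \<open>x + s z\<close> is paid by the gradient along the
  segment. By translation invariance every point of the segment costs the same integral, taken over
  a ball larger by 1.\<close>

lemma ball_avg_approx:
 fixes phi :: "'a::euclidean_space => real"
 assumes phi: "phi \<in> tests" and s: "0 <= s" "s <= 1"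
 shows "BN (%x. ennreal \<bar>phi x - ball_avg phi x s\<bar> * indicator (cball 0 R) x)
  <= ennreal s * BN (%x. ennreal (norm (grad phi x)) * indicator (cball 0 (R + 1)) x)" proof -
 interpret P: prob_space "unif_ball :: 'a measure" by (rule prob_space_unif_ball)
 interpret PP: pair_sigma_finite "unif_ball :: 'a measure" "lborel :: 'a measure" ..
 have [measurable]: "phi \<in> borel_measurable borel" "grad phi \<in> borel_measurable borel"
  using test_continuous[OF phi, of UNIV] test_continuous_grad[OF phi, of UNIV] by (auto intro: borel_measurable_continuous_onI)
 have [measurable]: "cball (0::'a) r \<in> sets borel" for r by simp
 obtain B where B: "0 < B" "!!x. \<bar>phi x\<bar> <= B" using test_bounded[OF phi] by metis
 have int: "integrable unif_ball (%z. phi (x + s *\<^sub>R z))" for x using B by (intro P.integrable_const_bound[of _ B]) auto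
 let ?g = "%x. ennreal (norm (grad phi x))"
 have pt: "ennreal \<bar>phi x - ball_avg phi x s\<bar> <= (\<integral>\<^sup>+z. BN (%t. ?g (x + t *\<^sub>R z) * indicator {0..s} t) \<partial>unif_ball)" for x proof -
  have "phi x - ball_avg phi x s = (\<integral>z. phi x - phi (x + s *\<^sub>R z) \<partial>unif_ball)" unfolding ball_avg_def using int P.prob_space by simp
  then have "ennreal \<bar>phi x - ball_avg phi x s\<bar> <= (\<integral>\<^sup>+z. ennreal \<bar>phi x - phi (x + s *\<^sub>R z)\<bar> \<partial>unif_ball)"
   using integral_norm_bound_ennreal[of unif_ball "%z. phi x - phi (x + s *\<^sub>R z)"] int by simp
  also have "... <= (\<integral>\<^sup>+z. BN (%t. ?g (x + t *\<^sub>R z) * indicator {0..s} t) \<partial>unif_ball)"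
   by (rule nn_integral_mono_AE, use AE_unif_ball in eventually_elim)
    (subst abs_minus_commute, intro segment_estimate[OF phi] s, simp)
  finally show ?thesis .
 qed
 have "BN (%x. ennreal \<bar>phi x - ball_avg phi x s\<bar> * indicator (cball 0 R) x)
  <= BN (%x. (\<integral>\<^sup>+z. BN (%t. ?g (x + t *\<^sub>R z) * indicator {0..s} t) \<partial>unif_ball) * indicator (cball 0 R) x)"
  by (intro nn_integral_mono mult_right_mono pt) auto
 also have "... = BN (%x. (\<integral>\<^sup>+z. BN (%t. ?g (x + t *\<^sub>R z) * indicator {0..s} t * indicator (cball 0 R) x) \<partial>unif_ball))"
  by (simp add: nn_integral_multc[symmetric])
 also have "... = (\<integral>\<^sup>+z. BN (%x. BN (%t. ?g (x + t *\<^sub>R z) * indicator {0..s} t * indicator (cball 0 R) x)) \<partial>unif_ball)"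
  by (rule PP.Fubini') measurable
 also have "... <= (\<integral>\<^sup>+z. ennreal s * BN (%x. ?g x * indicator (cball 0 (R + 1)) x) \<partial>(unif_ball :: 'a measure))"
 proof (rule nn_integral_mono_AE, use AE_unif_ball in eventually_elim)
  fix z :: 'a assume z: "z ~= 0 & norm z < 1"
  have "BN (%x. BN (%t. ?g (x + t *\<^sub>R z) * indicator {0..s} t * indicator (cball 0 R) x))
   = BN (%t. BN (%x. ?g (x + t *\<^sub>R z) * indicator {0..s} t * indicator (cball 0 R) x))" by (rule lborel_pair.Fubini') measurable
  also have "... <= BN (%t. BN (%x. ?g x * indicator (cball 0 (R + 1)) x) * indicator {0..s} t)" proof (rule nn_integral_mono)
   fix t :: real
   show "BN (%x. ?g (x + t *\<^sub>R z) * indicator {0..s} t * indicator (cball 0 R) x)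
    <= BN (%x. ?g x * indicator (cball 0 (R + 1)) x) * indicator {0..s} t" proof (cases "t \<in> {0..s}")
    case True
    have tz: "norm (t *\<^sub>R z) <= 1" using True z s mult_mono[of "\<bar>t\<bar>" 1 "norm z" 1] by auto
    have "BN (%x. ?g (x + t *\<^sub>R z) * indicator {0..s} t * indicator (cball 0 R) x)
     <= BN (%x. ?g (x + t *\<^sub>R z) * indicator (cball 0 (R + 1)) (x + t *\<^sub>R z))" proof (rule nn_integral_mono)
     fix x
     show "?g (x + t *\<^sub>R z) * indicator {0..s} t * indicator (cball 0 R) x <= ?g (x + t *\<^sub>R z) * indicator (cball 0 (R + 1)) (x + t *\<^sub>R z)"
      using True tz norm_triangle_ineq[of x "t *\<^sub>R z"] by (auto simp: indicator_def)
    qed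
    also have "... = BN (%x. ?g x * indicator (cball 0 (R + 1)) x)" by (rule nn_integral_translate[of "%x. ?g x * indicator (cball 0 (R + 1)) x"]) measurable
    finally show ?thesis using True by simp
   qed simp
  qed
  also have "... = ennreal s * BN (%x. ?g x * indicator (cball 0 (R + 1)) x)" using s by (subst nn_integral_cmult_indicator) (auto simp: mult.commute)
  finally show "BN (%x. BN (%t. ?g (x + t *\<^sub>R z) * indicator {0..s} t * indicator (cball 0 R) x))
   <= ennreal s * BN (%x. ?g x * indicator (cball 0 (R + 1)) x)" .
 qed
 also have "... = ennreal s * BN (%x. ?g x * indicator (cball 0 (R + 1)) x)" using P.emeasure_space_1 by simp
 finally show ?thesis .
qed

text \<open>Reduced to the nonnegative function \<open>phi + B\<close>, to which
  \<open>ball_avg_integral\<close> applies.\<close>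

lemma ball_avg_eq_integral:
 fixes phi :: "'a::euclidean_space => real"
 assumes phi: "phi \<in> borel_measurable borel" "!!x. \<bar>phi x\<bar> <= B" and s: "0 < s"
 shows "ball_avg phi x s = (\<integral>y. phi y * (indicator (ball x s) y / measure lborel (ball x s)) \<partial>lborel)"
  and "integrable lborel (%y. phi y * indicator (ball x s) y)" proof -
 interpret P: prob_space "unif_ball :: 'a measure" by (rule prob_space_unif_ball)
 note [measurable] = phi(1)
 have [measurable]: "ball x s \<in> sets borel" by simp
 define m where "m = measure lborel (ball x s)"
 have m: "emeasure lborel (ball x s) = ennreal m" "0 < m" using s by (auto simp: m_def emeasure_ball content_ball)
 have B0: "0 <= B" using phi(2)[of 0] by linarith
 have g: "bdd_borel (2 * B) (%y. phi y + B)" unfolding bdd_borel_def using phi by (auto simp: abs_le_iff) (smt (verit) phi(2))+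
 have ii: "integrable lborel (indicat_real (ball x s))" using m by (intro integrable_real_indicator) auto
 show i1: "integrable lborel (%y. phi y * indicator (ball x s) y)" by (rule Bochner_Integration.integrable_bound[OF integrable_mult_right[OF ii, of B]])
   (use phi(2) B0 in \<open>auto simp: indicator_def\<close>)
 have "ennreal (ball_avg (%y. phi y + B) x s * m) = BN (%y. ennreal (phi y + B) * indicator (ball x s) y)"
  using ball_avg_integral[OF g s, of x] m ball_avg_nonneg[OF g, of x s] by (simp add: ennreal_mult)
 also have "... = BI (%y. phi y * indicator (ball x s) y + B * indicator (ball x s) y)" by (intro nn_integral_cong) (auto simp: indicator_def)
 also have "... = ennreal (\<integral>y. phi y * indicator (ball x s) y + B * indicator (ball x s) y \<partial>lborel)" proof (rule nn_integral_eq_integral)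
  show "AE y in lborel. 0 <= phi y * indicator (ball x s) y + B * indicator (ball x s) y" proof (rule AE_I2)
   fix y show "0 <= phi y * indicator (ball x s) y + B * indicator (ball x s) y" using phi(2)[of y] by (auto simp: indicator_def)
  qed
 qed (use i1 ii in auto)
 also have "(\<integral>y. phi y * indicator (ball x s) y + B * indicator (ball x s) y \<partial>lborel)
  = (\<integral>y. phi y * indicator (ball x s) y \<partial>lborel) + B * m" using i1 ii by (simp add: m_def)
 finally have e: "ennreal (ball_avg (%y. phi y + B) x s * m) = ennreal ((\<integral>y. phi y * indicator (ball x s) y \<partial>lborel) + B * m)" .
 have "0 <= (\<integral>y. phi y * indicator (ball x s) y + B * indicator (ball x s) y \<partial>lborel)" proof (rule Bochner_Integration.integral_nonneg)
  fix y show "0 <= phi y * indicator (ball x s) y + B * indicator (ball x s) y" using phi(2)[of y] by (auto simp: indicator_def)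
 qed
 then have "0 <= (\<integral>y. phi y * indicator (ball x s) y \<partial>lborel) + B * m" using i1 ii by (simp add: m_def)
 then have "ball_avg (%y. phi y + B) x s * m = (\<integral>y. phi y * indicator (ball x s) y \<partial>lborel) + B * m"
  using e m ball_avg_nonneg[OF g, of x s] by (subst (asm) ennreal_inj) auto
 moreover have "ball_avg (%y. phi y + B) x s = ball_avg phi x s + B" proof -
  have "integrable unif_ball (%z. phi (x + s *\<^sub>R z))" using phi by (intro P.integrable_const_bound[of _ B]) auto
  then show ?thesis using P.prob_space by (simp add: ball_avg_def)
 qed
 ultimately have "ball_avg phi x s * m = (\<integral>y. phi y * indicator (ball x s) y \<partial>lborel)" by (simp add: distrib_right)
 then have "ball_avg phi x s = (\<integral>y. phi y * indicator (ball x s) y \<partial>lborel) / m" using m by (simp add: field_simps)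
 then show "ball_avg phi x s = (\<integral>y. phi y * (indicator (ball x s) y / measure lborel (ball x s)) \<partial>lborel)" by (simp add: m_def)
qed

text \<open>A Rellich theorem: replacing \<open>w n\<close> by its averages over balls of radius
  \<open>s\<close> costs at most \<open>s * K\<close> in L1, uniformly in \<open>n\<close>. For
  fixed \<open>s\<close> the averages tend to 0 at every point by weak convergence and are bounded,
  so dominated convergence applies.\<close>

lemma test_L1_loc_tendsto_0:
 fixes w :: "nat => 'a::euclidean_space => real"
 assumes w: "!!n. w n \<in> tests"
  and weak: "!!k B R. k \<in> borel_measurable borel ==> (!!x. \<bar>k x\<bar> <= B) ==> (!!x. R < norm x ==> k x = 0) ==>
   (%n. \<integral>x. w n x * k x \<partial>lebesgue) ----> 0"
  and grad: "!!R. \<exists>K\<ge>0. \<forall>n. LN (%x. ennreal (norm (grad (w n) x)) * indicator (cball 0 R) x) <= ennreal K"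
  and bdd: "!!R. \<exists>K\<ge>0. \<forall>n. LN (%x. ennreal \<bar>w n x\<bar> * indicator (cball 0 R) x) <= ennreal K"
 shows "(%n. \<integral>\<^sup>+x. ennreal \<bar>w n x\<bar> * indicator (cball 0 R) x \<partial>lebesgue) ----> 0" unfolding nn_integral_completion
proof (rule ennreal_tendsto_0I)
 fix e :: real assume e: "0 < e"
 interpret P: prob_space "unif_ball :: 'a measure" by (rule prob_space_unif_ball)
 have w_meas[measurable]: "w n \<in> borel_measurable borel" for n using test_continuous[OF w, of UNIV] by (intro borel_measurable_continuous_onI)
 have [measurable]: "cball (0::'a) r \<in> sets borel" for r by simp
 obtain K where K: "0 <= K" "!!n. BN (%x. ennreal (norm (grad (w n) x)) * indicator (cball 0 (R + 1)) x) <= ennreal K"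
  using grad[of "R + 1"] unfolding nn_integral_completion by blast
 obtain M where M: "0 <= M" "!!n. BN (%x. ennreal \<bar>w n x\<bar> * indicator (cball 0 (R + 1)) x) <= ennreal M"
  using bdd[of "R + 1"] unfolding nn_integral_completion by blast
 define s where "s = min 1 (e / (2 * (K + 1)))"
 have s: "0 < s" "s <= 1" "s * K <= e / 2" proof -
  show "0 < s" "s <= 1" using e K by (auto simp: s_def)
  have "s * K <= e / (2 * (K + 1)) * (K + 1)" using e K by (intro mult_mono) (auto simp: s_def)
  also have "... = e / 2" using K by (simp add: divide_simps)
  finally show "s * K <= e / 2" .
 qed
 define m where "m = measure lborel (ball (0::'a) s)"
 have m: "0 < m" "!!x::'a. measure lborel (ball x s) = m" using s by (auto simp: m_def content_ball)
 have avg_eq: "ball_avg (w n) x s = (\<integral>y. w n y * (indicator (ball x s) y / m) \<partial>lborel)" for n x proof -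
  obtain B where "!!x. \<bar>w n x\<bar> <= B" using test_bounded[OF w] by metis
  from ball_avg_eq_integral(1)[OF w_meas this s(1), of x] show ?thesis by (simp add: m)
 qed
 have avg_lim: "(%n. ball_avg (w n) x s) ----> 0" for x proof -
  have [measurable]: "ball x s \<in> sets borel" by simp
  have "(%n. \<integral>y. w n y * (indicator (ball x s) y / m) \<partial>lebesgue) ----> 0" proof (rule weak[of _ "1 / m" "norm x + s"])
   show "indicator (ball x s) y / m = 0" if "norm x + s < norm y" for y using that norm_triangle_ineq2[of y x] by (auto simp: dist_norm norm_minus_commute indicator_def)
  qed (use m in \<open>auto simp: indicator_def\<close>)
  moreover have "LB (%y. w n y * (indicator (ball x s) y / m)) = ball_avg (w n) x s" for n unfolding avg_eq by (rule integral_completion) measurable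
  ultimately show ?thesis by simp
 qed
 have avg_bd: "ennreal \<bar>ball_avg (w n) x s\<bar> <= ennreal (M / m)" if x: "x \<in> cball 0 R" for n x proof -
  have [measurable]: "ball x s \<in> sets borel" by simp
  have "ennreal \<bar>ball_avg (w n) x s\<bar> <= BI (%y. norm (w n y * (indicator (ball x s) y / m)))" unfolding avg_eq real_norm_def[symmetric]
  proof (rule integral_norm_bound_ennreal)
   obtain B where "!!x. \<bar>w n x\<bar> <= B" using test_bounded[OF w] by metis
   from ball_avg_eq_integral(2)[OF w_meas this s(1), of x]
   show "integrable lborel (%y. w n y * (indicator (ball x s) y / m))" by simp
  qed
  also have "... <= BN (%y. ennreal (1 / m) * (ennreal \<bar>w n y\<bar> * indicator (cball 0 (R + 1)) y))" proof (rule nn_integral_mono)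
   fix y
   have "y \<in> cball 0 (R + 1)" if "y \<in> ball x s" using that x s norm_triangle_ineq2[of y x] by (auto simp: dist_norm norm_minus_commute)
   then show "ennreal (norm (w n y * (indicator (ball x s) y / m))) <= ennreal (1 / m) * (ennreal \<bar>w n y\<bar> * indicator (cball 0 (R + 1)) y)"
    using m(1) by (auto simp: indicator_def ennreal_mult[symmetric] mult.commute)
  qed
  also have "... = ennreal (1 / m) * BN (%y. ennreal \<bar>w n y\<bar> * indicator (cball 0 (R + 1)) y)" by (rule nn_integral_cmult) measurable
  also have "... <= ennreal (1 / m) * ennreal M" by (intro mult_left_mono M) auto
  also have "... = ennreal (M / m)" using M m by (simp add: ennreal_mult[symmetric])
  finally show ?thesis .
 qed
 have avg_meas[measurable]: "(%x. ball_avg (w n) x s) \<in> borel_measurable borel" for n unfolding ball_avg_def by (rule P.borel_measurable_lebesgue_integral) measurable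
 have "(%n. \<integral>\<^sup>+x. ennreal \<bar>ball_avg (w n) x s\<bar> * indicator (cball 0 R) x \<partial>lborel) ----> (\<integral>\<^sup>+x. 0 \<partial>(lborel :: 'a measure))"
 proof (rule nn_integral_dominated_convergence[where w = "%x. ennreal (M / m) * indicator (cball 0 R) x"])
  show "AE x in lborel. ennreal \<bar>ball_avg (w n) x s\<bar> * indicator (cball 0 R) x <= ennreal (M / m) * indicator (cball 0 R) x" for n proof (rule AE_I2)
   fix x show "ennreal \<bar>ball_avg (w n) x s\<bar> * indicator (cball 0 R) x <= ennreal (M / m) * indicator (cball 0 R) x"
    using avg_bd[of x n] by (cases "x \<in> cball 0 R") auto
  qed
  show "BN (%x. ennreal (M / m) * indicator (cball (0::'a) R) x) < \<infinity>" using emeasure_bounded_finite[OF bounded_cball, of "0::'a" R]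
   by (subst nn_integral_cmult_indicator) (auto simp: ennreal_mult_less_top)
  show "AE x in lborel. (%n. ennreal \<bar>ball_avg (w n) x s\<bar> * indicator (cball 0 R) x) ----> 0" proof (rule AE_I2)
   fix x :: 'a
   have "(%n. ennreal \<bar>ball_avg (w n) x s\<bar>) ----> ennreal \<bar>0\<bar>" by (intro tendsto_ennrealI tendsto_rabs avg_lim)
   then show "(%n. ennreal \<bar>ball_avg (w n) x s\<bar> * indicator (cball 0 R) x) ----> 0" by (cases "x \<in> cball 0 R") auto
  qed
 qed auto
 then have "(%n. \<integral>\<^sup>+x. ennreal \<bar>ball_avg (w n) x s\<bar> * indicator (cball 0 R) x \<partial>lborel) ----> 0" by simp
 then have "eventually (%n. BN (%x. ennreal \<bar>ball_avg (w n) x s\<bar> * indicator (cball 0 R) x) < ennreal (e / 2)) sequentially"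
  using e by (intro order_tendstoD) auto
 then show "eventually (%n. BN (%x. ennreal \<bar>w n x\<bar> * indicator (cball 0 R) x) <= ennreal e) sequentially" proof eventually_elim
  case (elim n)
  have "BN (%x. ennreal \<bar>w n x\<bar> * indicator (cball 0 R) x)
   <= BN (%x. ennreal \<bar>w n x - ball_avg (w n) x s\<bar> * indicator (cball 0 R) x + ennreal \<bar>ball_avg (w n) x s\<bar> * indicator (cball 0 R) x)"
  proof (rule nn_integral_mono)
   fix x
   have "ennreal \<bar>w n x\<bar> <= ennreal (\<bar>w n x - ball_avg (w n) x s\<bar> + \<bar>ball_avg (w n) x s\<bar>)" by (intro ennreal_leI) linarith
   then show "ennreal \<bar>w n x\<bar> * indicator (cball 0 R) x <= ennreal \<bar>w n x - ball_avg (w n) x s\<bar> * indicator (cball 0 R) x + ennreal \<bar>ball_avg (w n) x s\<bar> * indicator (cball 0 R) x"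
    by (cases "x \<in> cball 0 R") auto
  qed
  also have "... = BN (%x. ennreal \<bar>w n x - ball_avg (w n) x s\<bar> * indicator (cball 0 R) x)
   + BN (%x. ennreal \<bar>ball_avg (w n) x s\<bar> * indicator (cball 0 R) x)" by (rule nn_integral_add) measurable
  also have "... <= ennreal s * ennreal K + ennreal (e / 2)" proof (intro add_mono)
   show "BN (%x. ennreal \<bar>w n x - ball_avg (w n) x s\<bar> * indicator (cball 0 R) x) <= ennreal s * ennreal K"
    using s by (intro order_trans[OF ball_avg_approx[OF w] mult_left_mono[OF K(2)]]) auto
  qed (use elim in simp)
  also have "... <= ennreal e" using s K e by (simp add: ennreal_mult[symmetric] ennreal_plus[symmetric] ennreal_leI del: ennreal_plus)
  finally show ?case .
 qed
qed

section \<open>Continuity of modulars and the Brezis--Lieb lemma\<close>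

text \<open>The constant \<open>C\<close> in \<open>norm (x + y) powr r <= (1 + eps) * norm x powr r
  + C * norm y powr r\<close>. With \<open>1 + dl = (1 + eps) powr (1 / b)\<close> it is
  \<open>(1 + 1 / dl) powr b\<close>: the first term wins if \<open>norm y <= dl * norm x\<close>,
  the second otherwise.\<close>

definition split_const :: "real => real => real" where
 "split_const eps b = (1 + 1 / ((1 + eps) powr (1 / b) - 1)) powr b"

lemma norm_add_powr_le:
 fixes eps b :: real and x y :: "'b::real_normed_vector"
 assumes e: "0 < eps" and b: "1 <= b"
 shows "0 < split_const eps b"
  and "1 <= r ==> r <= b ==> norm (x + y) powr r <= (1 + eps) * norm x powr r + split_const eps b * norm y powr r" proof -
 define dl where "dl = (1 + eps) powr (1 / b) - 1"
 have "1 < (1 + eps) powr (1 / b)" using e b by (intro gr_one_powr) auto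
 then have d: "0 < dl" by (simp add: dl_def)
 have db: "(1 + dl) powr b = 1 + eps" using e b by (simp add: dl_def powr_powr)
 have C_def: "split_const eps b = (1 + 1 / dl) powr b" by (simp add: split_const_def dl_def)
 have "0 < 1 + 1 / dl" using d by (simp add: add_pos_pos)
 then show C: "0 < split_const eps b" by (simp add: C_def)
 assume r: "1 <= r" "r <= b"
 show "norm (x + y) powr r <= (1 + eps) * norm x powr r + split_const eps b * norm y powr r" proof (cases "norm y <= dl * norm x")
  case True
  have "norm (x + y) powr r <= ((1 + dl) * norm x) powr r" using True norm_triangle_ineq[of x y] r by (intro powr_mono2) (auto simp: algebra_simps)
  also have "... = (1 + dl) powr r * norm x powr r" by (rule powr_mult)
  also have "... <= (1 + dl) powr b * norm x powr r" using d r by (intro mult_right_mono powr_mono) auto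
  finally show ?thesis using C by (simp add: db add_increasing2)
 next
  case False
  then have "norm x <= norm y / dl" using d by (simp add: field_simps)
  then have "norm (x + y) powr r <= ((1 + 1 / dl) * norm y) powr r" using norm_triangle_ineq[of x y] r by (intro powr_mono2) (auto simp: algebra_simps)
  also have "... = (1 + 1 / dl) powr r * norm y powr r" by (rule powr_mult)
  also have "... <= split_const eps b * norm y powr r" unfolding C_def using d r by (intro mult_right_mono powr_mono) auto
  finally show ?thesis using e by (simp add: add_increasing)
 qed
qed

lemma abs_norm_powr_diff_le:
 fixes eps b :: real
 assumes e: "0 < eps" and b: "1 <= b"
 obtains C where "0 < C" "!!r (x :: 'b::real_normed_vector) y. 1 <= r ==> r <= b ==>
  \<bar>norm (x + y) powr r - norm x powr r\<bar> <= eps * norm x powr r + C * norm y powr r" proof -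
 \<comment> \<open>The splitting inequality is used for the pair \<open>x\<close>, \<open>y\<close>
   and for the pair \<open>x + y\<close>, \<open>- y\<close>. The second use multiplies the first
   bound by \<open>eps'\<close> again, and \<open>eps' <= 1\<close> with
   \<open>2 * eps' <= eps\<close> absorbs the products.\<close>
 define eps' where "eps' = min 1 (eps / 2)"
 have e': "0 < eps'" "eps' <= 1" "2 * eps' <= eps" using e by (auto simp: eps'_def)
 define C where "C = split_const eps' b"
 note C = norm_add_powr_le[OF e'(1) b, folded C_def]
 show thesis proof (rule that[of "2 * C"])
  show "0 < 2 * C" using C by simp
  fix r and x y :: 'b assume r: "1 <= r" "r <= b"
  define X Y Z where "X = norm x powr r" and "Y = norm y powr r" and "Z = norm (x + y) powr r"
  have nn: "0 <= X" "0 <= Y" by (auto simp: X_def Y_def)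
  have up: "Z <= X + eps' * X + C * Y" using C(2)[OF r, of x y] by (simp add: X_def Y_def Z_def algebra_simps)
  have lo: "X <= Z + eps' * Z + C * Y" using C(2)[OF r, of "x + y" "- y"] by (simp add: X_def Y_def Z_def algebra_simps)
  have "eps' * Z <= eps' * (X + eps' * X + C * Y)" using up e' by (intro mult_left_mono) auto
  also have "... = eps' * X + eps' * (eps' * X) + eps' * (C * Y)" by (simp add: algebra_simps)
  also have "... <= eps' * X + 1 * (eps' * X) + 1 * (C * Y)" using e' nn C(1) by (intro add_mono mult_right_mono) auto
  finally have "eps' * Z <= 2 * eps' * X + C * Y" by linarith
  moreover have "2 * eps' * X <= eps * X" using e' nn by (intro mult_right_mono) auto
  moreover have "0 <= eps' * X" "0 <= C * Y" using e' nn C(1) by auto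
  ultimately have "\<bar>Z - X\<bar> <= eps * X + 2 * (C * Y)" using up lo by linarith
  then show "\<bar>norm (x + y) powr r - norm x powr r\<bar> <= eps * norm x powr r + 2 * C * norm y powr r" by (simp add: X_def Y_def Z_def)
 qed
qed

lemma modular_continuous:
 fixes a b :: "nat => 'a::euclidean_space => 'b::{real_normed_vector, second_countable_topology}"
 assumes [measurable]: "!!n. a n \<in> lmeas" "!!n. b n \<in> lmeas" "r \<in> lmeas"
  and r: "!!x. 1 <= r x" "!!x. r x <= B"
  and K: "!!n. Mod r (a n) <= ennreal K" "0 <= K"
  and lim: "(%n. \<integral>\<^sup>+x. ennreal (norm (a n x - b n x) powr r x) \<partial>lebesgue) ----> 0"
 shows "(%n. \<integral>\<^sup>+x. ennreal \<bar>norm (a n x) powr r x - norm (b n x) powr r x\<bar> \<partial>lebesgue) ----> 0" proof (rule ennreal_tendsto_0I)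
 fix e :: real assume e: "0 < e"
 define eps where "eps = e / (2 * (K + 1))"
 have eps: "0 < eps" "eps * K <= e / 2" proof -
  show "0 < eps" using e K by (simp add: eps_def)
  have "eps * K <= eps * (K + 1)" using \<open>0 < eps\<close> by (intro mult_left_mono) auto
  also have "... = e / 2" using K by (simp add: eps_def divide_simps)
  finally show "eps * K <= e / 2" .
 qed
 have B: "1 <= B" using r order_trans by blast
 obtain C where C: "0 < C" "!!r (x :: 'b) y. 1 <= r ==> r <= B ==>
  \<bar>norm (x + y) powr r - norm x powr r\<bar> <= eps * norm x powr r + C * norm y powr r" using abs_norm_powr_diff_le[OF eps(1) B, where 'b = 'b] by metis
 have "eventually (%n. LI (%x. norm (a n x - b n x) powr r x) < ennreal (e / (2 * C))) sequentially" using lim e C(1) by (intro order_tendstoD) auto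
 then show "eventually (%n. LN (%x. ennreal \<bar>norm (a n x) powr r x - norm (b n x) powr r x\<bar>) <= ennreal e) sequentially" proof eventually_elim
  case (elim n)
  have "LN (%x. ennreal \<bar>norm (a n x) powr r x - norm (b n x) powr r x\<bar>)
   <= LN (%x. ennreal eps * ennreal (norm (a n x) powr r x) + ennreal C * ennreal (norm (a n x - b n x) powr r x))" proof (rule nn_integral_mono)
   fix x
   have "\<bar>norm (a n x) powr r x - norm (b n x) powr r x\<bar> <= eps * norm (a n x) powr r x + C * norm (a n x - b n x) powr r x"
    using C(2)[OF r(1)[of x] r(2)[of x], of "a n x" "b n x - a n x"] by (simp add: abs_minus_commute norm_minus_commute)
   then show "ennreal \<bar>norm (a n x) powr r x - norm (b n x) powr r x\<bar>
    <= ennreal eps * ennreal (norm (a n x) powr r x) + ennreal C * ennreal (norm (a n x - b n x) powr r x)"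
    using eps C(1) by (simp add: ennreal_mult[symmetric] ennreal_plus[symmetric] ennreal_leI del: ennreal_plus)
  qed
  also have "... = ennreal eps * Mod r (a n)
   + ennreal C * LI (%x. norm (a n x - b n x) powr r x)" by (subst nn_integral_add) (auto simp: nn_integral_cmult)
  also have "... <= ennreal eps * ennreal K + ennreal C * ennreal (e / (2 * C))" using K elim by (intro add_mono mult_left_mono) auto
  also have "... <= ennreal e" using eps K C(1) e by (simp add: ennreal_mult[symmetric] ennreal_plus[symmetric] ennreal_leI del: ennreal_plus)
  finally show ?case .
 qed
qed

text \<open>Both quantities in the integrand may fail to be dominated, but after subtracting
  \<open>eps\<close> times \<open>\<bar>a n - b\<bar> powr r\<close> the positive part is dominated
  by a multiple of \<open>\<bar>b\<bar> powr r\<close> and tends to 0. What was subtracted has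
  integral at most \<open>eps * K\<close>.\<close>

lemma Brezis_Lieb:
 fixes a :: "nat => 'a::euclidean_space => real"
 assumes [measurable]: "!!n. a n \<in> lmeas" "b \<in> lmeas" "r \<in> lmeas"
  and r: "!!x. 1 <= r x" "!!x. r x <= B"
  and K: "!!n. LI (%x. \<bar>a n x - b x\<bar> powr r x) <= ennreal K" "0 <= K"
  and b: "Mda r b < top"
  and lim: "AE x in lebesgue. (%n. a n x) ----> b x"
 shows "(%n. \<integral>\<^sup>+x. ennreal \<bar>\<bar>a n x\<bar> powr r x - \<bar>a n x - b x\<bar> powr r x - \<bar>b x\<bar> powr r x\<bar> \<partial>lebesgue) ----> 0"
proof (rule ennreal_tendsto_0I)
 fix e :: real assume e: "0 < e"
 define eps where "eps = e / (2 * (K + 1))"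
 have eps: "0 < eps" "eps * K <= e / 2" proof -
  show "0 < eps" using e K by (simp add: eps_def)
  have "eps * K <= eps * (K + 1)" using \<open>0 < eps\<close> by (intro mult_left_mono) auto
  also have "... = e / 2" using K by (simp add: eps_def divide_simps)
  finally show "eps * K <= e / 2" .
 qed
 have B: "1 <= B" using r order_trans by blast
 obtain C where C: "0 < C" "!!r (x :: real) y. 1 <= r ==> r <= B ==>
  \<bar>norm (x + y) powr r - norm x powr r\<bar> <= eps * norm x powr r + C * norm y powr r" using abs_norm_powr_diff_le[OF eps(1) B, where 'b = real] by metis
 define D where "D n x = \<bar>\<bar>a n x\<bar> powr r x - \<bar>a n x - b x\<bar> powr r x - \<bar>b x\<bar> powr r x\<bar>" for n x
 define W where "W n x = max 0 (D n x - eps * \<bar>a n x - b x\<bar> powr r x)" for n x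
 have [measurable]: "D n \<in> lmeas" "W n \<in> lmeas" for n unfolding D_def[abs_def] W_def[abs_def] by measurable
 have W_le: "W n x <= (C + 1) * \<bar>b x\<bar> powr r x" for n x proof -
  have aux: "max 0 (\<bar>A - B - c\<bar> - E) <= (C + 1) * c" if "\<bar>A - B\<bar> <= E + C * c" "0 <= c" "0 <= C * c" for A B c E :: real
   using that by (simp add: distrib_right)
  show ?thesis unfolding W_def D_def by (rule aux) (use C(1) C(2)[OF r(1)[of x] r(2)[of x], of "a n x - b x" "b x"] in simp_all)
 qed
 have "(%n. \<integral>\<^sup>+x. ennreal (W n x) \<partial>lebesgue) ----> (\<integral>\<^sup>+x. 0 \<partial>(lebesgue :: 'a measure))"
 proof (rule nn_integral_dominated_convergence[where w = "%x. ennreal ((C + 1) * \<bar>b x\<bar> powr r x)"])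
  show "AE x in lebesgue. ennreal (W n x) <= ennreal ((C + 1) * \<bar>b x\<bar> powr r x)" for n using W_le by (intro AE_I2 ennreal_leI)
  show "LI (%x. (C + 1) * \<bar>b x\<bar> powr r x) < \<infinity>" using C(1) b by (subst ennreal_mult) (auto simp: nn_integral_cmult ennreal_mult_less_top)
  show "AE x in lebesgue. (%n. ennreal (W n x)) ----> 0" using lim proof eventually_elim
   case (elim x)
   have r0: "0 < r x" using r(1)[of x] by linarith
   have "(%n. \<bar>a n x\<bar> powr r x) ----> \<bar>b x\<bar> powr r x" using elim r0 by (intro tendsto_powr' tendsto_intros) auto
   moreover have "(%n. \<bar>a n x - b x\<bar> powr r x) ----> \<bar>b x - b x\<bar> powr r x" using elim r0 by (intro tendsto_powr' tendsto_intros) auto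
   ultimately have "(%n. W n x) ----> max 0 (\<bar>\<bar>b x\<bar> powr r x - \<bar>b x - b x\<bar> powr r x - \<bar>b x\<bar> powr r x\<bar> - eps * \<bar>b x - b x\<bar> powr r x)"
    unfolding W_def D_def by (intro tendsto_max tendsto_diff tendsto_rabs tendsto_const tendsto_mult)
   then have "(%n. W n x) ----> 0" using r0 by simp
   then show ?case using tendsto_ennrealI[of "%n. W n x" 0] by simp
  qed
 qed auto
 then have "(%n. \<integral>\<^sup>+x. ennreal (W n x) \<partial>lebesgue) ----> 0" by simp
 then have "eventually (%n. LI (%x. W n x) < ennreal (e / 2)) sequentially" using e by (intro order_tendstoD) auto
 then show "eventually (%n. LN (%x. ennreal \<bar>\<bar>a n x\<bar> powr r x - \<bar>a n x - b x\<bar> powr r x - \<bar>b x\<bar> powr r x\<bar>) <= ennreal e) sequentially"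
 proof eventually_elim
  case (elim n)
  have "LI (%x. D n x)
   <= LN (%x. ennreal (W n x) + ennreal eps * ennreal (\<bar>a n x - b x\<bar> powr r x))" proof (rule nn_integral_mono)
   fix x
   have "ennreal (D n x) <= ennreal (W n x + eps * \<bar>a n x - b x\<bar> powr r x)" by (intro ennreal_leI) (simp add: W_def)
   then show "ennreal (D n x) <= ennreal (W n x) + ennreal eps * ennreal (\<bar>a n x - b x\<bar> powr r x)" using eps by (simp add: ennreal_mult W_def)
  qed
  also have "... = LI (%x. W n x) + ennreal eps * LI (%x. \<bar>a n x - b x\<bar> powr r x)" by (subst nn_integral_add) (auto simp: nn_integral_cmult)
  also have "... <= ennreal (e / 2) + ennreal eps * ennreal K" using K elim by (intro add_mono mult_left_mono) auto
  also have "... <= ennreal e" using eps K e by (simp add: ennreal_mult[symmetric] ennreal_plus[symmetric] ennreal_leI del: ennreal_plus)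
  finally show ?case by (simp add: D_def)
 qed
qed

section \<open>Approximation by test functions\<close>

abbreviation (input) "wMod h r f \<equiv> \<integral>\<^sup>+x. ennreal (h x * norm (f x) powr r x) \<partial>lebesgue"

lemma modular_add_tendsto_0:
 fixes f g :: "nat => 'a::euclidean_space => 'b::{real_normed_vector, second_countable_topology}"
 assumes "!!n. f n \<in> lmeas" "!!n. g n \<in> lmeas" "r \<in> lmeas"
  and "!!x. 1 <= r x" "!!x. r x <= B"
  and "(%n. Mod r (f n)) ----> 0" "(%n. Mod r (g n)) ----> 0"
 shows "(%n. Mod r (%x. f n x - g n x)) ----> 0" proof (rule tendsto_sandwich[of "%_. 0"])
 have "(%n. ennreal (2 powr B) * (Mod r (f n) + Mod r (g n))) ----> ennreal (2 powr B) * (0 + 0)" using assms by (intro ennreal_tendsto_cmult tendsto_add) auto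
 then show "(%n. ennreal (2 powr B) * (Mod r (f n) + Mod r (g n))) ----> 0" by simp
 show "\<forall>\<^sub>F n in sequentially. Mod r (%x. f n x - g n x) <= ennreal (2 powr B) * (Mod r (f n) + Mod r (g n))"
  by (intro always_eventually allI modular_add_le(2) assms)
qed auto

text \<open>A triangle inequality with a factor close to 1 on the main part \<open>b\<close>. One
  error, \<open>d\<close>, keeps the weight \<open>h\<close>, the other, \<open>e\<close>, loses it:
  in the uses \<open>d\<close> is fixed and small in the weighted sense, and \<open>e\<close> tends
  to 0 globally.\<close>

lemma weighted_modular_add_le:
 fixes eps B :: real and h :: "'a::euclidean_space => real" and a b d e :: "'a => 'b::{real_normed_vector, second_countable_topology}"
 assumes eps: "0 < eps" and r[measurable]: "r \<in> lmeas" and r1: "!!x. 1 <= r x" "!!x. r x <= B"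
  and [measurable]: "h \<in> lmeas" "b \<in> lmeas" "d \<in> lmeas" "e \<in> lmeas"
  and h: "!!x. 0 <= h x & h x <= 1" and a: "!!x. a x = b x + (d x + e x)"
 shows "wMod h r a <= ennreal (1 + eps) * wMod h r b + ennreal (split_const eps B * 2 powr B) * (wMod h r d + Mod r e)" proof -
 have B: "1 <= B" using r1 order_trans by blast
 define C where "C = split_const eps B"
 note C = norm_add_powr_le[OF eps B, folded C_def]
  have "wMod h r a <= LN (%x. ennreal (1 + eps) * ennreal (h x * norm (b x) powr r x)
   + ennreal (C * 2 powr B) * (ennreal (h x * norm (d x) powr r x) + ennreal (norm (e x) powr r x)))" proof (rule nn_integral_mono)
   fix x
   have h': "0 <= h x" "h x <= 1" using h[of x] by auto
   have "norm (a x) powr r x <= (1 + eps) * norm (b x) powr r x + C * norm (d x + e x) powr r x" unfolding a by (rule C(2)[OF r1])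
   also have "... <= (1 + eps) * norm (b x) powr r x + C * (norm (d x) + norm (e x)) powr r x"
    using C(1) r1(1)[of x] by (intro add_left_mono mult_left_mono powr_mono2 norm_triangle_ineq) auto
   also have "... <= (1 + eps) * norm (b x) powr r x + C * (2 powr B * (norm (d x) powr r x + norm (e x) powr r x))"
    using C(1) r1 by (intro add_left_mono mult_left_mono powr_add_le) auto
   finally have "h x * norm (a x) powr r x
    <= h x * ((1 + eps) * norm (b x) powr r x + C * (2 powr B * (norm (d x) powr r x + norm (e x) powr r x)))" using h' by (intro mult_left_mono)
   also have "... = (1 + eps) * (h x * norm (b x) powr r x) + C * 2 powr B * (h x * norm (d x) powr r x + h x * norm (e x) powr r x)" by (simp add: algebra_simps)
   also have "... <= (1 + eps) * (h x * norm (b x) powr r x) + C * 2 powr B * (h x * norm (d x) powr r x + 1 * norm (e x) powr r x)"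
    using C(1) h' by (intro add_left_mono mult_left_mono mult_right_mono) auto
   finally show "ennreal (h x * norm (a x) powr r x) <= ennreal (1 + eps) * ennreal (h x * norm (b x) powr r x)
     + ennreal (C * 2 powr B) * (ennreal (h x * norm (d x) powr r x) + ennreal (norm (e x) powr r x))"
    using h' eps C(1) by (simp add: ennreal_leI flip: ennreal_plus ennreal_mult)
  qed
  also have "... = ennreal (1 + eps) * wMod h r b + ennreal (C * 2 powr B) * (wMod h r d + Mod r e)"
   by (subst nn_integral_add, measurable, (subst nn_integral_cmult, measurable)+, subst nn_integral_add) auto
  finally show ?thesis by (simp add: C_def)
qed

lemma L1_loc_tendsto_0_of_modular:
 fixes f :: "nat => 'a::euclidean_space => real"
 assumes [measurable]: "!!n. f n \<in> lmeas" "r \<in> lmeas"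
  and r: "!!x. 1 <= r x" "!!x. r x <= B" and lim: "(%n. Mod r (f n)) ----> 0"
 shows "(%n. L1ball R (f n)) ----> 0" proof (rule ennreal_tendsto_0I)
 fix e :: real assume e: "0 < e"
 have [measurable]: "cball (0::'a) R \<in> sets lebesgue" by simp
 obtain V where V: "emeasure lebesgue (cball (0::'a) R) = ennreal V" "0 <= V" using emeasure_cball_finite .
 define l where "l = min 1 (e / (2 * (V + 1)))"
 have l: "0 < l" "l <= 1" "l * V <= e / 2" proof -
  show "0 < l" "l <= 1" using e V by (auto simp: l_def)
  have "l * V <= e / (2 * (V + 1)) * (V + 1)" using e V by (intro mult_mono) (auto simp: l_def)
  also have "... = e / 2" using V by (simp add: divide_simps)
  finally show "l * V <= e / 2" .
 qed
 define D where "D = l powr (1 - B)"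
 have D: "0 < D" using l by (simp add: D_def)
 have pt: "t <= l + D * t powr s" if "0 <= t" "1 <= s" "s <= B" for t s :: real proof (cases "t <= l")
  case True
  then show ?thesis using D by (simp add: add_increasing2)
 next
  case False
  have "t = t powr (1 - s) * t powr s" using False l by (simp flip: powr_add)
  also have "... <= l powr (1 - s) * t powr s" using False l that by (intro mult_right_mono powr_mono2') auto
  also have "... <= D * t powr s" unfolding D_def using l that by (intro mult_right_mono powr_mono') auto
  finally show ?thesis using l by simp
 qed
 have "eventually (%n. Mod r (f n) < ennreal (e / (2 * D))) sequentially" using lim e D by (intro order_tendstoD) auto
 then show "eventually (%n. L1ball R (f n) <= ennreal e) sequentially" proof eventually_elim
  case (elim n)
  have "L1ball R (f n) <= LN (%x. ennreal l * indicator (cball 0 R) x + ennreal D * ennreal (norm (f n x) powr r x))" using pt[OF abs_ge_zero r] l D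
   by (intro nn_integral_mono) (auto simp: indicator_def ennreal_leI simp flip: ennreal_plus ennreal_mult)
  also have "... = ennreal l * ennreal V + ennreal D * Mod r (f n)" by (subst nn_integral_add) (auto simp: nn_integral_cmult nn_integral_cmult_indicator V)
  also have "... <= ennreal l * ennreal V + ennreal D * ennreal (e / (2 * D))" using elim by (intro add_left_mono mult_left_mono) auto
  also have "... = ennreal (l * V + e / 2)" using l D e V by (simp flip: ennreal_plus ennreal_mult)
  also have "... <= ennreal e" using l by (intro ennreal_leI) simp
  finally show ?case .
 qed
qed

text \<open>Below the height \<open>T\<close> the power \<open>r\<close> is a multiple of
  \<open>\<bar>w n\<bar>\<close>, which tends to 0 in L1; above it the gap \<open>kp\<close> gains
  the factor \<open>T powr (- kp)\<close> against the bounded \<open>s\<close>-modular.\<close>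

lemma interpolation_tendsto_0:
 fixes w :: "nat => 'a::euclidean_space => real"
 assumes [measurable]: "!!n. w n \<in> lmeas" "r \<in> lmeas" "s \<in> lmeas" "A \<in> sets lebesgue"
  and A: "A \<subseteq> cball 0 R" and r: "!!x. x \<in> A ==> 1 <= r x" "!!x. x \<in> A ==> r x + kp <= s x" "!!x. s x <= B" and kp: "0 < kp"
  and K: "!!n. Mod s (w n) <= ennreal K" "0 <= K" and lim: "(%n. L1ball R (w n)) ----> 0"
 shows "(%n. wMod (indicator A) r (w n)) ----> 0" proof (rule ennreal_tendsto_0I)
 fix e :: real assume e: "0 < e"
 have [measurable]: "cball (0::'a) R \<in> sets lebesgue" by simp
 \<comment> \<open>Chosen so that \<open>T powr (- kp) = e / (e + 2 * K)\<close>, whose product with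
   \<open>K\<close> is at most \<open>e / 2\<close>.\<close>
 define T where "T = (1 + 2 * K / e) powr (1 / kp)"
 have T1: "1 <= T" unfolding T_def using e K kp by (intro ge_one_powr_ge_zero) auto
 have "T powr (- kp) = e / (e + 2 * K)" using e K kp by (simp add: T_def powr_powr powr_minus field_simps)
 moreover have "e / (e + 2 * K) * K = e * K / (e + 2 * K)" "e * K / (e + 2 * K) <= e / 2" using e K by (simp, simp add: field_simps)
 ultimately have T2: "T powr (- kp) * K <= e / 2" by simp
 have pt: "t powr r x <= T powr B * t + T powr (- kp) * t powr s x" if t: "0 <= t" and x: "x \<in> A" for t x proof (cases "t <= T")
  case True
  have "t powr r x <= T powr B * t" proof (cases "t = 0")
   case False
   have "t powr r x = t powr (r x - 1) * t" using False t by (simp add: powr_diff)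
   also have "... <= T powr (r x - 1) * t" using True t r(1)[OF x] by (intro mult_right_mono powr_mono2) auto
   also have "... <= T powr B * t" using T1 t r(2)[OF x] r(3)[of x] kp by (intro mult_right_mono powr_mono) auto
   finally show ?thesis .
  qed simp
  then show ?thesis by (simp add: add_increasing2)
 next
  case False
  have "t powr r x = t powr (r x - s x) * t powr s x" by (simp flip: powr_add)
  also have "... <= T powr (r x - s x) * t powr s x" using False T1 r(2)[OF x] kp by (intro mult_right_mono powr_mono2') auto
  also have "... <= T powr (- kp) * t powr s x" using T1 r(2)[OF x] by (intro mult_right_mono powr_mono) auto
  finally show ?thesis using t by (simp add: add_increasing)
 qed
 define D where "D = T powr B"
 have D: "0 < D" using T1 by (simp add: D_def)
 have "eventually (%n. L1ball R (w n) < ennreal (e / (2 * D))) sequentially" using lim e D by (intro order_tendstoD) auto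
 then show "eventually (%n. wMod (indicator A) r (w n) <= ennreal e) sequentially" proof eventually_elim
  case (elim n)
  have "wMod (indicator A) r (w n)
   <= LN (%x. ennreal D * (ennreal \<bar>w n x\<bar> * indicator (cball 0 R) x) + ennreal (T powr (- kp)) * ennreal (norm (w n x) powr s x))"
  proof (rule nn_integral_mono)
   fix x
   show "ennreal (indicator A x * norm (w n x) powr r x)
    <= ennreal D * (ennreal \<bar>w n x\<bar> * indicator (cball 0 R) x) + ennreal (T powr (- kp)) * ennreal (norm (w n x) powr s x)"
    using pt[OF abs_ge_zero, of x "w n x"] A D by (cases "x \<in> A") (auto simp: D_def ennreal_leI simp flip: ennreal_plus ennreal_mult)
  qed
  also have "... = ennreal D * L1ball R (w n) + ennreal (T powr (- kp)) * Mod s (w n)" by (subst nn_integral_add) (auto simp: nn_integral_cmult)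
  also have "... <= ennreal D * ennreal (e / (2 * D)) + ennreal (T powr (- kp)) * ennreal K" using elim K by (intro add_mono mult_left_mono) auto
  also have "... = ennreal (e / 2 + T powr (- kp) * K)" using D e K by (simp flip: ennreal_plus ennreal_mult)
  also have "... <= ennreal e" using T2 by (intro ennreal_leI) simp
  finally show ?case .
 qed
qed

lemma ennreal_tendsto_0_mono:
 fixes X Y :: "nat => ennreal"
 assumes "!!n. X n <= Y n" "Y ----> 0"
 shows "X ----> 0" using assms by (intro tendsto_sandwich[of "%_. 0" X sequentially Y]) (auto intro!: always_eventually)

lemma modular_bounded_diff:
 fixes f g h :: "nat => 'a::euclidean_space => 'b::{real_normed_vector, second_countable_topology}"
 assumes [measurable]: "!!n. f n \<in> lmeas" "!!n. g n \<in> lmeas" "r \<in> lmeas"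
  and r: "!!x. 1 <= r x" "!!x. r x <= B"
  and f: "\<exists>K\<ge>0. \<forall>n. Mod r (f n) <= ennreal K" and g: "\<exists>K\<ge>0. \<forall>n. Mod r (g n) <= ennreal K"
  and h: "!!n x. h n x = f n x - g n x"
 shows "\<exists>K\<ge>0. \<forall>n. Mod r (h n) <= ennreal K" proof -
 obtain K L where K: "0 <= K" "!!n. Mod r (f n) <= ennreal K" and L: "0 <= L" "!!n. Mod r (g n) <= ennreal L" using f g by blast
 have "Mod r (h n) <= ennreal (2 powr B * (K + L))" for n proof -
  have "Mod r (h n) <= ennreal (2 powr B) * (Mod r (f n) + Mod r (g n))" unfolding h by (rule modular_add_le(2)[OF _ _ _ r]) measurable
  also have "... <= ennreal (2 powr B) * (ennreal K + ennreal L)" by (intro mult_left_mono add_mono K L) auto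
  also have "... = ennreal (2 powr B * (K + L))" using K(1) L(1) by (simp add: ennreal_mult)
  finally show ?thesis .
 qed
 then show ?thesis using K(1) L(1) by (intro exI[of _ "2 powr B * (K + L)"]) auto
qed

context exponents
begin

lemma modular_test_bounded:
 assumes "0 <= K"
 obtains K' where "0 <= K'" "!!phi. phi \<in> tests ==> Mod p (grad phi) <= ennreal K ==>
  Mod ps phi <= ennreal K' & Mod q phi <= ennreal K'" proof -
 obtain C where C: "0 < C" "!!phi. phi \<in> tests ==>
  BI (%x. norm (grad phi x) powr p x) <= 1 ==>
  BI (%x. \<bar>phi x\<bar> powr ps x) <= ennreal C" using sobolev_ps by blast
 define l where "l = max 1 K"
 have l: "1 <= l" "K <= l" by (auto simp: l_def)
 obtain C' where C': "0 < C'" "!!t. t \<in> lmeas ==> (!!x. 0 <= t x) ==>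
  LI (%x. t x powr ps x) <= ennreal (l powr psp * C) ==>
  LI (%x. t x powr q x) <= ennreal C'" using sobolev_q_of_ps[of "l powr psp * C"] C(1) by auto
 show thesis proof (rule that[of "max (l powr psp * C) C'"])
  show "0 <= max (l powr psp * C) C'" using C'(1) by simp
  fix phi :: "'a => real" assume phi: "phi \<in> tests" and le: "Mod p (grad phi) <= ennreal K"
  note [measurable] = test_lebesgue[OF phi]
  have "LI (%x. (norm (grad phi x) / l) powr p x) <= LN (%x. ennreal (1 / l) * ennreal (norm (grad phi x) powr p x))" proof (rule nn_integral_mono)
   fix x
   have "l powr 1 <= l powr p x" using l p_gt_1[of x] by (intro powr_mono) auto
   then have "norm (grad phi x) powr p x / l powr p x <= norm (grad phi x) powr p x / l" using l by (intro divide_left_mono) auto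
   then show "ennreal ((norm (grad phi x) / l) powr p x) <= ennreal (1 / l) * ennreal (norm (grad phi x) powr p x)"
    using l by (simp add: powr_divide ennreal_leI flip: ennreal_mult)
  qed
  also have "... <= ennreal (1 / l) * ennreal K" using le by (simp add: nn_integral_cmult mult_left_mono)
  also have "... <= 1" using l assms by (simp flip: ennreal_mult)
  finally have "LI (%x. (\<bar>phi x\<bar> / l) powr ps x) <= ennreal C" using l by (intro sobolev_ps_scaled[OF C(2) phi]) auto
  then have "ennreal (l powr psp) * LI (%x. (\<bar>phi x\<bar> / l) powr ps x) <= ennreal (l powr psp * C)" using C(1) by (simp add: ennreal_mult mult_left_mono)
  with modular_scale_le[of phi ps psp l] have *: "Mda ps phi <= ennreal (l powr psp * C)" using l ps_gt_1 ps_le by (auto simp: less_imp_le max_def split: if_splits)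
  then have "Mda q phi <= ennreal C'" by (intro C'(2)) auto
  with * show "Mod ps phi <= ennreal (max (l powr psp * C) C') & Mod q phi <= ennreal (max (l powr psp * C) C')"
   unfolding real_norm_def by (meson ennreal_leI max.cobounded1 max.cobounded2 order_trans)
 qed
qed

text \<open>\<open>u n\<close> and \<open>u0\<close> are replaced by test functions
  \<open>psi n\<close> and \<open>zt n\<close> up to errors \<open>1 / (n + 1)\<close> in all
  modulars, and \<open>w n\<close> is their difference. Weak convergence of \<open>u n\<close> then
  passes to integrals of \<open>w n\<close> against bounded functions of bounded support, which
  \<open>test_L1_loc_tendsto_0\<close> turns into strong local convergence.\<close>

lemma approximating_sequence:
 assumes conv: "weakly_converges_D1 p u u0"
 obtains w K where "!!n. w n \<in> tests" "0 <= K"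
  "(%n. Mod p (%x. wgr (u n) x - wgr u0 x - grad (w n) x)) ----> 0"
  "(%n. Mod q (%x. u n x - u0 x - w n x)) ----> 0"
  "!!n. Mod p (wgr (u n)) <= ennreal K" "!!n. Mod q (u n) <= ennreal K"
  "!!n. Mod p (grad (w n)) <= ennreal K" "!!n. Mod ps (w n) <= ennreal K" "!!n. Mod q (w n) <= ennreal K"
  "!!R. (%n. L1ball R (w n)) ----> 0" "!!R. (%n. L1ball R (%x. u n x - u0 x)) ----> 0"
  "Mod q u0 < top" proof -
 have u: "u n \<in> D1 p" and u0: "u0 \<in> D1 p" for n using conv by (auto simp: weakly_converges_D1_def)
 note [measurable] = D1_D(2,3)[OF u] D1_D(2,3)[OF u0]
 note pb = less_imp_le[OF p_gt_1] p_le note qb = q_ge_1 q_le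
 note psb = less_imp_le[OF ps_gt_1] ps_le
 define A where "A phi v n = (phi \<in> tests & Mod p (%x. wgr v x - grad phi x) <= ennreal (1 / real (Suc n)) &
  Mod ps (%x. v x - phi x) <= ennreal (1 / real (Suc n)) & Mod q (%x. v x - phi x) <= ennreal (1 / real (Suc n)))" for phi v n
 have ex: "\<exists>phi. A phi v n" if "v \<in> D1 p" for v n proof -
  have "0 < 1 / real (Suc n)" by simp
  from D1_approx[OF that this] show ?thesis unfolding A_def real_norm_def by blast
 qed
 have "\<forall>n. \<exists>phi. A phi (u n) n" "\<forall>n. \<exists>phi. A phi u0 n" using ex u u0 by blast+
 from this[THEN choice] obtain psi zt where "\<forall>n. A (psi n) (u n) n" "\<forall>n. A (zt n) u0 n" by blast
 then have A: "A (psi n) (u n) n" "A (zt n) u0 n" for n by blast+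
 note A' = A[unfolded A_def]
 have psi: "psi n \<in> tests" and zt: "zt n \<in> tests" for n using A' by blast+
 note [measurable] = test_lebesgue[OF psi] test_lebesgue[OF zt]
 have inv: "X ----> 0" if "!!n. X n <= ennreal (1 / real (Suc n))" for X
  using that tendsto_ennrealI[OF LIMSEQ_inverse_real_of_nat] by (elim ennreal_tendsto_0_mono) (simp add: inverse_eq_divide)
 have bnd: "\<exists>K\<ge>0. \<forall>n. X n <= ennreal K" if X: "!!n. X n <= ennreal (1 / real (Suc n))" for X proof (intro exI[of _ 1] conjI allI)
  show "X n <= ennreal 1" for n by (rule order_trans[OF X ennreal_leI]) (simp add: field_simps)
 qed simp
 have fin: "\<exists>K\<ge>0. \<forall>n::nat. X <= ennreal K" if "X < top" for X using that by (cases X) auto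
 define w where "w n x = psi n x - zt n x" for n x
 have w: "w n \<in> tests" for n unfolding w_def[abs_def] by (rule test_diff[OF psi zt])
 have gw: "grad (w n) x = grad (psi n) x - grad (zt n) x" for n x unfolding w_def[abs_def] by (intro grad_diff test_differentiable[OF psi] test_differentiable[OF zt])
 note [measurable] = test_lebesgue[OF w]
 define e where "e n x = u n x - u0 x - w n x" for n x
 define g where "g n x = wgr (u n) x - wgr u0 x - grad (w n) x" for n x
 have e_eq: "e n x = (u n x - psi n x) - (u0 x - zt n x)" and
  g_eq: "g n x = (wgr (u n) x - grad (psi n) x) - (wgr u0 x - grad (zt n) x)" for n x by (auto simp: e_def g_def gw w_def)
 have [measurable]: "e n \<in> lmeas" "g n \<in> lmeas" for n unfolding e_def[abs_def] g_def[abs_def] by measurable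
 have e0: "(%n. Mod ps (e n)) ----> 0" "(%n. Mod q (e n)) ----> 0" and g0: "(%n. Mod p (g n)) ----> 0" unfolding e_eq g_eq
  subgoal by (rule modular_add_tendsto_0[OF _ _ _ psb inv inv]) (use A' in auto)
  subgoal by (rule modular_add_tendsto_0[OF _ _ _ qb inv inv]) (use A' in auto)
  subgoal by (rule modular_add_tendsto_0[OF _ _ _ pb inv inv]) (use A' in auto)
  done
 have bg: "\<exists>K\<ge>0. \<forall>n. Mod p (g n) <= ennreal K" by (rule modular_bounded_diff[OF _ _ _ pb bnd bnd g_eq]) (use A' in auto)
 have beps: "\<exists>K\<ge>0. \<forall>n. Mod ps (e n) <= ennreal K" by (rule modular_bounded_diff[OF _ _ _ psb bnd bnd e_eq]) (use A' in auto)
 have beq: "\<exists>K\<ge>0. \<forall>n. Mod q (e n) <= ennreal K" by (rule modular_bounded_diff[OF _ _ _ qb bnd bnd e_eq]) (use A' in auto)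
 obtain K1 where K1: "0 <= K1" "!!n. Mod p (wgr (u n)) <= ennreal K1" using weak_imp_bounded[OF conv] by blast
 have bd: "\<exists>K\<ge>0. \<forall>n. Mod p (%x. wgr (u n) x - wgr u0 x) <= ennreal K"
  by (rule modular_bounded_diff[OF _ _ _ pb _ fin[OF D1_D(4)[OF u0]]]) (use K1 in auto)
 have "\<exists>K\<ge>0. \<forall>n. Mod p (grad (w n)) <= ennreal K" by (rule modular_bounded_diff[OF _ _ _ pb bd bg]) (auto simp: g_def)
 then obtain K4 where K4: "0 <= K4" "!!n. Mod p (grad (w n)) <= ennreal K4" by blast
 obtain K5 where K5: "0 <= K5" "!!n. Mod ps (w n) <= ennreal K5" "!!n. Mod q (w n) <= ennreal K5" by (rule modular_test_bounded[OF K4(1)]) (use K4(2) w in blast)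
 have u0q: "Mod q u0 < top" proof -
  have z: "u0 = (%x. (u0 x - zt 0 x) + zt 0 x)" by auto
  have "Mod q u0 <= ennreal (2 powr psp) * (Mod q (%x. u0 x - zt 0 x) + Mod q (zt 0))" by (subst z, rule modular_add_le(1)[OF _ _ _ qb]) measurable
  also have "... < top" using test_modular_finite(1)[OF zt[of 0] qb] A'(2)[of 0] by (auto simp: ennreal_mult_less_top intro: order_le_less_trans)
  finally show ?thesis .
 qed
 have bd: "\<exists>K\<ge>0. \<forall>n. Mod q (%x. - w n x - u0 x) <= ennreal K" by (rule modular_bounded_diff[OF _ _ _ qb _ fin[OF u0q]]) (use K5 in auto)
 have "\<exists>K\<ge>0. \<forall>n. Mod q (u n) <= ennreal K" by (rule modular_bounded_diff[OF _ _ _ qb beq bd]) (auto simp: e_def)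
 then obtain K9 where K9: "0 <= K9" "!!n. Mod q (u n) <= ennreal K9" by blast
 have eL: "(%n. L1ball R (e n)) ----> 0" for R by (rule L1_loc_tendsto_0_of_modular[OF _ _ psb e0(1)]) auto
 have loc: "\<exists>K\<ge>0. \<forall>n. LN (%x. ennreal (norm (f n x)) * indicator (cball 0 R) x) <= ennreal K"
  if [measurable]: "!!n. f n \<in> lmeas" "r \<in> lmeas" and r: "!!x. 1 <= r x" and K: "\<exists>K\<ge>0. \<forall>n. Mod r (f n) <= ennreal K"
  for f :: "nat => 'a => 'b::{real_normed_vector, second_countable_topology}" and r R proof -
  obtain K where K: "0 <= K" "!!n. Mod r (f n) <= ennreal K" using K by blast
  obtain V where V: "emeasure lebesgue (cball (0::'a) R) = ennreal V" "0 <= V" using emeasure_cball_finite .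
  have "LN (%x. ennreal (norm (f n x)) * indicator (cball 0 R) x) <= ennreal (1 * (V + K))" for n using K V r by (intro nn_integral_le_modular[where r = r]) auto
  then show ?thesis using V K by (intro exI[of _ "V + K"]) auto
 qed
 have bw: "\<exists>K\<ge>0. \<forall>n. Mod ps (w n) <= ennreal K" and bgw: "\<exists>K\<ge>0. \<forall>n. Mod p (grad (w n)) <= ennreal K" using K4 K5 by blast+
 have locw: "\<exists>K\<ge>0. \<forall>n. L1ball R (w n) <= ennreal K" for R unfolding real_norm_def[symmetric] by (rule loc[OF _ _ psb(1) bw]) auto
 have loce: "\<exists>K\<ge>0. \<forall>n. L1ball R (e n) <= ennreal K" for R unfolding real_norm_def[symmetric] by (rule loc[OF _ _ psb(1) beps]) auto
 have wL: "(%n. L1ball R (w n)) ----> 0" for R proof (rule test_L1_loc_tendsto_0[OF w _ _ locw])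
  show "\<exists>K\<ge>0. \<forall>n. LN (%x. ennreal (norm (grad (w n) x)) * indicator (cball 0 R) x) <= ennreal K" for R by (rule loc[OF _ _ pb(1) bgw]) auto
 next
  fix k :: "'a => real" and B R assume k: "k \<in> borel_measurable borel" "!!x. \<bar>k x\<bar> <= B" "!!x. R < norm x ==> k x = 0"
  have km[measurable]: "k \<in> lmeas" using k(1) by (rule borel_lebesgue)
  have W: "(%u. \<integral>x. u x * k x \<partial>lebesgue) \<in> D1_dual p" "!!u. u \<in> D1 p ==> integrable lebesgue (%x. u x * k x)"
   by (rule weighted_integral_functional[OF km, of B R]; use k in blast)+
  have wi: "integrable lebesgue (%x. w n x * k x)" for n using locw[of R] weighted_integral_bound(1)[OF _ km k(2) k(3), of "w n"] by auto
  have ei: "LB (%x. e n x * k x) = LB (%x. u n x * k x) - LB (%x. u0 x * k x) - LB (%x. w n x * k x)" for n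
   using W(2)[OF u] W(2)[OF u0] wi by (simp add: e_def left_diff_distrib)
  have E: "(%n. \<integral>x. e n x * k x \<partial>lebesgue) ----> 0" proof (rule Lim_null_comparison)
   have top: "L1ball R (e n) < top" for n using loce[of R] by (auto intro: order_le_less_trans)
   have "\<bar>\<integral>x. e n x * k x \<partial>lebesgue\<bar> <= B * enn2real (L1ball R (e n))" for n
    by (rule weighted_integral_bound(2)[OF _ km k(2) k(3)]) (use top in auto)
   then show "\<forall>\<^sub>F n in sequentially. norm (LB (%x. e n x * k x)) <= B * enn2real (L1ball R (e n))" by simp
   show "(%n. B * enn2real (L1ball R (e n))) ----> 0" by (intro tendsto_mult_right_zero tendsto_enn2real) (use eL[of R] in auto)
  qed
  have U: "(%n. \<integral>x. u n x * k x \<partial>lebesgue) ----> LB (%x. u0 x * k x)" using conv W(1) by (auto simp: weakly_converges_D1_def)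
  show "(%n. \<integral>x. w n x * k x \<partial>lebesgue) ----> 0"
   using tendsto_diff[OF tendsto_diff[OF U tendsto_const] E, of "\<integral>x. u0 x * k x \<partial>lebesgue"] by (simp add: ei)
 qed
 have uL: "(%n. L1ball R (%x. u n x - u0 x)) ----> 0" for R proof -
  have [measurable]: "cball (0::'a) R \<in> sets lebesgue" by simp
  have "L1ball R (%x. u n x - u0 x) <= L1ball R (e n) + L1ball R (w n)" for n proof -
   have "L1ball R (%x. u n x - u0 x) <= LN (%x. ennreal \<bar>e n x\<bar> * indicator (cball 0 R) x + ennreal \<bar>w n x\<bar> * indicator (cball 0 R) x)"
    by (intro nn_integral_mono) (auto simp: e_def indicator_def ennreal_leI simp flip: ennreal_plus)
   also have "... = L1ball R (e n) + L1ball R (w n)" by (rule nn_integral_add) measurable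
   finally show ?thesis .
  qed
  then show ?thesis by (rule ennreal_tendsto_0_mono) (use tendsto_add[OF eL[of R] wL[of R]] in simp)
 qed
 define K where "K = K1 + K4 + K5 + K9"
 have KM: "K1 <= K" "K4 <= K" "K5 <= K" "K9 <= K" "0 <= K" using K1 K4 K5 K9 by (auto simp: K_def)
 note KE = KM(1-4)[THEN ennreal_leI]
 show thesis by (rule that[OF w KM(5) g0[unfolded g_def] e0(2)[unfolded e_def]
    order_trans[OF K1(2) KE(1)] order_trans[OF K9(2) KE(4)] order_trans[OF K4(2) KE(2)]
    order_trans[OF K5(2) KE(3)] order_trans[OF K5(3) KE(3)] wL uL u0q])
qed

end

section \<open>Vague limits\<close>

text \<open>Truncation at 1 and the weight \<open>decay\<close> convert convergence on all balls
  into one global L1 convergence, so that a single subsequence serves the whole space; as the weight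
  is positive it can be divided out afterwards.\<close>

lemma AE_subsequence_of_L1_loc:
 fixes v :: "nat => 'a::euclidean_space => real"
 assumes [measurable]: "!!n. v n \<in> lmeas" and lim: "!!R. (%n. L1ball R (v n)) ----> 0"
 shows "\<exists>k. strict_mono k & (AE x in lebesgue. (%n. v (k n) x) ----> 0)" proof -
 have dm: "(decay :: 'a => real) \<in> borel_measurable borel" unfolding decay_def[abs_def] by measurable
 note [measurable] = dm borel_lebesgue[OF dm]
 have d1: "decay y <= 1" "0 < decay y" for y :: 'a unfolding decay_def using powr_mono2'[of "- (real DIM('a) + 1)" 1 "1 + norm y"] add_pos_nonneg[of 1 "norm y"] by auto
 have fin: "LI (%y::'a. decay y) < \<infinity>" using nn_integral_decay by (simp add: nn_integral_completion)
 have [measurable]: "cball (0::'a) R \<in> sets lebesgue" for R by simp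
 define g where "g n x = min 1 \<bar>v n x\<bar> * decay x" for n x
 have [measurable]: "g n \<in> lmeas" for n unfolding g_def[abs_def] by measurable
 have g0: "0 <= g n x" for n x using d1(2)[of x] by (simp add: g_def)
 have g_le: "g n x <= decay x" "g n x <= \<bar>v n x\<bar>" for n x
  using d1[of x] mult_right_mono[of "min 1 \<bar>v n x\<bar>" 1 "decay x"] mult_mono[of "min 1 \<bar>v n x\<bar>" "\<bar>v n x\<bar>" "decay x" 1] by (auto simp: g_def)
 have gi: "integrable lebesgue (g n)" for n proof (rule integrableI_bounded)
  have "LI (%x. norm (g n x)) <= LI (%y::'a. decay y)" using g0 g_le by (intro nn_integral_mono ennreal_leI) auto
  then show "LI (%x. norm (g n x)) < \<infinity>" using fin by (rule order_le_less_trans)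
 qed measurable
 have "(%n. \<integral>\<^sup>+x. ennreal (g n x) \<partial>lebesgue) ----> 0" proof (rule ennreal_tendsto_0I)
  fix e :: real assume e: "0 < e"
  have "(%j. \<integral>\<^sup>+x. ennreal (decay x) * indicator (- cball 0 (real j)) x \<partial>(lebesgue :: 'a measure)) ----> (\<integral>\<^sup>+x. 0 \<partial>(lebesgue :: 'a measure))"
  proof (rule nn_integral_dominated_convergence[where w = "%x. ennreal (decay x)"])
   show "AE x in lebesgue. (%j. ennreal (decay x) * indicator (- cball (0::'a) (real j)) x) ----> 0" proof (rule AE_I2)
    fix x :: 'a
    obtain N where "norm x <= real N" using real_arch_simple by blast
    then show "(%j. ennreal (decay x) * indicator (- cball (0::'a) (real j)) x) ----> 0" by (intro tendsto_eventually eventually_sequentiallyI[of N]) auto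
   qed
   show "LI (%x::'a. decay x) < \<infinity>" by (rule fin)
  qed (measurable, auto simp: indicator_def)
  then have "eventually (%j. (\<integral>\<^sup>+x. ennreal (decay x) * indicator (- cball 0 (real j)) x \<partial>(lebesgue :: 'a measure)) < ennreal (e / 2)) sequentially"
   using e by (intro order_tendstoD) auto
  then obtain j where j: "LN (%x. ennreal (decay x) * indicator (- cball (0::'a) (real j)) x) < ennreal (e / 2)" by (auto simp: eventually_sequentially)
  have "eventually (%n. L1ball (real j) (v n) < ennreal (e / 2)) sequentially" using lim e by (intro order_tendstoD) auto
  then show "eventually (%n. LI (%x. g n x) <= ennreal e) sequentially" proof eventually_elim
   case (elim n)
   have "LI (%x. g n x) <= LN (%x. ennreal \<bar>v n x\<bar> * indicator (cball 0 (real j)) x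
    + ennreal (decay x) * indicator (- cball 0 (real j)) x)" using g_le by (intro nn_integral_mono) (auto simp: indicator_def ennreal_leI)
   also have "... = L1ball (real j) (v n) + LN (%x. ennreal (decay x) * indicator (- cball (0::'a) (real j)) x)" by (rule nn_integral_add) measurable
   also have "... <= ennreal (e / 2) + ennreal (e / 2)" using elim j by (intro add_mono) auto
   also have "... = ennreal e" using e by (simp flip: ennreal_plus)
   finally show ?case .
  qed
 qed
 then have "(%n. ennreal (LB (%x. norm (g n x)))) ----> ennreal 0" using g0 gi by (simp add: nn_integral_eq_integral)
 then have "(%n. \<integral>x. norm (g n x) \<partial>lebesgue) ----> 0" by (subst (asm) tendsto_ennreal_iff) auto
 from tendsto_L1_AE_subseq[OF gi this] obtain k where k: "strict_mono k" "AE x in lebesgue. (%n. g (k n) x) ----> 0" by blast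
 from k(2) have "AE x in lebesgue. (%n. v (k n) x) ----> 0" proof eventually_elim
  case (elim x)
  have "(%n. min 1 \<bar>v (k n) x\<bar>) ----> 0" using tendsto_divide[OF elim tendsto_const[of "decay x"]] d1(2)[of x] by (simp add: g_def)
  then have *: "eventually (%n. min 1 \<bar>v (k n) x\<bar> < min 1 e) sequentially" if "0 < e" for e :: real using that by (intro order_tendstoD) auto
  have "eventually (%n. \<bar>v (k n) x\<bar> < e) sequentially" if "0 < e" for e :: real
   using *[OF that] by (rule eventually_mono) (use that in \<open>auto simp: min_def split: if_splits\<close>)
  then show ?case by (simp add: tendsto_iff)
 qed
 with k(1) show ?thesis by blast
qed

lemma weakly_converges_measure_nn:
 fixes g :: "nat => 'a::euclidean_space => 'b::{real_normed_vector, second_countable_topology}"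
 assumes conv: "weakly_converges_measure (%n. power_measure r (g n)) M" and M: "finite_measure M" "sets M = sets borel"
  and [measurable]: "!!n. g n \<in> lmeas" "r \<in> lmeas"
  and K: "!!n. Mod r (g n) <= ennreal K"
  and f: "continuous_on UNIV f" "compact (closure {x. f x ~= 0})" "!!x. 0 <= f x"
 shows "(%n. wMod f r (g n)) ----> EN M f" proof -
 interpret M: finite_measure M by fact
 have "bounded (f ` closure {x. f x ~= 0})" using f by (intro compact_imp_bounded compact_continuous_image) (auto intro: continuous_on_subset)
 then obtain B where B: "0 < B" "!!x. x \<in> closure {x. f x ~= 0} ==> \<bar>f x\<bar> <= B" by (auto simp: bounded_pos)
 have fB: "\<bar>f x\<bar> <= B" for x using B closure_subset[of "{x. f x ~= 0}"] by (cases "f x = 0") auto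
 have fb[measurable]: "f \<in> borel_measurable borel" using f by (intro borel_measurable_continuous_onI)
 have [measurable]: "f \<in> lmeas" by (rule borel_lebesgue[OF fb])
 have fM: "f \<in> borel_measurable M" using fb M(2) by (simp cong: measurable_cong_sets)
 have i: "integrable lebesgue (%x. norm (g n x) powr r x)" for n using order_le_less_trans[OF K[of n], of top] by (intro integrableI_bounded) auto
 have i2: "integrable lebesgue (%x. f x * norm (g n x) powr r x)" for n by (rule Bochner_Integration.integrable_bound[OF integrable_mult_right[OF i[of n], of B]])
   (use fB B in \<open>auto simp: abs_mult intro!: mult_right_mono\<close>)
 have "integral\<^sup>L (power_measure r (g n)) f = LB (%x. f x * norm (g n x) powr r x)" for n
  unfolding power_measure_def by (subst integral_density) (auto simp: mult.commute)
 then have "(%n. \<integral>x. f x * norm (g n x) powr r x \<partial>lebesgue) ----> integral\<^sup>L M f" using conv f unfolding weakly_converges_measure_def by auto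
 then have "(%n. ennreal (LB (%x. f x * norm (g n x) powr r x))) ----> ennreal (integral\<^sup>L M f)" by (rule tendsto_ennrealI)
 moreover have "ennreal (integral\<^sup>L M f) = EN M f" using fM fB f(3) by (intro nn_integral_eq_integral[symmetric] M.integrable_const_bound[of _ B]) auto
 moreover have "ennreal (LB (%x. f x * norm (g n x) powr r x)) = wMod f r (g n)" for n using i2 f(3) by (intro nn_integral_eq_integral[symmetric]) auto
 ultimately show ?thesis by simp
qed

lemma finite_measure_compact_approx:
 fixes M :: "'a::euclidean_space measure"
 assumes "finite_measure M" "sets M = sets borel" "A \<in> sets borel" "c < emeasure M A"
 obtains K where "compact K" "K \<subseteq> A" "c < emeasure M K" proof -
 have "emeasure M (space M) ~= \<infinity>" using assms(1) by (simp add: finite_measure.emeasure_finite)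
 with assms have "c < (SUP K\<in>{K. K \<subseteq> A & compact K}. emeasure M K)" by (subst (asm) inner_regular) auto
 then show thesis by (auto simp: less_SUP_iff intro: that)
qed

lemma finite_measure_open_approx:
 fixes M :: "'a::euclidean_space measure"
 assumes "finite_measure M" "sets M = sets borel" "A \<in> sets borel" "emeasure M A < c"
 obtains U where "open U" "A \<subseteq> U" "emeasure M U < c" proof -
 have "emeasure M (space M) ~= \<infinity>" using assms(1) by (simp add: finite_measure.emeasure_finite)
 with assms have "(INF U\<in>{U. A \<subseteq> U & open U}. emeasure M U) < c" by (subst (asm) outer_regular) auto
 then show thesis by (auto simp: INF_less_iff intro: that)
qed

lemma test_nn_integral:
 fixes M :: "'a::euclidean_space measure"
 assumes phi: "phi \<in> test_functions U" "!!x. 0 <= phi x" "!!x. phi x <= 1" and M: "sets M = sets borel"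
 shows "A \<in> sets borel ==> (!!x. x \<in> A ==> phi x = 1) ==> emeasure M A <= EN M phi"
  and "U \<in> sets borel ==> EN M phi <= emeasure M U" proof -
 show "emeasure M A <= EN M phi" if "A \<in> sets borel" "!!x. x \<in> A ==> phi x = 1" proof -
  have "emeasure M A = (\<integral>\<^sup>+x. indicator A x \<partial>M)" using that M by simp
  also have "... <= EN M phi" using that by (intro nn_integral_mono) (auto simp: indicator_def)
  finally show ?thesis .
 qed
 have "phi x = 0" if "x \<notin> U" for x using phi(1) that closure_subset[of "{x. phi x ~= 0}"] by (auto simp: test_functions_def)
 then show "EN M phi <= emeasure M U" if "U \<in> sets borel" proof -
  have "EN M phi <= (\<integral>\<^sup>+x. indicator U x \<partial>M)"
   using \<open>!!x. x \<notin> U ==> phi x = 0\<close> phi(3) by (intro nn_integral_mono) (auto simp: indicator_def)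
  then show ?thesis using that M by simp
 qed
qed

text \<open>Inner regularity on the left, outer regularity on the right and a smooth Urysohn
  function in between. Two measures on each side allow sums to be compared; the null measure fills a
  free place.\<close>

lemma measure_add_le_of_test:
 fixes M1 M2 M3 M4 :: "'a::euclidean_space measure"
 assumes M1: "finite_measure M1" "sets M1 = sets borel" and M2: "finite_measure M2" "sets M2 = sets borel"
  and M3: "finite_measure M3" "sets M3 = sets borel" and M4: "finite_measure M4" "sets M4 = sets borel"
  and le: "!!phi. phi \<in> tests ==> (!!x. 0 <= phi x) ==> (!!x. phi x <= 1) ==>
   EN M1 phi + EN M2 phi <= EN M3 phi + EN M4 phi"
  and A: "A \<in> sets borel"
 shows "emeasure M1 A + emeasure M2 A <= emeasure M3 A + emeasure M4 A" proof -
 have fin: "emeasure M A < top" if "finite_measure M" for M :: "'a measure" using finite_measure.emeasure_finite[OF that] by (simp add: less_top)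
 have "measure M1 A + measure M2 A <= measure M3 A + measure M4 A" proof (rule field_le_epsilon)
  fix e :: real assume e: "0 < e"
  have em: "emeasure M B = ennreal (measure M B)" if "finite_measure M" for M and B :: "'a set" using finite_measure.emeasure_eq_measure[OF that] .
  have cpt: "\<exists>K. compact K & K \<subseteq> A & measure M A - e / 4 <= measure M K" if M: "finite_measure M" "sets M = sets borel" for M :: "'a measure"
  proof (cases "measure M A - e / 4 < 0")
   case True
   then show ?thesis by (intro exI[of _ "{}"]) auto
  next
   case False
   then have "ennreal (measure M A - e / 4) < emeasure M A" using e by (simp add: em[OF M(1)] ennreal_less_iff)
   then obtain K where "compact K" "K \<subseteq> A" "ennreal (measure M A - e / 4) < emeasure M K" by (rule finite_measure_compact_approx[OF M A])
   then show ?thesis using False by (intro exI[of _ K]) (simp add: em[OF M(1)] ennreal_less_iff)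
  qed
  have op: "\<exists>U. open U & A \<subseteq> U & measure M U <= measure M A + e / 4" if M: "finite_measure M" "sets M = sets borel" for M :: "'a measure" proof -
   have "emeasure M A < ennreal (measure M A + e / 4)" using e by (simp add: em[OF M(1)] ennreal_less_iff)
   then obtain U where "open U" "A \<subseteq> U" "emeasure M U < ennreal (measure M A + e / 4)" by (rule finite_measure_open_approx[OF M A])
   then show ?thesis by (intro exI[of _ U]) (simp add: em[OF M(1)] ennreal_less_iff)
  qed
  obtain K1 where K1: "compact K1" "K1 \<subseteq> A" "measure M1 A - e / 4 <= measure M1 K1" using cpt[OF M1] by blast
  obtain K2 where K2: "compact K2" "K2 \<subseteq> A" "measure M2 A - e / 4 <= measure M2 K2" using cpt[OF M2] by blast
  obtain U3 where U3: "open U3" "A \<subseteq> U3" "measure M3 U3 <= measure M3 A + e / 4" using op[OF M3] by blast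
  obtain U4 where U4: "open U4" "A \<subseteq> U4" "measure M4 U4 <= measure M4 A + e / 4" using op[OF M4] by blast
  have K: "compact (K1 \<union> K2)" and U: "open (U3 \<inter> U4)" "K1 \<union> K2 \<subseteq> U3 \<inter> U4" using K1 K2 U3 U4 by (auto intro: compact_Un)
  obtain phi where phi: "phi \<in> test_functions (U3 \<inter> U4)" "!!x. 0 <= phi x" "!!x. phi x <= 1" "!!x. x \<in> K1 \<union> K2 ==> phi x = 1"
   using smooth_Urysohn[OF K U] by blast
  have t: "phi \<in> tests" "phi \<in> test_functions U3" "phi \<in> test_functions U4" by (rule test_mono[OF _ phi(1)]; simp)+
  have "emeasure M1 K1 + emeasure M2 K2 <= EN M1 phi + EN M2 phi" using K1 K2 phi M1 M2 t(1) by (intro add_mono test_nn_integral(1)) (auto intro: borel_compact)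
  also have "... <= EN M3 phi + EN M4 phi" by (rule le[OF t(1) phi(2,3)])
  also have "... <= emeasure M3 U3 + emeasure M4 U4" using U3 U4 phi M3 M4 t by (intro add_mono test_nn_integral(2)) auto
  finally have "measure M1 K1 + measure M2 K2 <= measure M3 U3 + measure M4 U4" by (simp add: em M1 M2 M3 M4 flip: ennreal_plus)
  then show "measure M1 A + measure M2 A <= measure M3 A + measure M4 A + e" using K1(3) K2(3) U3(3) U4(3) by linarith
 qed
 then show ?thesis using M1(1) M2(1) M3(1) M4(1) by (simp add: finite_measure.emeasure_eq_measure ennreal_leI flip: ennreal_plus)
qed

text \<open>The atoms are indexed by natural numbers through an enumeration of \<open>D\<close>,
  which is injective because \<open>D\<close> is countable; the sum is then countable additivity
  over singletons.\<close>

lemma dirac_sum_eq_emeasure: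
 fixes M :: "'a::euclidean_space measure"
 assumes M: "finite_measure M" "sets M = sets borel" and D: "countable D"
 shows "dirac_sum (to_nat_on D ` D) (%i. measure M {from_nat_into D i}) (from_nat_into D) A = emeasure M (A \<inter> D)" proof -
 define B where "B n = (if n \<in> to_nat_on D ` D & from_nat_into D n \<in> A then {from_nat_into D n} else {})" for n
 have "dirac_sum (to_nat_on D ` D) (%i. measure M {from_nat_into D i}) (from_nat_into D) A = (\<Sum>\<^sub>\<infinity>n. emeasure M (B n))" unfolding dirac_sum_def
  by (rule infsum_cong_neutral) (auto simp: B_def finite_measure.emeasure_eq_measure[OF M(1)])
 also have "... = (\<Sum>n. emeasure M (B n))" proof -
  have "(%n. emeasure M (B n)) summable_on UNIV" by (rule nonneg_summable_on_complete) simp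
  then show ?thesis by (intro sums_unique has_sum_imp_sums has_sum_infsum)
 qed
 also have "... = emeasure M (\<Union>n. B n)" proof (rule suminf_emeasure)
  show "disjoint_family B" using D by (auto simp: disjoint_family_on_def B_def split: if_splits)
  have "B n \<in> sets M" for n using M by (simp add: B_def)
  then show "range B \<subseteq> sets M" by blast
 qed
 also have "(\<Union>n. B n) = A \<inter> D" proof (intro equalityI subsetI)
  fix y assume "y \<in> A \<inter> D"
  then have "y \<in> B (to_nat_on D y)" using D by (simp add: B_def)
  then show "y \<in> (\<Union>n. B n)" by blast
 next
  fix y assume "y \<in> (\<Union>n. B n)"
  then obtain n where "y \<in> B n" by blast
  then show "y \<in> A \<inter> D" using D by (cases "n \<in> to_nat_on D ` D") (auto simp: B_def split: if_splits)
 qed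
 finally show ?thesis .
qed

text \<open>A cutoff splits each modular into a part that converges by vague convergence and a tail.
  The tail function is monotone in \<open>R\<close>, so its limit exists, and the cutoff integrals
  exhaust \<open>M\<close>.\<close>

lemma mass_at_infinity:
 fixes g :: "nat => 'a::euclidean_space => 'b::{real_normed_vector, second_countable_topology}"
 assumes conv: "weakly_converges_measure (%n. power_measure r (g n)) M" and M: "finite_measure M" "sets M = sets borel"
  and [measurable]: "!!n. g n \<in> lmeas" "r \<in> lmeas"
  and K: "!!n. Mod r (g n) <= ennreal K"
 defines "T \<equiv> %R::real. limsup (%n. \<integral>\<^sup>+y\<in>{y. R < norm y}. ennreal (norm (g n y) powr r y) \<partial>lebesgue)"
 obtains c where "0 <= c" "(T \<longlongrightarrow> ennreal c) at_top" "limsup (%n. Mod r (g n)) = emeasure M UNIV + ennreal c" proof -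
 define L where "L = (INF R. T R)"
 have out[measurable]: "{y::'a. R < norm y} \<in> sets lebesgue" for R proof -
  have "open {y::'a. R < norm y}" by (intro open_Collect_less continuous_intros)
  then show ?thesis by auto
 qed
 have anti: "T R' <= T R" if "R <= R'" for R R' unfolding T_def using that by (intro Limsup_mono always_eventually allI nn_integral_mono) (auto simp: indicator_def)
 have limT: "(T \<longlongrightarrow> L) at_top" proof (rule order_tendstoI)
  show "eventually (%R. a < T R) at_top" if "a < L" for a using that by (intro always_eventually allI) (auto simp: L_def intro: less_le_trans INF_lower)
  fix a assume "L < a"
  then obtain R where "T R < a" by (auto simp: L_def INF_less_iff)
  then show "eventually (%R. T R < a) at_top" by (intro eventually_at_top_linorderI[of R]) (use anti order_le_less_trans in blast)
 qed
 have "T 0 <= ennreal K" unfolding T_def proof (intro Limsup_bounded always_eventually allI)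
  fix n
  have "(\<integral>\<^sup>+y\<in>{y. 0 < norm y}. ennreal (norm (g n y) powr r y) \<partial>lebesgue) <= Mod r (g n)"
   by (intro nn_integral_mono) (auto simp: indicator_def)
  also note K
  finally show "(\<integral>\<^sup>+y\<in>{y. 0 < norm y}. ennreal (norm (g n y) powr r y) \<partial>lebesgue) <= ennreal K" .
 qed
 then have "L < top" unfolding L_def by (meson INF_lower UNIV_I ennreal_less_top order_le_less_trans)
 then obtain c where c: "L = ennreal c" "0 <= c" by (cases L) auto
 let ?X = "limsup (%n. Mod r (g n))"
 let ?a = "%j. \<integral>\<^sup>+x. ennreal (cutoff 0 (real (Suc j)) x) \<partial>M"
 \<comment> \<open>The cutoff is 1 up to radius \<open>j + 1\<close> and 0 beyond twice that radius,
   so the tails at these two radii give the upper and the lower estimate.\<close>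
 have bounds: "?X <= ?a j + T (real (Suc j))" "?a j + T (2 * real (Suc j)) <= ?X" for j proof -
  define f where "f = cutoff (0::'a) (real (Suc j))"
  have f: "f \<in> tests" "!!x. 0 <= f x" "!!x. f x <= 1" by (auto simp: f_def cutoff_bounds intro: cutoff_test_functions)
  have f1: "f x = 1" if "norm x <= real (Suc j)" for x using that by (simp add: f_def cutoff_eq_1)
  have f0: "f x = 0" if "2 * real (Suc j) < norm x" for x using that by (simp add: f_def cutoff_eq_0)
  note [measurable] = test_lebesgue(1)[OF f(1)]
  have lim: "(%n. wMod f r (g n)) ----> ?a j" unfolding f_def[symmetric]
   by (rule weakly_converges_measure_nn[OF conv M _ _ K]) (use f in \<open>auto simp: test_functions_def intro: test_continuous[OF f(1)]\<close>)
  have fin: "?a j < top" proof -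
   have "?a j <= emeasure M UNIV" using test_nn_integral(2)[OF f M(2)] by (simp add: f_def)
   also have "... < top" using finite_measure.emeasure_finite[OF M(1)] by (simp add: less_top)
   finally show ?thesis .
  qed
  let ?o = "%R n. \<integral>\<^sup>+y\<in>{y. R < norm y}. ennreal (norm (g n y) powr r y) \<partial>lebesgue"
  have up: "Mod r (g n) <= wMod f r (g n) + ?o (real (Suc j)) n" for n proof -
   have "Mod r (g n) <= LN (%y. ennreal (f y * norm (g n y) powr r y) + ennreal (norm (g n y) powr r y) * indicator {y. real (Suc j) < norm y} y)"
    by (intro nn_integral_mono) (auto simp: indicator_def f1 not_less)
   also have "... = wMod f r (g n) + ?o (real (Suc j)) n" by (rule nn_integral_add) measurable
   finally show ?thesis .
  qed
  have lo: "wMod f r (g n) + ?o (2 * real (Suc j)) n <= Mod r (g n)" for n proof -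
   have "wMod f r (g n) + ?o (2 * real (Suc j)) n
    = LN (%y. ennreal (f y * norm (g n y) powr r y) + ennreal (norm (g n y) powr r y) * indicator {y. 2 * real (Suc j) < norm y} y)"
    by (rule nn_integral_add[symmetric]) measurable
   also have "... <= Mod r (g n)" using f by (intro nn_integral_mono) (auto simp: indicator_def f0 intro!: ennreal_leI mult_left_le_one_le)
   finally show ?thesis .
  qed
  show "?X <= ?a j + T (real (Suc j))" proof (rule ennreal_le_epsilon)
   fix e :: real assume e: "0 < e"
   have "eventually (%n. wMod f r (g n) < ?a j + ennreal e) sequentially"
    using fin e by (intro order_tendstoD[OF lim]) (cases "?a j"; simp add: ennreal_less_iff flip: ennreal_plus)
   then have "?X <= limsup (%n. (?a j + ennreal e) + ?o (real (Suc j)) n)" by (intro Limsup_mono, elim eventually_mono) (rule order_trans[OF up add_right_mono], simp)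
   also have "... = ?a j + T (real (Suc j)) + ennreal e" by (subst Limsup_const_add) (auto simp: T_def ac_simps)
   finally show "?X <= ?a j + T (real (Suc j)) + ennreal e" .
  qed
  show "?a j + T (2 * real (Suc j)) <= ?X" proof (rule ennreal_le_epsilon)
   fix e :: real assume e: "0 < e"
   have "eventually (%n. ?a j <= wMod f r (g n) + ennreal e) sequentially" proof (cases "?a j = 0")
    case False
    then have "?a j - ennreal e < ?a j" using fin e by (intro ennreal_between) (auto simp: zero_less_iff_neq_zero)
    then have "eventually (%n. ?a j - ennreal e < wMod f r (g n)) sequentially" by (rule order_tendstoD[OF lim])
    then show ?thesis by eventually_elim (drule less_imp_le, simp add: ennreal_minus_le_iff add.commute)
   qed simp
   then have "limsup (%n. ?a j + ?o (2 * real (Suc j)) n) <= limsup (%n. ennreal e + Mod r (g n))" proof (intro Limsup_mono, elim eventually_mono)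
    fix n assume "?a j <= wMod f r (g n) + ennreal e"
    then have "?a j + ?o (2 * real (Suc j)) n <= ennreal e + (wMod f r (g n) + ?o (2 * real (Suc j)) n)" using add_right_mono by (fastforce simp: ac_simps)
    also have "... <= ennreal e + Mod r (g n)" by (intro add_left_mono lo)
    finally show "?a j + ?o (2 * real (Suc j)) n <= ennreal e + Mod r (g n)" .
   qed
   then show "?a j + T (2 * real (Suc j)) <= ?X + ennreal e" by (simp add: Limsup_const_add T_def add.commute)
  qed
 qed
 have lima: "?a ----> (\<integral>\<^sup>+x. 1 \<partial>M)" proof (rule nn_integral_dominated_convergence[where w = "%_. 1"])
  have "cutoff (0::'a) R \<in> borel_measurable borel" if "0 < R" for R
   using test_continuous[OF cutoff_test_functions[OF that subset_UNIV]] by (intro borel_measurable_continuous_onI)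
  then show "(%x. ennreal (cutoff 0 (real (Suc j)) x)) \<in> borel_measurable M" for j
   using M(2) by (intro measurable_compose[OF _ measurable_ennreal]) (auto cong: measurable_cong_sets)
  show "AE x in M. ennreal (cutoff 0 (real (Suc j)) x) <= 1" for j by (intro AE_I2) (simp add: cutoff_bounds)
  show "(\<integral>\<^sup>+x. 1 \<partial>M) < \<infinity>" using finite_measure.emeasure_finite[OF M(1)] by (simp add: less_top)
  show "AE x in M. (%j. ennreal (cutoff 0 (real (Suc j)) x)) ----> 1" proof (rule AE_I2)
   fix x :: 'a
   obtain N where "norm x <= real N" using real_arch_simple by blast
   then show "(%j. ennreal (cutoff 0 (real (Suc j)) x)) ----> 1" by (intro tendsto_eventually eventually_sequentiallyI[of N]) (simp add: cutoff_eq_1)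
  qed
 qed auto
 have fl: "filterlim (%j. real (Suc j)) at_top sequentially" by (rule filterlim_compose[OF filterlim_real_sequentially filterlim_Suc])
 then have fl2: "filterlim (%j. 2 * real (Suc j)) at_top sequentially" by (intro filterlim_tendsto_pos_mult_at_top[OF tendsto_const]) auto
 have "?X <= (\<integral>\<^sup>+x. 1 \<partial>M) + L" by (rule LIMSEQ_le_const[OF tendsto_add[OF lima filterlim_compose[OF limT fl]]]) (use bounds in auto)
 moreover have "(\<integral>\<^sup>+x. 1 \<partial>M) + L <= ?X" by (rule LIMSEQ_le_const2[OF tendsto_add[OF lima filterlim_compose[OF limT fl2]]]) (use bounds in auto)
 moreover have "(\<integral>\<^sup>+x. 1 \<partial>M) = emeasure M UNIV" using sets_eq_imp_space_eq[OF M(2)] by simp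
 ultimately show thesis using c limT by (intro that[of c]) auto
qed

section \<open>Sobolev inequalities in modular form\<close>

lemma test_eq_0:
 assumes "phi \<in> test_functions U" "x \<notin> U"
 shows "phi x = 0" "grad phi x = 0" proof -
 have x: "x \<in> - closure {x. phi x ~= 0}" using assms by (auto simp: test_functions_def)
 have z: "phi y = 0" if "y \<in> - closure {x. phi x ~= 0}" for y using that closure_subset[of "{x. phi x ~= 0}"] by auto
 show "phi x = 0" by (rule z[OF x])
 show "grad phi x = 0" by (rule grad_eq_0[OF _ x z]) auto
qed

lemma modular_eq:
 assumes "U \<in> sets lebesgue"
 shows "modular r U f = LN (%x. ennreal (norm (f x) powr r x) * indicator U x)" unfolding modular_def using assms by (simp add: nn_integral_restrict_space)

context exponents
begin

text \<open>The inequality \<open>c * Lnorm q v <= Lnorm p (grad v)\<close> on test functions,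
  expressed by modulars: \<open>t\<close> stands for any admissible scale of the gradient.\<close>

definition SI :: "real => 'a set => bool" where
 "SI c U \<longleftrightarrow> (\<forall>v\<in>test_functions U. \<forall>t>0. LI (%x. (norm (grad v x) / t) powr p x) <= 1 -->
  LI (%x. (c * \<bar>v x\<bar> / t) powr q x) <= 1)"

lemma SI_mono: "SI c U ==> V \<subseteq> U ==> SI c V" unfolding SI_def using test_mono by blast

text \<open>The available modular bound \<open>C'\<close> may exceed 1. As \<open>q >= 1\<close>,
  shrinking \<open>v\<close> by \<open>c <= 1\<close> multiplies the modular by at most
  \<open>c\<close>, and \<open>c * C' <= 1\<close>.\<close>

lemma SI_global: obtains c where "0 < c" "c <= 1" "SI c UNIV" proof -
 obtain C where C: "0 < C" "!!phi. phi \<in> tests ==>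
  BI (%x. norm (grad phi x) powr p x) <= 1 ==>
  BI (%x. \<bar>phi x\<bar> powr ps x) <= ennreal C" using sobolev_ps by blast
 obtain C' where C': "0 < C'" "!!t. t \<in> lmeas ==> (!!x. 0 <= t x) ==>
  LI (%x. t x powr ps x) <= ennreal C ==>
  LI (%x. t x powr q x) <= ennreal C'" using sobolev_q_of_ps[of C] C(1) by auto
 define c where "c = 1 / max 1 C'"
 have c: "0 < c" "c <= 1" "c * C' <= 1" using C'(1) by (auto simp: c_def field_simps max_def)
 have "SI c UNIV" unfolding SI_def proof (intro ballI allI impI)
  fix v :: "'a => real" and t :: real assume v: "v \<in> tests" and t: "0 < t"
   and le: "LI (%x. (norm (grad v x) / t) powr p x) <= 1"
  note [measurable] = test_lebesgue(1)[OF v]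
  have "LI (%x. (\<bar>v x\<bar> / t) powr q x) <= ennreal C'" using sobolev_ps_scaled[OF C(2) v t le] t by (intro C'(2)) auto
  then have "ennreal c * LI (%x. (\<bar>v x\<bar> / t) powr q x) <= ennreal c * ennreal C'" by (rule mult_left_mono) simp
  also have "... <= 1" using c C'(1) by (simp flip: ennreal_mult)
  also have "ennreal c * LI (%x. (\<bar>v x\<bar> / t) powr q x) = LN (%x. ennreal c * ennreal ((\<bar>v x\<bar> / t) powr q x))"
   by (rule nn_integral_cmult[symmetric]) measurable
  finally have *: "LN (%x. ennreal c * ennreal ((\<bar>v x\<bar> / t) powr q x)) <= 1" .
  show "LI (%x. (c * \<bar>v x\<bar> / t) powr q x) <= 1" proof (rule order_trans[OF nn_integral_mono *])
   fix x
   have "(c * (\<bar>v x\<bar> / t)) powr q x = c powr q x * (\<bar>v x\<bar> / t) powr q x" by (rule powr_mult)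
   also have "... <= c * (\<bar>v x\<bar> / t) powr q x" using powr_mono'[of 1 "q x" c] c q_ge_1[of x] by (intro mult_right_mono) auto
   finally show "ennreal ((c * \<bar>v x\<bar> / t) powr q x) <= ennreal c * ennreal ((\<bar>v x\<bar> / t) powr q x)"
    using c by (simp add: ennreal_leI flip: ennreal_mult)
  qed
 qed
 with c that show thesis by blast
qed

lemma test_function_W10:
 assumes U: "open U" and v: "v \<in> test_functions U"
 shows "v \<in> W10 p U" proof -
 have [measurable]: "U \<in> sets lebesgue" using U by auto
 have wg: "!!phi. phi \<in> tests ==> AE x in lebesgue. x \<in> U --> wgrad U phi x = grad phi x" by (rule wgrad_test_function[OF U])
 have vU: "v \<in> tests" by (rule test_mono[OF _ v]) simp
 note [measurable] = test_lebesgue[OF v]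
 have fin: "Mod p v < top" "Mod p (grad v) < top" by (rule test_modular_finite[OF v less_imp_le[OF p_gt_1] p_le])+
 have vW1: "v \<in> W1 p U" unfolding W1_def Lvar_def proof (intro CollectI conjI)
  show "v \<in> W11loc U" unfolding W11loc_def using has_weak_gradient_test_function[OF vU] by blast
  show "v \<in> borel_measurable (lebesgue_on U)" by (rule measurable_restrict_space1) measurable
  show "modular p U v < \<infinity>" using fin by (auto simp: modular_eq intro!: order_le_less_trans[OF nn_integral_mono fin(1)] simp: indicator_def)
  have "(%x. if x \<in> U then wgrad U v x else 0) \<in> lmeas"
   by (rule borel_measurable_AE[of "%x. if x \<in> U then grad v x else 0"]) (measurable, use wg[OF vU] in \<open>auto elim: eventually_mono\<close>)
  then have "(%x. if x \<in> U then wgrad U v x else 0) \<in> borel_measurable (lebesgue_on U)" by (rule measurable_restrict_space1)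
  then show "wgrad U v \<in> borel_measurable (lebesgue_on U)" by (subst measurable_cong[where g = "%x. if x \<in> U then wgrad U v x else 0"]) auto
  have "modular p U (wgrad U v) <= Mod p (grad v)" unfolding modular_eq[OF \<open>U \<in> sets lebesgue\<close>]
   by (rule nn_integral_mono_AE) (use wg[OF vU] in \<open>auto elim!: eventually_mono simp: indicator_def\<close>)
  then show "modular p U (wgrad U v) < \<infinity>" using fin(2) by (simp add: order_le_less_trans)
 qed
 have "W1norm p U (%x. v x - v x) < ennreal eps" if e: "0 < eps" for eps proof -
  have m0: "modular p U (%x. (0::real) /\<^sub>R s) <= 1" for s :: real using p_gt_1 by (simp add: modular_def)
  have wg0: "AE x in lebesgue. x \<in> U --> wgrad U (%x. 0) x = 0" using wg[OF test_zero] by (auto simp: grad_const)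
  have "LN (%x. ennreal (norm (wgrad U (%x. 0) x /\<^sub>R s) powr p x) * indicator U x) = (\<integral>\<^sup>+x. 0 \<partial>(lebesgue :: 'a measure))" for s :: real
  proof (rule nn_integral_cong_AE, use wg0 in eventually_elim)
   fix x assume "x \<in> U --> wgrad U (%x. 0) x = 0"
   then show "ennreal (norm (wgrad U (%x. 0) x /\<^sub>R s) powr p x) * indicator U x = 0" by (cases "x \<in> U") auto
  qed
  then have m1: "modular p U (%x. wgrad U (%x. 0) x /\<^sub>R s) <= 1" for s :: real by (simp add: modular_eq)
  define s where "s = eps / 3"
  have s: "0 < s" "s + s < eps" using e by (auto simp: s_def)
  have "W1norm p U (%x. v x - v x) <= ennreal s + ennreal s" unfolding W1norm_def using s m0 m1 by (intro add_mono Lnorm_le) auto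
  also have "... < ennreal eps" using s by (simp add: ennreal_less_iff flip: ennreal_plus)
  finally show ?thesis .
 qed
 with vW1 v show ?thesis unfolding W10_def by blast
qed

text \<open>Strictness of \<open>c\<close> below the Sobolev constant gives a norm strictly below
  \<open>t / c\<close>, so that the modular at scale \<open>t / c\<close> is at most 1 by the
  definition of the infimum. Functions that vanish almost everywhere, over which the constant does
  not range, are treated apart.\<close>

lemma SI_of_sobolev_const:
 assumes U: "open U" and c: "0 < c" "ennreal c < sobolev_const p q U"
 shows "SI c U" unfolding SI_def proof (intro ballI allI impI)
 fix v :: "'a => real" and t :: real assume v: "v \<in> test_functions U" and t: "0 < t"
  and le: "LI (%x. (norm (grad v x) / t) powr p x) <= 1"
 have [measurable]: "U \<in> sets lebesgue" using U by auto
 have vU: "v \<in> tests" by (rule test_mono[OF _ v]) simp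
 have v0: "v x = 0" if "x \<notin> U" for x using test_eq_0[OF v that] by simp
 have eqU: "LI (%x. (c * \<bar>v x\<bar> / t) powr q x) = modular q U (%x. v x /\<^sub>R (t / c))"
  using c t v0 q_ge_1 by (subst modular_eq) (auto intro!: nn_integral_cong simp: indicator_def abs_mult field_simps)
 show "LI (%x. (c * \<bar>v x\<bar> / t) powr q x) <= 1" proof (cases "AE x in lebesgue_on U. v x = 0")
  case True
  then have "modular q U (%x. v x /\<^sub>R (t / c)) = (\<integral>\<^sup>+x. 0 \<partial>lebesgue_on U)"
   unfolding modular_def by (intro nn_integral_cong_AE) (auto elim!: eventually_mono)
  then show ?thesis by (simp add: eqU)
 next
  case False
  have "modular p U (%x. wgrad U v x /\<^sub>R t) <= LI (%x. (norm (grad v x) / t) powr p x)" unfolding modular_eq[OF \<open>U \<in> sets lebesgue\<close>]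
   by (rule nn_integral_mono_AE) (use wgrad_test_function[OF U vU] t in \<open>auto elim!: eventually_mono simp: indicator_def divide_inverse_commute\<close>)
  then have Lp: "Lnorm p U (wgrad U v) <= ennreal t" using le t by (intro Lnorm_le) auto
  have "sobolev_const p q U <= Lnorm p U (wgrad U v) / Lnorm q U v" unfolding sobolev_const_def by (rule INF_lower) (use False test_function_W10[OF U v] in auto)
  also have "... <= ennreal t / Lnorm q U v" using Lp by (rule divide_right_mono_ennreal)
  finally have cl: "ennreal c < ennreal t / Lnorm q U v" using c by order
  have "Lnorm q U v < ennreal (t / c)" proof (cases "Lnorm q U v")
   case (real l)
   show ?thesis proof (cases "l = 0")
    case False
    then have "c < t / l" using cl real t c by (simp add: divide_ennreal ennreal_less_iff)
    then show ?thesis using real False c t by (simp add: ennreal_less_iff field_simps)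
   qed (use real c t in simp)
  next
   case top
   then show ?thesis using cl by simp
  qed
  then show ?thesis unfolding eqU using q_ge_1 by (intro modular_le_1_if_Lnorm_less) (auto intro: order_trans[OF zero_le_one])
 qed
qed

end

section \<open>Concentration of a vanishing sequence of test functions\<close>

locale concentration = exponents p q p_inf q_inf for p q :: "'a::euclidean_space => real" and p_inf q_inf +
 fixes w :: "nat => 'a => real" and K :: real and M N :: "'a measure"
 assumes w: "!!n. w n \<in> tests" and K0: "0 <= K"
  and Kp: "!!n. Mod p (grad (w n)) <= ennreal K" and Kps: "!!n. Mod ps (w n) <= ennreal K"
  and Kq: "!!n. Mod q (w n) <= ennreal K" and wL: "!!R. (%n. L1ball R (w n)) ----> 0"
  and M: "finite_measure M" "sets M = sets borel" "weakly_converges_measure (%n. power_measure p (grad (w n))) M"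
  and N: "finite_measure N" "sets N = sets borel" "weakly_converges_measure (%n. power_measure q (w n)) N"
begin

text \<open>In the gradient of \<open>eta * w n\<close> the term with \<open>grad eta\<close> tends
  to 0 in the p-modular by interpolation, since \<open>p\<close> stays below \<open>ps\<close> by a
  fixed gap. The modular is thus eventually at most \<open>b\<close>; as
  \<open>b <= t powr p\<close> on \<open>U\<close>, the scale \<open>t\<close> is admissible in
  \<open>SI\<close>, and \<open>s\<close> bounds the factor that leads back to the
  q-modular.\<close>

lemma cutoff_inequality:
 assumes SI: "SI c U" and c: "0 < c" and etak: "!!k. C_k k eta" and eta: "!!x. 0 <= eta x" "!!x. eta x <= 1"
  and etaU: "!!v. v \<in> tests ==> (%x. eta x * v x) \<in> test_functions U"
  and G: "!!x. norm (grad eta x) <= G" "!!x. R < norm x ==> grad eta x = 0"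
  and b: "0 <= b'" "b' < b" and le: "eventually (%n. wMod eta p (grad (w n)) <= ennreal b') sequentially"
  and t: "0 < t" "!!x. x \<in> U ==> b <= t powr p x" and s: "0 <= s" "!!x. x \<in> U ==> (t / c) powr q x <= s"
 shows "eventually (%n. Mod q (%x. eta x * w n x) <= ennreal s) sequentially" proof -
 note [measurable] = test_lebesgue[OF w]
 have [measurable]: "eta \<in> lmeas" "grad eta \<in> lmeas"
  using C_k_continuous[OF etak] continuous_on_grad[OF etak] by (auto intro: borel_measurable_lebesgue_continuous)
 have [measurable]: "cball (0::'a) R \<in> sets lebesgue" by simp
 \<comment> \<open>Half of the distance from \<open>b'\<close> to \<open>b\<close> pays for the
   factor \<open>1 + eps\<close>, the other half for the vanishing term.\<close>
 define eps where "eps = (b - b') / (2 * b)"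
 have e: "0 < eps" using b by (simp add: eps_def)
 have "eps * b' <= eps * b" using b e by (intro mult_left_mono) auto
 also have "eps * b = (b - b') / 2" using b by (simp add: eps_def)
 finally have e2: "(1 + eps) * b' <= (b + b') / 2" by (simp add: field_simps)
 define G' where "G' = max 1 G powr pp"
 have G': "norm (w n x *\<^sub>R grad eta x) powr p x <= G' * (indicator (cball 0 R) x * norm (w n x) powr p x)" for n x proof (cases "norm x <= R")
  case True
  have "norm (w n x *\<^sub>R grad eta x) powr p x = norm (grad eta x) powr p x * norm (w n x) powr p x" by (simp add: powr_mult mult.commute)
  also have "norm (grad eta x) powr p x <= max 1 G powr p x" using G(1)[of x] p_gt_1[of x] by (intro powr_mono2) auto
  also have "... <= G'" unfolding G'_def using p_le by (intro powr_mono) auto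
  finally show ?thesis using True by (simp add: mult_right_mono)
 qed (use G(2)[of x] p_gt_1[of x] in simp)
 note pb = less_imp_le[OF p_gt_1] p_le
 define C where "C = split_const eps pp * 2 powr pp"
 have C: "0 < C" using norm_add_powr_le(1)[OF e, of pp] pm_gt_1 pm_le_pp by (simp add: C_def)
 note C = C weighted_modular_add_le[OF e lebesgue_exponents(1) pb, folded C_def]
 have "(%n. wMod (indicator (cball 0 R)) p (w n)) ----> 0" by (rule interpolation_tendsto_0[where s = ps and kp = "1 / dm" and R = R and B = psp and K = K])
   (use p_gt_1 p_le_ps ps_le dm_pos Kps K0 wL in \<open>auto intro: less_imp_le\<close>)
 then have "(%n. ennreal (C * G') * wMod (indicator (cball 0 R)) p (w n)) ----> ennreal (C * G') * 0" by (intro ennreal_tendsto_cmult) auto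
 then have "eventually (%n. ennreal (C * G') * wMod (indicator (cball 0 R)) p (w n) < ennreal ((b - b') / 2)) sequentially" using b by (intro order_tendstoD) auto
 then show ?thesis using le proof eventually_elim
  case (elim n)
  let ?v = "%x. eta x * w n x"
  have v: "?v \<in> test_functions U" by (rule etaU[OF w])
  have gv: "grad ?v x = eta x *\<^sub>R grad (w n) x + (w n x *\<^sub>R grad eta x + 0)" for x
   using grad_mult[OF C_k_differentiable[OF etak[of "Suc 0"]] test_differentiable[OF w]] by simp
  have "wMod (%_. 1) p (grad ?v) <= ennreal (1 + eps) * wMod (%_. 1) p (%x. eta x *\<^sub>R grad (w n) x)
    + ennreal C * (wMod (%_. 1) p (%x. w n x *\<^sub>R grad eta x) + Mod p (%_. 0 :: 'a))" by (rule C(2)[OF _ _ _ _ _ gv]) auto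
  also have "Mod p (%_. 0 :: 'a) = 0" using p_gt_1 by simp
  also have "wMod (%_. 1) p (%x. eta x *\<^sub>R grad (w n) x) <= wMod eta p (grad (w n))" proof (rule nn_integral_mono)
   fix x
   have "eta x powr p x <= eta x" using eta[of x] p_gt_1[of x] powr_mono'[of 1 "p x" "eta x"] by simp
   then show "ennreal (1 * norm (eta x *\<^sub>R grad (w n) x) powr p x) <= ennreal (eta x * norm (grad (w n) x) powr p x)"
    using eta[of x] by (intro ennreal_leI) (simp add: powr_mult mult_right_mono)
  qed
  also note elim(2)
  also have "wMod (%_. 1) p (%x. w n x *\<^sub>R grad eta x) <= LN (%x. ennreal G' * ennreal (indicator (cball 0 R) x * norm (w n x) powr p x))"
   using G'[of n] by (intro nn_integral_mono) (simp add: G'_def ennreal_leI flip: ennreal_mult)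
  also have "... = ennreal G' * wMod (indicator (cball 0 R)) p (w n)" by (rule nn_integral_cmult) measurable
  finally have "Mod p (grad ?v) <= ennreal (1 + eps) * ennreal b' + ennreal C * (ennreal G' * wMod (indicator (cball 0 R)) p (w n) + 0)"
   by (simp add: add_mono mult_left_mono)
  also have "... <= ennreal ((1 + eps) * b') + ennreal ((b - b') / 2)" using elim(1) e b C(1) by (intro add_mono) (auto simp: ennreal_mult G'_def mult.assoc)
  also have "... <= ennreal b" using e2 b e by (simp add: ennreal_leI field_simps flip: ennreal_plus)
  finally have Mb: "Mod p (grad ?v) <= ennreal b" .
  note [measurable] = test_lebesgue[OF v]
  have b0: "0 < b" using b by simp
  have "LI (%x. (norm (grad ?v x) / t) powr p x) <= LN (%x. ennreal (1 / b) * ennreal (norm (grad ?v x) powr p x))" proof (rule nn_integral_mono)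
   fix x
   show "ennreal ((norm (grad ?v x) / t) powr p x) <= ennreal (1 / b) * ennreal (norm (grad ?v x) powr p x)" proof (cases "x \<in> U")
    case True
    then have "norm (grad ?v x) powr p x / t powr p x <= norm (grad ?v x) powr p x / b" using t b0 by (intro divide_left_mono) auto
    then show ?thesis using b0 t by (simp add: powr_divide ennreal_leI flip: ennreal_mult)
   next
    case False
    then show ?thesis using test_eq_0(2)[OF v] p_gt_1[of x] by simp
   qed
  qed
  also have "... = ennreal (1 / b) * Mod p (grad ?v)" by (rule nn_integral_cmult) measurable
  also have "... <= ennreal (1 / b) * ennreal b" using Mb by (rule mult_left_mono) simp
  also have "... = 1" using b0 by (simp flip: ennreal_mult)
  finally have S: "LI (%x. (c * \<bar>?v x\<bar> / t) powr q x) <= 1" using SI t v unfolding SI_def by blast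
  have "Mod q ?v <= LN (%x. ennreal s * ennreal ((c * \<bar>?v x\<bar> / t) powr q x))" proof (rule nn_integral_mono)
   fix x
   show "ennreal (norm (?v x) powr q x) <= ennreal s * ennreal ((c * \<bar>?v x\<bar> / t) powr q x)" proof (cases "x \<in> U")
    case True
    have "norm (?v x) = (t / c) * (c * \<bar>?v x\<bar> / t)" using c t by simp
    then have "norm (?v x) powr q x = (t / c) powr q x * (c * \<bar>?v x\<bar> / t) powr q x" by (simp only: powr_mult)
    also have "... <= s * (c * \<bar>?v x\<bar> / t) powr q x" using s(2)[OF True] by (rule mult_right_mono) simp
    finally have "ennreal (norm (?v x) powr q x) <= ennreal (s * (c * \<bar>?v x\<bar> / t) powr q x)" by (rule ennreal_leI)
    then show ?thesis using s(1) by (simp add: ennreal_mult)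
   next
    case False
    then show ?thesis using test_eq_0(1)[OF v False] q_ge_1[of x] by auto
   qed
  qed
  also have "... = ennreal s * LI (%x. (c * \<bar>?v x\<bar> / t) powr q x)" by (rule nn_integral_cmult) measurable
  also have "... <= ennreal s * 1" using S by (rule mult_left_mono) simp
  finally show ?case by simp
 qed
qed

text \<open>The form of \<open>cutoff_inequality\<close> for the limit measures: a cutoff that is 1
  on \<open>A\<close> and lives in \<open>V\<close> sees gradient mass below \<open>b\<close> in the
  limit.\<close>

lemma compact_inequality:
 assumes SI: "SI c V" and c: "0 < c" and A: "compact A" "A \<subseteq> V" and V: "open V" and b: "emeasure M V < ennreal b"
  and t: "0 < t" "!!x. x \<in> V ==> b <= t powr p x" and s: "0 <= s" "!!x. x \<in> V ==> (t / c) powr q x <= s"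
 shows "emeasure N A <= ennreal s" proof -
 note [measurable] = test_lebesgue[OF w]
 obtain phi where phi: "phi \<in> test_functions V" "!!x. 0 <= phi x" "!!x. phi x <= 1" "!!x. x \<in> A ==> phi x = 1" using smooth_Urysohn[OF A(1) V A(2)] by blast
 have cs: "continuous_on UNIV phi" "compact (closure {x. phi x ~= 0})" using phi(1) test_continuous by (auto simp: test_functions_def)
 obtain G where G: "!!x. norm (grad phi x) <= G" using test_bounded[OF phi(1)] by metis
 obtain R where R: "!!x. R <= norm x ==> grad phi x = 0" using test_support_ball[OF phi(1)] by metis
 have "EN M phi < ennreal b" using test_nn_integral(2)[OF phi(1-3) M(2)] V b by (auto intro: order_le_less_trans)
 then obtain b' where b': "0 <= b'" "b' < b" "EN M phi < ennreal b'" proof (cases "\<integral>\<^sup>+x. ennreal (phi x) \<partial>M")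
  case (real m)
  then have "m < b" using \<open>EN M phi < ennreal b\<close> by (simp add: ennreal_less_iff)
  then show thesis using real that[of "(m + b) / 2"] by (simp add: ennreal_less_iff)
 qed simp
 have "(%n. wMod phi p (grad (w n))) ----> EN M phi" by (rule weakly_converges_measure_nn[OF M(3,1,2) _ _ Kp cs phi(2)]) measurable
 then have "eventually (%n. wMod phi p (grad (w n)) < ennreal b') sequentially" using b'(3) by (rule order_tendstoD)
 then have "eventually (%n. wMod phi p (grad (w n)) <= ennreal b') sequentially" by (rule eventually_mono) simp
 then have ev: "eventually (%n. Mod q (%x. phi x * w n x) <= ennreal s) sequentially"
 proof (intro cutoff_inequality[OF SI c test_C_k[OF phi(1)] phi(2,3) _ G _ b'(1,2) _ t s])
  show "(%x. phi x * v x) \<in> test_functions V" if "v \<in> tests" for v using test_mult_left[OF test_C_k[OF that] phi(1)] by (simp add: mult.commute)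
  show "grad phi x = 0" if "R < norm x" for x using R that by simp
 qed auto
 \<comment> \<open>The power \<open>psp\<close> of \<open>phi\<close> lies below its power
   \<open>q x\<close> at every point, has the same support, and is 1 on \<open>A\<close>; so it is a
   suitable function for the vague convergence to \<open>N\<close>.\<close>
 let ?f = "%x. phi x powr psp"
 have sf: "{x. ?f x ~= 0} = {x. phi x ~= 0}" using psp_gt_1 by simp
 have "(%n. wMod ?f q (w n)) ----> EN N ?f" by (rule weakly_converges_measure_nn[OF N(3,1,2) _ _ Kq])
   (unfold sf, use cs phi(2) psp_gt_1 in \<open>auto intro!: continuous_on_powr' continuous_on_const\<close>)
 moreover have "wMod ?f q (w n) <= Mod q (%x. phi x * w n x)" for n proof (intro nn_integral_mono ennreal_leI)
  fix x
  have "?f x <= phi x powr q x" using phi(2,3)[of x] q_le by (intro powr_mono') auto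
  then show "?f x * norm (w n x) powr q x <= norm (phi x * w n x) powr q x" using phi(2)[of x] by (simp add: abs_mult powr_mult mult_right_mono)
 qed
 ultimately have "EN N ?f <= ennreal s" using ev by (elim LIMSEQ_le_const2) (auto simp: eventually_sequentially intro: order_trans)
 moreover have "emeasure N A <= EN N ?f" proof -
  have "emeasure N A = (\<integral>\<^sup>+x. indicator A x \<partial>N)" using A N(2) by (simp add: borel_compact)
  also have "... <= EN N ?f" using phi(4) by (intro nn_integral_mono) (auto simp: indicator_def)
  finally show ?thesis .
 qed
 ultimately show ?thesis by simp
qed

end

text \<open>The parameter \<open>tht\<close> provides the strict inequalities needed for the mass,
  for the scale and for the final bound; it tends to 0.\<close>

lemma powr_inequality_limit:
 fixes v m c a b :: real
 assumes vm: "0 <= v" "0 <= m" "0 < c" "0 < a" "0 < b"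
  and le: "!!tht. 0 < tht ==> v <= ((m + tht) powr (1 / a) * (1 + tht) / c) powr b + tht"
 shows "c * v powr (1 / b) <= m powr (1 / a)" proof -
 have "((%tht. ((m + tht) powr (1 / a) * (1 + tht) / c) powr b + tht) \<longlongrightarrow> ((m + 0) powr (1 / a) * (1 + 0) / c) powr b + 0) (at_right 0)"
  using vm by (intro tendsto_intros tendsto_powr') (auto simp: eventually_at_right_less intro!: eventually_at_right_less[THEN eventually_mono])
 then have "v <= ((m + 0) powr (1 / a) * (1 + 0) / c) powr b + 0" using le by (intro tendsto_lowerbound) (auto intro!: eventually_at_right_less[THEN eventually_mono])
 then have "v powr (1 / b) <= ((m powr (1 / a) / c) powr b) powr (1 / b)" using vm by (intro powr_mono2) auto
 also have "... = m powr (1 / a) / c" using vm by (simp add: powr_powr)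
 finally show ?thesis using vm by (simp add: field_simps)
qed

context concentration
begin

lemma M_eq: "emeasure M A = ennreal (measure M A)" and N_eq: "emeasure N A = ennreal (measure N A)" using M N by (auto intro: finite_measure.emeasure_eq_measure)

text \<open>By regularity a small neighbourhood of \<open>x\<close> has M-mass below
  \<open>b\<close>, and by continuity of \<open>p\<close> and \<open>q\<close> one scale
  \<open>t\<close>, slightly above \<open>b powr (1 / p x)\<close>, serves all its points. Shrinking
  the neighbourhood replaces the variable exponents by their values at \<open>x\<close>.\<close>

lemma point_inequality:
 assumes SI: "SI c (ball x eps)" and c: "0 < c" "0 < eps"
 shows "c * measure N {x} powr (1 / q x) <= measure M {x} powr (1 / p x)" proof (rule powr_inequality_limit)
 show "0 < p x" "0 < q x" using p_gt_1[of x] q_ge_1[of x] by auto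
 fix tht :: real assume tht: "0 < tht"
 define b where "b = measure M {x} + tht"
 define t where "t = b powr (1 / p x) * (1 + tht)"
 define s where "s = (t / c) powr q x + tht"
 have b: "0 < b" using tht by (simp add: b_def add_nonneg_pos)
 have t: "0 < t" using tht b by (simp add: t_def)
 have s: "0 < s" using tht by (simp add: s_def add_nonneg_pos)
 have "t powr p x = b * (1 + tht) powr p x" using b p_gt_1[of x] by (simp add: t_def powr_mult powr_powr)
 moreover have "1 < (1 + tht) powr p x" using tht p_gt_1[of x] by (intro gr_one_powr) auto
 ultimately have tp: "b < t powr p x" using b by simp
 obtain O' where O': "open O'" "{x} \<subseteq> O'" "emeasure M O' < ennreal b"
  by (rule finite_measure_open_approx[OF M(1,2), of "{x}" "ennreal b"]) (use tht in \<open>auto simp: M_eq b_def ennreal_less_iff\<close>)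
 define V where "V = ball x eps \<inter> O' \<inter> {y. b < t powr p y} \<inter> {y. (t / c) powr q y < s}"
 have oV: "open V" unfolding V_def using O' t c by (intro open_Int open_Collect_less continuous_on_powr continuous_on_const continuous_on_p continuous_on_q) auto
 have "emeasure N {x} <= ennreal s" proof (rule compact_inequality[OF SI_mono[OF SI] c(1) _ _ oV _ t])
  show "emeasure M V < ennreal b" using O' emeasure_mono[of V O' M] M(2) by (auto simp: V_def intro: order_le_less_trans)
 qed (use O' tp s c tht in \<open>auto simp: V_def s_def\<close>)
 then show "measure N {x} <= ((measure M {x} + tht) powr (1 / p x) * (1 + tht) / c) powr q x + tht" using s by (simp add: N_eq s_def t_def b_def)
qed (use c in auto)

text \<open>Near \<open>x\<close> the exponent \<open>q\<close> stays below \<open>ps\<close> by the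
  fixed amount \<open>kp\<close>, so interpolation makes the q-modulars of \<open>w n\<close> vanish
  there.\<close>

lemma noncritical:
 assumes x: "q x < ps x"
 obtains V where "open V" "x \<in> V" "emeasure N V = 0" proof -
 note [measurable] = test_lebesgue[OF w]
 define kp where "kp = (ps x - q x) / 2"
 have k: "0 < kp" "q x + kp < ps x" using x by (auto simp: kp_def field_simps)
 define V where "V = ball x 1 \<inter> {y. q y + kp < ps y}"
 have oV: "open V" unfolding V_def by (intro open_Int open_Collect_less continuous_intros continuous_on_q continuous_on_ps) auto
 have [measurable]: "V \<in> sets lebesgue" using oV by auto
 have "(%n. wMod (indicator V) q (w n)) ----> 0" proof (rule interpolation_tendsto_0[where s = ps and kp = kp and R = "norm x + 1" and B = psp and K = K])
  show "V \<subseteq> cball 0 (norm x + 1)" proof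
   fix y assume "y \<in> V"
   then show "y \<in> cball 0 (norm x + 1)" using norm_triangle_ineq2[of y x] by (simp add: V_def dist_norm norm_minus_commute)
  qed
 qed (use q_ge_1 ps_le k Kps K0 wL in \<open>auto simp: V_def\<close>)
 note lim = this
 have c0: "emeasure N A = 0" if A: "compact A" "A \<subseteq> V" for A proof -
  obtain phi where phi: "phi \<in> test_functions V" "!!x. 0 <= phi x" "!!x. phi x <= 1" "!!x. x \<in> A ==> phi x = 1" using smooth_Urysohn[OF A(1) oV A(2)] by blast
  have "(%n. wMod phi q (w n)) ----> EN N phi" by (rule weakly_converges_measure_nn[OF N(3,1,2) _ _ Kq])
    (use phi test_continuous[OF phi(1)] in \<open>auto simp: test_functions_def\<close>)
  moreover have "(%n. wMod phi q (w n)) ----> 0" proof (rule ennreal_tendsto_0_mono[OF _ lim], intro nn_integral_mono ennreal_leI mult_right_mono)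
   show "phi y <= indicator V y" for y using phi(3) test_eq_0(1)[OF phi(1)] by (simp add: indicator_def)
  qed simp
  ultimately have "EN N phi = 0" by (rule LIMSEQ_unique)
  moreover have "emeasure N A <= EN N phi" using A phi(4) by (intro test_nn_integral(1)[OF phi(1-3) N(2)]) (auto intro: borel_compact)
  ultimately show ?thesis by simp
 qed
 have "emeasure N V = 0" proof (rule ccontr)
  assume "emeasure N V ~= 0"
  then have "0 < emeasure N V" by (simp add: zero_less_iff_neq_zero)
  then obtain A where "compact A" "A \<subseteq> V" "0 < emeasure N A" by (rule finite_measure_compact_approx[OF N(1,2) borel_open[OF oV]])
  then show False using c0 by simp
 qed
 then show thesis using oV k by (intro that[of V]) (auto simp: V_def)
qed

text \<open>The reverse Hoelder inequality. Near \<open>x\<close> one has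
  \<open>p < al < bt < q\<close>. For mass \<open>b < 1\<close> the scale
  \<open>t = b powr (1 / al)\<close> satisfies \<open>t powr p >= b\<close>, while
  \<open>t powr q <= b * b powr ga\<close>. Since \<open>x\<close> is no atom of \<open>M\<close>,
  the neighbourhood can be taken with so little mass that the additional factor is below
  \<open>e\<close>.\<close>

lemma critical_small:
 assumes x: "p x < q x" and M0: "emeasure M {x} = 0" and e: "0 < e"
 obtains V where "open V" "x \<in> V" "!!U. open U ==> U \<subseteq> V ==> emeasure N U <= ennreal e * emeasure M U" proof -
 obtain c where c: "0 < c" "c <= 1" "SI c UNIV" using SI_global by blast
 define al bt where "al = (2 * p x + q x) / 3" and "bt = (p x + 2 * q x) / 3"
 have ab: "1 < al" "p x < al" "al < bt" "bt < q x" using x p_gt_1[of x] by (auto simp: al_def bt_def field_simps)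
 define ga where "ga = bt / al - 1"
 have g: "0 < ga" using ab by (simp add: ga_def field_simps)
 \<comment> \<open>Mass below \<open>dl\<close> has its power \<open>ga\<close> at most
   \<open>e * c powr psp\<close>, which also pays for the division by
   \<open>c powr q\<close>.\<close>
 define dl where "dl = min 1 ((e * c powr psp) powr (1 / ga))"
 have d: "0 < dl" "dl <= 1" using e c by (auto simp: dl_def)
 have "dl powr ga <= ((e * c powr psp) powr (1 / ga)) powr ga" using d g by (intro powr_mono2) (auto simp: dl_def)
 also have "... = e * c powr psp" using g e c by (simp add: powr_powr)
 finally have dg: "dl powr ga <= e * c powr psp" .
 obtain O' where O': "open O'" "{x} \<subseteq> O'" "emeasure M O' < ennreal dl" by (rule finite_measure_open_approx[OF M(1,2), of "{x}" "ennreal dl"]) (use d M0 in auto)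
 define V where "V = O' \<inter> {y. p y < al} \<inter> {y. bt < q y}"
 have oV: "open V" unfolding V_def using O' by (intro open_Int open_Collect_less continuous_on_const continuous_on_p continuous_on_q)
 show thesis proof (rule that[OF oV])
  show "x \<in> V" using O' ab by (simp add: V_def)
  fix U assume U: "open U" "U \<subseteq> V"
  define m where "m = measure M U"
  have "emeasure M U <= emeasure M O'" using U O' M(2) by (intro emeasure_mono) (auto simp: V_def)
  then have m: "m < dl" "0 <= m" using O'(3) by (auto simp: m_def M_eq[symmetric] ennreal_less_iff[symmetric] intro: order_le_less_trans)
  have cpt: "measure N A <= e * m" if A: "compact A" "A \<subseteq> U" for A proof -
   have "measure N A / e <= m" proof (rule dense_ge_bounded[OF m(1)])
    fix b assume b: "m < b" "b < dl"
    then have b1: "0 < b" "b < 1" using m d by auto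
    have "emeasure N A <= ennreal (e * b)" proof (rule compact_inequality[OF SI_mono[OF c(3)] c(1) A U(1), where t = "b powr (1 / al)"])
     show "emeasure M U < ennreal b" using b m by (simp add: M_eq m_def ennreal_less_iff)
     have t1: "b powr (1 / al) <= 1" using b1 ab by (intro powr_le1) auto
     fix y assume "y \<in> U"
     then have y: "p y < al" "bt < q y" using U by (auto simp: V_def)
     have "(b powr (1 / al)) powr al <= (b powr (1 / al)) powr p y" using t1 y by (intro powr_mono') auto
     then show "b <= (b powr (1 / al)) powr p y" using b1 ab by (simp add: powr_powr)
     have "(b powr (1 / al) / c) powr q y = (b powr (1 / al)) powr q y / c powr q y" using b1 c by (simp add: powr_divide)
     also have "... <= (b powr (1 / al)) powr bt / c powr psp" using t1 y c q_le by (intro frac_le powr_mono') auto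
     also have "(b powr (1 / al)) powr bt = b * b powr ga" using b1 ab by (simp add: powr_powr ga_def powr_diff)
     also have "b * b powr ga / c powr psp <= b * (e * c powr psp) / c powr psp" proof -
      have "b powr ga <= dl powr ga" using b b1 g by (intro powr_mono2) auto
      then show ?thesis using dg b1 c by (intro divide_right_mono mult_left_mono) auto
     qed
     also have "... = e * b" using c by simp
     finally show "(b powr (1 / al) / c) powr q y <= e * b" .
    qed (use b1 e in auto)
    then show "measure N A / e <= b" using e b1 by (simp add: N_eq field_simps)
   qed
   then show ?thesis using e by (simp add: field_simps)
  qed
  have "measure N U <= e * m" proof (rule ccontr)
   assume "\<not> measure N U <= e * m"
   then have "ennreal (e * m) < emeasure N U" using e m by (simp add: N_eq ennreal_less_iff)
   then obtain A where "compact A" "A \<subseteq> U" "ennreal (e * m) < emeasure N A" by (rule finite_measure_compact_approx[OF N(1,2) borel_open[OF U(1)]])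
   then show False using cpt[of A] e m by (simp add: N_eq ennreal_less_iff)
  qed
  then show "emeasure N U <= ennreal e * emeasure M U" using e m by (simp add: N_eq M_eq m_def ennreal_leI flip: ennreal_mult)
 qed
qed

text \<open>Every point that is no atom of \<open>M\<close> has a neighbourhood on which
  \<open>N <= e * M\<close>: by \<open>critical_small\<close> if \<open>p < q\<close>, and otherwise
  by \<open>noncritical\<close>, because then \<open>q <= p < ps\<close>. Lindelof's theorem and
  disjoint pieces sum this up, and \<open>e\<close> is arbitrary.\<close>

lemma null_off_atoms: "emeasure N {x. measure M {x} = 0} = 0" proof -
 let ?Z = "{x. measure M {x} = 0}"
 have cnt: "countable {x. measure M {x} ~= 0}" by (rule finite_measure.countable_support[OF M(1)])
 have Zb: "?Z \<in> sets borel" proof -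
  have "- {x. measure M {x} ~= 0} \<in> sets borel" using sets.countable[OF _ cnt, of borel] by (intro borel_comp) simp
  moreover have "- {x. measure M {x} ~= 0} = ?Z" by auto
  ultimately show ?thesis by simp
 qed
 have "emeasure N ?Z <= ennreal (e * measure M UNIV)" if e: "0 < e" for e proof -
  define F where "F = {V. open V & (\<forall>U. open U --> U \<subseteq> V --> emeasure N U <= ennreal e * emeasure M U)}"
  have cover: "?Z \<subseteq> \<Union>F" proof
   fix x assume x: "x \<in> ?Z"
   obtain V where V: "open V" "x \<in> V" "!!U. open U ==> U \<subseteq> V ==> emeasure N U <= ennreal e * emeasure M U" proof (cases "p x < q x")
    case True
    show thesis by (rule critical_small[OF True _ e]) (use x that in \<open>auto simp: M_eq\<close>)
   next
    case False
    obtain V where V: "open V" "x \<in> V" "emeasure N V = 0" using noncritical[of x] False p_less_ps[of x] by auto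
    have "emeasure N U <= ennreal e * emeasure M U" if "U \<subseteq> V" for U using emeasure_mono[OF that, of N] V N(2) by simp
    with V show thesis by (intro that[of V])
   qed
   then show "x \<in> \<Union>F" unfolding F_def by blast
  qed
  obtain F' where F': "F' \<subseteq> F" "countable F'" "\<Union>F' = \<Union>F" using Lindelof[of F] by (auto simp: F_def)
  define W where "W = from_nat_into (insert {} F')"
  have W: "W n \<in> F \<or> W n = {}" for n using from_nat_into[of "insert {} F'" n] F' unfolding W_def by blast
  have rW: "range W = insert {} F'" unfolding W_def using F' by (intro range_from_nat_into) auto
  have Wo: "open (W n)" for n using W[of n] by (auto simp: F_def)
  \<comment> \<open>The local inequality is known for open sets; outer regularity of
    \<open>M\<close> extends it to Borel sets, so that it can be applied to the disjoint
    pieces.\<close>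
  have le: "emeasure N B <= ennreal e * emeasure M B" if B: "B \<in> sets borel" "B \<subseteq> W n" for B n proof (rule ccontr)
   assume "\<not> ?thesis"
   then have "ennreal (e * measure M B) < emeasure N B" using e by (simp add: M_eq ennreal_mult not_le)
   then have "measure M B < measure N B / e" using e by (simp add: N_eq ennreal_less_iff field_simps)
   then have "emeasure M B < ennreal (measure N B / e)" by (simp add: M_eq ennreal_less_iff)
   from finite_measure_open_approx[OF M(1,2) B(1) this] obtain U where U: "open U" "B \<subseteq> U" "emeasure M U < ennreal (measure N B / e)" .
   have "emeasure N B <= emeasure N (U \<inter> W n)" using B U Wo N(2) by (intro emeasure_mono) auto
   also have "... <= ennreal e * emeasure M (U \<inter> W n)"         using W[of n] open_Int[OF U(1) Wo[of n]] unfolding F_def by (cases "W n = {}") (simp, blast)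
   also have "... <= ennreal e * emeasure M U" using U M(2) by (intro mult_left_mono emeasure_mono) auto
   finally have "measure N B <= e * measure M U" using e by (simp add: N_eq M_eq flip: ennreal_mult)
   moreover have "measure M U < measure N B / e" using U(3) by (simp add: M_eq ennreal_less_iff)
   ultimately show False using e by (simp add: field_simps)
  qed
  have dW: "disjointed W n \<in> sets borel" for n using Wo sets.range_disjointed_sets[of W borel] by (auto simp: image_subset_iff)
  have "emeasure N ?Z <= emeasure N (\<Union>n. disjointed W n)"
   unfolding UN_disjointed_eq rW using cover F'(3) Wo N(2) by (intro emeasure_mono) (auto simp: F_def intro!: borel_open)
  also have "... = (\<Sum>n. emeasure N (disjointed W n))" using dW N(2) by (intro suminf_emeasure[symmetric] disjoint_family_disjointed) auto
  also have "... <= (\<Sum>n. ennreal e * emeasure M (disjointed W n))" by (intro suminf_le le[OF dW disjointed_subset]) auto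
  also have "... = ennreal e * emeasure M (\<Union>n. disjointed W n)"
   using dW M(2) by (subst ennreal_suminf_cmult, subst suminf_emeasure) (auto intro: disjoint_family_disjointed)
  also have "... <= ennreal e * emeasure M UNIV" using M(2) by (intro mult_left_mono emeasure_mono) auto
  finally show ?thesis using e by (simp add: M_eq ennreal_mult)
 qed
 then have le: "measure N ?Z <= e * measure M UNIV" if "0 < e" for e using that by (simp add: N_eq)
 have "measure N ?Z <= e" if e: "0 < e" for e proof -
  define m where "m = measure M UNIV + 1"
  have m: "0 < m" "measure M UNIV <= m" by (auto simp: m_def add_nonneg_pos)
  have "measure N ?Z <= e / m * measure M UNIV" using e m by (intro le) simp
  also have "... <= e / m * m" using e m by (intro mult_left_mono) auto
  finally show ?thesis using m by simp
 qed
 then have "measure N ?Z <= 0" by (rule dense_ge)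
 then show ?thesis using measure_nonneg[of N ?Z] by (simp add: N_eq)
qed

text \<open>\<open>N\<close> lives on the countably many atoms of \<open>M\<close>; those among them
  that are no atoms of \<open>N\<close> have N-measure 0 together. An atom of \<open>N\<close> is
  critical because noncritical points have N-null neighbourhoods.\<close>

lemma atomic:
 defines "E \<equiv> {x. measure N {x} ~= 0}"
 shows "countable E" "E \<subseteq> crit_set p q" "A \<in> sets borel ==> emeasure N A = emeasure N (A \<inter> E)" proof -
 show cE: "countable E" unfolding E_def by (rule finite_measure.countable_support[OF N(1)])
 show "E \<subseteq> crit_set p q" proof
  fix x assume x: "x \<in> E"
  show "x \<in> crit_set p q" proof (rule ccontr)
   assume "x \<notin> crit_set p q"
   then have "q x < ps x" using q_le_ps[of x] by (simp add: crit_set_def)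
   then obtain V where "open V" "x \<in> V" "emeasure N V = 0" by (rule noncritical)
   then have "emeasure N {x} = 0" using emeasure_mono[of "{x}" V N] N(2) by auto
   then show False using x by (simp add: E_def N_eq)
  qed
 qed
 let ?D = "{x. measure M {x} ~= 0}"
 have cD: "countable ?D" by (rule finite_measure.countable_support[OF M(1)])
 assume A: "A \<in> sets borel"
 have cs: "S \<in> sets N" if "countable S" for S using sets.countable[of S N] that N(2) by simp
 note Es = cs[OF cE] cs[OF cD]
 have "emeasure N (A - E) <= emeasure N (\<Union>x\<in>?D - E. {x}) + emeasure N {x. measure M {x} = 0}" proof (rule order_trans[OF emeasure_mono emeasure_subadditive])
  have "- ?D \<in> sets N" using Es(2) N(2) by (simp add: borel_comp)
  also have "- ?D = {x. measure M {x} = 0}" by auto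
  finally have Z: "{x. measure M {x} = 0} \<in> sets N" .
  show Z: "{x. measure M {x} = 0} \<in> sets N" by (rule Z)
  show D: "(\<Union>x\<in>?D - E. {x}) \<in> sets N" using sets.Diff[OF Es(2,1)] by simp
  show "(\<Union>x\<in>?D - E. {x}) \<union> {x. measure M {x} = 0} \<in> sets N" using Z D by (rule sets.Un[rotated])
 qed auto
 also have "emeasure N (\<Union>x\<in>?D - E. {x}) = (\<integral>\<^sup>+x. emeasure N {x} \<partial>count_space (?D - E))"
  using cD N(2) by (intro emeasure_UN_countable) (auto simp: disjoint_family_on_def)
 also have "... = (\<integral>\<^sup>+x. 0 \<partial>count_space (?D - E))" by (rule nn_integral_cong) (auto simp: E_def N_eq)
 finally have z: "emeasure N (A - E) = 0" by (simp add: null_off_atoms)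
 have "emeasure N A = emeasure N ((A \<inter> E) \<union> (A - E))" by (simp add: Int_Diff_Un)
 also have "... = emeasure N (A \<inter> E) + emeasure N (A - E)" using A Es N(2) by (intro plus_emeasure[symmetric]) auto
 finally show "emeasure N A = emeasure N (A \<inter> E)" using z by simp
qed

end

section \<open>Concentration at infinity\<close>

abbreviation (input) "tail R r f \<equiv> wMod (indicator {y. R < norm y}) r f"

lemma outside_ball_lebesgue: "{y::'a::euclidean_space. R < norm y} \<in> sets lebesgue" proof -
 have "open {y::'a. R < norm y}" by (intro open_Collect_less continuous_intros)
 then show ?thesis by auto
qed

lemma tail_mono: "R <= R' ==> tail R' r f <= tail R r f" by (intro nn_integral_mono ennreal_leI mult_right_mono) (auto simp: indicator_def)

lemma tail_small:
 fixes f :: "'a::euclidean_space => 'b::{real_normed_vector, second_countable_topology}"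
 assumes [measurable]: "f \<in> lmeas" "r \<in> lmeas"
  and fin: "Mod r f < top" and e: "0 < e"
 shows "\<forall>\<^sub>F R in at_top. tail R r f <= ennreal e" proof -
 note [measurable] = outside_ball_lebesgue
 have "(%j. tail (real j) r f) ----> (\<integral>\<^sup>+x. 0 \<partial>(lebesgue :: 'a measure))"
 proof (rule nn_integral_dominated_convergence[where w = "%x. ennreal (norm (f x) powr r x)"])
  show "AE x in lebesgue. (%j. ennreal (indicator {y. real j < norm y} x * norm (f x) powr r x)) ----> 0" proof (rule AE_I2)
   fix x :: 'a
   obtain n where "norm x <= real n" using real_arch_simple by blast
   then show "(%j. ennreal (indicator {y. real j < norm y} x * norm (f x) powr r x)) ----> 0" by (intro tendsto_eventually eventually_sequentiallyI[of n]) auto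
  qed
  show "Mod r f < \<infinity>" using fin by simp
 qed (measurable, auto simp: indicator_def)
 then have "eventually (%j. tail (real j) r f < ennreal e) sequentially" using e by (intro order_tendstoD) auto
 then obtain j where "tail (real j) r f < ennreal e" by (auto simp: eventually_sequentially)
 note j = this
 show ?thesis proof (rule eventually_at_top_linorderI[of "real j"])
  fix R assume "real j <= R"
  from order_trans[OF tail_mono[OF this] less_imp_le[OF j]] show "tail R r f <= ennreal e" .
 qed
qed

text \<open>The fixed summand \<open>d\<close> has small tails for large \<open>R\<close>, and
  \<open>e n\<close> is small for large \<open>n\<close>; the main term is multiplied by a factor
  close to 1. It is used once from the given gradients to those of \<open>w\<close>, and once from
  \<open>w\<close> back to \<open>u\<close>.\<close>

lemma tail_transfer:
 fixes a b :: "nat => 'a::euclidean_space => 'b::{real_normed_vector, second_countable_topology}"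
 assumes [measurable]: "!!n. b n \<in> lmeas" "d \<in> lmeas" "!!n. e n \<in> lmeas"
   "r \<in> lmeas"
  and r: "!!x. 1 <= r x" "!!x. r x <= B" and eq: "!!n x. a n x = b n x + (d x + e n x)"
  and d: "Mod r d < top" and lim: "(%n. Mod r (e n)) ----> 0" and m: "0 <= m"
  and b: "!!tht. 0 < tht ==> \<forall>\<^sub>F R in at_top. \<forall>\<^sub>F n in sequentially. tail R r (b n) <= ennreal (m + tht)"
  and tht: "0 < tht"
 shows "\<forall>\<^sub>F R in at_top. \<forall>\<^sub>F n in sequentially. tail R r (a n) <= ennreal (m + tht)" proof -
 note [measurable] = outside_ball_lebesgue
 \<comment> \<open>Half of \<open>tht\<close> is left for the error terms:
   \<open>(1 + eps) * (m + tht / 4) <= m + tht / 2\<close>.\<close>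
 define eps where "eps = tht / (4 * (m + tht))"
 have e: "0 < eps" using m tht by (simp add: eps_def)
 have "eps * (m + tht / 4) <= eps * (m + tht)" using e tht by (intro mult_left_mono) auto
 also have "... = tht / 4" using m tht by (simp add: eps_def divide_simps)
 finally have e2: "(1 + eps) * (m + tht / 4) <= m + tht / 2" by (simp add: distrib_right)
 define C where "C = split_const eps B * 2 powr B"
 have C: "0 < C" using norm_add_powr_le(1)[OF e, of B] order_trans[OF r] by (simp add: C_def)
 note C = C weighted_modular_add_le[OF e \<open>r \<in> lmeas\<close> r, folded C_def]
 define dl where "dl = tht / (4 * C)"
 have dl: "0 < dl" "C * (dl + dl) = tht / 2" using tht C(1) by (auto simp: dl_def)
 have "\<forall>\<^sub>F n in sequentially. Mod r (e n) < ennreal dl" using lim dl by (intro order_tendstoD) auto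
 then have E: "\<forall>\<^sub>F n in sequentially. Mod r (e n) <= ennreal dl" by (rule eventually_mono) simp
 have "0 < tht / 4" using tht by simp
 note b' = b[OF this]
 have "\<forall>\<^sub>F R in at_top. tail R r d <= ennreal dl" by (rule tail_small[OF _ _ d dl(1)]) measurable
 with b' show ?thesis proof eventually_elim
  fix R assume 3: "\<forall>\<^sub>F n in sequentially. tail R r (b n) <= ennreal (m + tht / 4)" "tail R r d <= ennreal dl"
  from 3(1) E show "\<forall>\<^sub>F n in sequentially. tail R r (a n) <= ennreal (m + tht)" proof eventually_elim
   case (elim n)
   have "tail R r (a n) <= ennreal (1 + eps) * tail R r (b n) + ennreal C * (tail R r d + Mod r (e n))"
    by (rule C(2)[OF borel_measurable_indicator[OF outside_ball_lebesgue] _ _ _ _ eq]) (use assms(1-3) in \<open>auto simp: indicator_def\<close>)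
   also have "... <= ennreal (1 + eps) * ennreal (m + tht / 4) + ennreal C * (ennreal dl + ennreal dl)" using elim 3(2) by (intro add_mono mult_left_mono) auto
   also have "... = ennreal ((1 + eps) * (m + tht / 4) + C * (dl + dl))" using e m tht C(1) dl(1) by (simp flip: ennreal_plus ennreal_mult)
   also have "... <= ennreal (m + tht)" using e2 dl(2) by (intro ennreal_leI) linarith
   finally show ?case .
  qed
 qed
qed

context concentration
begin

text \<open>The argument of \<open>point_inequality\<close> with exterior domains as neighbourhoods
  of infinity: \<open>p\<close> and \<open>q\<close> converge there, so one scale \<open>t\<close>
  serves all points beyond \<open>R2\<close>. The bound for the tails of the gradients takes the
  place of the mass of a point.\<close>

lemma infinity_cutoff:
 assumes SI: "SI c (- cball 0 R0)" and c: "0 < c" and m: "0 <= m" and tht: "0 < tht"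
  and tail: "!!tht. 0 < tht ==> \<forall>\<^sub>F R in at_top. \<forall>\<^sub>F n in sequentially. tail R p (grad (w n)) <= ennreal (m + tht)"
 shows "\<forall>\<^sub>F R in at_top. \<forall>\<^sub>F n in sequentially. tail R q (w n)
  <= ennreal (((m + tht) powr (1 / p_inf) * (1 + tht) / c) powr q_inf + tht)" proof -
 define b where "b = m + tht"
 define t where "t = b powr (1 / p_inf) * (1 + tht)"
 define s where "s = (t / c) powr q_inf + tht"
 have b: "0 < b" using tht m by (simp add: b_def)
 have t: "0 < t" using tht b by (simp add: t_def)
 have s: "0 < s" using tht by (simp add: s_def add_nonneg_pos)
 have "t powr p_inf = b * (1 + tht) powr p_inf" using b p_inf_gt_1 by (simp add: t_def powr_mult powr_powr)
 moreover have "1 < (1 + tht) powr p_inf" using tht p_inf_gt_1 by (intro gr_one_powr) auto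
 ultimately have tp: "b < t powr p_inf" using b by simp
 have "((%y. t powr p y) \<longlongrightarrow> t powr p_inf) at_infinity" "((%y. (t / c) powr q y) \<longlongrightarrow> (t / c) powr q_inf) at_infinity"
  using t c tendsto_of_log_decay[OF H2(1)] tendsto_of_log_decay[OF H2(2)] by (auto intro!: tendsto_powr)
 then have "\<forall>\<^sub>F y in at_infinity. b < t powr p y" "\<forall>\<^sub>F y in at_infinity. (t / c) powr q y < s"
  using tp tht by (auto intro!: order_tendstoD simp: s_def)
 then have "\<forall>\<^sub>F y in at_infinity. b < t powr p y & (t / c) powr q y < s" by (rule eventually_conj)
 then obtain R1 where R1: "!!y. R1 <= norm y ==> b < t powr p y & (t / c) powr q y < s" by (auto simp: eventually_at_infinity)
 define R2 where "R2 = max R0 (max R1 1)"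
 define U where "U = - cball (0::'a) R2"
 have SIU: "SI c U" by (rule SI_mono[OF SI]) (auto simp: U_def R2_def)
 have U: "b <= t powr p y" "(t / c) powr q y <= s" if "y \<in> U" for y proof -
  have "R1 <= norm y" using that by (simp add: U_def R2_def not_le)
  from R1[OF this] show "b <= t powr p y" "(t / c) powr q y <= s" by auto
 qed
 have "0 < tht / 2" using tht by simp
 from tail[OF this] eventually_gt_at_top[of R2]
 have "\<forall>\<^sub>F R in at_top. \<forall>\<^sub>F n in sequentially. tail (2 * R) q (w n) <= ennreal s" proof eventually_elim
  case (elim R)
  have R: "0 < R" "R2 < R" using elim(2) by (auto simp: R2_def)
  \<comment> \<open>The support of \<open>eta\<close> is unbounded, but that of its gradient is
    bounded, and the product of \<open>eta\<close> with a test function is a test function on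
    \<open>U\<close>. This is why \<open>cutoff_inequality\<close> does not ask for a compactly
    supported cutoff.\<close>
  define eta where "eta x = 1 - cutoff (0::'a) R x" for x
  have T: "cutoff (0::'a) R \<in> tests" using R by (intro cutoff_test_functions) auto
  have etak: "C_k k eta" for k unfolding eta_def[abs_def] by (intro C_k_diff C_k_const test_C_k[OF T])
  have eta: "0 <= eta x" "eta x <= 1" for x using cutoff_bounds[of 0 R x] by (auto simp: eta_def)
  have eta0: "eta x = 0" if "norm x <= R" for x using that R by (simp add: eta_def cutoff_eq_1)
  have eta1: "eta x = 1" if "2 * R < norm x" for x using that R by (simp add: eta_def cutoff_eq_0)
  have geta: "grad eta x = - grad (cutoff 0 R) x" for x unfolding eta_def[abs_def] by (subst grad_diff) (auto simp: grad_const intro: test_differentiable[OF T])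
  obtain G where G: "!!x. norm (grad (cutoff (0::'a) R) x) <= G" using test_bounded[OF T] by metis
  obtain R' where R': "!!x. R' <= norm x ==> grad (cutoff (0::'a) R) x = 0" using test_support_ball[OF T] by metis
  have ev: "\<forall>\<^sub>F n in sequentially. wMod eta p (grad (w n)) <= ennreal (m + tht / 2)" proof (use elim(1) in eventually_elim)
   fix n assume le: "tail R p (grad (w n)) <= ennreal (m + tht / 2)"
   have "wMod eta p (grad (w n)) <= tail R p (grad (w n))" using eta eta0 by (intro nn_integral_mono ennreal_leI mult_right_mono) (auto simp: indicator_def)
   then show "wMod eta p (grad (w n)) <= ennreal (m + tht / 2)" using le by (rule order_trans)
  qed
  have "\<forall>\<^sub>F n in sequentially. Mod q (%x. eta x * w n x) <= ennreal s"
  proof (rule cutoff_inequality[where R = R', OF SIU c etak eta _ _ _ _ _ ev t U(1) _ U(2)])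
   fix v :: "'a => real" assume v: "v \<in> tests"
   obtain A where A: "compact A" "!!x. x \<notin> A ==> v x = 0" using test_functionsE[OF v] by metis
   show "(%x. eta x * v x) \<in> test_functions U" proof (rule test_functionsI[of _ "A - ball 0 R"])
    show "C_k k (%x. eta x * v x)" for k by (intro C_k_mult etak test_C_k[OF v])
    show "compact (A - ball 0 R)" using A(1) by (intro compact_diff) auto
    show "A - ball 0 R \<subseteq> U" using R by (auto simp: U_def)
    show "eta x * v x = 0" if "x \<notin> A - ball 0 R" for x using that A(2)[of x] eta0[of x] by auto
   qed
  qed (use G R' m tht s in \<open>auto simp: geta b_def\<close>)
  then show ?case proof eventually_elim
   fix n assume le: "Mod q (%x. eta x * w n x) <= ennreal s"
   have "tail (2 * R) q (w n) <= Mod q (%x. eta x * w n x)" using eta1 by (intro nn_integral_mono ennreal_leI) (auto simp: indicator_def)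
   then show "tail (2 * R) q (w n) <= ennreal s" using le by (rule order_trans)
  qed
 qed
 then obtain R where R: "0 < R" "\<forall>\<^sub>F n in sequentially. tail (2 * R) q (w n) <= ennreal s"
  using eventually_happens'[OF _ eventually_conj[OF _ eventually_gt_at_top[of 0]]] by (metis (mono_tags, lifting) trivial_limit_at_top_linorder)
 show ?thesis unfolding t_def[unfolded b_def, symmetric] s_def[symmetric] proof (rule eventually_at_top_linorderI[of "2 * R"])
  fix R' :: real assume "2 * R <= R'"
  from R(2) show "\<forall>\<^sub>F n in sequentially. tail R' q (w n) <= ennreal s"
   by (rule eventually_mono) (rule order_trans[OF tail_mono[OF \<open>2 * R <= R'\<close>]])
 qed
qed

end

section \<open>Splitting off the weak limit\<close>

text \<open>\<open>power_measure\<close> carries the Lebesgue sigma-algebra. Its image under the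
  identity is the restriction to Borel sets, to which the comparison of finite Borel measures
  applies.\<close>

definition borel_power :: "('a::euclidean_space => real) => ('a => 'b::real_normed_vector) => 'a measure"
 where "borel_power r f = distr (power_measure r f) borel (%x. x)"

lemma borel_power:
 fixes f :: "'a::euclidean_space => 'b::{real_normed_vector, second_countable_topology}"
 assumes [measurable]: "f \<in> lmeas" "r \<in> lmeas" and fin: "Mod r f < top"
 shows "finite_measure (borel_power r f)" "sets (borel_power r f) = sets borel"
  and "!!A. A \<in> sets borel ==> emeasure (borel_power r f) A = emeasure (power_measure r f) A"
  and "!!phi. phi \<in> borel_measurable borel ==> (!!x. 0 <= phi x) ==> EN (borel_power r f) phi = wMod phi r f"
  and "!!x. emeasure (borel_power r f) {x} = 0" proof -
 have id: "(%x. x) \<in> measurable (power_measure r f) borel" unfolding power_measure_def by (simp add: borel_measurable_lebesgue_continuous)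
 show em: "emeasure (borel_power r f) A = emeasure (power_measure r f) A" if "A \<in> sets borel" for A
  unfolding borel_power_def using id that by (subst emeasure_distr) (auto simp: power_measure_def)
 show s: "sets (borel_power r f) = sets borel" by (simp add: borel_power_def)
 have "emeasure (power_measure r f) UNIV = Mod r f" unfolding power_measure_def by (subst emeasure_density) auto
 then show "finite_measure (borel_power r f)" using fin em[of UNIV] by (intro finite_measureI) (simp add: borel_power_def)
 show "EN (borel_power r f) phi = wMod phi r f" if phi: "phi \<in> borel_measurable borel" "!!x. 0 <= phi x" for phi proof -
  have [measurable]: "phi \<in> lmeas" by (rule borel_lebesgue[OF phi(1)])
  have "EN (borel_power r f) phi = (\<integral>\<^sup>+x. ennreal (phi x) \<partial>power_measure r f)"
   unfolding borel_power_def using phi(1) by (intro nn_integral_distr id) auto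
  also have "... = wMod phi r f" unfolding power_measure_def using phi(2)
   by (subst nn_integral_density) (auto intro!: nn_integral_cong simp: mult.commute simp flip: ennreal_mult)
  finally show ?thesis .
 qed
 show "emeasure (borel_power r f) {x} = 0" for x proof -
  have "emeasure (power_measure r f) {x} = 0" proof -
   have "absolutely_continuous lebesgue (power_measure r f)" unfolding power_measure_def by (rule absolutely_continuousI_density) measurable
   moreover have "{x} \<in> null_sets lebesgue" using null_sets_completionI[of "{x}" lborel] by (simp add: null_sets_def)
   ultimately show ?thesis unfolding absolutely_continuous_def by blast
  qed
  then show ?thesis by (simp add: em)
 qed
qed

lemma finite_measure_null: "finite_measure (null_measure borel :: 'a::euclidean_space measure)" by (rule finite_measureI) simp

lemma finite_measure_scale: "finite_measure M ==> finite_measure (scale_measure (ennreal c) M)"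
 by (intro finite_measureI) (simp add: finite_measure.emeasure_finite ennreal_mult_eq_top_iff)

text \<open>\<open>g\<close> and \<open>g0\<close> stand for the weak gradients of \<open>u\<close>
  and \<open>u0\<close>. They are kept as plain vector fields, tied to the test functions by
  \<open>gerr\<close> and to the limit measure by \<open>lsc\<close>.\<close>

locale splitting = concentration p q p_inf q_inf w K M N
 for p q :: "'a::euclidean_space => real" and p_inf q_inf w K M N +
 fixes u :: "nat => 'a => real" and u0 :: "'a => real" and g :: "nat => 'a => 'a" and g0 :: "'a => 'a" and \<mu> \<nu> :: "'a measure"
 assumes meas[measurable]: "!!n. u n \<in> lmeas" "u0 \<in> lmeas"
   "!!n. g n \<in> lmeas" "g0 \<in> lmeas"
  and gerr: "(%n. Mod p (%x. g n x - g0 x - grad (w n) x)) ----> 0"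
  and uerr: "(%n. Mod q (%x. u n x - u0 x - w n x)) ----> 0"
  and gK: "!!n. Mod p (g n) <= ennreal K" and uK: "!!n. Mod q (u n) <= ennreal K"
  and g0_fin: "Mod p g0 < top" and u0_fin: "Mod q u0 < top" and ae: "AE x in lebesgue. (%n. u n x) ----> u0 x"
  and \<mu>: "finite_measure \<mu>" "sets \<mu> = sets borel" "weakly_converges_measure (%n. power_measure p (g n)) \<mu>"
  and \<nu>: "finite_measure \<nu>" "sets \<nu> = sets borel" "weakly_converges_measure (%n. power_measure q (u n)) \<nu>"
  and lsc: "!!phi. phi \<in> tests ==> (!!x. 0 <= phi x) ==> (!!x. phi x <= 1) ==>
   wMod phi p g0 <= EN \<mu> phi"
begin

lemma w_meas[measurable]: "w n \<in> lmeas" "grad (w n) \<in> lmeas" using test_lebesgue[OF w] .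

lemma pb: "1 <= p x" "p x <= pp" and qb: "1 <= q x" "q x <= psp" using p_gt_1[of x] p_le q_ge_1 q_le by auto

lemma test_limits:
 assumes phi: "phi \<in> tests" "!!x. 0 <= phi x"
 shows "(%n. wMod phi p (grad (w n))) ----> EN M phi" "(%n. wMod phi q (w n)) ----> EN N phi"
  "(%n. wMod phi p (g n)) ----> EN \<mu> phi" "(%n. wMod phi q (u n)) ----> EN \<nu> phi" proof -
 have cs: "continuous_on UNIV phi" "compact (closure {x. phi x ~= 0})" using phi(1) test_continuous[OF phi(1)] by (auto simp: test_functions_def)
 show "(%n. wMod phi p (grad (w n))) ----> EN M phi" by (rule weakly_converges_measure_nn[OF M(3,1,2) _ _ Kp cs phi(2)]) measurable
 show "(%n. wMod phi q (w n)) ----> EN N phi" by (rule weakly_converges_measure_nn[OF N(3,1,2) _ _ Kq cs phi(2)]) measurable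
 show "(%n. wMod phi p (g n)) ----> EN \<mu> phi" by (rule weakly_converges_measure_nn[OF \<mu>(3,1,2) _ _ gK cs phi(2)]) measurable
 show "(%n. wMod phi q (u n)) ----> EN \<nu> phi" by (rule weakly_converges_measure_nn[OF \<nu>(3,1,2) _ _ uK cs phi(2)]) measurable
qed

text \<open>The Brezis--Lieb lemma concerns \<open>u n - u0\<close>;
  \<open>modular_continuous\<close> exchanges this difference for \<open>w n\<close>.\<close>

lemma splitting_limit:
 "(%n. \<integral>\<^sup>+x. ennreal \<bar>\<bar>u n x\<bar> powr q x - \<bar>w n x\<bar> powr q x - \<bar>u0 x\<bar> powr q x\<bar> \<partial>lebesgue) ----> 0" proof -
 obtain L where L: "Mod q u0 = ennreal L" "0 <= L" using u0_fin by (cases "Mod q u0") auto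
 have b: "Mod q (%x. u n x - u0 x) <= ennreal (2 powr psp * (K + L))" for n proof -
  have "Mod q (%x. u n x - u0 x) <= ennreal (2 powr psp) * (Mod q (u n) + Mod q u0)" by (rule modular_add_le(2)[OF _ _ _ qb]) measurable
  also have "... <= ennreal (2 powr psp) * (ennreal K + ennreal L)" using uK L by (intro mult_left_mono add_mono) auto
  also have "... = ennreal (2 powr psp * (K + L))" using K0 L by (simp add: ennreal_mult)
  finally show ?thesis .
 qed
 have BL: "(%n. \<integral>\<^sup>+x. ennreal \<bar>\<bar>u n x\<bar> powr q x - \<bar>u n x - u0 x\<bar> powr q x - \<bar>u0 x\<bar> powr q x\<bar> \<partial>lebesgue) ----> 0"
  by (rule Brezis_Lieb[OF _ _ _ qb b[unfolded real_norm_def] _ u0_fin[unfolded real_norm_def] ae]) (use K0 L in auto)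
 have "(%n. Mod q (%x. w n x - (u n x - u0 x))) ----> 0" using uerr by (simp add: abs_minus_commute)
 then have MC: "(%n. \<integral>\<^sup>+x. ennreal \<bar>norm (w n x) powr q x - norm (u n x - u0 x) powr q x\<bar> \<partial>lebesgue) ----> 0"
  by (intro modular_continuous[OF _ _ _ qb Kq K0]) measurable
 let ?D = "%n x. ennreal \<bar>\<bar>u n x\<bar> powr q x - \<bar>u n x - u0 x\<bar> powr q x - \<bar>u0 x\<bar> powr q x\<bar>"
 let ?E = "%n x. ennreal \<bar>norm (w n x) powr q x - norm (u n x - u0 x) powr q x\<bar>"
 show ?thesis proof (rule ennreal_tendsto_0_mono)
  show "(%n. LN (%x. ?D n x) + LN (%x. ?E n x)) ----> 0" using tendsto_add[OF BL MC] by simp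
  fix n
  have "LN (%x. ennreal \<bar>\<bar>u n x\<bar> powr q x - \<bar>w n x\<bar> powr q x - \<bar>u0 x\<bar> powr q x\<bar>) <= LN (%x. ?D n x + ?E n x)"
  proof (rule nn_integral_mono)
   have "\<bar>a - b - c\<bar> <= \<bar>a - v - c\<bar> + \<bar>b - v\<bar>" for a b c v :: real by arith
   then show "ennreal \<bar>\<bar>u n x\<bar> powr q x - \<bar>w n x\<bar> powr q x - \<bar>u0 x\<bar> powr q x\<bar> <= ?D n x + ?E n x" for x
    by (simp add: ennreal_leI flip: ennreal_plus)
  qed
  also have "... = LN (%x. ?D n x) + LN (%x. ?E n x)" by (rule nn_integral_add) measurable
  finally show "LN (%x. ennreal \<bar>\<bar>u n x\<bar> powr q x - \<bar>w n x\<bar> powr q x - \<bar>u0 x\<bar> powr q x\<bar>)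
   <= LN (%x. ?D n x) + LN (%x. ?E n x)" .
 qed
qed

lemma \<nu>_test:
 assumes phi: "phi \<in> tests" "!!x. 0 <= phi x" "!!x. phi x <= 1"
 shows "EN \<nu> phi = EN N phi + wMod phi q u0" proof -
 note [measurable] = test_lebesgue(1)[OF phi(1)]
 let ?Z = "%n. \<integral>\<^sup>+x. ennreal \<bar>\<bar>u n x\<bar> powr q x - \<bar>w n x\<bar> powr q x - \<bar>u0 x\<bar> powr q x\<bar> \<partial>lebesgue"
 have pt: "phi x * a <= phi x * b + phi x * c + \<bar>a - b - c\<bar>" "phi x * b + phi x * c <= phi x * a + \<bar>a - b - c\<bar>" for x and a b c :: real proof -
  have "\<bar>phi x * (a - b - c)\<bar> <= \<bar>a - b - c\<bar>" using phi(2,3)[of x] by (simp add: abs_mult mult_left_le_one_le)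
  then have "phi x * (a - b - c) <= \<bar>a - b - c\<bar>" "- (phi x * (a - b - c)) <= \<bar>a - b - c\<bar>" by linarith+
  then show "phi x * a <= phi x * b + phi x * c + \<bar>a - b - c\<bar>" "phi x * b + phi x * c <= phi x * a + \<bar>a - b - c\<bar>" by (simp_all add: algebra_simps)
 qed
 have le1: "wMod phi q (u n) <= wMod phi q (w n) + wMod phi q u0 + ?Z n" for n proof -
  have "wMod phi q (u n) <= LN (%x. ennreal (phi x * norm (w n x) powr q x) + ennreal (phi x * norm (u0 x) powr q x)
    + ennreal \<bar>\<bar>u n x\<bar> powr q x - \<bar>w n x\<bar> powr q x - \<bar>u0 x\<bar> powr q x\<bar>)"
   using pt(1) phi(2) by (intro nn_integral_mono) (simp add: ennreal_leI flip: ennreal_plus)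
  also have "... = wMod phi q (w n) + wMod phi q u0 + ?Z n" by (subst nn_integral_add, measurable, subst nn_integral_add) auto
  finally show ?thesis .
 qed
 have le2: "wMod phi q (w n) + wMod phi q u0 <= wMod phi q (u n) + ?Z n" for n proof -
  have "wMod phi q (w n) + wMod phi q u0 = LN (%x. ennreal (phi x * norm (w n x) powr q x) + ennreal (phi x * norm (u0 x) powr q x))"
   by (rule nn_integral_add[symmetric]) measurable
  also have "... <= LN (%x. ennreal (phi x * norm (u n x) powr q x)
    + ennreal \<bar>\<bar>u n x\<bar> powr q x - \<bar>w n x\<bar> powr q x - \<bar>u0 x\<bar> powr q x\<bar>)"
   using pt(2) phi(2) by (intro nn_integral_mono) (simp add: ennreal_leI flip: ennreal_plus)
  also have "... = wMod phi q (u n) + ?Z n" by (rule nn_integral_add) measurable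
  finally show ?thesis .
 qed
 note lim = test_limits[OF phi(1,2)]
 have r: "(%n. wMod phi q (w n) + wMod phi q u0 + ?Z n) ----> EN N phi + wMod phi q u0 + 0" by (intro tendsto_add lim tendsto_const splitting_limit)
 have l: "(%n. wMod phi q (w n) + wMod phi q u0) ----> EN N phi + wMod phi q u0" by (intro tendsto_add lim tendsto_const)
 have r2: "(%n. wMod phi q (u n) + ?Z n) ----> EN \<nu> phi + 0" by (intro tendsto_add lim tendsto_const splitting_limit)
 from LIMSEQ_le[OF lim(4) r] LIMSEQ_le[OF l r2] le1 le2 show ?thesis by (intro antisym) auto
qed

lemma test_borel: "phi \<in> test_functions U ==> phi \<in> borel_measurable borel" by (intro borel_measurable_continuous_onI test_continuous)

lemma \<nu>_eq:
 assumes A: "A \<in> sets borel"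
 shows "emeasure \<nu> A = emeasure (power_measure q u0) A + emeasure N A" proof -
 note bp = borel_power[OF meas(2) lebesgue_exponents(2) u0_fin]
 note nl = finite_measure_null
 have e: "EN \<nu> phi = EN N phi + EN (borel_power q u0) phi"
  if "phi \<in> tests" "!!x. 0 <= phi x" "!!x. phi x <= 1" for phi using \<nu>_test[OF that] bp(4)[OF test_borel[OF that(1)] that(2)] by simp
 have "emeasure \<nu> A + emeasure (null_measure borel) A <= emeasure N A + emeasure (borel_power q u0) A"
  by (rule measure_add_le_of_test[OF \<nu>(1,2) nl _ N(1,2) bp(1,2) _ A]) (simp_all add: e)
 moreover have "emeasure N A + emeasure (borel_power q u0) A <= emeasure \<nu> A + emeasure (null_measure borel) A"
  by (rule measure_add_le_of_test[OF N(1,2) bp(1,2) \<nu>(1,2) nl _ _ A]) (simp_all add: e)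
 ultimately show ?thesis by (simp add: bp(3)[OF A] add.commute)
qed

lemma \<mu>_ge:
 assumes A: "A \<in> sets borel"
 shows "emeasure (borel_power p g0) A <= emeasure \<mu> A" proof -
 note bp = borel_power[OF meas(4) lebesgue_exponents(1) g0_fin]
 note nl = finite_measure_null
 have "emeasure (borel_power p g0) A + emeasure (null_measure borel) A <= emeasure \<mu> A + emeasure (null_measure borel) A"
  by (rule measure_add_le_of_test[OF bp(1,2) nl _ \<mu>(1,2) nl _ _ A]) (simp_all add: bp(4) test_borel lsc)
 then show ?thesis by simp
qed

text \<open>On test functions \<open>M\<close> is at most \<open>1 + eps\<close> times
  \<open>\<mu>\<close> plus a multiple of the density of \<open>g0\<close>. The density charges no
  point, so the large constant is harmless there, and \<open>eps\<close> tends to 0.\<close>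

lemma M_point_le: "measure M {x} <= measure \<mu> {x}" proof -
 note bp = borel_power[OF meas(4) lebesgue_exponents(1) g0_fin]
 have "measure M {x} <= (1 + eps) * measure \<mu> {x}" if e: "0 < eps" for eps proof -
  define C where "C = split_const eps pp * 2 powr pp"
  have C: "0 < C" using norm_add_powr_le(1)[OF e, of pp] pm_gt_1 pm_le_pp by (simp add: C_def)
  note C = C weighted_modular_add_le[OF e lebesgue_exponents(1) pb, folded C_def]
  let ?S = "scale_measure (ennreal (1 + eps)) \<mu>" and ?P = "scale_measure (ennreal C) (borel_power p g0)"
  have "emeasure M {x} + emeasure (null_measure borel) {x} <= emeasure ?S {x} + emeasure ?P {x}"
  proof (rule measure_add_le_of_test[OF M(1,2) finite_measure_null _ finite_measure_scale[OF \<mu>(1)] _ finite_measure_scale[OF bp(1)]])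
   fix phi :: "'a => real" assume phi: "phi \<in> tests" "!!x. 0 <= phi x" "!!x. phi x <= 1"
   note [measurable] = test_lebesgue(1)[OF phi(1)]
   have phib: "phi \<in> borel_measurable borel" by (rule test_borel[OF phi(1)])
   have le: "wMod phi p (grad (w n)) <= ennreal (1 + eps) * wMod phi p (g n) + ennreal C * (wMod phi p (%x. - g0 x) + Mod p (%x. - (g n x - g0 x - grad (w n) x)))" for n
    by (rule C(2)) (use phi in auto)
   note lim = test_limits[OF phi(1,2)]
   have "(%n. ennreal (1 + eps) * wMod phi p (g n) + ennreal C * (wMod phi p (%x. - g0 x) + Mod p (%x. - (g n x - g0 x - grad (w n) x))))
    ----> ennreal (1 + eps) * EN \<mu> phi + ennreal C * (wMod phi p g0 + 0)"
    unfolding norm_minus_cancel by (intro tendsto_add ennreal_tendsto_cmult lim tendsto_const gerr) auto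
   from LIMSEQ_le[OF lim(1) this] le
   have "EN M phi <= ennreal (1 + eps) * EN \<mu> phi + ennreal C * wMod phi p g0" by auto
   then show "EN M phi + EN (null_measure borel) phi <= EN ?S phi + EN ?P phi"
    using phib \<mu>(2) bp(2) by (simp add: nn_integral_scale_measure bp(4)[OF phib phi(2)] cong: measurable_cong_sets)
  qed (use \<mu> bp(2) in auto)
  then have "ennreal (measure M {x}) <= ennreal (1 + eps) * ennreal (measure \<mu> {x})" by (simp add: bp(5) M_eq finite_measure.emeasure_eq_measure[OF \<mu>(1)])
  then show ?thesis using e by (simp del: ennreal_plus flip: ennreal_mult)
 qed
 note le = this
 show ?thesis proof (rule field_le_epsilon)
  fix e :: real assume e: "0 < e"
  define m where "m = measure \<mu> {x} + 1"
  have m: "0 < m" "measure \<mu> {x} <= m" by (auto simp: m_def add_nonneg_pos)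
  have "e / m * measure \<mu> {x} <= e / m * m" using e m by (intro mult_left_mono) auto
  then show "measure M {x} <= measure \<mu> {x} + e" using le[of "e / m"] e m by (simp add: distrib_right)
 qed
qed

text \<open>Tail bounds travel from \<open>g\<close> to the gradients of \<open>w\<close>, through
  the exterior cutoff to \<open>w\<close> itself, and from there to \<open>u\<close>.\<close>

lemma infinity_inequality:
 assumes SI: "SI c (- cball 0 R0)" and c: "0 < c" and mn: "0 <= m" "0 <= n"
  and m: "((%R. limsup (%n. tail R p (g n))) \<longlongrightarrow> ennreal m) at_top"
  and n: "((%R. limsup (%n. tail R q (u n))) \<longlongrightarrow> ennreal n) at_top"
 shows "c * n powr (1 / q_inf) <= m powr (1 / p_inf)" proof (rule powr_inequality_limit[OF mn(2,1) c])
 have g: "\<forall>\<^sub>F R in at_top. \<forall>\<^sub>F n in sequentially. tail R p (g n) <= ennreal (m + tht)" if "0 < tht" for tht proof -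
  have "\<forall>\<^sub>F R in at_top. limsup (%n. tail R p (g n)) < ennreal (m + tht)" using that mn by (intro order_tendstoD[OF m]) (simp add: ennreal_less_iff)
  then show ?thesis by (rule eventually_mono) (rule eventually_mono[OF Limsup_lessD], auto)
 qed
 have gw: "\<forall>\<^sub>F R in at_top. \<forall>\<^sub>F n in sequentially. tail R p (grad (w n)) <= ennreal (m + tht)" if "0 < tht" for tht
 proof (rule tail_transfer[OF _ _ _ _ pb _ _ _ mn(1) g that])
  show "grad (w n) x = g n x + (- g0 x + - (g n x - g0 x - grad (w n) x))" for n x by simp
 qed (use g0_fin gerr in \<open>auto simp: norm_minus_commute\<close>)
 fix tht :: real assume tht: "0 < tht"
 define s where "s = ((m + tht) powr (1 / p_inf) * (1 + tht) / c) powr q_inf + tht"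
 have s: "0 <= s" using tht by (simp add: s_def)
 have W: "\<forall>\<^sub>F R in at_top. \<forall>\<^sub>F n in sequentially. tail R q (w n) <= ennreal s" unfolding s_def by (rule infinity_cutoff[OF SI c mn(1) tht gw])
 have W': "\<forall>\<^sub>F R in at_top. \<forall>\<^sub>F n in sequentially. tail R q (w n) <= ennreal (s + tht')" if "0 < tht'" for tht'
  using W by (rule eventually_mono, elim eventually_mono) (erule order_trans, use that in \<open>simp add: ennreal_leI\<close>)
 have U: "\<forall>\<^sub>F R in at_top. \<forall>\<^sub>F n in sequentially. tail R q (u n) <= ennreal (s + tht')" if "0 < tht'" for tht'
 proof (rule tail_transfer[OF _ _ _ _ qb _ _ _ s W' that])
  show "u n x = w n x + (u0 x + (u n x - u0 x - w n x))" for n x by simp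
 qed (use u0_fin uerr in auto)
 have "n <= s" proof (rule field_le_epsilon)
  fix e :: real assume e: "0 < e"
  have "\<forall>\<^sub>F R in at_top. limsup (%n. tail R q (u n)) <= ennreal (s + e)" using U[OF e] by (rule eventually_mono) (rule Limsup_bounded)
  then have "ennreal n <= ennreal (s + e)" by (rule tendsto_upperbound[OF n]) simp
  then show "n <= s + e" using s e by (simp del: ennreal_plus)
 qed
 then show "n <= ((m + tht) powr (1 / p_inf) * (1 + tht) / c) powr q_inf + tht" by (simp add: s_def)
qed (use p_inf_gt_1 q_inf_gt_1 in auto)

end

section \<open>Choice of the subsequence and assembly of the theorem\<close>

lemma power_measure_vague_compactness:
 fixes f :: "nat => 'a::euclidean_space => 'b::{real_normed_vector, second_countable_topology}"
 assumes [measurable]: "!!n. f n \<in> lmeas" "r \<in> lmeas" and K: "!!n. Mod r (f n) <= ennreal K"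
 shows "\<exists>k M. strict_mono (k :: nat => nat) & sets M = sets borel & finite_measure M &
  weakly_converges_measure (%n. power_measure r (f (k n))) M" proof (rule vague_compactness)
 show "(%x. x) \<in> measurable (power_measure r (f n)) borel" for n unfolding power_measure_def by (simp add: borel_measurable_lebesgue_continuous)
 have "emeasure (power_measure r (f n)) UNIV = Mod r (f n)" for n unfolding power_measure_def by (subst emeasure_density) auto
 then show "emeasure (power_measure r (f n)) (space (power_measure r (f n))) <= ennreal K" for n using K[of n] by (simp add: power_measure_def)
qed

lemma weakly_converges_measure_subseq:
 "weakly_converges_measure X M ==> strict_mono k ==> weakly_converges_measure (%n. X (k n)) M"
 unfolding weakly_converges_measure_def using LIMSEQ_subseq_LIMSEQ[where f = k] by (fastforce simp: o_def)

text \<open>The Sobolev constant is an extended number, while \<open>SI\<close> takes real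
  constants; approximation from below passes from one to the other.\<close>

lemma ennreal_mult_le_of_less:
 assumes le: "!!c. 0 < c ==> ennreal c < S ==> c * a <= b" and ab: "0 <= a" "0 <= b"
 shows "S * ennreal a <= ennreal b" proof (cases "a = 0")
 case False
 then have a: "0 < a" using ab by simp
 have "S <= ennreal (b / a)" proof (rule ccontr)
  assume "\<not> ?thesis"
  then obtain c where c: "ennreal (b / a) < c" "c < S" using dense not_le by metis
  then obtain d where d: "c = ennreal d" "0 <= d" by (cases c) auto
  then have "b / a < d" using c(1) ab by (simp add: ennreal_less_iff)
  moreover from this have "0 < d" using a ab by (meson divide_nonneg_pos order_le_less_trans)
  ultimately show False using le[of d] c(2) d a by (simp add: field_simps)
 qed
 then have "S * ennreal a <= ennreal (b / a) * ennreal a" by (rule mult_right_mono) simp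
 also have "... = ennreal b" using a ab by (simp flip: ennreal_mult)
 finally show ?thesis .
qed simp

theorem theorem4p1:
  fixes p q :: "'a::euclidean_space \<Rightarrow> real"
    and p_inf q_inf :: real
    and u :: "nat \<Rightarrow> 'a \<Rightarrow> real"
    and u0 :: "'a \<Rightarrow> real"
  assumes meas: "p \<in> borel_measurable lebesgue" "q \<in> borel_measurable lebesgue"
    and ge1: "\<forall>x. 1 \<le> p x" "\<forall>x. 1 \<le> q x"
    and H1: "\<exists>\<rho> :: 'a \<Rightarrow> real. ((\<lambda>h. \<rho> h * ln (norm h)) \<longlongrightarrow> 0) (at 0) \<and>
      (\<forall>x h. \<bar>p (x + h) - p x\<bar> \<le> \<rho> h \<and> \<bar>q (x + h) - q x\<bar> \<le> \<rho> h)"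
    and H2: "((\<lambda>x. \<bar>p x - p_inf\<bar> * ln (norm x)) \<longlongrightarrow> 0) at_infinity"
      "((\<lambda>x. \<bar>q x - q_inf\<bar> * ln (norm x)) \<longlongrightarrow> 0) at_infinity"
    and H3: "1 < Inf (range p)" "bdd_above (range p)" "Sup (range p) < real DIM('a)"
      "\<forall>x. q x \<le> crit_exp p x"
      "q_inf = real DIM('a) * p_inf / (real DIM('a) - p_inf)"
    and conv: "weakly_converges_D1 p u u0"
  shows "\<exists>k :: nat \<Rightarrow> nat. strict_mono k \<and>
    (\<exists>(\<mu> :: 'a measure) (\<nu> :: 'a measure) (I :: nat set) (x :: nat \<Rightarrow> 'a)
        (\<mu>i :: nat \<Rightarrow> real) (\<nu>i :: nat \<Rightarrow> real).
      sets \<mu> = sets borel \<and> finite_measure \<mu> \<and>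
      sets \<nu> = sets borel \<and> finite_measure \<nu> \<and>
      (\<forall>i\<in>I. x i \<in> crit_set p q \<and> 0 < \<mu>i i \<and> 0 < \<nu>i i) \<and>
      weakly_converges_measure (\<lambda>n. power_measure p (wgrad UNIV (u (k n)))) \<mu> \<and>
      (\<forall>A\<in>sets borel.
         emeasure \<mu> A \<ge> emeasure (power_measure p (wgrad UNIV u0)) A + dirac_sum I \<mu>i x A) \<and>
      weakly_converges_measure (\<lambda>n. power_measure q (u (k n))) \<nu> \<and>
      (\<forall>A\<in>sets borel.
         emeasure \<nu> A = emeasure (power_measure q u0) A + dirac_sum I \<nu>i x A) \<and>
      (\<forall>i\<in>I. sobolev_const_at p q (x i) * ennreal (\<nu>i i powr (1 / crit_exp p (x i)))
         \<le> ennreal (\<mu>i i powr (1 / p (x i)))) \<and>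
      (\<exists>(\<nu>_inf::real) (\<mu>_inf::real). 0 \<le> \<nu>_inf \<and> 0 \<le> \<mu>_inf \<and>
        ((\<lambda>R::real. limsup (\<lambda>n. \<integral>\<^sup>+ y\<in>{y. R < norm y}.
            ennreal (\<bar>u (k n) y\<bar> powr q y) \<partial>lebesgue)) \<longlongrightarrow> ennreal \<nu>_inf) at_top \<and>
        ((\<lambda>R::real. limsup (\<lambda>n. \<integral>\<^sup>+ y\<in>{y. R < norm y}.
            ennreal (norm (wgrad UNIV (u (k n)) y) powr p y) \<partial>lebesgue)) \<longlongrightarrow> ennreal \<mu>_inf) at_top \<and>
        limsup (\<lambda>n. \<integral>\<^sup>+ y. ennreal (norm (wgrad UNIV (u (k n)) y) powr p y) \<partial>lebesgue)
          = emeasure \<mu> UNIV + ennreal \<mu>_inf \<and>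
        limsup (\<lambda>n. \<integral>\<^sup>+ y. ennreal (\<bar>u (k n) y\<bar> powr q y) \<partial>lebesgue)
          = emeasure \<nu> UNIV + ennreal \<nu>_inf \<and>
        sobolev_const_infinity p q * ennreal (\<nu>_inf powr (1 / q_inf))
          \<le> ennreal (\<mu>_inf powr (1 / p_inf))))"
proof -
 interpret exponents p q p_inf q_inf by unfold_locales (fact ge1 H1 H2 H3)+
 have uD: "u n \<in> D1 p" and u0D: "u0 \<in> D1 p" for n using conv by (auto simp: weakly_converges_D1_def)
 note [measurable] = D1_D(2,3)[OF uD] D1_D(2,3)[OF u0D]
 obtain w K where ws: "!!n. w n \<in> tests" "0 <= K"
  "(%n. Mod p (%x. wgr (u n) x - wgr u0 x - grad (w n) x)) ----> 0"
  "(%n. Mod q (%x. u n x - u0 x - w n x)) ----> 0"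
  "!!n. Mod p (wgr (u n)) <= ennreal K" "!!n. Mod q (u n) <= ennreal K"
  "!!n. Mod p (grad (w n)) <= ennreal K" "!!n. Mod ps (w n) <= ennreal K" "!!n. Mod q (w n) <= ennreal K"
  "!!R. (%n. L1ball R (w n)) ----> 0" "!!R. (%n. L1ball R (%x. u n x - u0 x)) ----> 0"
  "Mod q u0 < top" by (rule approximating_sequence[OF conv]) (rule that; assumption)
 note [measurable] = test_lebesgue[OF ws(1)]
 \<comment> \<open>Five successive extractions: almost everywhere convergence of \<open>u\<close>,
   then vague limits for the gradients of \<open>u\<close>, for \<open>u\<close>, for the gradients
   of \<open>w\<close> and for \<open>w\<close>. Each passes to further subsequences.\<close>
 obtain k1 where k1: "strict_mono (k1 :: nat => nat)" "AE x in lebesgue. (%n. u (k1 n) x - u0 x) ----> 0"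
  using AE_subsequence_of_L1_loc[of "%n x. u n x - u0 x", OF _ ws(11)] by auto
 obtain k2 \<mu> where k2: "strict_mono (k2 :: nat => nat)" and \<mu>: "sets \<mu> = sets borel" "finite_measure \<mu>"
  "weakly_converges_measure (%n. power_measure p (wgr (u (k1 (k2 n))))) \<mu>" using power_measure_vague_compactness[of "%n. wgr (u (k1 n))" p K] ws(5) by auto
 obtain k3 \<nu> where k3: "strict_mono (k3 :: nat => nat)" and \<nu>: "sets \<nu> = sets borel" "finite_measure \<nu>"
  "weakly_converges_measure (%n. power_measure q (u (k1 (k2 (k3 n))))) \<nu>" using power_measure_vague_compactness[of "%n. u (k1 (k2 n))" q K] ws(6) by auto
 obtain k4 M where k4: "strict_mono (k4 :: nat => nat)" and M: "sets M = sets borel" "finite_measure M"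
  "weakly_converges_measure (%n. power_measure p (grad (w (k1 (k2 (k3 (k4 n))))))) M"
  using power_measure_vague_compactness[of "%n. grad (w (k1 (k2 (k3 n))))" p K] ws(7) by auto
 obtain k5 N where k5: "strict_mono (k5 :: nat => nat)" and N: "sets N = sets borel" "finite_measure N"
  "weakly_converges_measure (%n. power_measure q (w (k1 (k2 (k3 (k4 (k5 n))))))) N"
  using power_measure_vague_compactness[of "%n. w (k1 (k2 (k3 (k4 n))))" q K] ws(9) by auto
 define k where "k n = k1 (k2 (k3 (k4 (k5 n))))" for n
 have mono: "strict_mono (%n. k4 (k5 n))" "strict_mono (%n. k3 (k4 (k5 n)))" "strict_mono (%n. k2 (k3 (k4 (k5 n))))" and k: "strict_mono k"
  using k1(1) k2 k3 k4 k5 by (simp_all add: strict_mono_def k_def[abs_def])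
 have conv\<mu>: "weakly_converges_measure (%n. power_measure p (wgr (u (k n)))) \<mu>" using weakly_converges_measure_subseq[OF \<mu>(3) mono(2)] by (simp add: k_def)
 have conv\<nu>: "weakly_converges_measure (%n. power_measure q (u (k n))) \<nu>" using weakly_converges_measure_subseq[OF \<nu>(3) mono(1)] by (simp add: k_def)
 have convM: "weakly_converges_measure (%n. power_measure p (grad (w (k n)))) M" using weakly_converges_measure_subseq[OF M(3) k5] by (simp add: k_def)
 have sub: "X ----> l ==> (%n. X (k n)) ----> l" for X and l :: ennreal using LIMSEQ_subseq_LIMSEQ[OF _ k] by (simp add: o_def)
 have ae: "AE x in lebesgue. (%n. u (k n) x) ----> u0 x" using k1(2) proof eventually_elim
  case (elim x)
  have "(%n. u (k n) x - u0 x) ----> 0" using LIMSEQ_subseq_LIMSEQ[OF elim mono(3)] by (simp add: o_def k_def)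
  then show ?case by (simp add: LIM_zero_iff)
 qed
 \<comment> \<open>Lower semicontinuity is available for real integrals; finiteness of both sides
   allows the return to \<open>nn_integral\<close>.\<close>
 have lsc: "wMod phi p (wgr u0) <= EN \<mu> phi"
  if phi: "phi \<in> tests" "!!x. 0 <= phi x" "!!x. phi x <= 1" for phi proof -
  note [measurable] = test_lebesgue(1)[OF phi(1)]
  have fin: "EN \<mu> phi < top" by (rule order_le_less_trans[OF test_nn_integral(2)[OF phi \<mu>(1)]])
    (use finite_measure.emeasure_finite[OF \<mu>(2), of UNIV] in \<open>auto simp: less_top\<close>)
  have "(%n. wMod phi p (wgr (u (k n)))) ----> EN \<mu> phi" by (rule weakly_converges_measure_nn[OF conv\<mu> \<mu>(2,1) _ _ ws(5)])
    (use phi test_continuous[OF phi(1)] in \<open>auto simp: test_functions_def\<close>)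
  then have "(%n. enn2real (wMod phi p (wgr (u (k n))))) ----> enn2real (EN \<mu> phi)" using fin by (intro tendsto_enn2real) auto
  then have "(%n. \<integral>x. phi x * norm (wgr (u (k n)) x) powr p x \<partial>lebesgue) ----> enn2real (EN \<mu> phi)"
   using phi(2) by (subst integral_eq_nn_integral) auto
  then have "LB (%x. phi x * norm (wgr u0 x) powr p x) <= enn2real (EN \<mu> phi)" using phi by (intro gradient_lower_semicontinuous[OF conv _ _ _ k]) auto
  then have "enn2real (wMod phi p (wgr u0)) <= enn2real (EN \<mu> phi)" using phi(2) by (subst (asm) integral_eq_nn_integral) auto
  moreover have "wMod phi p (wgr u0) < top" by (rule order_le_less_trans[OF nn_integral_mono D1_D(4)[OF u0D]])
    (use phi in \<open>auto intro!: ennreal_leI mult_left_le_one_le\<close>)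
  ultimately show ?thesis using fin by (cases "wMod phi p (wgr u0)"; cases "\<integral>\<^sup>+x. ennreal (phi x) \<partial>\<mu>") (auto intro: ennreal_leI)
 qed
 interpret splitting p q p_inf q_inf "%n. w (k n)" K M N "%n. u (k n)" u0 "%n. wgr (u (k n))" "wgr u0" \<mu> \<nu>
 proof (intro splitting.intro concentration.intro concentration_axioms.intro splitting_axioms.intro)
  show "exponents p q p_inf q_inf" by (rule exponents_axioms)
  show "weakly_converges_measure (%n. power_measure q (w (k n))) N" using N(3) by (simp add: k_def)
  show "Mod p (wgr u0) < top" by (rule D1_D(4)[OF u0D])
  show "(%n. Mod p (%x. wgr (u (k n)) x - wgr u0 x - grad (w (k n)) x)) ----> 0" by (rule sub[OF ws(3)])
  show "(%n. Mod q (%x. u (k n) x - u0 x - w (k n) x)) ----> 0" by (rule sub[OF ws(4)])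
  show "(%n. L1ball R (w (k n))) ----> 0" for R by (rule sub[OF ws(10)])
 qed (fact ws \<mu> \<nu> M N convM conv\<mu> conv\<nu> ae D1_D(2)[OF uD] D1_D(3)[OF uD] D1_D(2)[OF u0D] D1_D(3)[OF u0D] | rule lsc; assumption)+
 \<comment> \<open>The points of the theorem are the atoms of \<open>N\<close>; their
   \<open>\<mu>\<close>-weights are the full masses of \<open>\<mu>\<close> there.\<close>
 define E where "E = {x. measure N {x} ~= 0}"
 note at = atomic[folded E_def]
 let ?I = "to_nat_on E ` E" and ?x = "from_nat_into E"
 let ?\<mu>i = "%i. measure \<mu> {?x i}" and ?\<nu>i = "%i. measure N {?x i}"
 have xE: "?x i \<in> E" if "i \<in> ?I" for i using that at(1) by auto
 have crit: "q (?x i) = ps (?x i)" "?x i \<in> crit_set p q" "0 < ?\<nu>i i" if "i \<in> ?I" for i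
  using xE[OF that] at(2) by (auto simp: crit_set_def E_def zero_less_measure_iff)
 \<comment> \<open>Any positive global Sobolev constant forces mass of \<open>M\<close>, hence of
   \<open>\<mu>\<close>, at an atom of \<open>N\<close>.\<close>
 have pos: "0 < ?\<mu>i i" if i: "i \<in> ?I" for i proof -
  obtain c where c: "0 < c" "SI c UNIV" using SI_global by blast
  have "0 < c * ?\<nu>i i powr (1 / q (?x i))" using c(1) crit(3)[OF i] by simp
  also have "... <= measure M {?x i} powr (1 / p (?x i))" by (rule point_inequality[OF SI_mono[OF c(2)] c(1) zero_less_one]) simp
  finally have "0 < measure M {?x i}" by (simp add: zero_less_measure_iff)
  then show ?thesis using M_point_le by (rule less_le_trans)
 qed
 have loc: "sobolev_const_at p q (?x i) * ennreal (?\<nu>i i powr (1 / crit_exp p (?x i))) <= ennreal (?\<mu>i i powr (1 / p (?x i)))"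
  if i: "i \<in> ?I" for i proof (rule ennreal_mult_le_of_less)
  fix c assume c: "0 < c" "ennreal c < sobolev_const_at p q (?x i)"
  then obtain eps where "0 < eps" "ennreal c < sobolev_const p q (ball (?x i) eps)" unfolding sobolev_const_at_def less_SUP_iff by auto
  then have "c * ?\<nu>i i powr (1 / q (?x i)) <= measure M {?x i} powr (1 / p (?x i))" using c(1) by (intro point_inequality SI_of_sobolev_const) auto
  also have "... <= ?\<mu>i i powr (1 / p (?x i))" using M_point_le p_gt_1[of "?x i"] by (intro powr_mono2) auto
  finally show "c * ?\<nu>i i powr (1 / ps (?x i)) <= ?\<mu>i i powr (1 / p (?x i))" by (simp add: crit[OF i])
 qed auto
 note bp = borel_power[OF D1_D(3)[OF u0D] lebesgue_exponents(1) D1_D(4)[OF u0D]]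
 \<comment> \<open>\<open>A\<close> is cut along the countable set \<open>E\<close>: on
   \<open>E\<close> the density has no mass and the Dirac sum is \<open>\<mu>\<close> itself, off
   \<open>E\<close> the Dirac sum has no mass and the density lies below \<open>\<mu>\<close>. So
   the two lower bounds add up.\<close>
 have lower: "emeasure (power_measure p (wgr u0)) A + dirac_sum ?I ?\<mu>i ?x A <= emeasure \<mu> A" if A: "A \<in> sets borel" for A proof -
  have cs: "countable S ==> S \<in> sets borel" for S :: "'a set" using sets.countable[of S borel] by simp
  have E: "A \<inter> E \<in> sets borel" "A - E \<in> sets borel" using A cs[OF at(1)] by auto
  have "emeasure (borel_power p (wgr u0)) (A \<inter> E) = (\<integral>\<^sup>+x. emeasure (borel_power p (wgr u0)) {x} \<partial>count_space (A \<inter> E))"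
   by (rule emeasure_countable_singleton) (use bp(2) at(1) in auto)
  then have z: "emeasure (borel_power p (wgr u0)) (A \<inter> E) = 0" by (simp add: bp(5))
  have "emeasure (borel_power p (wgr u0)) A = emeasure (borel_power p (wgr u0)) (A \<inter> E) + emeasure (borel_power p (wgr u0)) (A - E)"
   using E bp(2) by (subst plus_emeasure) (auto simp: Int_Diff_Un)
  also have "... <= emeasure \<mu> (A - E)" using \<mu>_ge[OF E(2)] z by simp
  finally have "emeasure (power_measure p (wgr u0)) A + dirac_sum ?I ?\<mu>i ?x A <= emeasure \<mu> (A - E) + emeasure \<mu> (A \<inter> E)"
   using dirac_sum_eq_emeasure[OF \<mu>(1,2) at(1)] by (simp add: bp(3)[OF A] add_mono)
  also have "... = emeasure \<mu> A" using E \<mu>(2) by (subst plus_emeasure) (auto simp: Un_Diff_Int)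
  finally show ?thesis .
 qed
 have split: "emeasure \<nu> A = emeasure (power_measure q u0) A + dirac_sum ?I ?\<nu>i ?x A" if "A \<in> sets borel" for A
  using \<nu>_eq[OF that] at(3)[OF that] dirac_sum_eq_emeasure[OF N(1,2) at(1)] by simp
 have tail_eq: "(\<integral>\<^sup>+y\<in>{y. R < norm y}. ennreal (norm (f y) powr r y) \<partial>lebesgue) = tail R r f"
  for R r and f :: "'a => 'b::real_normed_vector" by (intro nn_integral_cong) (auto simp: indicator_def)
 obtain n where n: "0 <= n" "((%R::real. limsup (%n. \<integral>\<^sup>+ y\<in>{y. R < norm y}. ennreal (norm (u (k n) y) powr q y) \<partial>lebesgue)) \<longlongrightarrow> ennreal n) at_top"
  "limsup (%n. Mod q (u (k n))) = emeasure \<nu> UNIV + ennreal n" by (rule mass_at_infinity[OF conv\<nu> \<nu>(1,2) _ _ ws(6)]) auto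
 obtain m where m: "0 <= m" "((%R::real. limsup (%n. \<integral>\<^sup>+ y\<in>{y. R < norm y}. ennreal (norm (wgr (u (k n)) y) powr p y) \<partial>lebesgue)) \<longlongrightarrow> ennreal m) at_top"
  "limsup (%n. Mod p (wgr (u (k n)))) = emeasure \<mu> UNIV + ennreal m" by (rule mass_at_infinity[OF conv\<mu> \<mu>(1,2) _ _ ws(5)]) auto
 have inf: "sobolev_const_infinity p q * ennreal (n powr (1 / q_inf)) <= ennreal (m powr (1 / p_inf))" proof (rule ennreal_mult_le_of_less)
  fix c assume c: "0 < c" "ennreal c < sobolev_const_infinity p q"
  then obtain R where "ennreal c < sobolev_const p q (- cball 0 R)" unfolding sobolev_const_infinity_def less_SUP_iff by auto
  then show "c * n powr (1 / q_inf) <= m powr (1 / p_inf)" using c(1) m(2) n(2) unfolding tail_eq by (intro infinity_inequality[OF SI_of_sobolev_const _ m(1) n(1)]) auto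
 qed auto
 note n' = n[unfolded real_norm_def]
 show ?thesis by (rule exI[of _ k], rule conjI[OF k], rule exI[of _ \<mu>], rule exI[of _ \<nu>], rule exI[of _ ?I], rule exI[of _ ?x],
    rule exI[of _ ?\<mu>i], rule exI[of _ ?\<nu>i], intro conjI ballI; (rule exI[of _ n], rule exI[of _ m], intro conjI)?)
   (rule \<mu> \<nu> crit(2,3) pos lower split loc n' m inf; assumption?)+
qed

end
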